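(* Let $\underline L$ be a cyclic generalized Lagrangian correspondence, $\underline\delta$ widths, and $\underline H\in\mathrm{Ham}^*(\underline L)$. Then the perturbed generalized correspondence $$\underline L':=\Bigl(L'_{j(j+1)}:=\bigl(\mathrm{Id}_{M_j}\times\phi^{H_{j+1}}_{\delta_{j+1}}\bigr)L_{j(j+1)}\Bigr)_{j=0,\ldots,r}$$ has the following intersection and composition properties. (a) The generalized intersection $$\mathcal I(\underline L',0)=(L'_{01}\times\ldots\times L'_{r(r+1)})\cap(\Delta_{M_1}\times\ldots\times\Delta_{M_r}\times\Delta_{M_0})^T$$ is transverse and canonically identified with $\mathcal I(\underline L,\underline H)$ (via the restriction of the map $\prod_{j=0}^r(\mathrm{Id}_{M_j}\times\phi^{H_{j+1}}_{\delta_{j+1}})$). (b) For any proper subset $I\subset\{0,\ldots,r\}$ the partial fiber product $\times_{I,0}\underline L'$ is cut out transversally (and canonically identified with $\times_{I,\underline H}\underline L$). It is a product, over consecutive pairs of indices $j<j'\in I^C$, of the transverse intersections $$L'_{j(j+1)}\times_{\Delta_{j+1}}L'_{(j+1)(j+2)}\ldots\times_{\Delta_{j'-1}}L'_{(j'-1)j'}:=\bigl(L'_{j(j+1)}\times\ldots\times L'_{(j'-1)j'}\bigr)\cap\bigl(M_j\times\Delta_{M_{j+1}}\times\ldots\times\Delta_{M_{j'-1}}\times M_{j'}\bigr),$$ which equal $$\bigl(\mathrm{Id}_{M_j}\times\phi^{H_{j+1}}_{\delta_{j+1}}\times\mathrm{Id}_{M_{j+1}}\times\ldots\times\phi^{H_{j'-1}}_{\delta_{j'-1}}\times\mathrm{Id}_{M_{j'-1}}\times\phi^{H_{j'}}_{\delta_{j'}}\bigr)\bigl(L_{j(j+1)}\times_{H_{j+1}}\ldots\times_{H_{j'-1}}L_{(j'-1)j'}\bigr).$$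 (c) For any such pair $j<j'$ the projection $$\Pi_{M_j\times M_{j'}}:\;L'_{j(j+1)}\times_{\Delta_{j+1}}\ldots\times_{\Delta_{j'-1}}L'_{(j'-1)j'}\longrightarrow M_j\times M_{j'}$$ is an immersion onto the geometric composition $L'_{j(j+1)}\circ\ldots\circ L'_{(j'-1)j'}\subset M_j\times M_{j'}$.
   Context: Let $r\ge 0$ and let $M_0,\ldots,M_r,M_{r+1}$ be symplectic manifolds with $M_{r+1}=M_0$; $M_j^-$ is $M_j$ with the negative symplectic form. A cyclic generalized Lagrangian correspondence $\underline L=(L_{j(j+1)})_{j=0,\ldots,r}$ is a sequence of Lagrangian submanifolds $L_{j(j+1)}\subset M_j^-\times M_{j+1}$; all of them are assumed compact. Indices are taken modulo $r+1$ (so $H_{r+1}=H_0$, $\delta_{r+1}=\delta_0$). Widths are $\underline\delta=(\delta_j>0)_{j=0,\ldots,r}$, and $\mathcal H_t(\underline\delta)=\bigoplus_{j=0}^r C^\infty([0,\delta_j]\times M_j,\mathbb R)$. $\phi^{H_j}_{\delta_j}$ is the time $\delta_j$ Hamiltonian flow of $H_j$; $\Delta_M\subset M\times M$ is the diagonal. A pair $j<j'$ means $j<j'\le j+r+1$. For $j+1<j'\le j+r+1$ set $$L_{j(j+1)}\times_{H_{j+1}}\ldots\times_{H_{j'-1}}L_{(j'-1)j'}:=\bigl(L_{j(j+1)}\times\ldots\times L_{(j'-1)j'}\bigr)\cap\bigl(M_j\times\mathrm{graph}(\phi^{H_{j+1}}_{\delta_{j+1}})\times\ldots\times\mathrm{graph}(\phi^{H_{j'-1}}_{\delta_{j'-1}})\times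 M_{j'}\bigr),$$ and for $j'=j+1$ this means $L_{j(j+1)}$ (similarly for $\underline L'$ and diagonals). For a proper subset $I\subset\{0,\ldots,r\}$ with complement $I^C$, a consecutive pair $j<j'\in I^C$ is a pair with $j,j'\in I^C$ and $\{j+1,\ldots,j'-1\}\subset I$ (modulo $r+1$), and $\times_{I,\underline H}\underline L$ is the product over all consecutive pairs $j<j'\in I^C$ of the fiber products above. $\times_{I,0}\underline L'$ is the same with $\underline L'$ in place of $\underline L$ and zero Hamiltonians (so graphs become diagonals). $\mathcal I(\underline L,\underline H)$ is the set of tuples $(x_j:[0,\delta_j]\to M_j)_{j}$ with $\dot x_j(t)=X_{H_j}(x_j(t))$ and $(x_j(\delta_j),x_{j+1}(0))\in L_{j(j+1)}$; it is identified, via $\underline x\mapsto(x_0(\delta_0),x_1(0),x_1(\delta_1),\ldots,x_r(\delta_r),x_0(0))$, with $$(L_{01}\times\ldots\times L_{r(r+1)})\cap(\mathrm{graph}(\phi^{H_1}_{\delta_1})\times\ldots\times\mathrm{graph}(\phi^{H_r}_{\delta_r})\times\mathrm{graph}(\phi^{H_0}_{\delta_0}))^T,$$ which is also denoted $\times_{\{0,\ldots,r\},\underline H}\underline L$. Here $(\ldots)^T$ is the exchange of factors $M_1\times M_1\times\ldots\times M_0\times M_0\to M_0\times M_1\times M_1\times\ldots\times M_0$ moving the last factor to the front. $\mathrm{Ham}^*(\underline L)\subset\mathcal H_t(\underline\delta)$ is the (dense open) set of all $\underline H$ such that for every $I\subset\{0,\ldots,r\}$ the defining equations of $\times_{I,\underline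 H}\underline L$ are transversal: writing points of $L_{01}\times\ldots\times L_{r(r+1)}$ as $(m_0',m_1,m_1',\ldots,m_r',m_{r+1})$ with $(m_j',m_{j+1})\in L_{j(j+1)}$, $m_0:=m_{r+1}$, the map $(m_0',\ldots,m_{r+1})\mapsto(\phi^{H_i}_{\delta_i}(m_i),m_i')_{i\in I}\in\prod_{i\in I}M_i\times M_i$ is transverse to $\prod_{i\in I}\Delta_{M_i}$. The geometric composition $L'_{j(j+1)}\circ\ldots\circ L'_{(j'-1)j'}$ is the set of $(q_j,q_{j'})\in M_j\times M_{j'}$ for which there are $q_i\in M_i$, $j<i<j'$, with $(q_i,q_{i+1})\in L'_{i(i+1)}$ for all $j\le i<j'$. *)

theory Defs
  imports "HOL-Analysis.Analysis"
begin

section \<open>Smooth maps between subsets of Euclidean spaces\<close>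

text \<open>\<open>f\<close> is \<open>C\<^sup>k\<close> on the open set \<open>U\<close>.  In the recursion step \<open>f' x v\<close> is the derivative
  of \<open>f\<close> at \<open>x\<close> in direction \<open>v\<close>; on a Euclidean space, \<open>f\<close> is \<open>C\<^sup>k\<^sup>+\<^sup>1\<close> iff it is differentiable
  with all directional derivatives \<open>C\<^sup>k\<close>.\<close>

primrec Ck_on :: "nat \<Rightarrow> 'e::euclidean_space set \<Rightarrow> ('e \<Rightarrow> 'f::real_normed_vector) \<Rightarrow> bool" where
  "Ck_on 0 U f \<longleftrightarrow> continuous_on U f"
| "Ck_on (Suc k) U f \<longleftrightarrow>
     (\<exists>f'. (\<forall>x\<in>U. (f has_derivative f' x) (at x)) \<and> (\<forall>v. Ck_on k U (\<lambda>x. f' x v)))"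

text \<open>Smoothness on an arbitrary subset \<open>S\<close>: local existence of smooth extensions to open
  sets.  For \<open>S\<close> open in a linear subspace, or a product of such a set with a compact interval,
  this is the usual notion (at the endpoints of the interval: one-sided derivatives).\<close>

definition smooth_on :: "'e::euclidean_space set \<Rightarrow> ('e \<Rightarrow> 'f::real_normed_vector) \<Rightarrow> bool" where
  "smooth_on S f \<longleftrightarrow>
     (\<forall>x\<in>S. \<exists>U g. open U \<and> x \<in> U \<and> (\<forall>k. Ck_on k U g) \<and> (\<forall>y\<in>U \<inter> S. g y = f y))"


section \<open>Smooth manifolds\<close>

text \<open>A manifold has an underlying topological space of points, whose carrier is a subset of a
  type, and is modelled on a linear subspace \<open>model\<close> of a Euclidean space, so that manifolds of
  different dimensions can share a type.  The atlas is presented by one chart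
  \<open>coord p : cdom p \<rightarrow> model\<close> around each point \<open>p\<close>.

  The tangent space at \<open>p\<close> is \<open>model\<close>: a tangent vector at \<open>p\<close> is identified with its
  coordinate vector in the chart \<open>coord p\<close>.\<close>

record ('a, 'e) manifold =
  mtop :: "'a topology"
  model :: "'e set"
  cdom :: "'a \<Rightarrow> 'a set"
  coord :: "'a \<Rightarrow> 'a \<Rightarrow> 'e"

abbreviation points :: "('a, 'e, 'x) manifold_scheme \<Rightarrow> 'a set" where
  "points M \<equiv> topspace (mtop M)"

abbreviation crange :: "('a, 'e, 'x) manifold_scheme \<Rightarrow> 'a \<Rightarrow> 'e set" where
  "crange M p \<equiv> coord M p ` cdom M p"

abbreviation cinv :: "('a, 'e, 'x) manifold_scheme \<Rightarrow> 'a \<Rightarrow> 'e \<Rightarrow> 'a" where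
  "cinv M p \<equiv> inv_into (cdom M p) (coord M p)"

text \<open>A homeomorphism from an open set of points onto an open subset of the model.\<close>

definition topological_chart ::
    "('a, 'e::euclidean_space, 'x) manifold_scheme \<Rightarrow> 'a set \<Rightarrow> ('a \<Rightarrow> 'e) \<Rightarrow> bool" where
  "topological_chart M U \<psi> \<longleftrightarrow>
     openin (mtop M) U \<and> openin (top_of_set (model M)) (\<psi> ` U) \<and>
     homeomorphic_map (subtopology (mtop M) U) (top_of_set (\<psi> ` U)) \<psi>"

definition smooth_manifold :: "('a, 'e::euclidean_space, 'x) manifold_scheme \<Rightarrow> bool" where
  "smooth_manifold M \<longleftrightarrow>
     Hausdorff_space (mtop M) \<and> second_countable (mtop M) \<and> subspace (model M) \<and>
     (\<forall>p\<in>points M. p \<in> cdom M p \<and> topological_chart M (cdom M p) (coord M p)) \<and>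
     (\<forall>p\<in>points M. \<forall>q\<in>points M.
        smooth_on (coord M p ` (cdom M p \<inter> cdom M q)) (coord M q \<circ> cinv M p))"

text \<open>Charts of the maximal atlas.\<close>

definition admissible_chart ::
    "('a, 'e::euclidean_space, 'x) manifold_scheme \<Rightarrow> 'a set \<Rightarrow> ('a \<Rightarrow> 'e) \<Rightarrow> bool" where
  "admissible_chart M U \<psi> \<longleftrightarrow>
     topological_chart M U \<psi> \<and>
     (\<forall>p\<in>points M.
        smooth_on (coord M p ` (U \<inter> cdom M p)) (\<psi> \<circ> cinv M p) \<and>
        smooth_on (\<psi> ` (U \<inter> cdom M p)) (coord M p \<circ> inv_into U \<psi>))"

definition embedded_submanifold ::
    "('a, 'e::euclidean_space, 'x) manifold_scheme \<Rightarrow> 'a set \<Rightarrow> bool" where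
  "embedded_submanifold M S \<longleftrightarrow>
     S \<subseteq> points M \<and>
     (\<forall>p\<in>S. \<exists>U \<psi> F. admissible_chart M U \<psi> \<and> p \<in> U \<and> subspace F \<and> F \<subseteq> model M \<and>
        \<psi> ` (U \<inter> S) = \<psi> ` U \<inter> F)"

definition mprod ::
    "('a, 'e, 'x) manifold_scheme \<Rightarrow> ('b, 'f, 'y) manifold_scheme \<Rightarrow> ('a \<times> 'b, 'e \<times> 'f) manifold" where
  "mprod M N =
     \<lparr>mtop = prod_topology (mtop M) (mtop N),
      model = model M \<times> model N,
      cdom = (\<lambda>(p, q). cdom M p \<times> cdom N q),
      coord = (\<lambda>(p, q). map_prod (coord M p) (coord N q))\<rparr>"

text \<open>\<open>c\<close> is (near time 0) a smooth curve through \<open>p\<close> at time 0, with velocity \<open>v\<close> there.\<close>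

definition curve_at ::
    "('a, 'e::euclidean_space, 'x) manifold_scheme \<Rightarrow> 'a \<Rightarrow> (real \<Rightarrow> 'a) \<Rightarrow> 'e \<Rightarrow> bool" where
  "curve_at M p c v \<longleftrightarrow>
     (\<exists>\<epsilon>>0. (\<forall>t\<in>{-\<epsilon><..<\<epsilon>}. c t \<in> cdom M p) \<and> smooth_on {-\<epsilon><..<\<epsilon>} (coord M p \<circ> c)) \<and>
     c 0 = p \<and> ((coord M p \<circ> c) has_vector_derivative v) (at 0)"

definition tangent_space ::
    "('a, 'e::euclidean_space, 'x) manifold_scheme \<Rightarrow> 'a set \<Rightarrow> 'a \<Rightarrow> 'e set" where
  "tangent_space M S p =
     {v. \<exists>c. curve_at M p c v \<and> (\<exists>\<epsilon>>0. \<forall>t\<in>{-\<epsilon><..<\<epsilon>}. c t \<in> S)}"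

text \<open>The derivative at the chart point \<open>x\<close>, in direction \<open>u\<close> of the model, of a function given
  in the chart at \<open>p\<close>.\<close>

definition chart_deriv ::
    "('a, 'e::euclidean_space, 'x) manifold_scheme \<Rightarrow> 'a \<Rightarrow> ('e \<Rightarrow> 'f::real_normed_vector)
      \<Rightarrow> 'e \<Rightarrow> 'e \<Rightarrow> 'f" where
  "chart_deriv M p f x u = frechet_derivative f (at x within crange M p) u"


section \<open>Symplectic manifolds and Lagrangian submanifolds\<close>

record ('a, 'e) symplectic = "('a, 'e) manifold" +
  form :: "'a \<Rightarrow> 'e \<Rightarrow> 'e \<Rightarrow> real"

text \<open>The coordinate expression of the 2-form in the chart at \<open>p\<close>: coordinate vectors with
  respect to that chart at the point \<open>q = cinv M p x\<close> are first converted to tangent vectors at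
  \<open>q\<close>, i.e. to coordinates with respect to the chart at \<open>q\<close>.\<close>

definition local_form ::
    "('a, 'e::euclidean_space, 'x) symplectic_scheme \<Rightarrow> 'a \<Rightarrow> 'e \<Rightarrow> 'e \<Rightarrow> 'e \<Rightarrow> real" where
  "local_form M p x u v =
     (let q = cinv M p x; T = chart_deriv M p (coord M q \<circ> cinv M p) x
      in form M q (T u) (T v))"

text \<open>Closedness is the vanishing, in every chart, of the exterior derivative evaluated on
  triples of constant vector fields.\<close>

definition symplectic_manifold :: "('a, 'e::euclidean_space, 'x) symplectic_scheme \<Rightarrow> bool" where
  "symplectic_manifold M \<longleftrightarrow>
     smooth_manifold M \<and>
     (\<forall>p\<in>points M.
        (\<forall>u\<in>model M. \<forall>u'\<in>model M. \<forall>v\<in>model M. \<forall>a b.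
           form M p (a *\<^sub>R u + b *\<^sub>R u') v = a * form M p u v + b * form M p u' v) \<and>
        (\<forall>u\<in>model M. \<forall>v\<in>model M. form M p v u = - form M p u v) \<and>
        (\<forall>u\<in>model M. (\<forall>v\<in>model M. form M p u v = 0) \<longrightarrow> u = 0) \<and>
        (\<forall>u\<in>model M. \<forall>v\<in>model M. smooth_on (crange M p) (\<lambda>x. local_form M p x u v)) \<and>
        (\<forall>x\<in>crange M p. \<forall>u\<in>model M. \<forall>v\<in>model M. \<forall>w\<in>model M.
           chart_deriv M p (\<lambda>y. local_form M p y v w) x u +
           chart_deriv M p (\<lambda>y. local_form M p y w u) x v +
           chart_deriv M p (\<lambda>y. local_form M p y u v) x w = 0))"

text \<open>\<open>twisted_prod M N\<close> is the symplectic manifold \<open>M\<^sup>- \<times> N\<close>.\<close>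

definition twisted_prod ::
    "('a, 'e) symplectic \<Rightarrow> ('b, 'f) symplectic \<Rightarrow> ('a \<times> 'b, 'e \<times> 'f) symplectic" where
  "twisted_prod M N =
     \<lparr>mtop = mtop (mprod M N), model = model (mprod M N), cdom = cdom (mprod M N),
      coord = coord (mprod M N),
      form = (\<lambda>(p, q) (u, u') (v, v'). - form M p u v + form N q u' v')\<rparr>"

definition lagrangian :: "('a, 'e::euclidean_space, 'x) symplectic_scheme \<Rightarrow> 'a set \<Rightarrow> bool" where
  "lagrangian M L \<longleftrightarrow>
     embedded_submanifold M L \<and>
     (\<forall>p\<in>L. (\<forall>u\<in>tangent_space M L p. \<forall>v\<in>tangent_space M L p. form M p u v = 0) \<and>
        2 * dim (tangent_space M L p) = dim (model M))"


section \<open>Hamiltonian flows\<close>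

definition smooth_hamiltonian ::
    "('a, 'e::euclidean_space, 'x) manifold_scheme \<Rightarrow> real \<Rightarrow> (real \<Rightarrow> 'a \<Rightarrow> real) \<Rightarrow> bool" where
  "smooth_hamiltonian M \<delta> h \<longleftrightarrow>
     (\<forall>p\<in>points M. smooth_on ({0..\<delta>} \<times> crange M p) (\<lambda>(t, x). h t (cinv M p x)))"

text \<open>The Hamiltonian vector field of \<open>h : M \<rightarrow> \<real>\<close>, with the sign convention
  \<open>\<omega>(X\<^sub>h, \<cdot>) = dh\<close>.\<close>

definition ham_vector_field ::
    "('a, 'e::euclidean_space, 'x) symplectic_scheme \<Rightarrow> ('a \<Rightarrow> real) \<Rightarrow> 'a \<Rightarrow> 'e" where
  "ham_vector_field M h p =
     (THE X. X \<in> model M \<and>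
        (\<forall>v\<in>model M. form M p X v = chart_deriv M p (h \<circ> cinv M p) (coord M p p) v))"

definition ham_trajectory ::
    "('a, 'e::euclidean_space, 'x) symplectic_scheme \<Rightarrow> real \<Rightarrow> (real \<Rightarrow> 'a \<Rightarrow> real)
      \<Rightarrow> (real \<Rightarrow> 'a) \<Rightarrow> bool" where
  "ham_trajectory M \<delta> h x \<longleftrightarrow>
     continuous_map (top_of_set {0..\<delta>}) (mtop M) x \<and>
     (\<forall>t\<in>{0..\<delta>}. ((coord M (x t) \<circ> x) has_vector_derivative ham_vector_field M (h t) (x t))
        (at t within {0..\<delta>}))"

text \<open>\<open>\<Phi>\<close> is the flow, on the time interval \<open>[0, \<delta>]\<close> and defined on all of \<open>M\<close>, of the
  Hamiltonian \<open>h\<close>: a smooth map \<open>[0, \<delta>] \<times> M \<rightarrow> M\<close>, starting at the identity and generated by the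
  Hamiltonian vector fields.\<close>

definition is_ham_flow ::
    "('a, 'e::euclidean_space, 'x) symplectic_scheme \<Rightarrow> real \<Rightarrow> (real \<Rightarrow> 'a \<Rightarrow> real)
      \<Rightarrow> (real \<Rightarrow> 'a \<Rightarrow> 'a) \<Rightarrow> bool" where
  "is_ham_flow M \<delta> h \<Phi> \<longleftrightarrow>
     (\<forall>p\<in>points M. \<Phi> 0 p = p \<and> ham_trajectory M \<delta> h (\<lambda>t. \<Phi> t p)) \<and>
     continuous_map (prod_topology (top_of_set {0..\<delta>}) (mtop M)) (mtop M) (\<lambda>(t, p). \<Phi> t p) \<and>
     (\<forall>p\<in>points M. \<forall>q\<in>points M.
        smooth_on {(t, x). t \<in> {0..\<delta>} \<and> x \<in> crange M p \<and> \<Phi> t (cinv M p x) \<in> cdom M q}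
          (\<lambda>(t, x). coord M q (\<Phi> t (cinv M p x))))"

text \<open>The time \<open>\<delta>\<close> flow.  On the points of \<open>M\<close> the choice is irrelevant, since a flow of \<open>h\<close> is
  unique there.\<close>

definition ham_diffeo ::
    "('a, 'e::euclidean_space, 'x) symplectic_scheme \<Rightarrow> real \<Rightarrow> (real \<Rightarrow> 'a \<Rightarrow> real) \<Rightarrow> 'a \<Rightarrow> 'a" where
  "ham_diffeo M \<delta> h = (SOME \<Phi>. is_ham_flow M \<delta> h \<Phi>) \<delta>"


section \<open>Transversality and immersions in finite products of manifolds\<close>

text \<open>Points, curves and tangent vectors of \<open>\<Prod>\<^sub>k\<^sub>\<in>\<^sub>K P k\<close> are families indexed by \<open>K\<close>.\<close>

definition family_curve ::
    "'k set \<Rightarrow> ('k \<Rightarrow> ('b, 'f::euclidean_space, 'x) manifold_scheme) \<Rightarrow> ('k \<Rightarrow> 'b) set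
      \<Rightarrow> ('k \<Rightarrow> 'b) \<Rightarrow> (real \<Rightarrow> 'k \<Rightarrow> 'b) \<Rightarrow> ('k \<Rightarrow> 'f) \<Rightarrow> bool" where
  "family_curve K P A y c v \<longleftrightarrow>
     (\<forall>k\<in>K. curve_at (P k) (y k) (\<lambda>t. c t k) (v k)) \<and> (\<exists>\<epsilon>>0. \<forall>t\<in>{-\<epsilon><..<\<epsilon>}. c t \<in> A)"

definition family_tangent ::
    "'k set \<Rightarrow> ('k \<Rightarrow> ('b, 'f::euclidean_space, 'x) manifold_scheme) \<Rightarrow> ('k \<Rightarrow> 'b) set
      \<Rightarrow> ('k \<Rightarrow> 'b) \<Rightarrow> ('k \<Rightarrow> 'f) set" where
  "family_tangent K P A y = {v. \<exists>c. family_curve K P A y c v}"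

text \<open>\<open>T\<^sub>yA + T\<^sub>yB = T\<^sub>y(\<Prod>\<^sub>k\<^sub>\<in>\<^sub>K P k)\<close> at all intersection points.\<close>

definition transverse_intersection ::
    "'k set \<Rightarrow> ('k \<Rightarrow> ('b, 'f::euclidean_space, 'x) manifold_scheme)
      \<Rightarrow> ('k \<Rightarrow> 'b) set \<Rightarrow> ('k \<Rightarrow> 'b) set \<Rightarrow> bool" where
  "transverse_intersection K P A B \<longleftrightarrow>
     (\<forall>y\<in>A \<inter> B. \<forall>a\<in>\<Pi> k\<in>K. model (P k).
        \<exists>v\<in>family_tangent K P A y. \<exists>w\<in>family_tangent K P B y. \<forall>k\<in>K. a k = v k + w k)"

text \<open>The image \<open>dF(T\<^sub>yA)\<close> for a smooth \<open>F : A \<rightarrow> \<Prod>\<^sub>i\<^sub>\<in>\<^sub>I N i\<close>: the velocities of \<open>F \<circ> c\<close> for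
  curves \<open>c\<close> in \<open>A\<close>.\<close>

definition differential_image ::
    "'k set \<Rightarrow> ('k \<Rightarrow> ('b, 'f::euclidean_space, 'x) manifold_scheme) \<Rightarrow> ('k \<Rightarrow> 'b) set
      \<Rightarrow> 'i set \<Rightarrow> ('i \<Rightarrow> ('c, 'g::euclidean_space, 'z) manifold_scheme)
      \<Rightarrow> (('k \<Rightarrow> 'b) \<Rightarrow> 'i \<Rightarrow> 'c) \<Rightarrow> ('k \<Rightarrow> 'b) \<Rightarrow> ('i \<Rightarrow> 'g) set" where
  "differential_image K P A I N F y =
     {u. \<exists>c v. family_curve K P A y c v \<and>
           (\<forall>i\<in>I. curve_at (N i) (F y i) (\<lambda>t. F (c t) i) (u i))}"

definition transverse_map ::
    "'k set \<Rightarrow> ('k \<Rightarrow> ('b, 'f::euclidean_space, 'x) manifold_scheme) \<Rightarrow> ('k \<Rightarrow> 'b) set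
      \<Rightarrow> 'i set \<Rightarrow> ('i \<Rightarrow> ('c, 'g::euclidean_space, 'z) manifold_scheme) \<Rightarrow> ('i \<Rightarrow> 'c) set
      \<Rightarrow> (('k \<Rightarrow> 'b) \<Rightarrow> 'i \<Rightarrow> 'c) \<Rightarrow> bool" where
  "transverse_map K P A I N Z F \<longleftrightarrow>
     (\<forall>y\<in>A. F y \<in> Z \<longrightarrow>
        (\<forall>a\<in>\<Pi> i\<in>I. model (N i).
           \<exists>u\<in>differential_image K P A I N F y. \<exists>w\<in>family_tangent I N Z (F y).
             \<forall>i\<in>I. a i = u i + w i))"

text \<open>\<open>F : A \<rightarrow> Q\<close> is an immersion, for a submanifold \<open>A\<close> of \<open>\<Prod>\<^sub>k\<^sub>\<in>\<^sub>K P k\<close>.  Smoothness is tested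
  on smooth curves, and \<open>D\<close> is the differential of \<open>F\<close> at \<open>y\<close>.\<close>

definition immersion_on ::
    "'k set \<Rightarrow> ('k \<Rightarrow> ('b, 'f::euclidean_space, 'x) manifold_scheme) \<Rightarrow> ('k \<Rightarrow> 'b) set
      \<Rightarrow> ('c, 'g::euclidean_space, 'z) manifold_scheme \<Rightarrow> (('k \<Rightarrow> 'b) \<Rightarrow> 'c) \<Rightarrow> bool" where
  "immersion_on K P A Q F \<longleftrightarrow>
     F ` A \<subseteq> points Q \<and>
     (\<forall>y\<in>A. \<exists>D.
        (\<forall>c v. family_curve K P A y c v \<longrightarrow> curve_at Q (F y) (\<lambda>t. F (c t)) (D v)) \<and>
        (\<forall>v\<in>family_tangent K P A y. \<forall>w\<in>family_tangent K P A y.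
           D v = D w \<longrightarrow> (\<forall>k\<in>K. v k = w k)))"


section \<open>Cyclic generalized Lagrangian correspondences\<close>

text \<open>Families with indices modulo \<open>r + 1\<close> are represented by periodic families over the natural
  numbers.  \<open>L j\<close> stands for the correspondence from \<open>M j\<close> to \<open>M (j + 1)\<close>.\<close>

definition cyclic :: "nat \<Rightarrow> (nat \<Rightarrow> 'x) \<Rightarrow> bool" where
  "cyclic r f \<longleftrightarrow> (\<forall>j. f (j + Suc r) = f j)"

definition corr_space :: "(nat \<Rightarrow> ('a, 'e) symplectic) \<Rightarrow> nat \<Rightarrow> ('a \<times> 'a, 'e \<times> 'e) symplectic" where
  "corr_space M j = twisted_prod (M j) (M (Suc j))"

text \<open>Nonemptiness is part of the convention: an empty component would make every condition
  imposed in \<open>Ham_star\<close> below vacuous, also for the remaining components.\<close>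

definition cyclic_lagrangian_correspondence ::
    "nat \<Rightarrow> (nat \<Rightarrow> ('a, 'e::euclidean_space) symplectic) \<Rightarrow> (nat \<Rightarrow> ('a \<times> 'a) set) \<Rightarrow> bool" where
  "cyclic_lagrangian_correspondence r M L \<longleftrightarrow>
     cyclic r M \<and> cyclic r L \<and>
     (\<forall>j. symplectic_manifold (M j) \<and> lagrangian (corr_space M j) (L j) \<and>
          compactin (mtop (corr_space M j)) (L j) \<and> L j \<noteq> {})"

text \<open>A point \<open>(m'\<^sub>0, m\<^sub>1, m'\<^sub>1, \<dots>, m'\<^sub>r, m\<^sub>r\<^sub>+\<^sub>1)\<close> of \<open>L 0 \<times> \<dots> \<times> L r\<close> is the family
  \<open>y j = (m'\<^sub>j, m\<^sub>j\<^sub>+\<^sub>1)\<close> on \<open>{..r}\<close>.  Thus \<open>m'\<^sub>i = fst (y i)\<close> and \<open>m\<^sub>i = incoming r y i\<close>,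
  where \<open>m\<^sub>0 = m\<^sub>r\<^sub>+\<^sub>1\<close>.\<close>

definition incoming :: "nat \<Rightarrow> (nat \<Rightarrow> 'a \<times> 'a) \<Rightarrow> nat \<Rightarrow> 'a" where
  "incoming r y i = snd (y (if i = 0 then r else i - 1))"

text \<open>Transversality of the defining equations \<open>\<phi>\<^sub>i(m\<^sub>i) = m'\<^sub>i\<close>, \<open>i \<in> I\<close>.\<close>

definition transversal_equations ::
    "nat \<Rightarrow> (nat \<Rightarrow> ('a, 'e::euclidean_space) symplectic) \<Rightarrow> (nat \<Rightarrow> ('a \<times> 'a) set)
      \<Rightarrow> (nat \<Rightarrow> 'a \<Rightarrow> 'a) \<Rightarrow> nat set \<Rightarrow> bool" where
  "transversal_equations r M L \<phi> I \<longleftrightarrow>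
     transverse_map {..r} (corr_space M) (\<Pi>\<^sub>E j\<in>{..r}. L j)
       I (\<lambda>i. mprod (M i) (M i)) (\<Pi>\<^sub>E i\<in>I. {(q, q) | q. q \<in> points (M i)})
       (\<lambda>y. \<lambda>i\<in>I. (\<phi> i (incoming r y i), fst (y i)))"

definition solution_set ::
    "nat \<Rightarrow> (nat \<Rightarrow> ('a \<times> 'a) set) \<Rightarrow> (nat \<Rightarrow> 'a \<Rightarrow> 'a) \<Rightarrow> nat set \<Rightarrow> (nat \<Rightarrow> 'a \<times> 'a) set" where
  "solution_set r L \<phi> I =
     {y \<in> (\<Pi>\<^sub>E j\<in>{..r}. L j). \<forall>i\<in>I. \<phi> i (incoming r y i) = fst (y i)}"

definition ham_diffeos ::
    "(nat \<Rightarrow> ('a, 'e::euclidean_space) symplectic) \<Rightarrow> (nat \<Rightarrow> real)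
      \<Rightarrow> (nat \<Rightarrow> real \<Rightarrow> 'a \<Rightarrow> real) \<Rightarrow> nat \<Rightarrow> 'a \<Rightarrow> 'a" where
  "ham_diffeos M \<delta> H j = ham_diffeo (M j) (\<delta> j) (H j)"

definition Ham_star ::
    "nat \<Rightarrow> (nat \<Rightarrow> ('a, 'e::euclidean_space) symplectic) \<Rightarrow> (nat \<Rightarrow> real)
      \<Rightarrow> (nat \<Rightarrow> ('a \<times> 'a) set) \<Rightarrow> (nat \<Rightarrow> real \<Rightarrow> 'a \<Rightarrow> real) set" where
  "Ham_star r M \<delta> L =
     {H. cyclic r H \<and>
         (\<forall>j. smooth_hamiltonian (M j) (\<delta> j) (H j) \<and> (\<exists>\<Phi>. is_ham_flow (M j) (\<delta> j) (H j) \<Phi>)) \<and>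
         (\<forall>I\<subseteq>{..r}. transversal_equations r M L (ham_diffeos M \<delta> H) I)}"

text \<open>The components \<open>L'\<^sub>j\<^sub>(\<^sub>j\<^sub>+\<^sub>1\<^sub>) = (Id \<times> \<phi>\<^sub>j\<^sub>+\<^sub>1) L\<^sub>j\<^sub>(\<^sub>j\<^sub>+\<^sub>1\<^sub>)\<close>.\<close>

definition perturbed :: "(nat \<Rightarrow> 'a \<Rightarrow> 'a) \<Rightarrow> (nat \<Rightarrow> ('a \<times> 'a) set) \<Rightarrow> nat \<Rightarrow> ('a \<times> 'a) set" where
  "perturbed \<phi> L j = map_prod id (\<phi> (Suc j)) ` L j"


subsection \<open>Generalized intersections\<close>

text \<open>\<open>\<I>(L, H)\<close>, as a set of tuples of trajectories \<open>x\<^sub>j : [0, \<delta>\<^sub>j] \<rightarrow> M\<^sub>j\<close>.\<close>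

definition gen_intersection ::
    "nat \<Rightarrow> (nat \<Rightarrow> ('a, 'e::euclidean_space) symplectic) \<Rightarrow> (nat \<Rightarrow> real)
      \<Rightarrow> (nat \<Rightarrow> ('a \<times> 'a) set) \<Rightarrow> (nat \<Rightarrow> real \<Rightarrow> 'a \<Rightarrow> real) \<Rightarrow> (nat \<Rightarrow> real \<Rightarrow> 'a) set" where
  "gen_intersection r M \<delta> L H =
     {x \<in> (\<Pi>\<^sub>E j\<in>{..r}. extensional {0..\<delta> j}).
        \<forall>j\<le>r. ham_trajectory (M j) (\<delta> j) (H j) (x j) \<and>
          (x j (\<delta> j), x (Suc j mod Suc r) 0) \<in> L j}"

text \<open>The tuple \<open>(x\<^sub>0(\<delta>\<^sub>0), x\<^sub>1(0), x\<^sub>1(\<delta>\<^sub>1), \<dots>, x\<^sub>r(\<delta>\<^sub>r), x\<^sub>0(0))\<close>.\<close>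

definition endpoints ::
    "nat \<Rightarrow> (nat \<Rightarrow> real) \<Rightarrow> (nat \<Rightarrow> real \<Rightarrow> 'a) \<Rightarrow> nat \<Rightarrow> 'a \<times> 'a" where
  "endpoints r \<delta> x = (\<lambda>j\<in>{..r}. (x j (\<delta> j), x (Suc j mod Suc r) 0))"

text \<open>\<open>(graph \<phi>\<^sub>1 \<times> \<dots> \<times> graph \<phi>\<^sub>r \<times> graph \<phi>\<^sub>0)\<^sup>T\<close>; for identity maps this is
  \<open>(\<Delta>\<^sub>M\<^sub>1 \<times> \<dots> \<times> \<Delta>\<^sub>M\<^sub>r \<times> \<Delta>\<^sub>M\<^sub>0)\<^sup>T\<close>.\<close>

definition cyclic_graphs ::
    "nat \<Rightarrow> (nat \<Rightarrow> ('a, 'e) symplectic) \<Rightarrow> (nat \<Rightarrow> 'a \<Rightarrow> 'a) \<Rightarrow> (nat \<Rightarrow> 'a \<times> 'a) set" where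
  "cyclic_graphs r M \<phi> =
     {y \<in> (\<Pi>\<^sub>E j\<in>{..r}. points (M j) \<times> points (M (Suc j))).
        \<forall>i\<le>r. \<phi> i (incoming r y i) = fst (y i)}"


subsection \<open>Fiber products and geometric composition\<close>

text \<open>\<open>M\<^sub>j \<times> graph \<phi>\<^sub>j\<^sub>+\<^sub>1 \<times> \<dots> \<times> graph \<phi>\<^sub>j\<^sub>'\<^sub>-\<^sub>1 \<times> M\<^sub>j\<^sub>'\<close>, with elements regrouped as families
  \<open>z i \<in> M\<^sub>i \<times> M\<^sub>i\<^sub>+\<^sub>1\<close>, \<open>j \<le> i < j'\<close>.\<close>

definition segment_graphs ::
    "(nat \<Rightarrow> ('a, 'e) symplectic) \<Rightarrow> (nat \<Rightarrow> 'a \<Rightarrow> 'a) \<Rightarrow> nat \<Rightarrow> nat \<Rightarrow> (nat \<Rightarrow> 'a \<times> 'a) set" where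
  "segment_graphs M \<phi> j j' =
     {z \<in> (\<Pi>\<^sub>E i\<in>{j..<j'}. points (M i) \<times> points (M (Suc i))).
        \<forall>i. j < i \<and> i < j' \<longrightarrow> \<phi> i (snd (z (i - 1))) = fst (z i)}"

definition fiber_product ::
    "(nat \<Rightarrow> ('a, 'e) symplectic) \<Rightarrow> (nat \<Rightarrow> ('a \<times> 'a) set) \<Rightarrow> (nat \<Rightarrow> 'a \<Rightarrow> 'a)
      \<Rightarrow> nat \<Rightarrow> nat \<Rightarrow> (nat \<Rightarrow> 'a \<times> 'a) set" where
  "fiber_product M L \<phi> j j' = (\<Pi>\<^sub>E i\<in>{j..<j'}. L i) \<inter> segment_graphs M \<phi> j j'"

text \<open>The consecutive pairs \<open>j < j' \<le> j + r + 1\<close> in the complement of \<open>I \<subseteq> {..r}\<close>, where only \<open>j\<close>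
  is reduced modulo \<open>r + 1\<close>.\<close>

definition consecutive :: "nat \<Rightarrow> nat set \<Rightarrow> (nat \<times> nat) set" where
  "consecutive r I =
     {(j, j'). j \<le> r \<and> j \<notin> I \<and> j < j' \<and> j' \<le> j + Suc r \<and> j' mod Suc r \<notin> I \<and>
        (\<forall>i. j < i \<and> i < j' \<longrightarrow> i mod Suc r \<in> I)}"

definition partial_fiber_product ::
    "nat \<Rightarrow> (nat \<Rightarrow> ('a, 'e) symplectic) \<Rightarrow> (nat \<Rightarrow> ('a \<times> 'a) set) \<Rightarrow> (nat \<Rightarrow> 'a \<Rightarrow> 'a)
      \<Rightarrow> nat set \<Rightarrow> (nat \<times> nat \<Rightarrow> nat \<Rightarrow> 'a \<times> 'a) set" where
  "partial_fiber_product r M L \<phi> I =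
     (\<Pi>\<^sub>E (j, j')\<in>consecutive r I. fiber_product M L \<phi> j j')"

text \<open>Regrouping of the components of a point of \<open>L 0 \<times> \<dots> \<times> L r\<close> according to the consecutive
  pairs.\<close>

definition regroup ::
    "nat \<Rightarrow> nat set \<Rightarrow> (nat \<Rightarrow> 'a \<times> 'a) \<Rightarrow> nat \<times> nat \<Rightarrow> nat \<Rightarrow> 'a \<times> 'a" where
  "regroup r I y = (\<lambda>(j, j')\<in>consecutive r I. \<lambda>i\<in>{j..<j'}. y (i mod Suc r))"

text \<open>The map \<open>Id \<times> \<phi>\<^sub>j\<^sub>+\<^sub>1 \<times> Id \<times> \<dots> \<times> \<phi>\<^sub>j\<^sub>'\<close> on families indexed by \<open>K = {j..<j'}\<close>
  (or \<open>K = {..r}\<close>).\<close>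

definition perturb_map ::
    "(nat \<Rightarrow> 'a \<Rightarrow> 'a) \<Rightarrow> nat set \<Rightarrow> (nat \<Rightarrow> 'a \<times> 'a) \<Rightarrow> nat \<Rightarrow> 'a \<times> 'a" where
  "perturb_map \<phi> K z = (\<lambda>i\<in>K. map_prod id (\<phi> (Suc i)) (z i))"

definition geometric_composition ::
    "(nat \<Rightarrow> ('a, 'e) symplectic) \<Rightarrow> (nat \<Rightarrow> ('a \<times> 'a) set) \<Rightarrow> nat \<Rightarrow> nat \<Rightarrow> ('a \<times> 'a) set" where
  "geometric_composition M L j j' =
     {(q j, q j') | q. (\<forall>i\<in>{j..j'}. q i \<in> points (M i)) \<and> (\<forall>i\<in>{j..<j'}. (q i, q (Suc i)) \<in> L i)}"

end

theory Submission
  imports Defs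
begin

text \<open>The composition \<open>Id \<times> \<phi>\<close> with the time \<open>\<delta>\<close> flows carries \<open>L\<close> to \<open>L'\<close>, and it carries the equations
  \<open>\<phi>\<^sub>i(m\<^sub>i) = m'\<^sub>i\<close> on \<open>L\<close> to the equations \<open>m\<^sub>i = m'\<^sub>i\<close> on \<open>L'\<close>.  So all identifications and all transversality
  statements for \<open>L'\<close> with zero Hamiltonians are transported from \<open>L\<close> and \<open>H\<close>, once the flow maps are known
  to be good enough to transport manifold structures, and once families of trajectories are known to
  be the same as solutions of the equations.

  The analytic input about a Hamiltonian flow consists of three facts.  Trajectories are unique
  (\<open>ham_trajectory_unique\<close>): in a chart, Hamilton's equation \<open>\<omega>(X, \<cdot>) = dh\<close> is a linear system for the
  velocity, with smooth nondegenerate coefficients, so the velocity is locally Lipschitz in the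
  position.  The flow preserves the symplectic form (\<open>flow_symplectic\<close>): the pullback of \<open>\<omega>\<close> to space-time is closed,
  its contraction with the time direction is the differential of the Hamiltonian along the flow, and so
  the time derivative of the pulled back form is a difference of mixed second derivatives, which are equal.
  Therefore the time \<open>\<delta>\<close> flow is injective with injective derivatives, and the inverse function theorem makes it
  an open embedding (\<open>flow_open_embedding\<close>).  Its inverse transports charts adapted to \<open>L\<close> into charts adapted
  to \<open>L'\<close>, and since the derivatives preserve the form, \<open>L'\<close> is again Lagrangian (\<open>lagrangian_image\<close>).

  Transversality of a set of equations on the full product implies transversality of the
  intersections with the corresponding products of diagonals, both for the cyclic intersection and for each
  segment between consecutive indices (\<open>transversal_equations_imp_transverse_intersection\<close>).  The projection
  of a segment to its end factors is an immersion by a symplectic argument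
  (\<open>fiber_product_projection_immersion\<close>): the difference of two tangent vectors with the same projection is
  orthogonal, for the total form, to the tangent spaces of the Lagrangians and to those of the diagonals;
  by transversality these span everything, and the form is nondegenerate.  That the segments partition the
  cyclic index set (\<open>consecutive_exists\<close>, \<open>consecutive_unique\<close>) identifies the partial fiber product with
  the product of the fiber products over the segments.\<close>

section \<open>Smooth functions on open sets\<close>

lemma linear_basis_expansion:
  assumes "linear A"
  shows "(\<Sum>b\<in>Basis. (v \<bullet> b) *\<^sub>R A b) = A v"
proof -
  have "A v = A (\<Sum>b\<in>Basis. (v \<bullet> b) *\<^sub>R b)" by (simp add: euclidean_representation)
  also have "\<dots> = (\<Sum>b\<in>Basis. (v \<bullet> b) *\<^sub>R A b)" using assms by (simp add: linear_sum linear_scale)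
  finally show ?thesis by simp
qed

lemma Ck_on_cong:
  assumes "open U" "\<And>x. x \<in> U \<Longrightarrow> f x = g x" "Ck_on k U f"
  shows "Ck_on k U g"
proof (cases k)
  case 0
  with assms show ?thesis by (auto cong: continuous_on_cong)
next
  case (Suc m)
  with assms(3) obtain f' where f': "\<And>x. x \<in> U \<Longrightarrow> (f has_derivative f' x) (at x)"
      and "\<forall>v. Ck_on m U (\<lambda>x. f' x v)" by auto
  moreover have "(g has_derivative f' x) (at x)" if "x \<in> U" for x
    using has_derivative_transform_within_open[OF f'[OF that] assms(1) that] assms(2) by auto
  ultimately show ?thesis unfolding Suc by auto
qed

text \<open>The derivative in the recursion step is unique, so it can be taken to be the Frechet derivative.
  This makes being \<open>C\<^sup>k\<close> a local property, since locally chosen derivatives agree on overlaps.\<close>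

lemma Ck_on_Suc_iff:
  assumes "open U"
  shows "Ck_on (Suc k) U f \<longleftrightarrow>
    (\<forall>x\<in>U. f differentiable (at x)) \<and> (\<forall>v. Ck_on k U (\<lambda>x. frechet_derivative f (at x) v))"
    (is "?l \<longleftrightarrow> ?r")
proof
  assume ?l
  then obtain f' where f': "\<And>x. x \<in> U \<Longrightarrow> (f has_derivative f' x) (at x)"
      and c: "\<And>v. Ck_on k U (\<lambda>x. f' x v)" by auto
  have "f' x v = frechet_derivative f (at x) v" if "x \<in> U" for x v
    using frechet_derivative_at[OF f'[OF that]] by simp
  then have "Ck_on k U (\<lambda>x. frechet_derivative f (at x) v)" for v
    by (rule Ck_on_cong[OF assms _ c])
  with f' show ?r unfolding differentiable_def by blast
next
  assume ?r
  then show ?l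
    unfolding Ck_on.simps using frechet_derivative_works by (intro exI[of _ "\<lambda>x. frechet_derivative f (at x)"]) blast
qed

lemma Ck_on_SucI:
  "(\<And>x. x \<in> U \<Longrightarrow> (f has_derivative f' x) (at x)) \<Longrightarrow> (\<And>v. Ck_on k U (\<lambda>x. f' x v)) \<Longrightarrow>
    Ck_on (Suc k) U f"
  by auto

lemma Ck_on_SucE:
  assumes "Ck_on (Suc k) U f"
  obtains f' where "\<And>x. x \<in> U \<Longrightarrow> (f has_derivative f' x) (at x)" "\<And>v. Ck_on k U (\<lambda>x. f' x v)"
  using assms by auto

lemma Ck_on_imp_continuous_on: "Ck_on k U f \<Longrightarrow> continuous_on U f"
  by (cases k) (auto elim!: Ck_on_SucE intro!: continuous_at_imp_continuous_on intro: has_derivative_continuous simp del: Ck_on.simps(2))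

lemma Ck_on_Suc_imp: "Ck_on (Suc k) U f \<Longrightarrow> Ck_on k U f"
proof (induction k arbitrary: f)
  case 0 then show ?case by (simp only: Ck_on.simps(1)) (rule Ck_on_imp_continuous_on)
next
  case (Suc k)
  then obtain f' where "\<forall>x\<in>U. (f has_derivative f' x) (at x)" "\<And>v. Ck_on (Suc k) U (\<lambda>x. f' x v)"
    unfolding Ck_on.simps(2)[of "Suc k"] by blast
  then show ?case by (intro Ck_on_SucI[of U f f'] Suc.IH) blast+
qed

lemma Ck_on_subset: "Ck_on k U f \<Longrightarrow> V \<subseteq> U \<Longrightarrow> Ck_on k V f"
proof (induction k arbitrary: f)
  case 0 then show ?case by (auto intro: continuous_on_subset)
next
  case (Suc k)
  then obtain f' where "\<And>x. x \<in> U \<Longrightarrow> (f has_derivative f' x) (at x)" "\<And>v. Ck_on k U (\<lambda>x. f' x v)"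
    by (elim Ck_on_SucE) blast
  with Suc show ?case by (intro Ck_on_SucI[of V f f']) blast+
qed

lemma Ck_on_local:
  assumes "\<And>x. x \<in> U \<Longrightarrow> \<exists>V. open V \<and> x \<in> V \<and> Ck_on k V f"
  shows "Ck_on k U f"
  using assms
proof (induction k arbitrary: f)
  case 0
  have "isCont f x" if "x \<in> U" for x
    using 0[OF that] by (auto simp: continuous_on_eq_continuous_at)
  then show ?case by (auto simp: continuous_at_imp_continuous_on)
next
  case (Suc k)
  have 1: "(f has_derivative frechet_derivative f (at x)) (at x)" if "x \<in> U" for x
    using Suc.prems[OF that] Ck_on_Suc_iff frechet_derivative_works by metis
  have "\<exists>V. open V \<and> x \<in> V \<and> Ck_on k V (\<lambda>x. frechet_derivative f (at x) v)" if "x \<in> U" for x v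
    using Suc.prems[OF that] Ck_on_Suc_iff by metis
  then have "Ck_on k U (\<lambda>x. frechet_derivative f (at x) v)" for v by (rule Suc.IH)
  with 1 show ?case by (rule Ck_on_SucI)
qed

lemma Ck_on_const: "Ck_on k U (\<lambda>_. c)"
proof (induction k arbitrary: c)
  case (Suc k) then show ?case by (intro Ck_on_SucI[where f' = "\<lambda>_ _. 0"]) auto
qed auto

lemma Ck_on_bounded_linear: "bounded_linear f \<Longrightarrow> Ck_on k U f"
proof (cases k)
  case (Suc m)
  assume "bounded_linear f"
  with Suc show ?thesis by (auto intro!: Ck_on_SucI[where f' = "\<lambda>_. f"] Ck_on_const bounded_linear_imp_has_derivative simp del: Ck_on.simps)
qed (auto intro: linear_continuous_on)

lemma Ck_on_bounded_linear_compose: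
  "bounded_linear h \<Longrightarrow> Ck_on k U f \<Longrightarrow> Ck_on k U (\<lambda>x. h (f x))"
proof (induction k arbitrary: f)
  case 0 then show ?case by (auto intro: bounded_linear.continuous_on)
next
  case (Suc k)
  then obtain f' where "\<And>x. x \<in> U \<Longrightarrow> (f has_derivative f' x) (at x)" "\<And>v. Ck_on k U (\<lambda>x. f' x v)"
    by (elim Ck_on_SucE) blast
  with Suc show ?case
    by (intro Ck_on_SucI[where f' = "\<lambda>x v. h (f' x v)"]) (auto intro: bounded_linear.has_derivative simp del: Ck_on.simps)
qed

lemma Ck_on_add: "Ck_on k U f \<Longrightarrow> Ck_on k U g \<Longrightarrow> Ck_on k U (\<lambda>x. f x + g x)"
proof (induction k arbitrary: f g)
  case (Suc k)
  then obtain f' g' where "\<And>x. x \<in> U \<Longrightarrow> (f has_derivative f' x) (at x)" "\<And>v. Ck_on k U (\<lambda>x. f' x v)"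
     "\<And>x. x \<in> U \<Longrightarrow> (g has_derivative g' x) (at x)" "\<And>v. Ck_on k U (\<lambda>x. g' x v)"
    by (elim Ck_on_SucE) blast
  with Suc.IH show ?case
    by (intro Ck_on_SucI[where f' = "\<lambda>x v. f' x v + g' x v"] has_derivative_add) (auto simp del: Ck_on.simps)
qed (auto intro: continuous_intros)

lemma Ck_on_sum:
  "(\<And>i. i \<in> A \<Longrightarrow> Ck_on k U (f i)) \<Longrightarrow> Ck_on k U (\<lambda>x. \<Sum>i\<in>A. f i x)"
  by (induction A rule: infinite_finite_induct) (auto simp: Ck_on_const intro: Ck_on_add)

lemma Ck_on_scaleR:
  "Ck_on k U f \<Longrightarrow> Ck_on k U g \<Longrightarrow> Ck_on k U (\<lambda>x. f x *\<^sub>R g x)"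
proof (induction k arbitrary: f g)
  case (Suc k)
  then obtain f' g' where d: "\<And>x. x \<in> U \<Longrightarrow> (f has_derivative f' x) (at x)" "\<And>v. Ck_on k U (\<lambda>x. f' x v)"
     "\<And>x. x \<in> U \<Longrightarrow> (g has_derivative g' x) (at x)" "\<And>v. Ck_on k U (\<lambda>x. g' x v)"
    by (elim Ck_on_SucE) blast
  have "Ck_on k U f" "Ck_on k U g" using Suc.prems Ck_on_Suc_imp by blast+
  then have "Ck_on k U (\<lambda>x. f x *\<^sub>R g' x v + f' x v *\<^sub>R g x)" for v
    by (intro Ck_on_add Suc.IH d)
  with d show ?case
    by (intro Ck_on_SucI[where f' = "\<lambda>x v. f x *\<^sub>R g' x v + f' x v *\<^sub>R g x"] has_derivative_scaleR) auto
qed (auto intro: continuous_intros)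

text \<open>The chain rule evaluates the derivative of \<open>g\<close> on a vector that varies with \<open>x\<close>.  Expanding that
  vector in the basis leaves products of functions to which the induction hypothesis applies.\<close>

lemma Ck_on_compose:
  fixes f :: "'e::euclidean_space \<Rightarrow> 'f::euclidean_space"
  shows "Ck_on k U f \<Longrightarrow> Ck_on k W g \<Longrightarrow> f ` U \<subseteq> W \<Longrightarrow> open U \<Longrightarrow> Ck_on k U (\<lambda>x. g (f x))"
proof (induction k arbitrary: g)
  case 0 then show ?case by (auto intro: continuous_on_compose2)
next
  case (Suc k)
  obtain f' where d1: "\<And>x. x \<in> U \<Longrightarrow> (f has_derivative f' x) (at x)" "\<And>v. Ck_on k U (\<lambda>x. f' x v)"
    using Ck_on_SucE[OF Suc.prems(1)] by metis
  obtain g' where d2: "\<And>x. x \<in> W \<Longrightarrow> (g has_derivative g' x) (at x)" "\<And>v. Ck_on k W (\<lambda>x. g' x v)"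
    using Ck_on_SucE[OF Suc.prems(2)] by metis
  note d = d1 d2
  have c: "((\<lambda>x. g (f x)) has_derivative (\<lambda>v. g' (f x) (f' x v))) (at x)" if "x \<in> U" for x
    using has_derivative_compose[OF d(1)[OF that] d(3)] that Suc.prems(3) by blast
  have "Ck_on k U f" using Suc.prems Ck_on_Suc_imp by blast
  then have "Ck_on k U (\<lambda>x. g' (f x) b)" for b
    by (rule Suc.IH) (use d Suc.prems in auto)
  then have 1: "Ck_on k U (\<lambda>x. \<Sum>b\<in>Basis. (f' x v \<bullet> b) *\<^sub>R g' (f x) b)" for v
    by (intro Ck_on_sum Ck_on_scaleR Ck_on_bounded_linear_compose[OF bounded_linear_inner_left] d)
  have "(\<Sum>b\<in>Basis. (f' x v \<bullet> b) *\<^sub>R g' (f x) b) = g' (f x) (f' x v)" if "x \<in> U" for x v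
  proof -
    have "linear (g' (f x))" using d(3) that Suc.prems(3) has_derivative_linear by blast
    then show ?thesis by (rule linear_basis_expansion)
  qed
  then have "Ck_on k U (\<lambda>x. g' (f x) (f' x v))" for v
    by (intro Ck_on_cong[OF \<open>open U\<close> _ 1]) auto
  with c show ?case by (rule Ck_on_SucI)
qed

definition Cinf_on :: "'e::euclidean_space set \<Rightarrow> ('e \<Rightarrow> 'f::real_normed_vector) \<Rightarrow> bool" where
  "Cinf_on U f \<longleftrightarrow> (\<forall>k. Ck_on k U f)"

lemma Cinf_on_cong:
  "open U \<Longrightarrow> (\<And>x. x \<in> U \<Longrightarrow> f x = g x) \<Longrightarrow> Cinf_on U f \<Longrightarrow> Cinf_on U g"
  unfolding Cinf_on_def using Ck_on_cong by blast

lemma Cinf_on_subset: "Cinf_on U f \<Longrightarrow> V \<subseteq> U \<Longrightarrow> Cinf_on V f"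
  unfolding Cinf_on_def using Ck_on_subset by blast

lemma Cinf_on_local:
  "(\<And>x. x \<in> U \<Longrightarrow> \<exists>V. open V \<and> x \<in> V \<and> Cinf_on V f) \<Longrightarrow> Cinf_on U f"
  unfolding Cinf_on_def by (intro allI Ck_on_local) blast

lemma Cinf_on_imp_continuous_on: "Cinf_on U f \<Longrightarrow> continuous_on U f"
  unfolding Cinf_on_def using Ck_on_imp_continuous_on by blast

lemma Cinf_on_has_derivative:
  "Cinf_on U f \<Longrightarrow> x \<in> U \<Longrightarrow> (f has_derivative frechet_derivative f (at x)) (at x)"
  unfolding Cinf_on_def
  by (drule spec[of _ "Suc 0"], erule Ck_on_SucE) (metis frechet_derivative_at)

lemma Cinf_on_derivative:
  "open U \<Longrightarrow> Cinf_on U f \<Longrightarrow> Cinf_on U (\<lambda>x. frechet_derivative f (at x) v)"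
  unfolding Cinf_on_def using Ck_on_Suc_iff by blast

lemma Cinf_on_const: "Cinf_on U (\<lambda>_. c)"
  unfolding Cinf_on_def by (simp add: Ck_on_const)

lemma Cinf_on_bounded_linear: "bounded_linear f \<Longrightarrow> Cinf_on U f"
  unfolding Cinf_on_def by (simp add: Ck_on_bounded_linear)

lemma Cinf_on_bounded_linear_compose:
  "bounded_linear h \<Longrightarrow> Cinf_on U f \<Longrightarrow> Cinf_on U (\<lambda>x. h (f x))"
  unfolding Cinf_on_def by (simp add: Ck_on_bounded_linear_compose)

lemma Cinf_on_add: "Cinf_on U f \<Longrightarrow> Cinf_on U g \<Longrightarrow> Cinf_on U (\<lambda>x. f x + g x)"
  unfolding Cinf_on_def by (simp add: Ck_on_add)

lemma Cinf_on_sum: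
  "(\<And>i. i \<in> A \<Longrightarrow> Cinf_on U (f i)) \<Longrightarrow> Cinf_on U (\<lambda>x. \<Sum>i\<in>A. f i x)"
  unfolding Cinf_on_def by (simp add: Ck_on_sum)

lemma Cinf_on_scaleR:
  "Cinf_on U f \<Longrightarrow> Cinf_on U g \<Longrightarrow> Cinf_on U (\<lambda>x. f x *\<^sub>R g x)"
  unfolding Cinf_on_def by (simp add: Ck_on_scaleR)

lemma Cinf_on_compose:
  fixes f :: "'e::euclidean_space \<Rightarrow> 'f::euclidean_space"
  shows "Cinf_on U f \<Longrightarrow> Cinf_on W g \<Longrightarrow> f ` U \<subseteq> W \<Longrightarrow> open U \<Longrightarrow> Cinf_on U (\<lambda>x. g (f x))"
  unfolding Cinf_on_def using Ck_on_compose by blast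

lemma Cinf_on_Pair:
  assumes "Cinf_on U f" "Cinf_on U g"
  shows "Cinf_on U (\<lambda>x. (f x, g x))"
proof -
  have "Cinf_on U (\<lambda>x. (f x, 0) + (0, g x))"
    by (intro Cinf_on_add Cinf_on_bounded_linear_compose[OF bounded_linear_Pair[OF bounded_linear_ident bounded_linear_zero]]
      Cinf_on_bounded_linear_compose[OF bounded_linear_Pair[OF bounded_linear_zero bounded_linear_ident]] assms)
  then show ?thesis by simp
qed

text \<open>A map into the linear maps is only ever seen through its values on fixed vectors; expanding
  a variable vector in the basis reduces its evaluation to that case.\<close>

lemma Cinf_on_linear_apply:
  fixes s :: "'e::euclidean_space \<Rightarrow> 'f::euclidean_space"
  assumes "open U" "\<And>x. x \<in> U \<Longrightarrow> linear (A x)" "\<And>v. Cinf_on U (\<lambda>x. A x v)" "Cinf_on U s"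
  shows "Cinf_on U (\<lambda>x. A x (s x))"
proof (rule Cinf_on_cong[OF assms(1)])
  show "Cinf_on U (\<lambda>x. \<Sum>b\<in>Basis. (s x \<bullet> b) *\<^sub>R A x b)"
    by (intro Cinf_on_sum Cinf_on_scaleR Cinf_on_bounded_linear_compose[OF bounded_linear_inner_left] assms)
  fix x assume "x \<in> U"
  then show "(\<Sum>b\<in>Basis. (s x \<bullet> b) *\<^sub>R A x b) = A x (s x)"
    using assms(2) linear_basis_expansion by blast
qed

lemma Cinf_on_locally_Lipschitz:
  assumes "open U" "Cinf_on U f" "x \<in> U"
  obtains d K where "0 < d" "0 \<le> K" "ball x d \<subseteq> U"
    "\<And>y z. y \<in> ball x d \<Longrightarrow> z \<in> ball x d \<Longrightarrow> norm (f y - f z) \<le> K * norm (y - z)"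
proof -
  obtain e where e: "0 < e" "cball x e \<subseteq> U"
    using assms open_contains_cball by blast
  define D where "D y b = frechet_derivative f (at y) b" for y b
  have c: "continuous_on (cball x e) (\<lambda>y. D y b)" for b
    using Cinf_on_imp_continuous_on[OF Cinf_on_derivative[OF assms(1,2)]] continuous_on_subset e(2)
    unfolding D_def by blast
  have "\<exists>C. \<forall>y\<in>cball x e. norm (D y b) \<le> C" for b
    using compact_imp_bounded[OF compact_continuous_image[OF c compact_cball]] unfolding bounded_iff by blast
  then obtain C where C: "\<And>b y. y \<in> cball x e \<Longrightarrow> norm (D y b) \<le> C b" by metis
  define K where "K = (\<Sum>b\<in>Basis. C b)"
  have C0: "0 \<le> C b" for b using C[of x b] e norm_ge_zero order_trans by (metis centre_in_cball less_imp_le)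
  have K: "norm (D y v) \<le> K * norm v" if "y \<in> cball x e" for y v
  proof -
    have l: "linear (D y)" using Cinf_on_has_derivative[OF assms(2)] that e(2) has_derivative_linear
      unfolding D_def by blast
    have "D y v = (\<Sum>b\<in>Basis. (v \<bullet> b) *\<^sub>R D y b)"
      using linear_basis_expansion[OF l] by simp
    also have "norm \<dots> \<le> (\<Sum>b\<in>Basis. norm ((v \<bullet> b) *\<^sub>R D y b))" by (rule norm_sum)
    also have "\<dots> \<le> (\<Sum>b\<in>Basis. norm v * C b)"
      by (intro sum_mono) (auto intro!: mult_mono Basis_le_norm C that)
    finally show ?thesis by (simp add: K_def sum_distrib_left mult.commute)
  qed
  show ?thesis
  proof (rule that)
    show "0 < e" "0 \<le> K" using e C0 by (auto simp: K_def intro: sum_nonneg)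
    show "ball x e \<subseteq> U" using e(2) by auto
    show "norm (f y - f z) \<le> K * norm (y - z)" if "y \<in> ball x e" "z \<in> ball x e" for y z
    proof (rule differentiable_bound[of "ball x e" f D])
      show "(f has_derivative D w) (at w within ball x e)" if "w \<in> ball x e" for w
      proof -
        have "w \<in> U" using subsetD[OF e(2), of w] that by simp
        then show ?thesis
          unfolding D_def by (rule has_derivative_at_withinI[OF Cinf_on_has_derivative[OF assms(2)]])
      qed
      show "onorm (D w) \<le> K" if "w \<in> ball x e" for w
        using K[of w] that by (intro onorm_le) auto
    qed (use that in auto)
  qed
qed

text \<open>Symmetry of second derivatives: the second difference of \<open>f\<close> over a small parallelogram is,
  by two applications of the mean value theorem, a mixed second derivative at a nearby point, in
  either order.\<close>

lemma second_difference_mean_value: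
  fixes f :: "'e::euclidean_space \<Rightarrow> real"
  assumes U: "open U" "Cinf_on U f" and h: "0 < h"
    and sub: "\<And>s t. 0 \<le> s \<Longrightarrow> s \<le> h \<Longrightarrow> 0 \<le> t \<Longrightarrow> t \<le> h \<Longrightarrow> x + s *\<^sub>R u + t *\<^sub>R v \<in> U"
  obtains s t where "0 \<le> s" "s \<le> h" "0 \<le> t" "t \<le> h"
    "f (x + h *\<^sub>R u + h *\<^sub>R v) - f (x + h *\<^sub>R u) - f (x + h *\<^sub>R v) + f x =
     h * h * frechet_derivative (\<lambda>y. frechet_derivative f (at y) u) (at (x + s *\<^sub>R u + t *\<^sub>R v)) v"
proof -
  define D where "D y = frechet_derivative f (at y)" for y
  define D2 where "D2 y = frechet_derivative (\<lambda>y. frechet_derivative f (at y) u) (at y)" for y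
  have D: "(f has_derivative D y) (at y)" if "y \<in> U" for y
    unfolding D_def using U that Cinf_on_has_derivative by blast
  have D2: "((\<lambda>y. D y u) has_derivative D2 y) (at y)" if "y \<in> U" for y
    unfolding D_def D2_def by (rule Cinf_on_has_derivative[OF Cinf_on_derivative[OF U] that])
  define g where "g s = f (x + s *\<^sub>R u + h *\<^sub>R v) - f (x + s *\<^sub>R u)" for s
  have g: "DERIV g s :> D (x + s *\<^sub>R u + h *\<^sub>R v) u - D (x + s *\<^sub>R u) u" if "0 \<le> s" "s \<le> h" for s
  proof -
    have 1: "x + s *\<^sub>R u + h *\<^sub>R v \<in> U" "x + s *\<^sub>R u \<in> U" using sub[of s h] sub[of s 0] that h by auto
    have "((\<lambda>s. f (x + s *\<^sub>R u + h *\<^sub>R v)) has_derivative (\<lambda>r. D (x + s *\<^sub>R u + h *\<^sub>R v) (r *\<^sub>R u))) (at s)"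
      by (rule has_derivative_compose[where g = f and f = "\<lambda>s. x + s *\<^sub>R u + h *\<^sub>R v", OF _ D[OF 1(1)]]) (auto intro!: derivative_eq_intros)
    moreover have "((\<lambda>s. f (x + s *\<^sub>R u)) has_derivative (\<lambda>r. D (x + s *\<^sub>R u) (r *\<^sub>R u))) (at s)"
      by (rule has_derivative_compose[where g = f and f = "\<lambda>s. x + s *\<^sub>R u", OF _ D[OF 1(2)]]) (auto intro!: derivative_eq_intros)
    ultimately have "(g has_derivative (\<lambda>r. D (x + s *\<^sub>R u + h *\<^sub>R v) (r *\<^sub>R u) - D (x + s *\<^sub>R u) (r *\<^sub>R u))) (at s)"
      unfolding g_def by (rule has_derivative_diff)
    moreover have "D (x + s *\<^sub>R u + h *\<^sub>R v) (r *\<^sub>R u) - D (x + s *\<^sub>R u) (r *\<^sub>R u) =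
        (D (x + s *\<^sub>R u + h *\<^sub>R v) u - D (x + s *\<^sub>R u) u) * r" for r
      using D[OF 1(1), THEN has_derivative_linear] D[OF 1(2), THEN has_derivative_linear]
      by (simp add: linear_scale algebra_simps)
    ultimately show ?thesis by (simp add: has_field_derivative_def)
  qed
  from MVT2[OF h g] obtain s where s: "0 < s" "s < h"
    "g h - g 0 = (h - 0) * (D (x + s *\<^sub>R u + h *\<^sub>R v) u - D (x + s *\<^sub>R u) u)" by auto
  define k where "k t = D (x + s *\<^sub>R u + t *\<^sub>R v) u" for t
  have k: "DERIV k t :> D2 (x + s *\<^sub>R u + t *\<^sub>R v) v" if "0 \<le> t" "t \<le> h" for t
  proof -
    have 1: "x + s *\<^sub>R u + t *\<^sub>R v \<in> U" using sub[of s t] that s by auto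
    have "(k has_derivative (\<lambda>r. D2 (x + s *\<^sub>R u + t *\<^sub>R v) (r *\<^sub>R v))) (at t)"
      unfolding k_def
      by (rule has_derivative_compose[where g = "\<lambda>y. D y u" and f = "\<lambda>t. x + s *\<^sub>R u + t *\<^sub>R v", OF _ D2[OF 1]]) (auto intro!: derivative_eq_intros)
    then show ?thesis
      using D2[OF 1, THEN has_derivative_linear]
      by (simp add: has_field_derivative_def linear_scale mult.commute[of _ "D2 (x + s *\<^sub>R u + t *\<^sub>R v) v"])
  qed
  from MVT2[OF h k] obtain t where t: "0 < t" "t < h"
    "k h - k 0 = (h - 0) * D2 (x + s *\<^sub>R u + t *\<^sub>R v) v" by auto
  show ?thesis
    by (rule that[of s t]) (use s t in \<open>auto simp: g_def k_def D2_def algebra_simps\<close>)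
qed

lemma symmetric_second_derivative:
  fixes f :: "'e::euclidean_space \<Rightarrow> real"
  assumes U: "open U" "Cinf_on U f" and x: "x \<in> U"
  shows "frechet_derivative (\<lambda>y. frechet_derivative f (at y) u) (at x) v =
         frechet_derivative (\<lambda>y. frechet_derivative f (at y) v) (at x) u"
proof -
  define D where "D u v y = frechet_derivative (\<lambda>y. frechet_derivative f (at y) u) (at y) v" for u v y
  have cont: "continuous_on U (D u v)" for u v
    unfolding D_def by (intro Cinf_on_imp_continuous_on Cinf_on_derivative U)
  have near: "\<bar>D u v x - D v u x\<bar> < e + e" if e: "0 < e" for e
  proof -
    obtain d1 where d1: "0 < d1" "\<And>y. y \<in> U \<Longrightarrow> dist y x < d1 \<Longrightarrow> dist (D u v y) (D u v x) < e"
      using cont[of u v] x e unfolding continuous_on_iff by metis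
    obtain d2 where d2: "0 < d2" "\<And>y. y \<in> U \<Longrightarrow> dist y x < d2 \<Longrightarrow> dist (D v u y) (D v u x) < e"
      using cont[of v u] x e unfolding continuous_on_iff by metis
    obtain d3 where d3: "0 < d3" "ball x d3 \<subseteq> U" using U(1) x open_contains_ball by blast
    define d where "d = min d1 (min d2 d3)"
    define h where "h = d / (norm u + norm v + 1)"
    have pos: "0 < norm u + norm v + 1" by (simp add: add_nonneg_pos)
    have d: "0 < d" using d1 d2 d3 by (simp add: d_def)
    then have h: "0 < h" using pos by (simp add: h_def)
    have close: "dist (x + s *\<^sub>R u + t *\<^sub>R v) x < d" if "0 \<le> s" "s \<le> h" "0 \<le> t" "t \<le> h" for s t
    proof -
      have "dist (x + s *\<^sub>R u + t *\<^sub>R v) x \<le> norm (s *\<^sub>R u) + norm (t *\<^sub>R v)"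
        by (simp add: dist_norm norm_triangle_ineq del: norm_scaleR)
      also have "\<dots> \<le> h * norm u + h * norm v" using that by (auto intro!: add_mono mult_right_mono)
      also have "\<dots> < h * (norm u + norm v + 1)" using h by (simp add: algebra_simps)
      also have "\<dots> = d" using pos by (simp add: h_def)
      finally show ?thesis .
    qed
    have sub: "x + s *\<^sub>R u + t *\<^sub>R v \<in> U" if "0 \<le> s" "s \<le> h" "0 \<le> t" "t \<le> h" for s t
      using close[OF that] d3(2) by (auto simp: d_def dist_commute)
    have sub': "x + s *\<^sub>R v + t *\<^sub>R u \<in> U" if "0 \<le> s" "s \<le> h" "0 \<le> t" "t \<le> h" for s t
      using sub[of t s] that by (simp add: algebra_simps)
    obtain s t where 1: "0 \<le> s" "s \<le> h" "0 \<le> t" "t \<le> h"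
      "f (x + h *\<^sub>R u + h *\<^sub>R v) - f (x + h *\<^sub>R u) - f (x + h *\<^sub>R v) + f x =
       h * h * D u v (x + s *\<^sub>R u + t *\<^sub>R v)"
      using second_difference_mean_value[OF U h sub] unfolding D_def by blast
    obtain s' t' where 2: "0 \<le> s'" "s' \<le> h" "0 \<le> t'" "t' \<le> h"
      "f (x + h *\<^sub>R v + h *\<^sub>R u) - f (x + h *\<^sub>R v) - f (x + h *\<^sub>R u) + f x =
       h * h * D v u (x + s' *\<^sub>R v + t' *\<^sub>R u)"
      using second_difference_mean_value[OF U h sub'] unfolding D_def by blast
    have "x + h *\<^sub>R v + h *\<^sub>R u = x + h *\<^sub>R u + h *\<^sub>R v" by simp
    then have "h * h * D u v (x + s *\<^sub>R u + t *\<^sub>R v) = h * h * D v u (x + s' *\<^sub>R v + t' *\<^sub>R u)"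
      unfolding 1(5)[symmetric] 2(5)[symmetric] by (simp add: add.commute add.left_commute)
    then have eq: "D u v (x + s *\<^sub>R u + t *\<^sub>R v) = D v u (x + s' *\<^sub>R v + t' *\<^sub>R u)" using h by simp
    have "dist (D u v (x + s *\<^sub>R u + t *\<^sub>R v)) (D u v x) < e"
      using d1(2)[OF sub[OF 1(1-4)]] close[OF 1(1-4)] by (simp add: d_def)
    moreover have "dist (D v u (x + s' *\<^sub>R v + t' *\<^sub>R u)) (D v u x) < e"
      using d2(2)[OF sub'[OF 2(1-4)]] close[OF 2(3,4,1,2)] by (simp add: d_def algebra_simps)
    ultimately show ?thesis using eq by (simp add: dist_real_def abs_if split: if_splits)
  qed
  have "D u v x = D v u x"
  proof (rule ccontr)
    assume "D u v x \<noteq> D v u x"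
    then show False using near[of "\<bar>D u v x - D v u x\<bar> / 2"] by simp
  qed
  then show ?thesis by (simp add: D_def)
qed

section \<open>Smooth solutions of linear systems and smooth inverse functions\<close>

text \<open>A linear map that is bounded below stays so, with half the constant, as long as the sum of
  the changes of the images of the basis vectors is small.\<close>

lemma locally_bounded_below:
  fixes A :: "'p::metric_space \<Rightarrow> 'f::euclidean_space \<Rightarrow> 'f"
  assumes V: "open V" "y0 \<in> V" and lin: "\<And>y. y \<in> V \<Longrightarrow> linear (A y)"
    and cont: "\<And>u. continuous_on V (\<lambda>y. A y u)" and inj: "inj (A y0)"
  obtains c d where "0 < c" "0 < d" "ball y0 d \<subseteq> V" "\<And>y u. y \<in> ball y0 d \<Longrightarrow> c * norm u \<le> norm (A y u)"
proof -
  obtain B where B: "0 < B" "\<And>u. B * norm u \<le> norm (A y0 u)"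
    using linear_inj_bounded_below_pos[OF lin[OF V(2)] inj] by metis
  define N where "N y = (\<Sum>b\<in>Basis. norm (A y b - A y0 b))" for y
  have "continuous_on V N" unfolding N_def by (intro continuous_intros cont)
  moreover have "N y0 = 0" by (simp add: N_def)
  ultimately obtain d1 where d1: "0 < d1" "\<And>y. y \<in> V \<Longrightarrow> dist y y0 < d1 \<Longrightarrow> dist (N y) 0 < B / 2"
    using V(2) B(1) unfolding continuous_on_iff by (metis half_gt_zero)
  obtain d2 where d2: "0 < d2" "ball y0 d2 \<subseteq> V" using V open_contains_ball by blast
  have "B / 2 * norm u \<le> norm (A y u)" if y: "y \<in> V" "dist y y0 < d1" for y u
  proof -
    have "linear (\<lambda>u. A y u - A y0 u)" using lin[OF y(1)] lin[OF V(2)] by (rule linear_compose_sub)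
    then have "A y u - A y0 u = (\<Sum>b\<in>Basis. (u \<bullet> b) *\<^sub>R (A y b - A y0 b))"
      using linear_basis_expansion by metis
    then have "norm (A y u - A y0 u) \<le> (\<Sum>b\<in>Basis. norm ((u \<bullet> b) *\<^sub>R (A y b - A y0 b)))"
      by (simp only: norm_sum)
    also have "\<dots> \<le> (\<Sum>b\<in>Basis. norm u * norm (A y b - A y0 b))"
      by (intro sum_mono) (auto intro!: mult_right_mono Basis_le_norm)
    also have "\<dots> = norm u * N y" by (simp add: N_def sum_distrib_left)
    also have "\<dots> \<le> norm u * (B / 2)" using d1(2)[OF y] by (intro mult_left_mono) auto
    finally have "norm (A y u - A y0 u) \<le> norm u * (B / 2)" .
    moreover have "norm (A y0 u) \<le> norm (A y u) + norm (A y u - A y0 u)"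
      by (metis norm_minus_commute norm_triangle_sub)
    ultimately show ?thesis using B(2)[of u] by (simp add: algebra_simps)
  qed
  then show ?thesis
    using B d1 d2 by (intro that[of "B / 2" "min d1 d2"]) (auto simp: dist_commute subset_iff)
qed

text \<open>The solutions are continuous since \<open>A y (w y - w y0) = s y - A y (w y0)\<close>, where the right hand side
  tends to \<open>0\<close> and \<open>A y\<close> is bounded below uniformly in \<open>y\<close>.\<close>

lemma linear_system_solution_continuous:
  fixes A :: "'p::euclidean_space \<Rightarrow> 'f::euclidean_space \<Rightarrow> 'f"
  assumes V: "open V" and lin: "\<And>y. y \<in> V \<Longrightarrow> linear (A y)" "\<And>y. y \<in> V \<Longrightarrow> inj (A y)"
    and cont: "\<And>u. continuous_on V (\<lambda>y. A y u)" "continuous_on V s"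
    and sol: "\<And>y. y \<in> V \<Longrightarrow> A y (w y) = s y"
  shows "continuous_on V w"
proof -
  have "isCont w y0" if y0: "y0 \<in> V" for y0
  proof -
    obtain c d where cd: "0 < c" "0 < d" "ball y0 d \<subseteq> V"
      "\<And>y u. y \<in> ball y0 d \<Longrightarrow> c * norm u \<le> norm (A y u)"
      using locally_bounded_below[OF V y0 lin(1) cont(1) lin(2)[OF y0]] by metis
    define z where "z y = s y - A y (w y0)" for y
    have "continuous_on V z" unfolding z_def by (intro continuous_intros cont)
    then have "isCont z y0" using V y0 continuous_on_eq_continuous_at by blast
    then have "((\<lambda>y. norm (z y) / c) \<longlongrightarrow> norm (z y0) / c) (at y0)"
      unfolding isCont_def by (intro tendsto_intros) (use cd in auto)
    then have lim: "((\<lambda>y. norm (z y) / c) \<longlongrightarrow> 0) (at y0)" using sol[OF y0] by (simp add: z_def)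
    have "\<forall>\<^sub>F y in at y0. norm (w y - w y0) \<le> norm (z y) / c"
      using eventually_at_ball[OF cd(2), of y0 UNIV]
    proof eventually_elim
      case (elim y)
      then have y: "y \<in> V" "y \<in> ball y0 d" using cd(3) by auto
      have "A y (w y - w y0) = z y" using lin(1)[OF y(1)] sol[OF y(1)] by (simp add: linear_diff z_def)
      then show ?case using cd(4)[OF y(2), of "w y - w y0"] cd(1) by (simp add: field_simps)
    qed
    then have "((\<lambda>y. w y - w y0) \<longlongrightarrow> 0) (at y0)" by (rule Lim_null_comparison[OF _ lim])
    then show ?thesis by (simp add: isCont_def LIM_zero_iff)
  qed
  then show ?thesis by (simp add: continuous_at_imp_continuous_on)
qed

text \<open>Applying \<open>A y\<close> to the remainder of the first-order expansion of \<open>w\<close> gives the remainder for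
  \<open>s y - A y (w y0)\<close>, up to a term with the factor \<open>A y - A y0\<close>; again \<open>A y\<close> is bounded below.\<close>

lemma linear_system_solution_has_derivative:
  fixes A :: "'p::euclidean_space \<Rightarrow> 'f::euclidean_space \<Rightarrow> 'f"
  assumes V: "open V" "y0 \<in> V" and lin: "\<And>y. y \<in> V \<Longrightarrow> linear (A y)" "inj (A y0)"
    and cont: "\<And>u. continuous_on V (\<lambda>y. A y u)"
    and sol: "\<And>y. y \<in> V \<Longrightarrow> A y (w y) = s y"
    and s': "(s has_derivative s') (at y0)"
    and A': "((\<lambda>y. A y (w y0)) has_derivative a') (at y0)"
    and w': "bounded_linear w'" "\<And>h. A y0 (w' h) = s' h - a' h"
  shows "(w has_derivative w') (at y0)"
proof -
  obtain c d where cd: "0 < c" "0 < d" "ball y0 d \<subseteq> V"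
    "\<And>y u. y \<in> ball y0 d \<Longrightarrow> c * norm u \<le> norm (A y u)"
    using locally_bounded_below[OF V lin(1) cont lin(2)] by metis
  define z where "z y = s y - A y (w y0)" for y
  define q where "q y = norm (z y - z y0 - (s' (y - y0) - a' (y - y0))) / norm (y - y0)" for y
  define N where "N y = (\<Sum>b\<in>Basis. norm (A y b - A y0 b))" for y
  have z': "(z has_derivative (\<lambda>h. s' h - a' h)) (at y0)"
    unfolding z_def by (rule has_derivative_diff[OF s' A'])
  have z0: "z y0 = 0" using sol V by (simp add: z_def)
  obtain K where K: "\<And>h. norm (w' h) \<le> norm h * K" using w'(1) bounded_linear.bounded by blast
  have limq: "(q \<longlongrightarrow> 0) (at y0)"
    using z' unfolding has_derivative_iff_norm q_def by blast
  have "continuous_on V N" unfolding N_def by (intro continuous_intros cont)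
  then have "isCont N y0" using V continuous_on_eq_continuous_at by blast
  then have limN: "(N \<longlongrightarrow> 0) (at y0)" by (simp add: isCont_def N_def)
  have "((\<lambda>y. (q y + N y * K) / c) \<longlongrightarrow> (0 + 0 * K) / c) (at y0)"
    by (intro tendsto_intros limq limN) (use cd in auto)
  then have lim: "((\<lambda>y. (q y + N y * K) / c) \<longlongrightarrow> 0) (at y0)" by simp
  have "\<forall>\<^sub>F y in at y0. norm (norm (w y - w y0 - w' (y - y0)) / norm (y - y0)) \<le> (q y + N y * K) / c"
    using eventually_at_ball[OF cd(2), of y0 UNIV] eventually_neq_at_within[of y0 y0 UNIV]
  proof eventually_elim
    case (elim y)
    then have y: "y \<in> V" "y \<in> ball y0 d" "y \<noteq> y0" using cd(3) by auto
    define h where "h = y - y0"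
    have h: "norm h > 0" using y(3) by (simp add: h_def)
    have la: "linear (A y)" "linear (A y0)" using lin(1) y(1) V by auto
    have "A y (w y - w y0 - w' h) = (z y - (s' h - a' h)) - (A y (w' h) - A y0 (w' h))"
      using sol[OF y(1)] w'(2)[of h] by (simp add: linear_diff[OF la(1)] z_def)
    then have "norm (A y (w y - w y0 - w' h)) \<le> norm (z y - (s' h - a' h)) + norm (A y (w' h) - A y0 (w' h))"
      by (metis norm_triangle_ineq4)
    also have "norm (z y - (s' h - a' h)) = q y * norm h"
      using h by (simp add: q_def h_def z0)
    also have "norm (A y (w' h) - A y0 (w' h)) \<le> N y * K * norm h"
    proof -
      have "linear (\<lambda>u. A y u - A y0 u)" using la by (rule linear_compose_sub)
      then have "A y (w' h) - A y0 (w' h) = (\<Sum>b\<in>Basis. (w' h \<bullet> b) *\<^sub>R (A y b - A y0 b))"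
        using linear_basis_expansion by metis
      then have "norm (A y (w' h) - A y0 (w' h)) \<le> (\<Sum>b\<in>Basis. norm ((w' h \<bullet> b) *\<^sub>R (A y b - A y0 b)))"
        by (simp only: norm_sum)
      also have "\<dots> \<le> (\<Sum>b\<in>Basis. norm (w' h) * norm (A y b - A y0 b))"
        by (intro sum_mono) (auto intro!: mult_right_mono Basis_le_norm)
      also have "\<dots> = norm (w' h) * N y" by (simp add: N_def sum_distrib_left)
      also have "\<dots> \<le> norm h * K * N y"
        by (intro mult_right_mono K) (auto simp: N_def intro: sum_nonneg)
      finally show ?thesis by (simp add: mult_ac)
    qed
    finally have "c * norm (w y - w y0 - w' h) \<le> (q y + N y * K) * norm h"
      using cd(4)[OF y(2), of "w y - w y0 - w' h"] by (simp add: algebra_simps)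
    then have "norm (w y - w y0 - w' h) / norm h \<le> (q y + N y * K) / c"
      using h cd(1) by (simp add: field_simps)
    then show ?case by (simp add: h_def)
  qed
  then have "((\<lambda>y. norm (w y - w y0 - w' (y - y0)) / norm (y - y0)) \<longlongrightarrow> 0) (at y0)"
    by (rule Lim_null_comparison[OF _ lim])
  with w'(1) show ?thesis by (simp add: has_derivative_iff_norm)
qed

text \<open>Differentiating \<open>A y (w y) = s y\<close> shows that the derivatives of \<open>w\<close> solve a linear system
  with the same \<open>A\<close>, whose right hand side involves \<open>w\<close> but no derivative of \<open>w\<close>.\<close>

lemma Ck_on_linear_system_solution:
  fixes A :: "'p::euclidean_space \<Rightarrow> 'f::euclidean_space \<Rightarrow> 'f"
  assumes V: "open V" and lin: "\<And>y. y \<in> V \<Longrightarrow> linear (A y)" "\<And>y. y \<in> V \<Longrightarrow> inj (A y)"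
  shows "(\<And>u. Ck_on k V (\<lambda>y. A y u)) \<Longrightarrow> Ck_on k V s \<Longrightarrow> (\<And>y. y \<in> V \<Longrightarrow> A y (w y) = s y) \<Longrightarrow> Ck_on k V w"
proof (induction k arbitrary: s w)
  case 0
  then show ?case using linear_system_solution_continuous[OF V lin, where s = s and w = w] by simp
next
  case (Suc k)
  have wk: "Ck_on k V w"
    by (rule Suc.IH[OF _ _ Suc.prems(3)]) (rule Ck_on_Suc_imp[OF Suc.prems(1)] Ck_on_Suc_imp[OF Suc.prems(2)])+
  obtain s' where s': "\<And>y. y \<in> V \<Longrightarrow> (s has_derivative s' y) (at y)" "\<And>v. Ck_on k V (\<lambda>y. s' y v)"
    using Ck_on_SucE[OF Suc.prems(2)] by metis
  have "\<exists>A'. (\<forall>y\<in>V. ((\<lambda>y. A y u) has_derivative A' y) (at y)) \<and> (\<forall>v. Ck_on k V (\<lambda>y. A' y v))" for u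
    using Suc.prems(1)[of u] by simp
  then obtain A' where A': "\<And>u y. y \<in> V \<Longrightarrow> ((\<lambda>y. A y u) has_derivative A' u y) (at y)"
    "\<And>u v. Ck_on k V (\<lambda>y. A' u y v)" by metis
  define a' where "a' y h = (\<Sum>b\<in>Basis. (w y \<bullet> b) *\<^sub>R A' b y h)" for y h
  define w' where "w' y h = inv (A y) (s' y h - a' y h)" for y h
  have surj: "surj (A y)" if "y \<in> V" for y
    using linear_injective_imp_surjective lin that by blast
  have eq: "A y (w' y h) = s' y h - a' y h" if "y \<in> V" for y h
    unfolding w'_def using surj_f_inv_f[OF surj[OF that]] .
  have a': "((\<lambda>y. A y (w y0)) has_derivative a' y0) (at y0)" if y0: "y0 \<in> V" for y0
  proof -
    have "((\<lambda>y. \<Sum>b\<in>Basis. (w y0 \<bullet> b) *\<^sub>R A y b) has_derivative a' y0) (at y0)"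
      unfolding a'_def
      by (intro has_derivative_sum has_derivative_scaleR_right A' y0)
    then show ?thesis
      by (rule has_derivative_transform_within_open[OF _ V y0]) (rule linear_basis_expansion[OF lin(1)])
  qed
  have "(w has_derivative w' y0) (at y0)" if y0: "y0 \<in> V" for y0
  proof (rule linear_system_solution_has_derivative[OF V y0 lin(1) lin(2)[OF y0] _ Suc.prems(3) s'(1)[OF y0] a'[OF y0]])
    show "continuous_on V (\<lambda>y. A y u)" for u using Suc.prems(1) Ck_on_imp_continuous_on by blast
    have "linear (inv (A y0))"
      using inj_linear_imp_inv_linear lin y0 by blast
    moreover have "linear (\<lambda>h. s' y0 h - a' y0 h)"
      using s'(1)[OF y0] a'[OF y0] by (intro linear_compose_sub has_derivative_linear)
    ultimately have "linear (w' y0)"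
      unfolding w'_def using linear_compose[of "\<lambda>h. s' y0 h - a' y0 h" "inv (A y0)"] by (simp add: o_def)
    then show "bounded_linear (w' y0)" by (rule linear_conv_bounded_linear[THEN iffD1])
  qed (use eq[OF y0] in auto)
  moreover have "Ck_on k V (\<lambda>y. w' y h)" for h
  proof (rule Suc.IH[OF _ _ eq])
    show "Ck_on k V (\<lambda>y. A y u)" for u using Suc.prems(1) Ck_on_Suc_imp by blast
    have "Ck_on k V (\<lambda>y. s' y h + (\<Sum>b\<in>Basis. (w y \<bullet> b) *\<^sub>R ((-1) *\<^sub>R A' b y h)))"
      by (intro Ck_on_add s' Ck_on_sum Ck_on_scaleR A' Ck_on_const wk
        Ck_on_bounded_linear_compose[OF bounded_linear_inner_left])
    then show "Ck_on k V (\<lambda>y. s' y h - a' y h)" by (simp add: a'_def sum_negf)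
  qed
  ultimately show ?case by (rule Ck_on_SucI)
qed

text \<open>The derivatives of the inverse \<open>g\<close> solve \<open>f'(g y) (g' y v) = v\<close>.  If \<open>g\<close> is \<open>C\<^sup>k\<close>, then so are the
  coefficients of this system, hence its solution, and \<open>g\<close> is \<open>C\<^sup>k\<^sup>+\<^sup>1\<close>.\<close>

lemma Cinf_inverse_function:
  fixes f :: "'e::euclidean_space \<Rightarrow> 'e"
  assumes U: "open U" and f: "Cinf_on U f" and x0: "x0 \<in> U" and inj: "inj (frechet_derivative f (at x0))"
  obtains U' V g where "open U'" "U' \<subseteq> U" "x0 \<in> U'" "open V" "f x0 \<in> V" "homeomorphism U' V f g" "Cinf_on V g"
proof -
  define F where "F x = Blinfun (frechet_derivative f (at x))" for x
  have der: "(f has_derivative frechet_derivative f (at x)) (at x)" if "x \<in> U" for x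
    by (rule Cinf_on_has_derivative[OF f that])
  have F: "blinfun_apply (F x) = frechet_derivative f (at x)" if "x \<in> U" for x
    unfolding F_def using der[OF that] has_derivative_bounded_linear bounded_linear_Blinfun_apply by blast
  have contF: "continuous_on U F"
  proof (rule continuous_on_blinfun_componentwise)
    fix i :: 'e
    have "continuous_on U (\<lambda>x. frechet_derivative f (at x) i)"
      by (rule Cinf_on_imp_continuous_on[OF Cinf_on_derivative[OF U f]])
    then show "continuous_on U (\<lambda>x. blinfun_apply (F x) i)" using F by (simp cong: continuous_on_cong)
  qed
  obtain h where h: "linear h" "h \<circ> frechet_derivative f (at x0) = id"
    using linear_injective_left_inverse[OF has_derivative_linear[OF der[OF x0]] inj] by blast
  have invF: "Blinfun h o\<^sub>L F x0 = id_blinfun"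
    using h F[OF x0] bounded_linear_Blinfun_apply[OF linear_conv_bounded_linear[THEN iffD1, OF h(1)]]
    by (intro blinfun_eqI) (simp add: fun_eq_iff)
  have derF: "\<And>x. x \<in> U \<Longrightarrow> (f has_derivative blinfun_apply (F x)) (at x)" using der F by simp
  obtain U' V g g' where IFT: "open U'" "U' \<subseteq> U" "x0 \<in> U'" "open V" "f x0 \<in> V" "homeomorphism U' V f g"
    "\<And>y. y \<in> V \<Longrightarrow> (g has_derivative (g' y)) (at y)"
    "\<And>y. y \<in> V \<Longrightarrow> g' y = inv (blinfun_apply (F (g y)))"
    "\<And>y. y \<in> V \<Longrightarrow> bij (blinfun_apply (F (g y)))"
    using inverse_function_theorem[OF U derF contF x0 invF] by metis
  have gV: "g ` V \<subseteq> U" using IFT(2,6) by (auto simp: homeomorphism_def)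
  have "Ck_on k V g" for k
  proof (induction k)
    case 0
    then show ?case using IFT(6) by (simp add: homeomorphism_def)
  next
    case (Suc k)
    have "Ck_on k V (\<lambda>y. g' y v)" for v
    proof (rule Ck_on_linear_system_solution[where A = "\<lambda>y. frechet_derivative f (at (g y))" and s = "\<lambda>_. v"])
      show "Ck_on k V (\<lambda>y. frechet_derivative f (at (g y)) u)" for u
        by (rule Ck_on_compose[OF Suc _ gV IFT(4), where g = "\<lambda>x. frechet_derivative f (at x) u"])
          (use Cinf_on_derivative[OF U f] in \<open>simp add: Cinf_on_def\<close>)
      fix y assume y: "y \<in> V"
      then have gy: "g y \<in> U" using gV by blast
      show "linear (frechet_derivative f (at (g y)))" using der[OF gy] by (rule has_derivative_linear)
      show "inj (frechet_derivative f (at (g y)))" using IFT(9)[OF y] F[OF gy] by (simp add: bij_def)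
      show "frechet_derivative f (at (g y)) (g' y v) = v"
        using IFT(8,9)[OF y] F[OF gy] by (simp add: bij_def surj_f_inv_f)
    qed (use IFT in \<open>auto intro: Ck_on_const\<close>)
    with IFT(7) show ?case by (rule Ck_on_SucI)
  qed
  then show ?thesis using IFT by (intro that[of U' V g]) (auto simp: Cinf_on_def)
qed


section \<open>Smooth maps on subsets\<close>

lemma smooth_on_iff:
  "smooth_on S f \<longleftrightarrow> (\<forall>x\<in>S. \<exists>U g. open U \<and> x \<in> U \<and> Cinf_on U g \<and> (\<forall>y\<in>U \<inter> S. g y = f y))"
  by (simp add: smooth_on_def Cinf_on_def)

lemma smooth_onE:
  assumes "smooth_on S f" "x \<in> S"
  obtains U g where "open U" "x \<in> U" "Cinf_on U g" "\<And>y. y \<in> U \<Longrightarrow> y \<in> S \<Longrightarrow> g y = f y"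
  using assms(1)[unfolded smooth_on_iff, rule_format, OF assms(2)] that by auto

lemma smooth_on_cong: "smooth_on S f \<Longrightarrow> (\<And>x. x \<in> S \<Longrightarrow> f x = g x) \<Longrightarrow> smooth_on S g"
  unfolding smooth_on_iff by simp

lemma smooth_on_subset: "smooth_on S f \<Longrightarrow> T \<subseteq> S \<Longrightarrow> smooth_on T f"
  unfolding smooth_on_iff by (rule ballI, drule bspec, erule (1) subsetD) fastforce

lemma smooth_on_imp_Cinf_on: "smooth_on U f \<Longrightarrow> open U \<Longrightarrow> Cinf_on U f"
proof (rule Cinf_on_local)
  fix x assume f: "smooth_on U f" "open U" "x \<in> U"
  obtain W g where "open W" "x \<in> W" "Cinf_on W g" "\<And>y. y \<in> W \<Longrightarrow> y \<in> U \<Longrightarrow> g y = f y"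
    using smooth_onE[OF f(1,3)] by blast
  moreover from this have "Cinf_on (W \<inter> U) f"
    using open_Int[OF _ f(2)] Cinf_on_cong[of "W \<inter> U" g f] Cinf_on_subset[of W g "W \<inter> U"] by simp
  ultimately show "\<exists>V. open V \<and> x \<in> V \<and> Cinf_on V f"
    using f by (intro exI[of _ "W \<inter> U"]) auto
qed

lemma Cinf_on_imp_smooth_on: "Cinf_on U f \<Longrightarrow> open U \<Longrightarrow> S \<subseteq> U \<Longrightarrow> smooth_on S f"
  unfolding smooth_on_iff by blast

lemma smooth_on_local:
  assumes "\<And>x. x \<in> S \<Longrightarrow> \<exists>T. x \<in> T \<and> openin (top_of_set S) T \<and> smooth_on T f"
  shows "smooth_on S f"
  unfolding smooth_on_iff
proof
  fix x assume "x \<in> S"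
  then obtain T where T: "x \<in> T" "openin (top_of_set S) T" "smooth_on T f" using assms by blast
  obtain U g where "open U" "x \<in> U" "Cinf_on U g" "\<And>y. y \<in> U \<Longrightarrow> y \<in> T \<Longrightarrow> g y = f y"
    using smooth_onE[OF T(3,1)] by blast
  moreover obtain W where "open W" "T = S \<inter> W" using T(2) openin_open by blast
  ultimately show "\<exists>U g. open U \<and> x \<in> U \<and> Cinf_on U g \<and> (\<forall>y\<in>U \<inter> S. g y = f y)"
    using T(1) by (intro exI[of _ "U \<inter> W"] exI[of _ g]) (auto intro: Cinf_on_subset)
qed

lemma smooth_on_imp_continuous_on: "smooth_on S f \<Longrightarrow> continuous_on S f"
proof (subst continuous_on_eq_continuous_within, rule ballI)
  fix x assume f: "smooth_on S f" and x: "x \<in> S"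
  obtain U g where U: "open U" "x \<in> U" "Cinf_on U g" "\<And>y. y \<in> U \<Longrightarrow> y \<in> S \<Longrightarrow> g y = f y"
    using smooth_onE[OF f x] by blast
  have "continuous (at x within S) g"
    using Cinf_on_imp_continuous_on[OF U(3)] U(1,2) continuous_on_eq_continuous_at continuous_at_imp_continuous_within
    by blast
  moreover have "\<forall>\<^sub>F y in at x within S. g y = f y"
    using U by (auto simp: eventually_at_topological)
  ultimately show "continuous (at x within S) f"
    using U(4)[OF U(2) x] by (simp add: continuous_within tendsto_cong)
qed

lemma smooth_on_compose:
  fixes f :: "'e::euclidean_space \<Rightarrow> 'f::euclidean_space"
  assumes f: "smooth_on S f" and g: "smooth_on T g" and sub: "\<And>x. x \<in> S \<Longrightarrow> f x \<in> T"
  shows "smooth_on S (\<lambda>x. g (f x))"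
  unfolding smooth_on_iff
proof
  fix x assume x: "x \<in> S"
  obtain U F where U: "open U" "x \<in> U" "Cinf_on U F" "\<And>y. y \<in> U \<Longrightarrow> y \<in> S \<Longrightarrow> F y = f y"
    using smooth_onE[OF f x] by blast
  obtain W G where W: "open W" "f x \<in> W" "Cinf_on W G" "\<And>y. y \<in> W \<Longrightarrow> y \<in> T \<Longrightarrow> G y = g y"
    using smooth_onE[OF g sub[OF x]] by blast
  have o: "open (U \<inter> F -` W)"
    by (rule continuous_open_preimage[OF Cinf_on_imp_continuous_on[OF U(3)] U(1) W(1)])
  moreover have "Cinf_on (U \<inter> F -` W) (\<lambda>y. G (F y))"
    by (rule Cinf_on_compose[OF Cinf_on_subset[OF U(3)] W(3) _ o]) auto
  ultimately show "\<exists>U g'. open U \<and> x \<in> U \<and> Cinf_on U g' \<and> (\<forall>y\<in>U \<inter> S. g' y = g (f y))"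
    using U W x sub by (intro exI[of _ "U \<inter> F -` W"] exI[of _ "\<lambda>y. G (F y)"]) auto
qed

lemma smooth_on_bounded_linear: "bounded_linear f \<Longrightarrow> smooth_on S f"
  using Cinf_on_imp_smooth_on[OF Cinf_on_bounded_linear open_UNIV] by blast

lemma smooth_on_const: "smooth_on S (\<lambda>_. c)"
  using Cinf_on_imp_smooth_on[OF Cinf_on_const open_UNIV] by blast

lemma smooth_on_id: "smooth_on S (\<lambda>x. x)"
  by (rule smooth_on_bounded_linear) simp

lemma smooth_on_Pair:
  assumes "smooth_on S f" "smooth_on S g"
  shows "smooth_on S (\<lambda>x. (f x, g x))"
  unfolding smooth_on_iff
proof
  fix x assume x: "x \<in> S"
  obtain U F where U: "open U" "x \<in> U" "Cinf_on U F" "\<And>y. y \<in> U \<Longrightarrow> y \<in> S \<Longrightarrow> F y = f y"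
    using smooth_onE[OF assms(1) x] by blast
  obtain W G where W: "open W" "x \<in> W" "Cinf_on W G" "\<And>y. y \<in> W \<Longrightarrow> y \<in> S \<Longrightarrow> G y = g y"
    using smooth_onE[OF assms(2) x] by blast
  show "\<exists>U h. open U \<and> x \<in> U \<and> Cinf_on U h \<and> (\<forall>y\<in>U \<inter> S. h y = (f y, g y))"
    by (intro exI[of _ "U \<inter> W"] exI[of _ "\<lambda>y. (F y, G y)"] conjI Cinf_on_Pair)
      (use U W in \<open>auto intro: Cinf_on_subset\<close>)
qed


section \<open>Derivatives along a linear subspace\<close>

text \<open>Composing with a projection onto the model subspace replaces functions on relatively open subsets of
  the model by functions on open subsets of the ambient space.\<close>

definition proj :: "'e::euclidean_space set \<Rightarrow> 'e \<Rightarrow> 'e" where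
  "proj V = (SOME \<pi>. bounded_linear \<pi> \<and> range \<pi> \<subseteq> V \<and> (\<forall>x\<in>V. \<pi> x = x))"

lemma proj:
  assumes "subspace V"
  shows bounded_linear_proj: "bounded_linear (proj V)" and proj_in: "proj V x \<in> V"
    and proj_id: "x \<in> V \<Longrightarrow> proj V x = x"
proof -
  obtain B where B: "B \<subseteq> V" "pairwise orthogonal B" "\<And>x. x \<in> B \<Longrightarrow> norm x = 1" "independent B" "span B = V"
    using orthonormal_basis_subspace[OF assms] by metis
  define g where "g x = (\<Sum>b\<in>B. (x \<bullet> b) *\<^sub>R b)" for x
  have fin: "finite B" using B(4) by (rule independent_imp_finite)
  have lin: "linear g" unfolding g_def
    by (auto intro!: linearI simp: inner_left_distrib scaleR_add_left sum.distrib scaleR_sum_right)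
  have "g b = b" if "b \<in> B" for b
  proof -
    have "g b = (\<Sum>c\<in>B. if c = b then b else 0)"
      unfolding g_def using B(2,3) that
      by (intro sum.cong) (auto simp: pairwise_def orthogonal_def dot_square_norm)
    then show ?thesis using fin that by simp
  qed
  then have "g x = x" if "x \<in> V" for x
    using linear_eq_on_span[OF lin linear_ident, of B x] that B(5) by simp
  moreover have "range g \<subseteq> V"
    using B(1) assms by (auto simp: g_def intro!: subspace_sum subspace_scale)
  ultimately have "\<exists>\<pi>. bounded_linear \<pi> \<and> range \<pi> \<subseteq> V \<and> (\<forall>x\<in>V. \<pi> x = x)"
    using lin linear_conv_bounded_linear by blast
  from someI_ex[OF this]
  show "bounded_linear (proj V)" "proj V x \<in> V" "x \<in> V \<Longrightarrow> proj V x = x"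
    unfolding proj_def by auto
qed

lemma open_proj_vimage:
  assumes "subspace V" "openin (top_of_set V) S"
  shows "open (proj V -` S)"
proof -
  obtain T where T: "open T" "S = V \<inter> T" using assms(2) openin_open by blast
  have "proj V -` S = proj V -` T" using T proj_in[OF assms(1)] by auto
  moreover have "continuous_on UNIV (proj V)"
    using bounded_linear_proj[OF assms(1)] linear_continuous_on by blast
  ultimately show ?thesis using open_vimage[OF T(1)] by simp
qed

lemma smooth_on_imp_Cinf_on_proj:
  assumes "subspace V" "openin (top_of_set V) S" "smooth_on S f"
  shows "Cinf_on (proj V -` S) (\<lambda>x. f (proj V x))"
  by (rule smooth_on_imp_Cinf_on[OF smooth_on_compose[OF smooth_on_bounded_linear[OF bounded_linear_proj[OF assms(1)]] assms(3)]])
    (use open_proj_vimage[OF assms(1,2)] in auto)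

text \<open>For \<open>f\<close> defined near \<open>x\<close> in \<open>V\<close>, the derivative at \<open>x\<close> along \<open>V\<close>.  Composing with the
  projection turns it into a derivative in the ambient space.\<close>

definition sderiv :: "'e::euclidean_space set \<Rightarrow> ('e \<Rightarrow> 'f::real_normed_vector) \<Rightarrow> 'e \<Rightarrow> 'e \<Rightarrow> 'f" where
  "sderiv V f x = frechet_derivative (\<lambda>y. f (proj V y)) (at x)"

text \<open>A derivative within a set that is open in \<open>V\<close> is determined along \<open>V\<close>, because short segments in
  these directions stay in the set; in other directions it is arbitrary.\<close>

lemma within_derivative_unique:
  assumes V: "subspace V" "openin (top_of_set V) R" and x: "x \<in> R"
    and A: "(f has_derivative A) (at x within R)" and B: "(f has_derivative B) (at x within R)"
    and u: "u \<in> V"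
  shows "A u = B u"
proof -
  obtain T where T: "open T" "R = V \<inter> T" using V(2) openin_open by blast
  define S where "S = (\<lambda>s::real. x + s *\<^sub>R u) -` T"
  have "open S" unfolding S_def by (intro open_vimage T) (auto intro!: continuous_intros)
  moreover have "0 \<in> S" using x T by (simp add: S_def)
  moreover have S: "x + s *\<^sub>R u \<in> R" if "s \<in> S" for s
    using that T x u V(1) by (auto simp: S_def subspace_add subspace_scale)
  moreover have "((\<lambda>s. f (x + s *\<^sub>R u)) has_derivative (\<lambda>s. D (s *\<^sub>R u))) (at 0 within S)"
    if "(f has_derivative D) (at x within R)" for D
  proof -
    have "((\<lambda>s. x + s *\<^sub>R u) has_derivative (\<lambda>s. s *\<^sub>R u)) (at 0 within S)"
      by (auto intro!: derivative_eq_intros)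
    moreover have "(f has_derivative D) (at (x + 0 *\<^sub>R u) within (\<lambda>s. x + s *\<^sub>R u) ` S)"
      using that S by (auto intro: has_derivative_subset)
    ultimately show ?thesis by (rule has_derivative_in_compose)
  qed
  ultimately have "(\<lambda>s. A (s *\<^sub>R u)) = (\<lambda>s. B (s *\<^sub>R u))"
    using A B by (metis at_within_open has_derivative_unique)
  then show ?thesis by (metis scaleR_one)
qed

lemma sderiv_has_derivative:
  assumes "subspace V" "openin (top_of_set V) S" "smooth_on S f" "x \<in> S"
  shows "((\<lambda>y. f (proj V y)) has_derivative sderiv V f x) (at x)"
proof -
  have "x \<in> proj V -` S" using assms openin_imp_subset proj_id[OF assms(1), of x] by fastforce
  then show ?thesis unfolding sderiv_def
    by (rule Cinf_on_has_derivative[OF smooth_on_imp_Cinf_on_proj[OF assms(1-3)]])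
qed

lemma sderiv_has_derivative_within:
  assumes "subspace V" "openin (top_of_set V) S" "smooth_on S f" "x \<in> S" "R \<subseteq> V" "x \<in> R"
  shows "(f has_derivative sderiv V f x) (at x within R)"
proof (rule has_derivative_transform[OF assms(6) _ has_derivative_at_withinI[OF sderiv_has_derivative[OF assms(1-4)]]])
  show "f y = f (proj V y)" if "y \<in> R" for y using that assms(5) proj_id[OF assms(1)] by auto
qed

lemma sderiv_linear:
  assumes "subspace V" "openin (top_of_set V) S" "smooth_on S f" "x \<in> S"
  shows "linear (sderiv V f x)"
  using sderiv_has_derivative[OF assms] by (rule has_derivative_linear)

lemma sderiv_unique:
  assumes V: "subspace V" "openin (top_of_set V) S" "smooth_on S f" "x \<in> S"
    and R: "openin (top_of_set V) R" "S \<subseteq> R"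
    and A: "(f has_derivative A) (at x within R)" and u: "u \<in> V"
  shows "A u = sderiv V f x u"
  using within_derivative_unique[OF V(1) R(1) _ A sderiv_has_derivative_within[OF V] u]
    R V(4) openin_imp_subset[OF R(1)] by blast

text \<open>Hamiltonians and flows are smooth jointly in time and space, which means that they have smooth
  extensions to open sets of space-time; this recovers their derivatives in space at a fixed time.\<close>

lemma sderiv_slice:
  fixes t :: "'t::euclidean_space"
  assumes V: "subspace V" "openin (top_of_set V) R" "smooth_on R f" and w: "w \<in> R" and v: "v \<in> V"
    and Q: "open Q" "(t, w) \<in> Q" "Cinf_on Q g" and eq: "\<And>y. y \<in> R \<Longrightarrow> (t, y) \<in> Q \<Longrightarrow> g (t, y) = f y"
  shows "sderiv V f w v = frechet_derivative g (at (t, w)) (0, v)"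
proof -
  define S where "S = R \<inter> (\<lambda>y. (t, y)) -` Q"
  have "open ((\<lambda>y. (t, y)) -` Q)" using Q(1) by (intro open_vimage continuous_intros)
  then have oS: "openin (top_of_set V) S" unfolding S_def using V(2) by (intro openin_Int_open)
  have wS: "w \<in> S" using w Q by (simp add: S_def)
  have sm: "smooth_on S f" by (rule smooth_on_subset[OF V(3)]) (auto simp: S_def)
  have "((\<lambda>y. (t, y)) has_derivative (\<lambda>v. (0, v))) (at w within S)" by (auto intro!: derivative_eq_intros)
  then have "((\<lambda>y. g (t, y)) has_derivative (\<lambda>v. frechet_derivative g (at (t, w)) (0, v))) (at w within S)"
    by (rule has_derivative_compose[where f = "\<lambda>y. (t, y)" and g = g, OF _ Cinf_on_has_derivative[OF Q(3,2)]])
  then have "(f has_derivative (\<lambda>v. frechet_derivative g (at (t, w)) (0, v))) (at w within S)"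
    by (rule has_derivative_transform[OF wS, rotated]) (use eq in \<open>auto simp: S_def\<close>)
  from sderiv_unique[OF V(1) oS sm wS oS order_refl this v] show ?thesis by simp
qed

lemma frechet_derivative_within_eq_sderiv:
  assumes V: "subspace V" "openin (top_of_set V) S" "smooth_on S f" "x \<in> S"
    and R: "openin (top_of_set V) R" "S \<subseteq> R" and u: "u \<in> V"
  shows "frechet_derivative f (at x within R) u = sderiv V f x u"
proof (rule sderiv_unique[OF V R _ u])
  have "f differentiable at x within R"
    using sderiv_has_derivative_within[OF V openin_imp_subset[OF R(1)]] R(2) V(4) differentiableI by blast
  then show "(f has_derivative frechet_derivative f (at x within R)) (at x within R)"
    by (simp add: frechet_derivative_works)
qed

lemma sderiv_cong:
  assumes V: "subspace V" "openin (top_of_set V) S" "smooth_on S f" "x \<in> S"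
    and eq: "\<And>y. y \<in> S \<Longrightarrow> f y = g y"
  shows "sderiv V f x = sderiv V g x"
proof -
  have x: "x \<in> proj V -` S" using V openin_imp_subset[OF V(2)] proj_id[OF V(1), of x] by auto
  have "((\<lambda>y. g (proj V y)) has_derivative sderiv V f x) (at x)"
    by (rule has_derivative_transform_within_open[OF sderiv_has_derivative[OF V] open_proj_vimage[OF V(1,2)] x])
      (use eq in auto)
  then show ?thesis unfolding sderiv_def[of V g] using frechet_derivative_at by blast
qed

lemma sderiv_compose:
  assumes V: "subspace V" "openin (top_of_set V) S" "smooth_on S f" "x \<in> S"
    and W: "subspace W" "openin (top_of_set W) T" "smooth_on T g"
    and sub: "\<And>y. y \<in> S \<Longrightarrow> f y \<in> T"
  shows "sderiv V (\<lambda>x. g (f x)) x u = sderiv W g (f x) (sderiv V f x u)"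
proof -
  have x: "x \<in> proj V -` S" "proj V x = x"
    using V openin_imp_subset[OF V(2)] proj_id[OF V(1), of x] by auto
  have "((\<lambda>y. g (proj W (f (proj V y)))) has_derivative (\<lambda>u. sderiv W g (f x) (sderiv V f x u))) (at x)"
    using has_derivative_compose[where g = "\<lambda>y. g (proj W y)" and f = "\<lambda>y. f (proj V y)" and x = x,
        OF sderiv_has_derivative[OF V]] sderiv_has_derivative[OF W sub[OF V(4)]] x(2) by metis
  then have "((\<lambda>y. g (f (proj V y))) has_derivative (\<lambda>u. sderiv W g (f x) (sderiv V f x u))) (at x)"
    by (rule has_derivative_transform_within_open[OF _ open_proj_vimage[OF V(1,2)] x(1)])
      (use subsetD[OF openin_imp_subset[OF W(2)] sub] proj_id[OF W(1)] in simp)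
  then show ?thesis unfolding sderiv_def[of V "\<lambda>x. g (f x)"] using frechet_derivative_at by metis
qed

lemma sderiv_in_subspace:
  fixes f :: "'e::euclidean_space \<Rightarrow> 'f::euclidean_space"
  assumes V: "subspace V" "openin (top_of_set V) S" "smooth_on S f" "x \<in> S"
    and W: "subspace W" "\<And>y. y \<in> S \<Longrightarrow> f y \<in> W"
  shows "sderiv V f x u \<in> W"
proof -
  have "proj W (sderiv V f x u) = sderiv V f x u"
  proof -
    have x: "x \<in> proj V -` S" using V openin_imp_subset[OF V(2)] proj_id[OF V(1), of x] by auto
    have "((\<lambda>y. proj W (f (proj V y))) has_derivative (\<lambda>u. proj W (sderiv V f x u))) (at x)"
      by (rule bounded_linear.has_derivative[OF bounded_linear_proj[OF W(1)] sderiv_has_derivative[OF V]])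
    then have "((\<lambda>y. f (proj V y)) has_derivative (\<lambda>u. proj W (sderiv V f x u))) (at x)"
      by (rule has_derivative_transform_within_open[OF _ open_proj_vimage[OF V(1,2)] x])
        (use W(2) proj_id[OF W(1)] in auto)
    then show ?thesis using has_derivative_unique[OF _ sderiv_has_derivative[OF V]] by metis
  qed
  then show ?thesis using proj_in[OF W(1)] by metis
qed

lemma sderiv_id:
  assumes "subspace V" "x \<in> V" "u \<in> V"
  shows "sderiv V (\<lambda>y. y) x u = u"
proof -
  have "((\<lambda>y. proj V y) has_derivative proj V) (at x)"
    by (rule bounded_linear_imp_has_derivative[OF bounded_linear_proj[OF assms(1)]])
  then have "sderiv V (\<lambda>y. y) x = proj V" unfolding sderiv_def using frechet_derivative_at by metis
  then show ?thesis using proj_id assms by simp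
qed

lemma sderiv_curve:
  assumes V: "subspace V" "openin (top_of_set V) S" "smooth_on S f"
    and c: "(c has_vector_derivative v) (at t within J)" "\<And>s. s \<in> J \<Longrightarrow> c s \<in> S" "t \<in> J"
  shows "((\<lambda>s. f (c s)) has_vector_derivative sderiv V f (c t) v) (at t within J)"
proof -
  note d = sderiv_has_derivative[OF V c(2)[OF c(3)]]
  have "((\<lambda>s. f (proj V (c s))) has_derivative (\<lambda>r. sderiv V f (c t) (r *\<^sub>R v))) (at t within J)"
    using has_derivative_compose[OF c(1)[unfolded has_vector_derivative_def] d] .
  then have "((\<lambda>s. f (proj V (c s))) has_vector_derivative sderiv V f (c t) v) (at t within J)"
    using has_derivative_linear[OF d] by (simp add: has_vector_derivative_def linear_scale)
  then show ?thesis
    by (rule has_vector_derivative_transform[OF c(3), rotated])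
      (use subsetD[OF openin_imp_subset[OF V(2)] c(2)] proj_id[OF V(1)] in simp)
qed

lemma has_vector_derivative_in_subspace:
  fixes c :: "real \<Rightarrow> 'e::euclidean_space"
  assumes V: "subspace V" and c: "(c has_vector_derivative v) (at t within J)" "\<And>s. s \<in> J \<Longrightarrow> c s \<in> V"
    and t: "t \<in> J" "at t within J \<noteq> bot"
  shows "v \<in> V"
proof -
  have "((\<lambda>s. proj V (c s)) has_vector_derivative proj V v) (at t within J)"
    by (rule bounded_linear.has_vector_derivative[OF bounded_linear_proj[OF V] c(1)])
  then have "(c has_vector_derivative proj V v) (at t within J)"
    by (rule has_vector_derivative_transform[OF t(1), rotated]) (use c(2) proj_id[OF V] in auto)
  then have "v = proj V v" using c(1) t(2) vector_derivative_unique_within by blast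
  then show ?thesis using proj_in[OF V] by metis
qed


section \<open>Charts\<close>

lemma topological_chart:
  assumes "topological_chart M U \<psi>"
  shows chart_open: "openin (mtop M) U" and chart_subset: "U \<subseteq> points M"
    and chart_range_open: "openin (top_of_set (model M)) (\<psi> ` U)"
    and chart_inj: "inj_on \<psi> U"
    and chart_continuous: "continuous_map (subtopology (mtop M) U) euclidean \<psi>"
    and chart_inv_continuous: "continuous_map (top_of_set (\<psi> ` U)) (mtop M) (inv_into U \<psi>)"
    and chart_image_open: "openin (mtop M) W \<Longrightarrow> W \<subseteq> U \<Longrightarrow> openin (top_of_set (model M)) (\<psi> ` W)"
proof -
  note a = assms[unfolded topological_chart_def]
  show U: "openin (mtop M) U" "openin (top_of_set (model M)) (\<psi> ` U)" using a by auto
  show sub: "U \<subseteq> points M" using U openin_subset by blast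
  then have ts: "topspace (subtopology (mtop M) U) = U" by auto
  have h: "homeomorphic_map (subtopology (mtop M) U) (top_of_set (\<psi> ` U)) \<psi>" using a by auto
  then show inj: "inj_on \<psi> U" using homeomorphic_imp_injective_map ts by metis
  show "continuous_map (subtopology (mtop M) U) euclidean \<psi>"
    using homeomorphic_imp_continuous_map[OF h] continuous_map_into_fulltopology by blast
  obtain g where g: "homeomorphic_maps (subtopology (mtop M) U) (top_of_set (\<psi> ` U)) \<psi> g"
    using h homeomorphic_map_maps by blast
  have "continuous_map (top_of_set (\<psi> ` U)) (subtopology (mtop M) U) g"
    using g by (simp add: homeomorphic_maps_def)
  then have "continuous_map (top_of_set (\<psi> ` U)) (mtop M) g" using continuous_map_into_fulltopology by blast
  moreover have "g y = inv_into U \<psi> y" if "y \<in> \<psi> ` U" for y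
    using g that inj ts by (auto simp: homeomorphic_maps_def)
  ultimately show "continuous_map (top_of_set (\<psi> ` U)) (mtop M) (inv_into U \<psi>)"
    by (rule continuous_map_eq) auto
  show "openin (top_of_set (model M)) (\<psi> ` W)" if W: "openin (mtop M) W" "W \<subseteq> U"
  proof -
    have "openin (subtopology (mtop M) U) W" using W U by (simp add: openin_open_subtopology)
    then have "openin (top_of_set (\<psi> ` U)) (\<psi> ` W)"
      using h homeomorphic_imp_open_map open_map_def by blast
    then show ?thesis using U(2) openin_trans by blast
  qed
qed

lemma chart_preimage_open:
  assumes "topological_chart M U \<psi>" "openin (top_of_set (model M)) T"
  shows "openin (mtop M) {x \<in> U. \<psi> x \<in> T}"
proof -
  obtain T' where T': "open T'" "T = model M \<inter> T'" using assms(2) openin_open by blast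
  have "openin (subtopology (mtop M) U) {x \<in> topspace (subtopology (mtop M) U). \<psi> x \<in> T'}"
    using openin_continuous_map_preimage[OF chart_continuous[OF assms(1)], of T'] T'(1) by simp
  moreover have "{x \<in> topspace (subtopology (mtop M) U). \<psi> x \<in> T'} = {x \<in> U. \<psi> x \<in> T}"
    using T' chart_subset[OF assms(1)] openin_imp_subset[OF chart_range_open[OF assms(1)]] by auto
  ultimately show ?thesis using chart_open[OF assms(1)] by (metis openin_trans_full)
qed

context
  fixes M :: "('a, 'e::euclidean_space, 'x) manifold_scheme"
  assumes M: "smooth_manifold M"
begin

lemma manifold_model: "subspace (model M)"
  using M by (simp add: smooth_manifold_def)

lemma manifold_chart: "p \<in> points M \<Longrightarrow> topological_chart M (cdom M p) (coord M p)"
  and manifold_centre: "p \<in> points M \<Longrightarrow> p \<in> cdom M p"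
  and manifold_transition: "p \<in> points M \<Longrightarrow> q \<in> points M \<Longrightarrow>
    smooth_on (coord M p ` (cdom M p \<inter> cdom M q)) (\<lambda>y. coord M q (cinv M p y))"
  using M by (auto simp: smooth_manifold_def o_def)

lemma cdom_points: "p \<in> points M \<Longrightarrow> x \<in> cdom M p \<Longrightarrow> x \<in> points M"
  using chart_subset[OF manifold_chart] by blast

lemma cinv_coord: "p \<in> points M \<Longrightarrow> x \<in> cdom M p \<Longrightarrow> cinv M p (coord M p x) = x"
  using chart_inj[OF manifold_chart] by simp

lemma coord_cinv: "y \<in> crange M p \<Longrightarrow> coord M p (cinv M p y) = y"
  and cinv_in: "y \<in> crange M p \<Longrightarrow> cinv M p y \<in> cdom M p"
  by (auto simp: f_inv_into_f inv_into_into)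

lemma crange_model: "p \<in> points M \<Longrightarrow> y \<in> crange M p \<Longrightarrow> y \<in> model M"
  using openin_imp_subset[OF chart_range_open[OF manifold_chart]] by blast

lemma coord_model: "p \<in> points M \<Longrightarrow> x \<in> cdom M p \<Longrightarrow> coord M p x \<in> model M"
  using crange_model by blast

lemma overlap_open: "p \<in> points M \<Longrightarrow> q \<in> points M \<Longrightarrow>
    openin (top_of_set (model M)) (coord M p ` (cdom M p \<inter> cdom M q))"
  by (intro chart_image_open[OF manifold_chart]) (auto intro: chart_open[OF manifold_chart])

lemma cinv_continuous: "p \<in> points M \<Longrightarrow> continuous_map (top_of_set (crange M p)) (mtop M) (cinv M p)"
  by (rule chart_inv_continuous[OF manifold_chart])

lemma coord_image_open:
  "p \<in> points M \<Longrightarrow> openin (mtop M) W \<Longrightarrow> W \<subseteq> cdom M p \<Longrightarrow> openin (top_of_set (model M)) (coord M p ` W)"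
  by (rule chart_image_open[OF manifold_chart])

end

text \<open>A tangent vector at \<open>z\<close> is given by its coordinates in the chart at \<open>z\<close>, whereas calculus along a
  curve or a flow uses one fixed chart; this is the translation between two charts over \<open>z\<close>.\<close>

definition tchange :: "('a, 'e::euclidean_space, 'x) manifold_scheme \<Rightarrow> 'a \<Rightarrow> 'a \<Rightarrow> 'a \<Rightarrow> 'e \<Rightarrow> 'e" where
  "tchange M p q z = sderiv (model M) (\<lambda>y. coord M q (cinv M p y)) (coord M p z)"

context
  fixes M :: "('a, 'e::euclidean_space, 'x) manifold_scheme"
  assumes M: "smooth_manifold M"
begin

lemma
  assumes pq: "p \<in> points M" "q \<in> points M" and z: "z \<in> cdom M p" "z \<in> cdom M q"
  shows tchange_linear: "linear (tchange M p q z)"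
    and tchange_in_model: "tchange M p q z u \<in> model M"
    and chart_deriv_transition:
      "u \<in> model M \<Longrightarrow> chart_deriv M p (coord M q \<circ> cinv M p) (coord M p z) u = tchange M p q z u"
proof -
  note a = manifold_model[OF M] overlap_open[OF M pq] manifold_transition[OF M pq]
  have x: "coord M p z \<in> coord M p ` (cdom M p \<inter> cdom M q)" using z by blast
  show "linear (tchange M p q z)" unfolding tchange_def by (rule sderiv_linear[OF a x])
  show "tchange M p q z u \<in> model M" unfolding tchange_def
    by (rule sderiv_in_subspace[OF a x manifold_model[OF M]])
      (use coord_model[OF M] cinv_coord[OF M] pq in auto)
  show "chart_deriv M p (coord M q \<circ> cinv M p) (coord M p z) u = tchange M p q z u" if "u \<in> model M"
    unfolding tchange_def chart_deriv_def o_def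
    by (rule frechet_derivative_within_eq_sderiv[OF a x chart_range_open[OF manifold_chart[OF M pq(1)]] _ that]) auto
qed

lemma tchange_compose:
  assumes pqr: "p \<in> points M" "q \<in> points M" "r \<in> points M"
    and z: "z \<in> cdom M p" "z \<in> cdom M q" "z \<in> cdom M r"
  shows "tchange M q r z (tchange M p q z u) = tchange M p r z u"
proof -
  let ?S = "coord M p ` (cdom M p \<inter> cdom M q \<inter> cdom M r)"
  have oS: "openin (top_of_set (model M)) ?S"
    by (rule coord_image_open[OF M pqr(1)]) (auto intro!: openin_Int chart_open[OF manifold_chart[OF M]] pqr)
  have sS: "smooth_on ?S (\<lambda>y. coord M q (cinv M p y))"
    by (rule smooth_on_subset[OF manifold_transition[OF M pqr(1,2)]]) auto
  have x: "coord M p z \<in> ?S" using z by blast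
  have c: "coord M q (cinv M p (coord M p z)) = coord M q z" using cinv_coord[OF M pqr(1) z(1)] by simp
  have sub: "coord M q (cinv M p y) \<in> coord M q ` (cdom M q \<inter> cdom M r)" if "y \<in> ?S" for y
    using that cinv_coord[OF M pqr(1)] by auto
  have "sderiv (model M) (\<lambda>y. coord M r (cinv M q (coord M q (cinv M p y)))) (coord M p z) u =
      tchange M q r z (tchange M p q z u)"
    unfolding tchange_def
    using sderiv_compose[OF manifold_model[OF M] oS sS x manifold_model[OF M] overlap_open[OF M pqr(2,3)]
        manifold_transition[OF M pqr(2,3)] sub, of u] unfolding c .
  moreover have "sderiv (model M) (\<lambda>y. coord M r (cinv M p y)) (coord M p z) =
      sderiv (model M) (\<lambda>y. coord M r (cinv M q (coord M q (cinv M p y)))) (coord M p z)"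
    by (rule sderiv_cong[OF manifold_model[OF M] oS _ x])
      (use cinv_coord[OF M] pqr in \<open>auto intro: smooth_on_subset[OF manifold_transition[OF M pqr(1,3)]]\<close>)
  ultimately show ?thesis by (simp add: tchange_def)
qed

lemma tchange_self:
  assumes p: "p \<in> points M" and z: "z \<in> cdom M p" and u: "u \<in> model M"
  shows "tchange M p p z u = u"
proof -
  have "sderiv (model M) (\<lambda>y. y) (coord M p z) = tchange M p p z" unfolding tchange_def
    by (rule sderiv_cong[OF manifold_model[OF M] chart_range_open[OF manifold_chart[OF M p]] smooth_on_id])
      (use z coord_cinv[OF M] in auto)
  then show ?thesis using sderiv_id[OF manifold_model[OF M] coord_model[OF M p z] u] by metis
qed


section \<open>Curves and velocities\<close>

lemma curve_eventually:
  assumes p: "p \<in> points M" and c: "curve_at M p c v" and W: "openin (mtop M) W" "p \<in> W"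
  obtains e where "0 < e" "\<And>t. t \<in> {-e<..<e} \<Longrightarrow> c t \<in> W \<and> c t \<in> cdom M p"
    "smooth_on {-e<..<e} (\<lambda>t. coord M p (c t))"
proof -
  obtain e where e: "0 < e" "\<And>t. t \<in> {-e<..<e} \<Longrightarrow> c t \<in> cdom M p" "smooth_on {-e<..<e} (coord M p \<circ> c)"
    and c0: "c 0 = p" using c unfolding curve_at_def by blast
  let ?W = "W \<inter> cdom M p"
  have W': "p \<in> ?W" "openin (top_of_set (model M)) (coord M p ` ?W)"
    using W p by (auto intro!: coord_image_open[OF M p] openin_Int chart_open[OF manifold_chart[OF M]]
        manifold_centre[OF M p])
  then obtain T where T: "open T" "coord M p ` ?W = model M \<inter> T" using openin_open by blast
  have "continuous_on {-e<..<e} (\<lambda>t. coord M p (c t))"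
    using smooth_on_imp_continuous_on[OF e(3)] by (simp add: o_def)
  then have "open ({-e<..<e} \<inter> (\<lambda>t. coord M p (c t)) -` T)"
    by (rule continuous_open_preimage) (use T in auto)
  moreover have "0 \<in> {-e<..<e} \<inter> (\<lambda>t. coord M p (c t)) -` T" using e c0 W' T by auto
  ultimately obtain d where d: "0 < d" "ball 0 d \<subseteq> {-e<..<e} \<inter> (\<lambda>t. coord M p (c t)) -` T"
    using open_contains_ball by blast
  have sub: "{-d<..<d} \<subseteq> {-e<..<e}" "\<And>t. t \<in> {-d<..<d} \<Longrightarrow> coord M p (c t) \<in> T"
    using d(2) by (auto simp: subset_iff dist_real_def)
  show ?thesis
  proof (rule that[OF d(1)])
    show "smooth_on {-d<..<d} (\<lambda>t. coord M p (c t))"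
      using smooth_on_subset[OF e(3) sub(1)] by (simp add: o_def)
    fix t assume t: "t \<in> {-d<..<d}"
    then have ct: "c t \<in> cdom M p" using sub e by blast
    then have "coord M p (c t) \<in> coord M p ` ?W"
      unfolding T(2) using sub(2)[OF t] coord_model[OF M p] by blast
    then obtain w where "w \<in> ?W" "coord M p w = coord M p (c t)" by auto
    then have "c t = w" using ct chart_inj[OF manifold_chart[OF M p]] by (auto dest: inj_onD)
    then show "c t \<in> W \<and> c t \<in> cdom M p" using \<open>w \<in> ?W\<close> by auto
  qed
qed

lemma curve_velocity_in_model:
  assumes p: "p \<in> points M" and c: "curve_at M p c v"
  shows "v \<in> model M"
proof -
  obtain e where e: "0 < e" "\<And>t. t \<in> {-e<..<e} \<Longrightarrow> c t \<in> cdom M p"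
    using curve_eventually[OF p c openin_topspace p] by metis
  have "((\<lambda>t. coord M p (c t)) has_vector_derivative v) (at 0 within {-e<..<e})"
    using c by (auto simp: curve_at_def o_def intro: has_vector_derivative_at_within)
  then show ?thesis
    by (rule has_vector_derivative_in_subspace[OF manifold_model[OF M]])
      (use e coord_model[OF M p] in \<open>auto simp: at_within_open[of 0 "{-e<..<e}"]\<close>)
qed

lemma curve_through:
  assumes p: "p \<in> points M" and v: "v \<in> model M"
  obtains c where "curve_at M p c v" "\<And>t. c t \<in> points M"
proof -
  have pc: "p \<in> cdom M p" by (rule manifold_centre[OF M p])
  obtain T where T: "open T" "crange M p = model M \<inter> T"
    using chart_range_open[OF manifold_chart[OF M p]] openin_open by blast
  define l where "l t = coord M p p + t *\<^sub>R v" for t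
  have l: "bounded_linear (\<lambda>t. t *\<^sub>R v)" by (rule bounded_linear_scaleR_left)
  have lm: "l t \<in> model M" for t
    using manifold_model[OF M] v coord_model[OF M p pc] by (simp add: l_def subspace_add subspace_scale)
  have "open (l -` T)" unfolding l_def by (intro open_vimage T) (auto intro!: continuous_intros)
  moreover have "0 \<in> l -` T" using T pc by (auto simp: l_def)
  ultimately obtain e where e: "0 < e" "ball 0 e \<subseteq> l -` T" using open_contains_ball by blast
  have le: "l t \<in> crange M p" if "t \<in> {-e<..<e}" for t
    using e(2) that lm T by (auto simp: subset_iff dist_real_def)
  define c where "c t = (if t \<in> {-e<..<e} then cinv M p (l t) else p)" for t
  have cl: "coord M p (c t) = l t" "c t \<in> cdom M p" if "t \<in> {-e<..<e}" for t
    using coord_cinv[OF M le[OF that]] cinv_in[OF M le[OF that]] that by (auto simp: c_def)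
  have "smooth_on {-e<..<e} l"
    unfolding l_def
    by (rule Cinf_on_imp_smooth_on[OF Cinf_on_add[OF Cinf_on_const Cinf_on_bounded_linear[OF l]] open_UNIV]) simp
  then have "smooth_on {-e<..<e} (coord M p \<circ> c)"
    by (rule smooth_on_cong) (use cl in auto)
  moreover have "((coord M p \<circ> c) has_vector_derivative v) (at 0)"
  proof (rule has_vector_derivative_transform_within_open[of l _ _ "{-e<..<e}"])
    show "(l has_vector_derivative v) (at 0)" unfolding l_def by (auto intro!: derivative_eq_intros)
  qed (use e cl in auto)
  moreover have "c 0 = p" using e cinv_coord[OF M p pc] by (simp add: c_def l_def)
  ultimately have "curve_at M p c v" unfolding curve_at_def using e(1) cl(2) by blast
  moreover have "c t \<in> points M" for t
    using cl(2)[of t] cdom_points[OF M p] p by (cases "t \<in> {-e<..<e}") (auto simp: c_def)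
  ultimately show ?thesis by (rule that)
qed

end

lemma curve_at_cong:
  assumes "curve_at M p c v" "0 < e" "\<And>t. t \<in> {-e<..<e} \<Longrightarrow> c t = c' t"
  shows "curve_at M p c' v"
proof -
  obtain d where d: "0 < d" "\<And>t. t \<in> {-d<..<d} \<Longrightarrow> c t \<in> cdom M p" "smooth_on {-d<..<d} (coord M p \<circ> c)"
    and c: "c 0 = p" "((coord M p \<circ> c) has_vector_derivative v) (at 0)"
    using assms(1) unfolding curve_at_def by blast
  define m where "m = min d e"
  have m: "0 < m" "{-m<..<m} \<subseteq> {-d<..<d}" "{-m<..<m} \<subseteq> {-e<..<e}" using d assms by (auto simp: m_def)
  have "smooth_on {-m<..<m} (coord M p \<circ> c')"
    by (rule smooth_on_cong[OF smooth_on_subset[OF d(3) m(2)]]) (use m assms(3) in auto)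
  moreover have "((coord M p \<circ> c') has_vector_derivative v) (at 0)"
    by (rule has_vector_derivative_transform_within_open[OF c(2), of "{-m<..<m}"]) (use m assms(3) in auto)
  moreover have "\<forall>t\<in>{-m<..<m}. c' t \<in> cdom M p" using m d(2) assms(3) by (metis subsetD)
  moreover have "c' 0 = p" using c(1) assms(2) assms(3)[of 0] by simp
  ultimately show ?thesis unfolding curve_at_def using m(1) by blast
qed

lemma curve_at_unique:
  assumes "curve_at M p c v" "curve_at M p c w"
  shows "v = w"
  using assms unfolding curve_at_def by (metis vector_derivative_unique_at)

section \<open>Smooth maps and open embeddings\<close>

text \<open>The domain \<open>W\<close> is an open set rather than all of \<open>M\<close> in order to cover inverses of open embeddings.\<close>

definition smooth_map_on ::
    "('a, 'e::euclidean_space, 'x) manifold_scheme \<Rightarrow> ('b, 'f::euclidean_space, 'y) manifold_scheme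
      \<Rightarrow> 'a set \<Rightarrow> ('a \<Rightarrow> 'b) \<Rightarrow> bool" where
  "smooth_map_on M N W f \<longleftrightarrow>
     openin (mtop M) W \<and> continuous_map (subtopology (mtop M) W) (mtop N) f \<and>
     (\<forall>p\<in>points M. \<forall>q\<in>points N.
        smooth_on (coord M p ` {x \<in> W \<inter> cdom M p. f x \<in> cdom N q}) (\<lambda>y. coord N q (f (cinv M p y))))"

text \<open>Tangent vectors are coordinate vectors in the chart centred at their foot point, so this is the
  derivative of the coordinate expression in the charts centred at \<open>p\<close> and at \<open>f p\<close>.\<close>

definition dmap ::
    "('a, 'e::euclidean_space, 'x) manifold_scheme \<Rightarrow> ('b, 'f::euclidean_space, 'y) manifold_scheme
      \<Rightarrow> ('a \<Rightarrow> 'b) \<Rightarrow> 'a \<Rightarrow> 'e \<Rightarrow> 'f" where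
  "dmap M N f p = sderiv (model M) (\<lambda>y. coord N (f p) (f (cinv M p y))) (coord M p p)"

text \<open>This is the kind of map that a Hamiltonian flow gives: on a noncompact manifold it need not be onto.
  Openness of the image is contained in the smoothness of the inverse.\<close>

definition open_embedding ::
    "('a, 'e::euclidean_space, 'x) manifold_scheme \<Rightarrow> ('b, 'f::euclidean_space, 'y) manifold_scheme
      \<Rightarrow> ('a \<Rightarrow> 'b) \<Rightarrow> bool" where
  "open_embedding M N f \<longleftrightarrow>
     smooth_map_on M N (points M) f \<and> inj_on f (points M) \<and>
     smooth_map_on N M (f ` points M) (inv_into (points M) f)"

lemma smooth_map_on_points: "smooth_map_on M N W f \<Longrightarrow> x \<in> W \<Longrightarrow> f x \<in> points N"
  unfolding smooth_map_on_def continuous_map_def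
  by (auto simp: topspace_subtopology dest!: openin_subset)

lemma smooth_map_on_subset: "smooth_map_on M N W f \<Longrightarrow> W \<subseteq> points M"
  by (auto simp: smooth_map_on_def dest: openin_subset)

lemma smooth_map_on_preimage_open:
  assumes f: "smooth_map_on M N W f" and T: "openin (mtop N) T"
  shows "openin (mtop M) {x \<in> W. f x \<in> T}"
proof -
  have "openin (subtopology (mtop M) W) {x \<in> topspace (subtopology (mtop M) W). f x \<in> T}"
    using f openin_continuous_map_preimage[OF _ T] unfolding smooth_map_on_def by blast
  moreover have "{x \<in> topspace (subtopology (mtop M) W). f x \<in> T} = {x \<in> W. f x \<in> T}"
    using smooth_map_on_subset[OF f] by auto
  ultimately show ?thesis using f unfolding smooth_map_on_def by (metis openin_trans_full)
qed

context
  fixes M :: "('a, 'e::euclidean_space, 'x) manifold_scheme"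
    and N :: "('b, 'f::euclidean_space, 'y) manifold_scheme"
  assumes M: "smooth_manifold M" and N: "smooth_manifold N"
begin

lemma smooth_map_on_coordinate_domain:
  assumes f: "smooth_map_on M N W f" and p: "p \<in> points M" "q \<in> points N"
  shows "openin (mtop M) {x \<in> W \<inter> cdom M p. f x \<in> cdom N q}" (is ?A)
    and "openin (top_of_set (model M)) (coord M p ` {x \<in> W \<inter> cdom M p. f x \<in> cdom N q})" (is ?B)
proof -
  have "openin (mtop M) ({x \<in> W. f x \<in> cdom N q} \<inter> cdom M p)"
    by (intro openin_Int smooth_map_on_preimage_open[OF f] chart_open[OF manifold_chart[OF M p(1)]]
        chart_open[OF manifold_chart[OF N p(2)]])
  moreover have "{x \<in> W. f x \<in> cdom N q} \<inter> cdom M p = {x \<in> W \<inter> cdom M p. f x \<in> cdom N q}" by auto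
  ultimately show ?A by simp
  then show ?B by (rule coord_image_open[OF M p(1)]) auto
qed

lemma
  assumes f: "smooth_map_on M N W f" and p: "p \<in> W"
  shows dmap_linear: "linear (dmap M N f p)"
    and smooth_map_on_curve: "curve_at M p c v \<Longrightarrow> curve_at N (f p) (\<lambda>t. f (c t)) (dmap M N f p v)"
proof -
  have pp: "p \<in> points M" and fp: "f p \<in> points N"
    using smooth_map_on_subset[OF f] p smooth_map_on_points[OF f p] by auto
  define D where "D = {x \<in> W \<inter> cdom M p. f x \<in> cdom N (f p)}"
  have D: "openin (mtop M) D" "openin (top_of_set (model M)) (coord M p ` D)"
    unfolding D_def by (rule smooth_map_on_coordinate_domain[OF f pp fp])+
  have pD: "p \<in> D" using p manifold_centre[OF M pp] manifold_centre[OF N fp] by (simp add: D_def)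
  have sF: "smooth_on (coord M p ` D) (\<lambda>y. coord N (f p) (f (cinv M p y)))"
    using f pp fp unfolding smooth_map_on_def D_def by blast
  show "linear (dmap M N f p)" unfolding dmap_def
    using sderiv_linear[OF manifold_model[OF M] D(2) sF] pD by blast
  assume c: "curve_at M p c v"
  obtain e where e: "0 < e" "\<And>t. t \<in> {-e<..<e} \<Longrightarrow> c t \<in> D \<and> c t \<in> cdom M p"
    "smooth_on {-e<..<e} (\<lambda>t. coord M p (c t))"
    using curve_eventually[OF M pp c D(1) pD] by blast
  have c0: "c 0 = p" "((\<lambda>t. coord M p (c t)) has_vector_derivative v) (at 0)"
    using c by (auto simp: curve_at_def o_def)
  have eq: "coord N (f p) (f (c t)) = coord N (f p) (f (cinv M p (coord M p (c t))))"
    if "t \<in> {-e<..<e}" for t using cinv_coord[OF M pp] e(2)[OF that] by simp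
  have "smooth_on {-e<..<e} (\<lambda>t. coord N (f p) (f (cinv M p (coord M p (c t)))))"
    by (rule smooth_on_compose[OF e(3) sF]) (use e(2) in blast)
  then have 1: "smooth_on {-e<..<e} (coord N (f p) \<circ> (\<lambda>t. f (c t)))"
    by (rule smooth_on_cong) (use eq in auto)
  have "((\<lambda>t. coord N (f p) (f (cinv M p (coord M p (c t))))) has_vector_derivative
      sderiv (model M) (\<lambda>y. coord N (f p) (f (cinv M p y))) (coord M p (c 0)) v) (at 0 within {-e<..<e})"
    by (rule sderiv_curve[OF manifold_model[OF M] D(2) sF has_vector_derivative_at_within[OF c0(2)]])
      (use e(2) in blast, use e(1) in simp)
  then have "((\<lambda>t. coord N (f p) (f (cinv M p (coord M p (c t))))) has_vector_derivative dmap M N f p v) (at 0)"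
    using e(1) by (simp add: dmap_def c0(1) at_within_open[of 0 "{-e<..<e}"])
  then have 2: "((coord N (f p) \<circ> (\<lambda>t. f (c t))) has_vector_derivative dmap M N f p v) (at 0)"
    by (rule has_vector_derivative_transform_within_open[of _ _ _ "{-e<..<e}"]) (use eq e(1) in auto)
  have 3: "f (c t) \<in> cdom N (f p)" if "t \<in> {-e<..<e}" for t using e(2)[OF that] by (auto simp: D_def)
  show "curve_at N (f p) (\<lambda>t. f (c t)) (dmap M N f p v)"
    unfolding curve_at_def using e(1) 1 2 3 c0(1) by blast
qed

lemma dmap_in_model:
  assumes "smooth_map_on M N W f" "p \<in> W" "v \<in> model M"
  shows "dmap M N f p v \<in> model N"
proof -
  have p: "p \<in> points M" using assms smooth_map_on_subset by blast
  obtain c where "curve_at M p c v" using curve_through[OF M p assms(3)] by blast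
  then show ?thesis
    by (rule curve_velocity_in_model[OF N smooth_map_on_points[OF assms(1,2)] smooth_map_on_curve[OF assms(1,2)]])
qed

text \<open>Coordinate expressions in other charts differ from the one in the charts centred at a point and at its
  image by transition maps, which are smooth.\<close>

lemma smooth_map_onI_centred:
  assumes W: "openin (mtop M) W" and cont: "continuous_map (subtopology (mtop M) W) (mtop N) f"
    and loc: "\<And>x. x \<in> W \<Longrightarrow> \<exists>X. openin (mtop M) X \<and> x \<in> X \<and> X \<subseteq> W \<inter> cdom M x \<and> f ` X \<subseteq> cdom N (f x) \<and>
      smooth_on (coord M x ` X) (\<lambda>y. coord N (f x) (f (cinv M x y)))"
  shows "smooth_map_on M N W f"
  unfolding smooth_map_on_def
proof (intro conjI W cont ballI)
  fix p q assume p: "p \<in> points M" and q: "q \<in> points N"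
  have Wp: "W \<subseteq> points M" using W by (rule openin_subset)
  define S where "S = {x \<in> W \<inter> cdom M p. f x \<in> cdom N q}"
  show "smooth_on (coord M p ` {x \<in> W \<inter> cdom M p. f x \<in> cdom N q}) (\<lambda>y. coord N q (f (cinv M p y)))"
    unfolding S_def[symmetric]
  proof (rule smooth_on_local)
    fix y assume "y \<in> coord M p ` S"
    then obtain x where x: "x \<in> W" "x \<in> cdom M p" "f x \<in> cdom N q" "y = coord M p x" by (auto simp: S_def)
    obtain X where X: "openin (mtop M) X" "x \<in> X" "X \<subseteq> W \<inter> cdom M x" "f ` X \<subseteq> cdom N (f x)"
      and sX: "smooth_on (coord M x ` X) (\<lambda>y. coord N (f x) (f (cinv M x y)))"
      using loc[OF x(1)] by blast
    have xp: "x \<in> points M" "f x \<in> points N" using Wp x chart_subset[OF manifold_chart[OF N q]] by auto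
    have "openin (subtopology (mtop M) W) {z \<in> topspace (subtopology (mtop M) W). f z \<in> cdom N q}"
      by (rule openin_continuous_map_preimage[OF cont chart_open[OF manifold_chart[OF N q]]])
    then have "openin (mtop M) {z \<in> topspace (subtopology (mtop M) W). f z \<in> cdom N q}"
      using W by (rule openin_trans_full)
    moreover have "{z \<in> topspace (subtopology (mtop M) W). f z \<in> cdom N q} = {z \<in> W. f z \<in> cdom N q}"
      using Wp by auto
    ultimately have "openin (mtop M) {z \<in> W. f z \<in> cdom N q}" by simp
    then have oX: "openin (mtop M) (X \<inter> cdom M p \<inter> {z \<in> W. f z \<in> cdom N q})"
      by (intro openin_Int X chart_open[OF manifold_chart[OF M p]])
    define T where "T = coord M p ` (X \<inter> cdom M p \<inter> {z \<in> W. f z \<in> cdom N q})"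
    have "openin (top_of_set (model M)) T" unfolding T_def
      by (rule coord_image_open[OF M p oX]) auto
    moreover have TS: "T \<subseteq> coord M p ` S" using X by (auto simp: T_def S_def)
    moreover have "coord M p ` S \<subseteq> model M" using coord_model[OF M p] by (auto simp: S_def)
    ultimately have oT: "openin (top_of_set (coord M p ` S)) T" by (rule openin_subset_trans)
    have 1: "smooth_on T (\<lambda>y. coord M x (cinv M p y))"
      by (rule smooth_on_subset[OF manifold_transition[OF M p xp(1)]]) (use X in \<open>auto simp: T_def\<close>)
    have 2: "smooth_on T (\<lambda>y. coord N (f x) (f (cinv M x (coord M x (cinv M p y)))))"
      by (rule smooth_on_compose[OF 1 sX]) (use cinv_coord[OF M p] in \<open>auto simp: T_def\<close>)
    have "smooth_on T (\<lambda>y. coord N q (cinv N (f x) (coord N (f x) (f (cinv M x (coord M x (cinv M p y)))))))"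
      by (rule smooth_on_compose[OF 2 manifold_transition[OF N xp(2) q]])
        (use cinv_coord[OF M p] cinv_coord[OF M xp(1)] X(3,4) in \<open>auto simp: T_def subset_iff\<close>)
    then have "smooth_on T (\<lambda>y. coord N q (f (cinv M p y)))"
    proof (rule smooth_on_cong)
      fix y assume "y \<in> T"
      then obtain z where z: "z \<in> X" "z \<in> cdom M p" "y = coord M p z" by (auto simp: T_def)
      have "z \<in> cdom M x" "f z \<in> cdom N (f x)" using z X by auto
      then show "coord N q (cinv N (f x) (coord N (f x) (f (cinv M x (coord M x (cinv M p y)))))) =
          coord N q (f (cinv M p y))"
        using z cinv_coord[OF M p] cinv_coord[OF M xp(1)] cinv_coord[OF N xp(2)] by simp
    qed
    moreover have "y \<in> T" using x X by (auto simp: T_def)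
    ultimately show "\<exists>T. y \<in> T \<and> openin (top_of_set (coord M p ` S)) T \<and>
        smooth_on T (\<lambda>y. coord N q (f (cinv M p y)))" using oT by blast
  qed
qed

end

text \<open>The inverse function theorem for maps between open subsets of the model.  To apply it in the ambient
  space, the coordinate expression \<open>F\<close> is extended by the identity on the kernel of the projection to the
  model; the extension \<open>f'\<close> takes values in the model only on the model, so its local inverse restricts
  to one of \<open>F\<close>.\<close>

lemma local_inverse_in_charts:
  assumes M: "smooth_manifold M" and f: "smooth_map_on M M (points M) f"
    and inj: "inj_on f (points M)" and d: "\<And>u. u \<in> model M \<Longrightarrow> dmap M M f x u = 0 \<Longrightarrow> u = 0"
    and W: "openin (mtop M) W" "x \<in> W"
  obtains X where "openin (mtop M) X" "x \<in> X" "X \<subseteq> W \<inter> cdom M x" "f ` X \<subseteq> cdom M (f x)"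
    "openin (mtop M) (f ` X)"
    "smooth_on (coord M (f x) ` f ` X) (\<lambda>y. coord M x (inv_into (points M) f (cinv M (f x) y)))"
proof -
  let ?V = "model M" and ?\<pi> = "proj (model M)"
  note V = manifold_model[OF M]
  have x: "x \<in> points M" using W openin_subset by blast
  have z: "f x \<in> points M" by (rule smooth_map_on_points[OF f x])
  define a where "a = coord M x x"
  define F where "F y = coord M (f x) (f (cinv M x y))" for y
  define A where "A = {y \<in> points M \<inter> cdom M x. f y \<in> cdom M (f x)}"
  have A: "openin (mtop M) A" "openin (top_of_set ?V) (coord M x ` A)"
    unfolding A_def by (rule smooth_map_on_coordinate_domain[OF M M f x z])+
  have xA: "x \<in> A" using x manifold_centre[OF M x] manifold_centre[OF M z] by (simp add: A_def)
  have sF: "smooth_on (coord M x ` A) F" using f x z unfolding smooth_map_on_def A_def F_def by blast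
  have FV: "F y \<in> ?V" if "y \<in> coord M x ` A" for y
    using that coord_model[OF M z] cinv_coord[OF M x] by (auto simp: F_def A_def)
  have aA: "a \<in> coord M x ` A" using xA by (simp add: a_def)
  have aV: "a \<in> ?V" using aA openin_imp_subset[OF A(2)] by blast
  define U where "U = ?\<pi> -` coord M x ` A"
  have U: "open U" "a \<in> U" using open_proj_vimage[OF V A(2)] aA proj_id[OF V aV] by (auto simp: U_def)
  define f' where "f' y = F (?\<pi> y) + (y + (-1) *\<^sub>R ?\<pi> y)" for y
  have lin: "bounded_linear (\<lambda>y. y + (-1) *\<^sub>R ?\<pi> y)"
    by (intro bounded_linear_add bounded_linear_ident bounded_linear_compose[OF bounded_linear_scaleR_right]
        bounded_linear_proj[OF V])
  have f': "Cinf_on U f'" unfolding f'_def U_def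
    by (rule Cinf_on_add[OF smooth_on_imp_Cinf_on_proj[OF V A(2) sF] Cinf_on_bounded_linear[OF lin]])
  have "(f' has_derivative (\<lambda>u. sderiv ?V F a u + (u + (-1) *\<^sub>R ?\<pi> u))) (at a)"
    unfolding f'_def
    by (rule has_derivative_add[OF sderiv_has_derivative[OF V A(2) sF aA] bounded_linear_imp_has_derivative[OF lin]])
  then have f'd: "frechet_derivative f' (at a) = (\<lambda>u. sderiv ?V F a u + (u + (-1) *\<^sub>R ?\<pi> u))"
    using frechet_derivative_at by metis
  have "inj (frechet_derivative f' (at a))"
  proof -
    have "linear (frechet_derivative f' (at a))"
      using Cinf_on_has_derivative[OF f' U(2)] by (rule has_derivative_linear)
    moreover have "u = 0" if "frechet_derivative f' (at a) u = 0" for u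
    proof -
      have dV: "sderiv ?V F a u \<in> ?V" by (rule sderiv_in_subspace[OF V A(2) sF aA V FV])
      have "sderiv ?V F a u + (u - ?\<pi> u) = 0" using that by (simp add: f'd)
      then have "?\<pi> u - u = sderiv ?V F a u" by (simp add: algebra_simps eq_neg_iff_add_eq_0)
      then have "?\<pi> u - u \<in> ?V" using dV by simp
      then have "?\<pi> u - (?\<pi> u - u) \<in> ?V" using V proj_in[OF V] subspace_diff by blast
      then have uV: "u \<in> ?V" by simp
      then have "sderiv ?V F a u = 0" using \<open>?\<pi> u - u = sderiv ?V F a u\<close> proj_id[OF V] by simp
      then show ?thesis using d[OF uV] by (simp add: dmap_def F_def[abs_def] a_def)
    qed
    ultimately show ?thesis using linear_injective_0 by blast
  qed
  then obtain U' V' g where g: "open U'" "U' \<subseteq> U" "a \<in> U'" "open V'" "homeomorphism U' V' f' g" "Cinf_on V' g"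
    using Cinf_inverse_function[OF U(1) f' U(2)] by metis
  have f'F: "f' y = F y" if "y \<in> ?V" for y using proj_id[OF V that] by (simp add: f'_def)
  define X where "X = W \<inter> A \<inter> {y \<in> cdom M x. coord M x y \<in> ?V \<inter> U'}"
  have oX: "openin (mtop M) X" unfolding X_def
    by (intro openin_Int W A chart_preimage_open[OF manifold_chart[OF M x]] openin_open_Int g)
  have xX: "x \<in> X" using W xA g(3) aV manifold_centre[OF M x] by (simp add: X_def a_def)
  have fX: "f ` X \<subseteq> cdom M (f x)" by (auto simp: X_def A_def)
  have oXm: "openin (top_of_set ?V) (coord M x ` X)"
    by (rule coord_image_open[OF M x oX]) (auto simp: X_def)
  have XU': "coord M x ` X \<subseteq> U'" by (auto simp: X_def)
  \<comment> \<open>A point whose image under \<open>f'\<close> lies in the model lies in the model itself, where \<open>f'\<close> is \<open>F\<close>.\<close>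
  have im: "coord M (f x) ` f ` X = ?V \<inter> f' ` (U' \<inter> ?\<pi> -` coord M x ` X)"
  proof (intro equalityI subsetI)
    fix v assume "v \<in> coord M (f x) ` f ` X"
    then obtain y where y: "y \<in> X" "v = coord M (f x) (f y)" by auto
    then have yc: "y \<in> cdom M x" "f y \<in> cdom M (f x)" using fX by (auto simp: X_def)
    have yV: "coord M x y \<in> ?V" by (rule coord_model[OF M x yc(1)])
    have "v = f' (coord M x y)" using y cinv_coord[OF M x yc(1)] by (simp add: f'F[OF yV] F_def)
    then show "v \<in> ?V \<inter> f' ` (U' \<inter> ?\<pi> -` coord M x ` X)"
      using y XU' proj_id[OF V yV] coord_model[OF M z yc(2)] by auto
  next
    fix v assume "v \<in> ?V \<inter> f' ` (U' \<inter> ?\<pi> -` coord M x ` X)"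
    then obtain y where y: "y \<in> U'" "?\<pi> y \<in> coord M x ` X" "v = f' y" "v \<in> ?V" by auto
    obtain w where w: "w \<in> X" "?\<pi> y = coord M x w" using y(2) by auto
    have wc: "w \<in> cdom M x" "w \<in> A" using w by (auto simp: X_def)
    then have "F (?\<pi> y) \<in> ?V" using FV w by simp
    then have "v - F (?\<pi> y) + ?\<pi> y \<in> ?V" using y(4) V proj_in[OF V] by (simp add: subspace_add subspace_diff)
    then have "y \<in> ?V" using y(3) by (simp add: f'_def)
    then have "v = F (coord M x w)" using f'F y(3) w(2) proj_id[OF V] by metis
    then show "v \<in> coord M (f x) ` f ` X" using w cinv_coord[OF M x wc(1)] by (simp add: F_def)
  qed
  have "open (f' ` (U' \<inter> ?\<pi> -` coord M x ` X))"
  proof -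
    have "f' ` (U' \<inter> ?\<pi> -` coord M x ` X) = V' \<inter> g -` (U' \<inter> ?\<pi> -` coord M x ` X)"
      using g(5) unfolding homeomorphism_def by force
    moreover have "open \<dots>"
      by (rule continuous_open_preimage)
        (use g open_proj_vimage[OF V oXm] in \<open>auto simp: homeomorphism_def\<close>)
    ultimately show ?thesis by simp
  qed
  then have "openin (mtop M) {y \<in> cdom M (f x). coord M (f x) y \<in> ?V \<inter> f' ` (U' \<inter> ?\<pi> -` coord M x ` X)}"
    by (intro chart_preimage_open[OF manifold_chart[OF M z]] openin_open_Int)
  moreover have "{y \<in> cdom M (f x). coord M (f x) y \<in> ?V \<inter> f' ` (U' \<inter> ?\<pi> -` coord M x ` X)} = f ` X"
    unfolding im[symmetric] using fX chart_inj[OF manifold_chart[OF M z]] by (auto dest!: inj_onD)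
  ultimately have ofX: "openin (mtop M) (f ` X)" by simp
  have sub: "coord M (f x) ` f ` X \<subseteq> V'" using im g(5) by (auto simp: homeomorphism_def)
  have "smooth_on (coord M (f x) ` f ` X) (\<lambda>y. coord M x (inv_into (points M) f (cinv M (f x) y)))"
  proof (rule smooth_on_cong[OF Cinf_on_imp_smooth_on[OF g(6,4) sub]])
    fix v assume "v \<in> coord M (f x) ` f ` X"
    then obtain y where y: "y \<in> X" "v = coord M (f x) (f y)" by auto
    then have yc: "y \<in> cdom M x" "f y \<in> cdom M (f x)" "y \<in> points M" using fX by (auto simp: X_def A_def)
    have yV: "coord M x y \<in> ?V" by (rule coord_model[OF M x yc(1)])
    have "v = f' (coord M x y)" using y cinv_coord[OF M x yc(1)] by (simp add: f'F[OF yV] F_def)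
    then have "g v = coord M x y" using g(5) XU' y(1) by (auto simp: homeomorphism_def)
    then show "g v = coord M x (inv_into (points M) f (cinv M (f x) v))"
      using y cinv_coord[OF M z yc(2)] inj yc(3) by simp
  qed
  then show ?thesis using that oX xX fX ofX by (auto simp: X_def)
qed

lemma open_embedding_if_injective_immersion:
  assumes M: "smooth_manifold M" and f: "smooth_map_on M M (points M) f"
    and inj: "inj_on f (points M)"
    and d: "\<And>x u. x \<in> points M \<Longrightarrow> u \<in> model M \<Longrightarrow> dmap M M f x u = 0 \<Longrightarrow> u = 0"
  shows "open_embedding M M f"
  unfolding open_embedding_def
proof (intro conjI f inj)
  let ?g = "inv_into (points M) f"
  have open_map: "openin (mtop M) (f ` W)" if W: "openin (mtop M) W" for W
    unfolding openin_subopen[of _ "f ` W"]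
  proof
    fix z assume "z \<in> f ` W"
    then obtain x where x: "x \<in> W" "z = f x" by auto
    then have xp: "x \<in> points M" using W openin_subset by blast
    obtain X where "x \<in> X" "X \<subseteq> W \<inter> cdom M x" "openin (mtop M) (f ` X)"
      using local_inverse_in_charts[OF M f inj d[OF xp] W x(1)] by metis
    then show "\<exists>T. openin (mtop M) T \<and> z \<in> T \<and> T \<subseteq> f ` W" using x by blast
  qed
  have fsub: "f ` points M \<subseteq> points M" using smooth_map_on_points[OF f] by blast
  show "smooth_map_on M M (f ` points M) ?g"
  proof (rule smooth_map_onI_centred[OF M M])
    show "openin (mtop M) (f ` points M)" by (rule open_map[OF openin_topspace])
    show "continuous_map (subtopology (mtop M) (f ` points M)) (mtop M) ?g"
      unfolding continuous_map_def
    proof (intro conjI allI impI)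
      show "?g \<in> topspace (subtopology (mtop M) (f ` points M)) \<rightarrow> topspace (mtop M)"
        by (auto simp: inv_into_into)
      fix W assume W: "openin (mtop M) W"
      then have "W \<subseteq> points M" by (rule openin_subset)
      then have "{z \<in> topspace (subtopology (mtop M) (f ` points M)). ?g z \<in> W} = f ` W"
        using fsub inj by (auto simp: image_iff subset_iff) 
      then show "openin (subtopology (mtop M) (f ` points M)) {z \<in> topspace (subtopology (mtop M) (f ` points M)). ?g z \<in> W}"
        using open_map[OF W] \<open>W \<subseteq> points M\<close> by (simp add: openin_subtopology_alt) blast
    qed
    fix z assume "z \<in> f ` points M"
    then obtain x where x: "x \<in> points M" "z = f x" by auto
    then have gz: "?g z = x" using inj by simp
    obtain X where X: "openin (mtop M) X" "x \<in> X" "X \<subseteq> points M \<inter> cdom M x" "f ` X \<subseteq> cdom M (f x)"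
      "openin (mtop M) (f ` X)" "smooth_on (coord M (f x) ` f ` X) (\<lambda>y. coord M x (?g (cinv M (f x) y)))"
      using local_inverse_in_charts[OF M f inj d[OF x(1)] openin_topspace x(1)] by metis
    have "?g ` f ` X \<subseteq> cdom M x" using X(3) inj by auto
    then show "\<exists>X. openin (mtop M) X \<and> z \<in> X \<and> X \<subseteq> f ` points M \<inter> cdom M z \<and> ?g ` X \<subseteq> cdom M (?g z) \<and>
        smooth_on (coord M z ` X) (\<lambda>y. coord M (?g z) (?g (cinv M z y)))"
      using X x(2) unfolding gz by (intro exI[of _ "f ` X"]) auto
  qed
qed

lemma smooth_map_on_cong:
  assumes f: "smooth_map_on M N W f" and eq: "\<And>x. x \<in> W \<Longrightarrow> f x = g x"
    and M: "smooth_manifold M"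
  shows "smooth_map_on M N W g"
  unfolding smooth_map_on_def
proof (intro conjI ballI)
  show "openin (mtop M) W" using f by (simp add: smooth_map_on_def)
  show "continuous_map (subtopology (mtop M) W) (mtop N) g"
    by (rule continuous_map_eq[of _ _ f]) (use f eq in \<open>auto simp: smooth_map_on_def\<close>)
  fix p q assume p: "p \<in> points M" "q \<in> points N"
  have "{x \<in> W \<inter> cdom M p. g x \<in> cdom N q} = {x \<in> W \<inter> cdom M p. f x \<in> cdom N q}" using eq by auto
  moreover have "smooth_on (coord M p ` {x \<in> W \<inter> cdom M p. f x \<in> cdom N q}) (\<lambda>y. coord N q (f (cinv M p y)))"
    using f p by (simp add: smooth_map_on_def)
  ultimately show "smooth_on (coord M p ` {x \<in> W \<inter> cdom M p. g x \<in> cdom N q}) (\<lambda>y. coord N q (g (cinv M p y)))"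
    by (auto intro!: smooth_on_cong[where f = "\<lambda>y. coord N q (f (cinv M p y))"] simp: cinv_coord[OF M p(1)] eq)
qed

lemma open_embedding_id:
  assumes M: "smooth_manifold M"
  shows "open_embedding M M id"
proof -
  have id: "smooth_map_on M M (points M) (\<lambda>x. x)"
    unfolding smooth_map_on_def
    by (auto intro!: smooth_on_subset[OF manifold_transition[OF M]])
  have "smooth_map_on M M (points M) id" "smooth_map_on M M (points M) (inv_into (points M) id)"
    by (rule smooth_map_on_cong[OF id _ M], simp)
      (rule smooth_map_on_cong[OF id _ M], metis id_apply inv_into_f_f inj_on_id)
  then show ?thesis by (simp add: open_embedding_def)
qed

section \<open>Images of submanifolds under open embeddings\<close>

context
  fixes M :: "('a, 'e::euclidean_space, 'x) manifold_scheme"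
    and N :: "('b, 'f::euclidean_space, 'y) manifold_scheme"
    and f :: "'a \<Rightarrow> 'b"
  assumes M: "smooth_manifold M" and N: "smooth_manifold N" and f: "open_embedding M N f"
begin

lemma
  shows open_embedding_smooth: "smooth_map_on M N (points M) f"
    and open_embedding_inj: "inj_on f (points M)"
    and open_embedding_inv: "x \<in> points M \<Longrightarrow> inv_into (points M) f (f x) = x"
    and open_embedding_inv_smooth: "smooth_map_on N M (f ` points M) (inv_into (points M) f)"
    and open_embedding_points: "x \<in> points M \<Longrightarrow> f x \<in> points N"
  using f smooth_map_on_points unfolding open_embedding_def by auto

lemma open_embedding_open_map: "openin (mtop M) W \<Longrightarrow> openin (mtop N) (f ` W)"
proof -
  assume W: "openin (mtop M) W"
  have "openin (mtop N) {z \<in> f ` points M. inv_into (points M) f z \<in> W}"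
    by (rule smooth_map_on_preimage_open[OF open_embedding_inv_smooth W])
  moreover have "{z \<in> f ` points M. inv_into (points M) f z \<in> W} = f ` W"
    using open_embedding_inv openin_subset[OF W] by force
  ultimately show ?thesis by simp
qed

text \<open>Every model vector is the velocity of a curve, so the identities below can be checked on
  curves.\<close>

lemma open_embedding_dmap_inverse:
  assumes p: "p \<in> points M"
  shows "u \<in> model M \<Longrightarrow> dmap N M (inv_into (points M) f) (f p) (dmap M N f p u) = u"
proof -
  let ?g = "inv_into (points M) f"
  assume u: "u \<in> model M"
  obtain c where c: "curve_at M p c u" "\<And>t. c t \<in> points M" using curve_through[OF M p u] by metis
  have "curve_at N (f p) (\<lambda>t. f (c t)) (dmap M N f p u)"
    by (rule smooth_map_on_curve[OF M N open_embedding_smooth p c(1)])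
  then have "curve_at M (?g (f p)) (\<lambda>t. ?g (f (c t))) (dmap N M ?g (f p) (dmap M N f p u))"
    by (rule smooth_map_on_curve[OF N M open_embedding_inv_smooth imageI[OF p]])
  then have "curve_at M p c (dmap N M ?g (f p) (dmap M N f p u))" using c by (simp add: open_embedding_inv p)
  then show ?thesis by (rule curve_at_unique[OF _ c(1)])
qed

text \<open>Curves in \<open>f ` S\<close> are images of curves in \<open>S\<close>, since the inverse of \<open>f\<close> is smooth.\<close>

lemma tangent_space_image:
  assumes S: "S \<subseteq> points M" and p: "p \<in> points M"
  shows "tangent_space N (f ` S) (f p) = dmap M N f p ` tangent_space M S p"
proof (intro equalityI subsetI)
  let ?g = "inv_into (points M) f"
  fix w assume "w \<in> tangent_space N (f ` S) (f p)"
  then obtain c e where c: "curve_at N (f p) c w" and e: "0 < e" "\<And>t. t \<in> {-e<..<e} \<Longrightarrow> c t \<in> f ` S"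
    unfolding tangent_space_def by blast
  define v where "v = dmap N M ?g (f p) w"
  have gc: "curve_at M p (\<lambda>t. ?g (c t)) v"
    using smooth_map_on_curve[OF N M open_embedding_inv_smooth imageI[OF p] c] open_embedding_inv[OF p]
    by (simp add: v_def)
  have gS: "?g (c t) \<in> S \<and> f (?g (c t)) = c t" if "t \<in> {-e<..<e}" for t
  proof -
    have "c t \<in> f ` S" using e(2)[OF that] .
    then obtain x where "x \<in> S" "c t = f x" by blast
    then show ?thesis using S open_embedding_inv by auto
  qed
  have "curve_at N (f p) (\<lambda>t. f (?g (c t))) (dmap M N f p v)"
    by (rule smooth_map_on_curve[OF M N open_embedding_smooth p gc])
  then have "curve_at N (f p) c (dmap M N f p v)"
    by (rule curve_at_cong[OF _ e(1)]) (use gS in blast)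
  then have "w = dmap M N f p v" by (rule curve_at_unique[OF c])
  moreover have "v \<in> tangent_space M S p" unfolding tangent_space_def using gc gS e(1) by blast
  ultimately show "w \<in> dmap M N f p ` tangent_space M S p" by blast
next
  fix w assume "w \<in> dmap M N f p ` tangent_space M S p"
  then obtain v c e where "w = dmap M N f p v" and c: "curve_at M p c v"
    and e: "0 < e" "\<And>t. t \<in> {-e<..<e} \<Longrightarrow> c t \<in> S" unfolding tangent_space_def by blast
  moreover have "curve_at N (f p) (\<lambda>t. f (c t)) (dmap M N f p v)"
    by (rule smooth_map_on_curve[OF M N open_embedding_smooth p c])
  moreover have "f (c t) \<in> f ` S" if "t \<in> {-e<..<e}" for t using e(2)[OF that] by blast
  ultimately show "w \<in> tangent_space N (f ` S) (f p)"
    unfolding tangent_space_def by (intro CollectI exI[of _ "\<lambda>t. f (c t)"] conjI exI[of _ e]) auto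
qed

lemma tangent_space_model: "p \<in> points M \<Longrightarrow> tangent_space M S p \<subseteq> model M"
  by (auto simp: tangent_space_def dest: curve_velocity_in_model[OF M])

lemma dim_tangent_space_image:
  assumes S: "S \<subseteq> points M" and p: "p \<in> points M"
  shows "dim (tangent_space N (f ` S) (f p)) = dim (tangent_space M S p)"
proof -
  have "span (tangent_space M S p) \<subseteq> model M"
    using tangent_space_model[OF p] manifold_model[OF M] by (rule span_minimal)
  moreover have "inj_on (dmap M N f p) (model M)"
    using open_embedding_dmap_inverse[OF p] by (rule inj_on_inverseI)
  ultimately show ?thesis
    unfolding tangent_space_image[OF S p]
    by (intro dim_image_eq dmap_linear[OF M N open_embedding_smooth p]) (rule inj_on_subset)
qed

end

text \<open>Near each point, a coordinate change involving the transported chart factors through the chart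
  centred at the preimage, into a coordinate change involving \<open>\<psi>\<close> and the coordinate expression of \<open>f\<close> or its
  inverse.\<close>

lemma admissible_chart_image:
  fixes M :: "('a, 'e::euclidean_space, 'x) manifold_scheme"
    and N :: "('b, 'e, 'y) manifold_scheme"
  assumes M: "smooth_manifold M" and N: "smooth_manifold N" and f: "open_embedding M N f"
    and model: "model N = model M"
    and U: "admissible_chart M U \<psi>"
  shows "admissible_chart N (f ` U) (\<lambda>z. \<psi> (inv_into (points M) f z))"
proof -
  let ?g = "inv_into (points M) f"
  define \<psi>' where "\<psi>' z = \<psi> (?g z)" for z
  note inv = open_embedding_inv[OF M N f]
  have tU: "topological_chart M U \<psi>"
    and sU: "\<And>p. p \<in> points M \<Longrightarrow> smooth_on (coord M p ` (U \<inter> cdom M p)) (\<lambda>y. \<psi> (cinv M p y))"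
      "\<And>p. p \<in> points M \<Longrightarrow> smooth_on (\<psi> ` (U \<inter> cdom M p)) (\<lambda>y. coord M p (inv_into U \<psi> y))"
    using U by (auto simp: admissible_chart_def o_def)
  have oU: "openin (mtop M) U" and Up: "U \<subseteq> points M" by (rule chart_open[OF tU], rule chart_subset[OF tU])
  have oU': "openin (mtop N) (f ` U)" by (rule open_embedding_open_map[OF M N f oU])
  have U'p: "f ` U \<subseteq> points N" using oU' by (rule openin_subset)
  have \<psi>'f: "\<psi>' (f x) = \<psi> x" if "x \<in> U" for x using inv Up that by (auto simp: \<psi>'_def)
  have im: "\<psi>' ` f ` X = \<psi> ` X" if "X \<subseteq> U" for X using \<psi>'f that by (force simp: image_image)
  have inj': "inj_on \<psi>' (f ` U)" using chart_inj[OF tU] \<psi>'f by (auto simp: inj_on_def)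
  have inv': "inv_into (f ` U) \<psi>' (\<psi> x) = f x" if "x \<in> U" for x
    using inv_into_f_f[OF inj', of "f x"] \<psi>'f[OF that] that by simp
  have gz: "?g z \<in> U" "f (?g z) = z" if "z \<in> f ` U" for z using that inv Up by auto
  have contg: "continuous_map (subtopology (mtop N) (f ` U)) (subtopology (mtop M) U) ?g"
  proof -
    have "continuous_map (subtopology (mtop N) (f ` points M)) (mtop M) ?g"
      using open_embedding_inv_smooth[OF M N f] by (simp add: smooth_map_on_def)
    then have "continuous_map (subtopology (subtopology (mtop N) (f ` points M)) (f ` U)) (mtop M) ?g"
      by (rule continuous_map_from_subtopology)
    moreover have "f ` points M \<inter> f ` U = f ` U" using Up by auto
    ultimately show ?thesis
      using gz by (auto simp: subtopology_subtopology continuous_map_in_subtopology)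
  qed
  have contf: "continuous_map (subtopology (mtop M) U) (subtopology (mtop N) (f ` U)) f"
    using open_embedding_smooth[OF M N f]
    by (auto simp: smooth_map_on_def continuous_map_in_subtopology intro: continuous_map_from_subtopology)
  have "homeomorphic_map (subtopology (mtop N) (f ` U)) (subtopology (mtop M) U) ?g"
    by (rule homeomorphic_maps_imp_map[where g = f])
      (use contg contf inv Up U'p in \<open>auto simp: homeomorphic_maps_def\<close>)
  then have "homeomorphic_map (subtopology (mtop N) (f ` U)) (top_of_set (\<psi> ` U)) (\<psi> \<circ> ?g)"
    by (rule homeomorphic_map_compose) (use tU in \<open>simp add: topological_chart_def\<close>)
  then have t: "topological_chart N (f ` U) \<psi>'"
    unfolding topological_chart_def using oU' chart_range_open[OF tU] model im[OF order_refl]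
    by (simp add: o_def \<psi>'_def[abs_def])
  have "smooth_on (coord N p ` (f ` U \<inter> cdom N p)) (\<lambda>y. \<psi>' (cinv N p y))"
    and "smooth_on (\<psi>' ` (f ` U \<inter> cdom N p)) (\<lambda>y. coord N p (inv_into (f ` U) \<psi>' y))"
    if p: "p \<in> points N" for p
  proof -
    have "f ` U \<inter> cdom N p \<subseteq> cdom N p" by simp
    show "smooth_on (coord N p ` (f ` U \<inter> cdom N p)) (\<lambda>y. \<psi>' (cinv N p y))"
    proof (rule smooth_on_local)
      fix y assume "y \<in> coord N p ` (f ` U \<inter> cdom N p)"
      then obtain x where x: "x \<in> U" "f x \<in> cdom N p" "y = coord N p (f x)" by auto
      have xp: "x \<in> points M" using x Up by auto
      define D where "D = {z \<in> f ` points M \<inter> cdom N p. ?g z \<in> cdom M x}"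
      have oD: "openin (mtop N) D" unfolding D_def
        by (rule smooth_map_on_coordinate_domain[OF N M open_embedding_inv_smooth[OF M N f] p xp])
      define T where "T = coord N p ` (f ` U \<inter> D)"
      have "smooth_on (coord N p ` D) (\<lambda>y. coord M x (?g (cinv N p y)))"
        using open_embedding_inv_smooth[OF M N f] p xp unfolding smooth_map_on_def D_def by blast
      then have sT: "smooth_on T (\<lambda>y. coord M x (?g (cinv N p y)))"
        by (rule smooth_on_subset) (auto simp: T_def)
      have gD: "coord M x (?g (cinv N p y)) \<in> coord M x ` (U \<inter> cdom M x)" if y: "y \<in> T" for y
      proof -
        obtain z where z: "z \<in> f ` U" "z \<in> D" "y = coord N p z" using y by (auto simp: T_def)
        then have "?g z \<in> U \<inter> cdom M x" "cinv N p y = z"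
          using gz(1)[OF z(1)] cinv_coord[OF N p] by (auto simp: D_def)
        then show ?thesis by simp
      qed
      have "smooth_on T (\<lambda>y. \<psi> (cinv M x (coord M x (?g (cinv N p y)))))"
        by (rule smooth_on_compose[OF sT sU(1)[OF xp]])
          (use gD in blast)
      then have "smooth_on T (\<lambda>y. \<psi>' (cinv N p y))"
        by (rule smooth_on_cong)
          (use cinv_coord[OF N p] cinv_coord[OF M xp] in \<open>auto simp: T_def D_def \<psi>'_def\<close>)
      moreover have "y \<in> T"
        using x xp inv[OF xp] manifold_centre[OF M xp] by (auto simp: T_def D_def)
      moreover have "openin (top_of_set (coord N p ` (f ` U \<inter> cdom N p))) T"
        by (rule openin_subset_trans[of "model N"])
          (use coord_model[OF N p] oD oU' in \<open>auto simp: T_def D_def intro!: coord_image_open[OF N p]\<close>)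
      ultimately show "\<exists>T. y \<in> T \<and> openin (top_of_set (coord N p ` (f ` U \<inter> cdom N p))) T \<and>
          smooth_on T (\<lambda>y. \<psi>' (cinv N p y))" by blast
    qed
    show "smooth_on (\<psi>' ` (f ` U \<inter> cdom N p)) (\<lambda>y. coord N p (inv_into (f ` U) \<psi>' y))"
    proof (rule smooth_on_local)
      fix y assume "y \<in> \<psi>' ` (f ` U \<inter> cdom N p)"
      then obtain x where x: "x \<in> U" "f x \<in> cdom N p" "y = \<psi> x" using \<psi>'f by auto
      have xp: "x \<in> points M" using x Up by auto
      define D where "D = {z \<in> points M \<inter> cdom M x. f z \<in> cdom N p}"
      have oD: "openin (mtop M) D" unfolding D_def
        by (rule smooth_map_on_coordinate_domain[OF M N open_embedding_smooth[OF M N f] xp p])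
      define T where "T = \<psi> ` (U \<inter> D)"
      have sT: "smooth_on T (\<lambda>y. coord M x (inv_into U \<psi> y))"
        by (rule smooth_on_subset[OF sU(2)[OF xp]]) (auto simp: T_def D_def)
      have iU: "inv_into U \<psi> (\<psi> z) = z" if "z \<in> U" for z using chart_inj[OF tU] that by simp
      have sF: "smooth_on (coord M x ` D) (\<lambda>y. coord N p (f (cinv M x y)))"
        using open_embedding_smooth[OF M N f] p xp unfolding smooth_map_on_def D_def by blast
      have "smooth_on T (\<lambda>y. coord N p (f (cinv M x (coord M x (inv_into U \<psi> y)))))"
        by (rule smooth_on_compose[OF sT sF]) (use iU in \<open>auto simp: T_def\<close>)
      then have "smooth_on T (\<lambda>y. coord N p (inv_into (f ` U) \<psi>' y))"
        by (rule smooth_on_cong)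
          (use iU inv' cinv_coord[OF M xp] in \<open>auto simp: T_def D_def\<close>)
      moreover have "y \<in> T" using x xp manifold_centre[OF M xp] by (auto simp: T_def D_def)
      moreover have "openin (top_of_set (\<psi>' ` (f ` U \<inter> cdom N p))) T"
      proof (rule openin_subset_trans[of "model M"])
        show "openin (top_of_set (model M)) T" unfolding T_def
          by (rule chart_image_open[OF tU]) (use oU oD in auto)
        show "T \<subseteq> \<psi>' ` (f ` U \<inter> cdom N p)" using \<psi>'f by (force simp: T_def D_def)
        show "\<psi>' ` (f ` U \<inter> cdom N p) \<subseteq> model M"
          using im[OF order_refl] openin_imp_subset[OF chart_range_open[OF tU]] by blast
      qed
      ultimately show "\<exists>T. y \<in> T \<and> openin (top_of_set (\<psi>' ` (f ` U \<inter> cdom N p))) T \<and>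
          smooth_on T (\<lambda>y. coord N p (inv_into (f ` U) \<psi>' y))" by blast
    qed
  qed
  with t show ?thesis unfolding admissible_chart_def \<psi>'_def[abs_def] by (simp add: o_def)
qed

lemma embedded_submanifold_image:
  fixes M :: "('a, 'e::euclidean_space, 'x) manifold_scheme"
    and N :: "('b, 'e, 'y) manifold_scheme"
  assumes M: "smooth_manifold M" and N: "smooth_manifold N" and f: "open_embedding M N f"
    and model: "model N = model M" and S: "embedded_submanifold M S"
  shows "embedded_submanifold N (f ` S)"
  unfolding embedded_submanifold_def
proof (intro conjI ballI)
  have Sp: "S \<subseteq> points M" using S by (simp add: embedded_submanifold_def)
  then show "f ` S \<subseteq> points N" using open_embedding_points[OF M N f] by blast
  fix z assume "z \<in> f ` S"
  then obtain p where p: "p \<in> S" "z = f p" by blast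
  obtain U \<psi> F where U: "admissible_chart M U \<psi>" "p \<in> U" "subspace F" "F \<subseteq> model M"
    "\<psi> ` (U \<inter> S) = \<psi> ` U \<inter> F"
    using S p(1) unfolding embedded_submanifold_def by blast
  let ?\<psi> = "\<lambda>z. \<psi> (inv_into (points M) f z)"
  have Up: "U \<subseteq> points M" using U(1) chart_subset unfolding admissible_chart_def by blast
  have "f ` U \<inter> f ` S = f ` (U \<inter> S)"
    using inj_on_image_Int[OF open_embedding_inj[OF M N f] Up Sp] by simp
  moreover have "?\<psi> ` f ` X = \<psi> ` X" if "X \<subseteq> points M" for X
    using that open_embedding_inv[OF M N f] by (force simp: image_image)
  ultimately have "?\<psi> ` (f ` U \<inter> f ` S) = ?\<psi> ` f ` U \<inter> F" using U(5) Up by (simp add: le_infI1)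
  then show "\<exists>U \<psi> F. admissible_chart N U \<psi> \<and> z \<in> U \<and> subspace F \<and> F \<subseteq> model N \<and>
      \<psi> ` (U \<inter> f ` S) = \<psi> ` U \<inter> F"
    using admissible_chart_image[OF M N f model U(1)] U(2-4) p(2) model by blast
qed

section \<open>Products\<close>

lemma mprod_simps [simp]:
  "mtop (mprod M N) = prod_topology (mtop M) (mtop N)"
  "model (mprod M N) = model M \<times> model N"
  "cdom (mprod M N) (p, q) = cdom M p \<times> cdom N q"
  "coord (mprod M N) (p, q) = map_prod (coord M p) (coord N q)"
  by (simp_all add: mprod_def)

lemma twisted_prod_simps [simp]:
  "mtop (twisted_prod M N) = prod_topology (mtop M) (mtop N)"
  "model (twisted_prod M N) = model M \<times> model N"
  "cdom (twisted_prod M N) (p, q) = cdom M p \<times> cdom N q"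
  "coord (twisted_prod M N) (p, q) = map_prod (coord M p) (coord N q)"
  "form (twisted_prod M N) (p, q) (u, u') (v, v') = - form M p u v + form N q u' v'"
  by (simp_all add: twisted_prod_def)

text \<open>The twisted product differs from the product only by carrying a form, so notions that concern the
  underlying manifold agree.\<close>

lemma twisted_prod_eq_mprod:
  "mtop (twisted_prod M N) = mtop (mprod M N)" "model (twisted_prod M N) = model (mprod M N)"
  "cdom (twisted_prod M N) = cdom (mprod M N)" "coord (twisted_prod M N) = coord (mprod M N)"
  by (simp_all add: twisted_prod_def mprod_def)

lemma twisted_prod_as_manifold:
  "curve_at (twisted_prod M N) = curve_at (mprod M N)"
  "tangent_space (twisted_prod M N) = tangent_space (mprod M N)"
  "embedded_submanifold (twisted_prod M N) = embedded_submanifold (mprod M N)"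
proof -
  show c: "curve_at (twisted_prod M N) = curve_at (mprod M N)"
    by (intro ext) (simp add: curve_at_def twisted_prod_eq_mprod)
  show "tangent_space (twisted_prod M N) = tangent_space (mprod M N)"
    by (intro ext) (simp add: tangent_space_def c)
  show "embedded_submanifold (twisted_prod M N) = embedded_submanifold (mprod M N)"
    by (intro ext) (simp add: embedded_submanifold_def admissible_chart_def topological_chart_def twisted_prod_eq_mprod)
qed

lemma second_countable_prod:
  assumes "second_countable X" "second_countable Y"
  shows "second_countable (prod_topology X Y)"
proof -
  obtain B where B: "countable B" "\<And>V. V \<in> B \<Longrightarrow> openin X V"
    "\<And>U x. openin X U \<Longrightarrow> x \<in> U \<Longrightarrow> \<exists>V\<in>B. x \<in> V \<and> V \<subseteq> U"
    using assms(1) unfolding second_countable_def by metis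
  obtain C where C: "countable C" "\<And>V. V \<in> C \<Longrightarrow> openin Y V"
    "\<And>U x. openin Y U \<Longrightarrow> x \<in> U \<Longrightarrow> \<exists>V\<in>C. x \<in> V \<and> V \<subseteq> U"
    using assms(2) unfolding second_countable_def by metis
  let ?P = "(\<lambda>(U, V). U \<times> V) ` (B \<times> C)"
  have "\<exists>V\<in>?P. z \<in> V \<and> V \<subseteq> U" if "openin (prod_topology X Y) U" "z \<in> U" for U z
  proof -
    obtain x y where z: "z = (x, y)" by (cases z)
    have "\<exists>S T. openin X S \<and> openin Y T \<and> x \<in> S \<and> y \<in> T \<and> S \<times> T \<subseteq> U"
      using that unfolding openin_prod_topology_alt z by blast
    then obtain S T where ST: "openin X S" "openin Y T" "x \<in> S" "y \<in> T" "S \<times> T \<subseteq> U" by blast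
    obtain S' where "S' \<in> B" "x \<in> S'" "S' \<subseteq> S" using B(3)[OF ST(1,3)] by metis
    moreover obtain T' where "T' \<in> C" "y \<in> T'" "T' \<subseteq> T" using C(3)[OF ST(2,4)] by metis
    ultimately show ?thesis using ST(5) z by (intro bexI[of _ "S' \<times> T'"]) auto
  qed
  moreover have "openin (prod_topology X Y) V" if "V \<in> ?P" for V
    using that B(2) C(2) by (auto simp: openin_prod_Times_iff)
  moreover have "countable ?P" using B(1) C(1) by simp
  ultimately show ?thesis unfolding second_countable_def by (intro exI[of _ ?P]) simp
qed

lemma inv_into_map_prod:
  assumes "inj_on f A" "inj_on g B" "x \<in> f ` A" "y \<in> g ` B"
  shows "inv_into (A \<times> B) (map_prod f g) (x, y) = (inv_into A f x, inv_into B g y)"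
proof -
  have "inj_on (map_prod f g) (A \<times> B)" using assms(1,2) by (auto simp: inj_on_def)
  moreover have "map_prod f g (inv_into A f x, inv_into B g y) = (x, y)"
    using assms(3,4) by (simp add: f_inv_into_f)
  moreover have "(inv_into A f x, inv_into B g y) \<in> A \<times> B" using assms(3,4) by (simp add: inv_into_into)
  ultimately show ?thesis using inv_into_f_f by metis
qed

lemma smooth_on_map_prod:
  fixes f :: "'e::euclidean_space \<Rightarrow> 'f::real_normed_vector" and g :: "'g::euclidean_space \<Rightarrow> 'h::real_normed_vector"
  assumes "smooth_on S f" "smooth_on T g"
  shows "smooth_on (S \<times> T) (\<lambda>z. (f (fst z), g (snd z)))"
  by (intro smooth_on_Pair smooth_on_compose[OF smooth_on_bounded_linear[OF bounded_linear_fst] assms(1)]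
      smooth_on_compose[OF smooth_on_bounded_linear[OF bounded_linear_snd] assms(2)]) auto

lemma cinv_mprod:
  assumes M: "smooth_manifold M" and N: "smooth_manifold N"
    and p: "p \<in> points M" "q \<in> points N" and y: "x \<in> crange M p" "y \<in> crange N q"
  shows "cinv (mprod M N) (p, q) (x, y) = (cinv M p x, cinv N q y)"
  using inv_into_map_prod[OF chart_inj[OF manifold_chart[OF M p(1)]] chart_inj[OF manifold_chart[OF N p(2)]] y]
  by simp

lemma smooth_manifold_mprod:
  assumes M: "smooth_manifold M" and N: "smooth_manifold N"
  shows "smooth_manifold (mprod M N)"
  unfolding smooth_manifold_def
proof (intro conjI ballI)
  show "Hausdorff_space (mtop (mprod M N))" "second_countable (mtop (mprod M N))"
    using M N by (auto simp: smooth_manifold_def Hausdorff_space_prod_topology second_countable_prod)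
  show "subspace (model (mprod M N))"
    using manifold_model[OF M] manifold_model[OF N] by (simp add: subspace_Times)
  fix z assume "z \<in> points (mprod M N)"
  then obtain p q where z: "z = (p, q)" and p: "p \<in> points M" "q \<in> points N" by auto
  show "z \<in> cdom (mprod M N) z"
    using manifold_centre[OF M p(1)] manifold_centre[OF N p(2)] by (simp add: z)
  have h: "homeomorphic_map (subtopology (mtop M) (cdom M p)) (top_of_set (crange M p)) (coord M p)"
    "homeomorphic_map (subtopology (mtop N) (cdom N q)) (top_of_set (crange N q)) (coord N q)"
    using manifold_chart[OF M p(1)] manifold_chart[OF N p(2)] by (auto simp: topological_chart_def)
  obtain f' g' where "homeomorphic_maps (subtopology (mtop M) (cdom M p)) (top_of_set (crange M p)) (coord M p) f'"
    "homeomorphic_maps (subtopology (mtop N) (cdom N q)) (top_of_set (crange N q)) (coord N q) g'"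
    using h homeomorphic_map_maps by metis
  then have "homeomorphic_maps (prod_topology (subtopology (mtop M) (cdom M p)) (subtopology (mtop N) (cdom N q)))
     (prod_topology (top_of_set (crange M p)) (top_of_set (crange N q)))
     (\<lambda>(x, y). (coord M p x, coord N q y)) (\<lambda>(x, y). (f' x, g' y))"
    by (simp only: homeomorphic_maps_prod) blast
  then have "homeomorphic_map (prod_topology (subtopology (mtop M) (cdom M p)) (subtopology (mtop N) (cdom N q)))
     (prod_topology (top_of_set (crange M p)) (top_of_set (crange N q))) (\<lambda>(x, y). (coord M p x, coord N q y))"
    by (rule homeomorphic_maps_imp_map)
  then have "homeomorphic_map (subtopology (mtop (mprod M N)) (cdom M p \<times> cdom N q))
     (top_of_set (crange M p \<times> crange N q)) (map_prod (coord M p) (coord N q))"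
    by (simp add: subtopology_Times map_prod_def)
  moreover have "openin (mtop (mprod M N)) (cdom M p \<times> cdom N q)"
    using chart_open[OF manifold_chart[OF M p(1)]] chart_open[OF manifold_chart[OF N p(2)]]
    by (simp add: openin_prod_Times_iff)
  moreover have "openin (top_of_set (model M \<times> model N)) (crange M p \<times> crange N q)"
    using chart_range_open[OF manifold_chart[OF M p(1)]] chart_range_open[OF manifold_chart[OF N p(2)]]
    by (rule openin_Times)
  moreover have im: "map_prod (coord M p) (coord N q) ` (A \<times> B) = coord M p ` A \<times> coord N q ` B" for A B
    by auto
  ultimately show "topological_chart (mprod M N) (cdom (mprod M N) z) (coord (mprod M N) z)"
    by (simp add: topological_chart_def z)
  fix z' assume "z' \<in> points (mprod M N)"
  then obtain p' q' where z': "z' = (p', q')" and p': "p' \<in> points M" "q' \<in> points N" by auto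
  have "smooth_on (coord M p ` (cdom M p \<inter> cdom M p') \<times> coord N q ` (cdom N q \<inter> cdom N q'))
      (\<lambda>y. (coord M p' (cinv M p (fst y)), coord N q' (cinv N q (snd y))))"
    by (rule smooth_on_map_prod[OF manifold_transition[OF M p(1) p'(1)] manifold_transition[OF N p(2) p'(2)]])
  then have "smooth_on (coord M p ` (cdom M p \<inter> cdom M p') \<times> coord N q ` (cdom N q \<inter> cdom N q'))
      (\<lambda>y. coord (mprod M N) z' (cinv (mprod M N) z y))"
  proof (rule smooth_on_cong)
    fix y assume y: "y \<in> coord M p ` (cdom M p \<inter> cdom M p') \<times> coord N q ` (cdom N q \<inter> cdom N q')"
    obtain a b where ab: "y = (a, b)" by (cases y)
    have "a \<in> crange M p" "b \<in> crange N q" using y ab by auto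
    then show "(coord M p' (cinv M p (fst y)), coord N q' (cinv N q (snd y))) =
        coord (mprod M N) z' (cinv (mprod M N) z y)"
      unfolding z z' ab by (simp only: cinv_mprod[OF M N p]) simp
  qed
  then show "smooth_on (coord (mprod M N) z ` (cdom (mprod M N) z \<inter> cdom (mprod M N) z'))
      (coord (mprod M N) z' \<circ> cinv (mprod M N) z)"
    by (simp add: z z' Times_Int_Times im o_def)
qed

lemma curve_at_mprod_iff:
  "curve_at (mprod M N) (p, q) c (v, w) \<longleftrightarrow>
    curve_at M p (\<lambda>t. fst (c t)) v \<and> curve_at N q (\<lambda>t. snd (c t)) w" (is "?l \<longleftrightarrow> ?r1 \<and> ?r2")
proof -
  have co: "coord (mprod M N) (p, q) \<circ> c = (\<lambda>t. ((coord M p \<circ> (\<lambda>t. fst (c t))) t, (coord N q \<circ> (\<lambda>t. snd (c t))) t))"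
    by (simp add: fun_eq_iff map_prod_def split_beta)
  have 1: "(coord (mprod M N) (p, q) \<circ> c has_vector_derivative (v, w)) (at 0) \<longleftrightarrow>
      (coord M p \<circ> (\<lambda>t. fst (c t)) has_vector_derivative v) (at 0) \<and>
      (coord N q \<circ> (\<lambda>t. snd (c t)) has_vector_derivative w) (at 0)" (is "?a \<longleftrightarrow> ?b \<and> ?c")
  proof (intro iffI conjI)
    assume ?a
    then show ?b unfolding co by (drule_tac bounded_linear.has_vector_derivative[OF bounded_linear_fst]) (simp add: o_def)
    from \<open>?a\<close> show ?c unfolding co by (drule_tac bounded_linear.has_vector_derivative[OF bounded_linear_snd]) (simp add: o_def)
  next
    assume bc: "?b \<and> ?c"
    show ?a unfolding co has_vector_derivative_def
      using has_derivative_Pair[OF bc[THEN conjunct1, unfolded has_vector_derivative_def]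
          bc[THEN conjunct2, unfolded has_vector_derivative_def]]
      by (simp add: scaleR_prod_def)
  qed
  have 2: "smooth_on S (coord (mprod M N) (p, q) \<circ> c) \<longleftrightarrow>
      smooth_on S (coord M p \<circ> (\<lambda>t. fst (c t))) \<and> smooth_on S (coord N q \<circ> (\<lambda>t. snd (c t)))" for S
    using smooth_on_Pair[of S "coord M p \<circ> (\<lambda>t. fst (c t))" "coord N q \<circ> (\<lambda>t. snd (c t))"]
      smooth_on_compose[OF _ smooth_on_bounded_linear[OF bounded_linear_fst, of UNIV], of S "coord (mprod M N) (p, q) \<circ> c"]
      smooth_on_compose[OF _ smooth_on_bounded_linear[OF bounded_linear_snd, of UNIV], of S "coord (mprod M N) (p, q) \<circ> c"]
    unfolding co by (auto simp: o_def)
  show ?thesis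
  proof
    assume ?l
    then show "?r1 \<and> ?r2" unfolding curve_at_def 1 2 by (auto simp: mem_Times_iff)
  next
    assume r: "?r1 \<and> ?r2"
    obtain e1 where e1: "0 < e1" "\<And>t. t \<in> {-e1<..<e1} \<Longrightarrow> fst (c t) \<in> cdom M p"
      "smooth_on {-e1<..<e1} (coord M p \<circ> (\<lambda>t. fst (c t)))"
      using r unfolding curve_at_def by blast
    obtain e2 where e2: "0 < e2" "\<And>t. t \<in> {-e2<..<e2} \<Longrightarrow> snd (c t) \<in> cdom N q"
      "smooth_on {-e2<..<e2} (coord N q \<circ> (\<lambda>t. snd (c t)))"
      using r unfolding curve_at_def by blast
    define e where "e = min e1 e2"
    have e: "0 < e" "{-e<..<e} \<subseteq> {-e1<..<e1}" "{-e<..<e} \<subseteq> {-e2<..<e2}" using e1 e2 by (auto simp: e_def)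
    have "smooth_on {-e<..<e} (coord (mprod M N) (p, q) \<circ> c)"
      unfolding 2 using smooth_on_subset[OF e1(3) e(2)] smooth_on_subset[OF e2(3) e(3)] by (rule conjI)
    moreover have "\<forall>t\<in>{-e<..<e}. c t \<in> cdom (mprod M N) (p, q)"
      using e e1(2) e2(2) by (simp add: mem_Times_iff subset_iff)
    moreover have "c 0 = (p, q)" using r by (simp add: curve_at_def prod_eq_iff)
    ultimately show ?l unfolding curve_at_def 1 using e(1) r by (auto simp: curve_at_def)
  qed
qed

lemma smooth_map_on_map_prod:
  assumes M: "smooth_manifold M" "smooth_manifold M'" and N: "smooth_manifold N" "smooth_manifold N'"
    and f: "smooth_map_on M N W f" and g: "smooth_map_on M' N' X g"
  shows "smooth_map_on (mprod M M') (mprod N N') (W \<times> X) (map_prod f g)"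
  unfolding smooth_map_on_def
proof (intro conjI ballI)
  show "openin (mtop (mprod M M')) (W \<times> X)"
    using f g by (simp add: smooth_map_on_def openin_prod_Times_iff)
  have "continuous_map (subtopology (mtop M) W) (mtop N) f" "continuous_map (subtopology (mtop M') X) (mtop N') g"
    using f g by (auto simp: smooth_map_on_def)
  then show "continuous_map (subtopology (mtop (mprod M M')) (W \<times> X)) (mtop (mprod N N')) (map_prod f g)"
    by (simp add: subtopology_Times map_prod_def continuous_map_prod_top)
  fix z z' assume "z \<in> points (mprod M M')" "z' \<in> points (mprod N N')"
  then obtain p q p' q' where z: "z = (p, q)" and p: "p \<in> points M" "q \<in> points M'"
    and z': "z' = (p', q')" and p': "p' \<in> points N" "q' \<in> points N'" by auto
  let ?S = "coord M p ` {x \<in> W \<inter> cdom M p. f x \<in> cdom N p'}"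
  let ?T = "coord M' q ` {x \<in> X \<inter> cdom M' q. g x \<in> cdom N' q'}"
  have "smooth_on (?S \<times> ?T) (\<lambda>y. (coord N p' (f (cinv M p (fst y))), coord N' q' (g (cinv M' q (snd y)))))"
    by (rule smooth_on_map_prod) (use f g p p' in \<open>auto simp: smooth_map_on_def\<close>)
  then have "smooth_on (?S \<times> ?T) (\<lambda>y. coord (mprod N N') z' (map_prod f g (cinv (mprod M M') z y)))"
  proof (rule smooth_on_cong)
    fix y assume y: "y \<in> ?S \<times> ?T"
    obtain a b where ab: "y = (a, b)" by (cases y)
    have "a \<in> crange M p" "b \<in> crange M' q" using y ab by auto
    then show "(coord N p' (f (cinv M p (fst y))), coord N' q' (g (cinv M' q (snd y)))) =
        coord (mprod N N') z' (map_prod f g (cinv (mprod M M') z y))"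
      unfolding z z' ab by (simp only: cinv_mprod[OF M p]) simp
  qed
  moreover have "coord (mprod M M') z ` {x \<in> (W \<times> X) \<inter> cdom (mprod M M') z. map_prod f g x \<in> cdom (mprod N N') z'} = ?S \<times> ?T"
    unfolding z z' by force
  ultimately show "smooth_on (coord (mprod M M') z ` {x \<in> (W \<times> X) \<inter> cdom (mprod M M') z. map_prod f g x \<in> cdom (mprod N N') z'})
      (\<lambda>y. coord (mprod N N') z' (map_prod f g (cinv (mprod M M') z y)))" by simp
qed

lemma open_embedding_map_prod:
  assumes M: "smooth_manifold M" "smooth_manifold M'" and N: "smooth_manifold N" "smooth_manifold N'"
    and f: "open_embedding M N f" and g: "open_embedding M' N' g"
  shows "open_embedding (mprod M M') (mprod N N') (map_prod f g)"
proof -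
  have inj: "inj_on f (points M)" "inj_on g (points M')" using f g by (auto simp: open_embedding_def)
  have im: "map_prod f g ` points (mprod M M') = f ` points M \<times> g ` points M'" by force
  have "smooth_map_on (mprod N N') (mprod M M') (f ` points M \<times> g ` points M')
      (map_prod (inv_into (points M) f) (inv_into (points M') g))"
    using f g by (intro smooth_map_on_map_prod M N) (auto simp: open_embedding_def)
  then have "smooth_map_on (mprod N N') (mprod M M') (f ` points M \<times> g ` points M')
      (inv_into (points (mprod M M')) (map_prod f g))"
    by (rule smooth_map_on_cong[OF _ _ smooth_manifold_mprod[OF N]])
      (auto simp: inv_into_map_prod[OF inj])
  moreover have "smooth_map_on (mprod M M') (mprod N N') (points M \<times> points M') (map_prod f g)"
    using f g by (intro smooth_map_on_map_prod M N) (auto simp: open_embedding_def)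
  moreover have "inj_on (map_prod f g) (points M \<times> points M')" using inj by (auto simp: inj_on_def)
  ultimately show ?thesis unfolding open_embedding_def im by simp
qed

section \<open>Nondegenerate bilinear forms on a subspace\<close>

definition bilinear_form_on :: "'e::euclidean_space set \<Rightarrow> ('e \<Rightarrow> 'e \<Rightarrow> real) \<Rightarrow> bool" where
  "bilinear_form_on V \<beta> \<longleftrightarrow>
     (\<forall>w\<in>V. \<forall>u\<in>V. \<forall>v\<in>V. \<forall>a b. \<beta> (a *\<^sub>R u + b *\<^sub>R v) w = a * \<beta> u w + b * \<beta> v w \<and>
        \<beta> w (a *\<^sub>R u + b *\<^sub>R v) = a * \<beta> w u + b * \<beta> w v)"

lemma bilinear_form_onD:
  assumes "bilinear_form_on V \<beta>" "w \<in> V" "u \<in> V" "v \<in> V"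
  shows "\<beta> (a *\<^sub>R u + b *\<^sub>R v) w = a * \<beta> u w + b * \<beta> v w"
    and "\<beta> w (a *\<^sub>R u + b *\<^sub>R v) = a * \<beta> w u + b * \<beta> w v"
  using assms unfolding bilinear_form_on_def by blast+

text \<open>The form extended to the whole space by the inner product on the kernel of the projection,
  read as a linear map.  A form that is nondegenerate on \<open>V\<close> becomes an injective map here, so that
  \<open>\<beta> X \<cdot> = l\<close> turns into a linear system with a unique solution.\<close>

definition gram :: "'e::euclidean_space set \<Rightarrow> ('e \<Rightarrow> 'e \<Rightarrow> real) \<Rightarrow> 'e \<Rightarrow> 'e" where
  "gram V \<beta> u = (\<Sum>b\<in>Basis. (\<beta> (proj V u) (proj V b) + (u - proj V u) \<bullet> (b - proj V b)) *\<^sub>R b)"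

lemma bilinear_form_on_proj:
  assumes V: "subspace V" and \<beta>: "bilinear_form_on V \<beta>"
  shows "linear (\<lambda>u. \<beta> (proj V u) (proj V v))" "linear (\<lambda>v. \<beta> (proj V u) (proj V v))"
proof -
  have \<pi>: "linear (proj V)" using bounded_linear_proj[OF V] by (rule bounded_linear.linear)
  have B: "\<beta> (a *\<^sub>R x + b *\<^sub>R y) w = a * \<beta> x w + b * \<beta> y w"
    "\<beta> w (a *\<^sub>R x + b *\<^sub>R y) = a * \<beta> w x + b * \<beta> w y" if "w \<in> V" "x \<in> V" "y \<in> V" for w x y a b
    using \<beta> that unfolding bilinear_form_on_def by blast+
  note P = proj_in[OF V]
  show "linear (\<lambda>u. \<beta> (proj V u) (proj V v))"
    using B(1)[OF P P P, where a = 1 and b = 1] B(1)[OF P P P, where b = 0]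
    by (intro linearI) (auto simp: linear_add[OF \<pi>] linear_scale[OF \<pi>])
  show "linear (\<lambda>v. \<beta> (proj V u) (proj V v))"
    using B(2)[OF P P P, where a = 1 and b = 1] B(2)[OF P P P, where b = 0]
    by (intro linearI) (auto simp: linear_add[OF \<pi>] linear_scale[OF \<pi>])
qed

lemma gram:
  assumes V: "subspace V" and \<beta>: "bilinear_form_on V \<beta>"
  shows gram_linear: "linear (gram V \<beta>)"
    and gram_inner: "gram V \<beta> u \<bullet> v = \<beta> (proj V u) (proj V v) + (u - proj V u) \<bullet> (v - proj V v)"
proof -
  have \<pi>: "linear (\<lambda>u. u - proj V u)"
    using bounded_linear.linear[OF bounded_linear_proj[OF V]] by (intro linear_compose_sub linear_ident)
  have l: "linear (\<lambda>u. \<beta> (proj V u) (proj V v) + (u - proj V u) \<bullet> (v - proj V v))"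
    "linear (\<lambda>v. \<beta> (proj V u) (proj V v) + (u - proj V u) \<bullet> (v - proj V v))" for u v
    using linear_compose[OF \<pi> bounded_linear.linear[OF bounded_linear_inner_left]]
      linear_compose[OF \<pi> bounded_linear.linear[OF bounded_linear_inner_right]]
    by (auto intro!: linear_compose_add bilinear_form_on_proj[OF V \<beta>] simp: o_def)
  show "linear (gram V \<beta>)"
    unfolding gram_def
    using linear_compose[OF l(1) bounded_linear.linear[OF bounded_linear_scaleR_left], unfolded o_def]
    by (intro linear_compose_sum ballI)
  have "gram V \<beta> u \<bullet> v = (\<Sum>b\<in>Basis. (v \<bullet> b) *\<^sub>R (\<beta> (proj V u) (proj V b) + (u - proj V u) \<bullet> (b - proj V b)))"
    by (simp add: gram_def inner_sum_left mult.commute inner_commute[of v])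
  then show "gram V \<beta> u \<bullet> v = \<beta> (proj V u) (proj V v) + (u - proj V u) \<bullet> (v - proj V v)"
    using linear_basis_expansion[OF l(2)[of u]] by simp
qed

lemma gram_inj:
  assumes V: "subspace V" and \<beta>: "bilinear_form_on V \<beta>"
    and nondeg: "\<And>u. u \<in> V \<Longrightarrow> (\<And>v. v \<in> V \<Longrightarrow> \<beta> u v = 0) \<Longrightarrow> u = 0"
  shows "inj (gram V \<beta>)"
proof -
  have "u = 0" if "gram V \<beta> u = 0" for u
  proof -
    have eq: "\<beta> (proj V u) (proj V v) + (u - proj V u) \<bullet> (v - proj V v) = 0" for v
      using gram_inner[OF V \<beta>, of u v] that by simp
    have "\<beta> (proj V u) v = 0" if "v \<in> V" for v using eq[of v] proj_id[OF V that] by simp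
    then have u0: "proj V u = 0" by (rule nondeg[OF proj_in[OF V]])
    have "\<beta> 0 0 = 0" using linear_0[OF bilinear_form_on_proj(1)[OF V \<beta>, of 0]]
      linear_0[OF bounded_linear.linear[OF bounded_linear_proj[OF V]]] by simp
    then show "u = 0" using eq[of u] by (simp add: u0)
  qed
  then show ?thesis using gram_linear[OF V \<beta>] linear_injective_0 by blast
qed

text \<open>This is what makes the definite description of Hamiltonian vector fields meaningful.\<close>

lemma nondegenerate_form_represents:
  fixes l :: "'e::euclidean_space \<Rightarrow> real"
  assumes V: "subspace V" and \<beta>: "bilinear_form_on V \<beta>"
    and nondeg: "\<And>u. u \<in> V \<Longrightarrow> (\<And>v. v \<in> V \<Longrightarrow> \<beta> u v = 0) \<Longrightarrow> u = 0"
    and l: "linear l"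
  shows "\<exists>!X. X \<in> V \<and> (\<forall>v\<in>V. \<beta> X v = l v)"
proof -
  have "surj (gram V \<beta>)"
    by (rule linear_injective_imp_surjective[OF gram_linear[OF V \<beta>] gram_inj[OF V \<beta> nondeg] refl])
  then obtain u where u: "gram V \<beta> u = (\<Sum>b\<in>Basis. l b *\<^sub>R b)" by (metis surjD)
  have "\<beta> (proj V u) v = l v" if v: "v \<in> V" for v
  proof -
    have "gram V \<beta> u \<bullet> v = l v"
      unfolding u using linear_basis_expansion[OF l, of v]
      by (simp add: inner_sum_left mult.commute inner_commute[of v])
    then show ?thesis using gram_inner[OF V \<beta>, of u v] proj_id[OF V v] by simp
  qed
  moreover have "X = Y" if "X \<in> V" "Y \<in> V" "\<And>v. v \<in> V \<Longrightarrow> \<beta> X v = \<beta> Y v" for X Y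
  proof -
    have "\<beta> (X - Y) v = 0" if v: "v \<in> V" for v
      using \<beta>[unfolded bilinear_form_on_def, rule_format, OF v \<open>X \<in> V\<close> \<open>Y \<in> V\<close>, of 1 "-1"]
        \<open>\<And>v. v \<in> V \<Longrightarrow> \<beta> X v = \<beta> Y v\<close>[OF v] by simp
    then show ?thesis using nondeg[of "X - Y"] V that(1,2) by (simp add: subspace_diff)
  qed
  ultimately show ?thesis using proj_in[OF V] by metis
qed


section \<open>The symplectic form in charts\<close>

context
  fixes M :: "('a, 'e::euclidean_space, 'x) symplectic_scheme"
  assumes M: "symplectic_manifold M"
begin

lemma symplectic_smooth: "smooth_manifold M"
  using M by (simp add: symplectic_manifold_def)

lemma
  assumes p: "p \<in> points M"
  shows form_bilinear: "bilinear_form_on (model M) (form M p)"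
    and form_antisym: "u \<in> model M \<Longrightarrow> v \<in> model M \<Longrightarrow> form M p v u = - form M p u v"
    and form_nondeg: "u \<in> model M \<Longrightarrow> (\<And>v. v \<in> model M \<Longrightarrow> form M p u v = 0) \<Longrightarrow> u = 0"
    and local_form_smooth: "u \<in> model M \<Longrightarrow> v \<in> model M \<Longrightarrow> smooth_on (crange M p) (\<lambda>x. local_form M p x u v)"
proof -
  note sm = bspec[OF M[unfolded symplectic_manifold_def, THEN conjunct2] p]
  have lin: "form M p (a *\<^sub>R u + b *\<^sub>R u') v = a * form M p u v + b * form M p u' v"
    if "u \<in> model M" "u' \<in> model M" "v \<in> model M" for a b u u' v
    using sm[THEN conjunct1] that by blast
  have anti: "form M p v u = - form M p u v" if "u \<in> model M" "v \<in> model M" for u v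
    using sm[THEN conjunct2, THEN conjunct1] that by blast
  show "u \<in> model M \<Longrightarrow> v \<in> model M \<Longrightarrow> form M p v u = - form M p u v" by (rule anti)
  have cl: "a *\<^sub>R u + b *\<^sub>R v \<in> model M" if "u \<in> model M" "v \<in> model M" for a b u v
    using manifold_model[OF symplectic_smooth] that by (simp add: subspace_add subspace_scale)
  show "bilinear_form_on (model M) (form M p)"
    unfolding bilinear_form_on_def
  proof (intro ballI allI conjI)
    fix w u v a b assume wuv: "w \<in> model M" "u \<in> model M" "v \<in> model M"
    show "form M p (a *\<^sub>R u + b *\<^sub>R v) w = a * form M p u w + b * form M p v w"
      by (rule lin[OF wuv(2,3,1)])
    then show "form M p w (a *\<^sub>R u + b *\<^sub>R v) = a * form M p w u + b * form M p w v"
      using anti[OF cl[OF wuv(2,3)] wuv(1), of a b] anti[OF wuv(2,1)] anti[OF wuv(3,1)] by simp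
  qed
  show "u \<in> model M \<Longrightarrow> (\<And>v. v \<in> model M \<Longrightarrow> form M p u v = 0) \<Longrightarrow> u = 0"
    "u \<in> model M \<Longrightarrow> v \<in> model M \<Longrightarrow> smooth_on (crange M p) (\<lambda>x. local_form M p x u v)"
    using sm[THEN conjunct2, THEN conjunct2, THEN conjunct1]
      sm[THEN conjunct2, THEN conjunct2, THEN conjunct2, THEN conjunct1] by blast+
qed

lemma local_form_at:
  assumes p: "p \<in> points M" and z: "z \<in> cdom M p" and uv: "u \<in> model M" "v \<in> model M"
  shows "local_form M p (coord M p z) u v = form M z (tchange M p z z u) (tchange M p z z v)"
proof -
  note S = symplectic_smooth
  have zp: "z \<in> points M" by (rule cdom_points[OF S p z])
  show ?thesis
    unfolding local_form_def Let_def cinv_coord[OF S p z]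
    using chart_deriv_transition[OF S p zp z manifold_centre[OF S zp]] uv by simp
qed

lemma local_form_bilinear:
  assumes p: "p \<in> points M" and x: "x \<in> crange M p"
  shows "bilinear_form_on (model M) (local_form M p x)"
    and "u \<in> model M \<Longrightarrow> v \<in> model M \<Longrightarrow> local_form M p x v u = - local_form M p x u v"
    and "u \<in> model M \<Longrightarrow> (\<And>v. v \<in> model M \<Longrightarrow> local_form M p x u v = 0) \<Longrightarrow> u = 0"
proof -
  note S = symplectic_smooth
  note V = manifold_model[OF S]
  obtain z where z: "z \<in> cdom M p" "x = coord M p z" using x by blast
  have zp: "z \<in> points M" by (rule cdom_points[OF S p z(1)])
  have zz: "z \<in> cdom M z" by (rule manifold_centre[OF S zp])
  let ?T = "tchange M p z z"
  note T = tchange_linear[OF S p zp z(1) zz] tchange_in_model[OF S p zp z(1) zz]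
  note lf = local_form_at[OF p z(1), folded z(2)]
  have cl: "a *\<^sub>R u + b *\<^sub>R v \<in> model M" if "u \<in> model M" "v \<in> model M" for a b u v
    using V that by (simp add: subspace_add subspace_scale)
  show "bilinear_form_on (model M) (local_form M p x)"
    unfolding bilinear_form_on_def
  proof (intro ballI allI conjI)
    fix w u v a b assume wuv: "w \<in> model M" "u \<in> model M" "v \<in> model M"
    have Tl: "?T (a *\<^sub>R u + b *\<^sub>R v) = a *\<^sub>R ?T u + b *\<^sub>R ?T v"
      by (simp only: linear_add[OF T(1)] linear_scale[OF T(1)])
    note lf' = lf[OF wuv(2,1)] lf[OF wuv(3,1)] lf[OF wuv(1,2)] lf[OF wuv(1,3)]
      lf[OF cl[OF wuv(2,3)] wuv(1)] lf[OF wuv(1) cl[OF wuv(2,3)]]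
    note B = bilinear_form_onD[OF form_bilinear[OF zp] T(2) T(2) T(2)]
    show "local_form M p x (a *\<^sub>R u + b *\<^sub>R v) w = a * local_form M p x u w + b * local_form M p x v w"
      unfolding lf' Tl by (rule B(1))
    show "local_form M p x w (a *\<^sub>R u + b *\<^sub>R v) = a * local_form M p x w u + b * local_form M p x w v"
      unfolding lf' Tl by (rule B(2))
  qed
  show "u \<in> model M \<Longrightarrow> v \<in> model M \<Longrightarrow> local_form M p x v u = - local_form M p x u v"
    using lf[of u v] lf[of v u] form_antisym[OF zp T(2)[of u] T(2)[of v]] by simp
  assume u: "u \<in> model M" and 0: "\<And>v. v \<in> model M \<Longrightarrow> local_form M p x u v = 0"
  have "form M z (?T u) w = 0" if w: "w \<in> model M" for w
  proof -
    have "w = ?T (tchange M z p z w)"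
      using tchange_compose[OF S zp p zp zz z(1) zz] tchange_self[OF S zp zz w] by simp
    then show ?thesis
      using 0[OF tchange_in_model[OF S zp p zz z(1), of w]] lf[OF u tchange_in_model[OF S zp p zz z(1), of w]]
      by simp
  qed
  then have "?T u = 0" by (rule form_nondeg[OF zp T(2)])
  then show "u = 0"
    using tchange_compose[OF S p zp p z(1) zz z(1), of u] tchange_self[OF S p z(1) u]
      linear_0[OF tchange_linear[OF S zp p zz z(1)]] by simp
qed

lemma local_form_closed:
  assumes p: "p \<in> points M" and x: "x \<in> crange M p" and uvw: "u \<in> model M" "v \<in> model M" "w \<in> model M"
  shows "sderiv (model M) (\<lambda>y. local_form M p y v w) x u +
    sderiv (model M) (\<lambda>y. local_form M p y w u) x v +
    sderiv (model M) (\<lambda>y. local_form M p y u v) x w = 0"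
proof -
  have "chart_deriv M p (\<lambda>y. local_form M p y b c) x a = sderiv (model M) (\<lambda>y. local_form M p y b c) x a"
    if "a \<in> model M" "b \<in> model M" "c \<in> model M" for a b c
    unfolding chart_deriv_def
    using that chart_range_open[OF manifold_chart[OF symplectic_smooth p]]
    by (intro frechet_derivative_within_eq_sderiv[OF manifold_model[OF symplectic_smooth] _ local_form_smooth[OF p] x]) auto
  moreover have "chart_deriv M p (\<lambda>y. local_form M p y v w) x u +
    chart_deriv M p (\<lambda>y. local_form M p y w u) x v +
    chart_deriv M p (\<lambda>y. local_form M p y u v) x w = 0"
    using bspec[OF M[unfolded symplectic_manifold_def, THEN conjunct2] p,
        THEN conjunct2, THEN conjunct2, THEN conjunct2, THEN conjunct2] x uvw by blast
  ultimately show ?thesis using uvw by simp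
qed


section \<open>Hamiltonian trajectories\<close>

lemma smooth_hamiltonian_slice:
  assumes "smooth_hamiltonian M \<delta> h" "t \<in> {0..\<delta>}" "p \<in> points M"
  shows "smooth_on (crange M p) (\<lambda>x. h t (cinv M p x))"
proof -
  have "smooth_on ({0..\<delta>} \<times> crange M p) (\<lambda>(t, x). h t (cinv M p x))"
    using assms by (simp add: smooth_hamiltonian_def)
  moreover have "smooth_on (crange M p) (\<lambda>x. (t, x))"
    by (intro smooth_on_Pair smooth_on_const smooth_on_id)
  ultimately show ?thesis
    using smooth_on_compose[of "crange M p" "\<lambda>x. (t, x)" "{0..\<delta>} \<times> crange M p" "\<lambda>(t, x). h t (cinv M p x)"] assms(2)
    by simp
qed

lemma ham_vector_field:
  assumes p: "p \<in> points M" and h: "smooth_on (crange M p) (\<lambda>x. h (cinv M p x))"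
  shows "ham_vector_field M h p \<in> model M"
    and "v \<in> model M \<Longrightarrow>
      form M p (ham_vector_field M h p) v = sderiv (model M) (\<lambda>x. h (cinv M p x)) (coord M p p) v"
proof -
  note S = symplectic_smooth
  note V = manifold_model[OF S]
  have x: "coord M p p \<in> crange M p" using manifold_centre[OF S p] by blast
  let ?d = "sderiv (model M) (\<lambda>x. h (cinv M p x)) (coord M p p)"
  have r: "openin (top_of_set (model M)) (crange M p)" by (rule chart_range_open[OF manifold_chart[OF S p]])
  have "chart_deriv M p (h \<circ> cinv M p) (coord M p p) v = ?d v" if "v \<in> model M" for v
    unfolding chart_deriv_def o_def using frechet_derivative_within_eq_sderiv[OF V r h x r _ that] by simp
  then have "ham_vector_field M h p = (THE X. X \<in> model M \<and> (\<forall>v\<in>model M. form M p X v = ?d v))"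
    unfolding ham_vector_field_def by (simp only: cong: ball_cong)
  moreover have "\<exists>!X. X \<in> model M \<and> (\<forall>v\<in>model M. form M p X v = ?d v)"
    by (rule nondegenerate_form_represents[OF V form_bilinear[OF p] form_nondeg[OF p] sderiv_linear[OF V r h x]])
  ultimately have "ham_vector_field M h p \<in> model M \<and> (\<forall>v\<in>model M. form M p (ham_vector_field M h p) v = ?d v)"
    by (simp only:) (rule theI')
  then show "ham_vector_field M h p \<in> model M"
    "v \<in> model M \<Longrightarrow> form M p (ham_vector_field M h p) v = ?d v" by auto
qed

text \<open>The Hamiltonian vector field at a point is defined in the chart centred there, which varies along a
  trajectory.  The equation \<open>\<omega>(X, v) = dh v\<close> is carried to a fixed chart by the change of coordinates at
  each time.\<close>

lemma ham_trajectory_in_chart: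
  assumes h: "smooth_hamiltonian M \<delta> h" and x: "ham_trajectory M \<delta> h x"
    and t: "t \<in> {0..\<delta>}" and q: "q \<in> points M" "x t \<in> cdom M q"
  obtains \<xi> where "\<xi> \<in> model M" "((\<lambda>s. coord M q (x s)) has_vector_derivative \<xi>) (at t within {0..\<delta>})"
    "\<And>v. v \<in> model M \<Longrightarrow> local_form M q (coord M q (x t)) \<xi> v =
       sderiv (model M) (\<lambda>y. h t (cinv M q y)) (coord M q (x t)) v"
proof -
  note S = symplectic_smooth
  note V = manifold_model[OF S]
  define z where "z = x t"
  have xc: "continuous_map (top_of_set {0..\<delta>}) (mtop M) x" using x by (simp add: ham_trajectory_def)
  have zp: "z \<in> points M" using xc t unfolding z_def continuous_map_def by auto
  have zz: "z \<in> cdom M z" "z \<in> cdom M q" using manifold_centre[OF S zp] q(2) by (auto simp: z_def)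
  define X where "X = ham_vector_field M (h t) z"
  have hz: "smooth_on (crange M p) (\<lambda>y. h t (cinv M p y))" if "p \<in> points M" for p
    by (rule smooth_hamiltonian_slice[OF h t that])
  have X: "X \<in> model M"
    "\<And>v. v \<in> model M \<Longrightarrow> form M z X v = sderiv (model M) (\<lambda>y. h t (cinv M z y)) (coord M z z) v"
    unfolding X_def using ham_vector_field[OF zp hz[OF zp]] by auto
  have oD: "openin (mtop M) (cdom M z \<inter> cdom M q)"
    by (intro openin_Int chart_open[OF manifold_chart[OF S]] zp q)
  have "openin (top_of_set {0..\<delta>}) {s \<in> {0..\<delta>}. x s \<in> cdom M z \<inter> cdom M q}"
    using openin_continuous_map_preimage[OF xc oD] by simp
  then obtain T where T: "open T" "{s \<in> {0..\<delta>}. x s \<in> cdom M z \<inter> cdom M q} = {0..\<delta>} \<inter> T"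
    using openin_open by blast
  define J where "J = {0..\<delta>} \<inter> T"
  have J: "x s \<in> cdom M z" "x s \<in> cdom M q" if "s \<in> J" for s
    using that unfolding J_def T(2)[symmetric] by auto
  have tJ: "t \<in> J" using t zz unfolding J_def T(2)[symmetric] by (simp add: z_def)
  have atJ: "at t within J = at t within {0..\<delta>}"
    by (rule at_within_nhd[of t T]) (use tJ T in \<open>auto simp: J_def\<close>)
  have "((\<lambda>s. coord M z (x s)) has_vector_derivative X) (at t within {0..\<delta>})"
    using x t by (simp add: ham_trajectory_def o_def z_def X_def)
  then have dz: "((\<lambda>s. coord M z (x s)) has_vector_derivative X) (at t within J)" by (simp add: atJ)
  define \<xi> where "\<xi> = tchange M z q z X"
  have "((\<lambda>s. coord M q (cinv M z (coord M z (x s)))) has_vector_derivative \<xi>) (at t within J)"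
    using sderiv_curve[OF V overlap_open[OF S zp q(1)] manifold_transition[OF S zp q(1)] dz _ tJ] J
    by (auto simp: \<xi>_def tchange_def z_def)
  then have "((\<lambda>s. coord M q (x s)) has_vector_derivative \<xi>) (at t within J)"
    by (rule has_vector_derivative_transform[OF tJ, rotated]) (use J cinv_coord[OF S zp] in auto)
  then have d: "((\<lambda>s. coord M q (x s)) has_vector_derivative \<xi>) (at t within {0..\<delta>})" by (simp add: atJ)
  have \<xi>: "\<xi> \<in> model M" unfolding \<xi>_def by (rule tchange_in_model[OF S zp q(1) zz])
  have "local_form M q (coord M q z) \<xi> v = sderiv (model M) (\<lambda>y. h t (cinv M q y)) (coord M q z) v"
    if v: "v \<in> model M" for v
  proof -
    have "tchange M q z z \<xi> = X"
      unfolding \<xi>_def using tchange_compose[OF S zp q(1) zp zz zz(1)] tchange_self[OF S zp zz(1) X(1)] by simp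
    then have "local_form M q (coord M q z) \<xi> v =
        sderiv (model M) (\<lambda>y. h t (cinv M z y)) (coord M z z) (tchange M q z z v)"
      using local_form_at[OF q(1) zz(2) \<xi> v] X(2)[OF tchange_in_model[OF S q(1) zp zz(2,1)]] by simp
    also have "\<dots> = sderiv (model M) (\<lambda>y. h t (cinv M z (coord M z (cinv M q y)))) (coord M q z) v"
      unfolding tchange_def
    proof -
      have "coord M z (cinv M q y) \<in> crange M z" if "y \<in> coord M q ` (cdom M q \<inter> cdom M z)" for y
        using that cinv_coord[OF S q(1)] by auto
      from sderiv_compose[OF V overlap_open[OF S q(1) zp] manifold_transition[OF S q(1) zp] _ V
          chart_range_open[OF manifold_chart[OF S zp]] hz[OF zp] this, of "coord M q z" v]
      show "sderiv (model M) (\<lambda>y. h t (cinv M z y)) (coord M z z)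
          (sderiv (model M) (\<lambda>y. coord M z (cinv M q y)) (coord M q z) v) =
        sderiv (model M) (\<lambda>y. h t (cinv M z (coord M z (cinv M q y)))) (coord M q z) v"
        using cinv_coord[OF S q(1) zz(2)] zz by simp
    qed
    also have "\<dots> = sderiv (model M) (\<lambda>y. h t (cinv M q y)) (coord M q z) v"
    proof -
      let ?T = "coord M q ` (cdom M q \<inter> cdom M z)"
      have "sderiv (model M) (\<lambda>y. h t (cinv M q y)) (coord M q z) =
          sderiv (model M) (\<lambda>y. h t (cinv M z (coord M z (cinv M q y)))) (coord M q z)"
        by (rule sderiv_cong[OF V overlap_open[OF S q(1) zp] smooth_on_subset[OF hz[OF q(1)]]])
          (use zz cinv_coord[OF S q(1)] cinv_coord[OF S zp] in auto)
      then show ?thesis by simp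
    qed
    finally show ?thesis .
  qed
  then show ?thesis using that \<xi> d by (simp add: z_def)
qed

end

text \<open>Subtracting the two systems gives \<open>A w (u - u') = (R (t, w) - R (t, w')) - (A w - A w') u'\<close>.  Here \<open>A w\<close> is
  bounded below, \<open>R\<close> and \<open>A\<close> are Lipschitz near \<open>(t0, x0)\<close>, and \<open>u'\<close> is bounded.\<close>

lemma implicit_velocity_Lipschitz:
  fixes A :: "'e::euclidean_space \<Rightarrow> 'e \<Rightarrow> 'e" and R :: "real \<times> 'e \<Rightarrow> 'e"
  assumes U: "open U" "x0 \<in> U" and lin: "\<And>w. w \<in> U \<Longrightarrow> linear (A w)" and inj: "inj (A x0)"
    and A: "\<And>u. Cinf_on U (\<lambda>w. A w u)" and Q: "open Q" "(t0, x0) \<in> Q" and R: "Cinf_on Q R"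
  obtains e K where "0 < e" "0 \<le> K"
    "\<And>t w w' u u'. \<bar>t - t0\<bar> < e \<Longrightarrow> w \<in> ball x0 e \<Longrightarrow> w' \<in> ball x0 e \<Longrightarrow>
       A w u = R (t, w) \<Longrightarrow> A w' u' = R (t, w') \<Longrightarrow> norm (u - u') \<le> K * norm (w - w')"
proof -
  obtain c d where c: "0 < c" "0 < d" "ball x0 d \<subseteq> U" "\<And>w u. w \<in> ball x0 d \<Longrightarrow> c * norm u \<le> norm (A w u)"
    using locally_bounded_below[OF U lin Cinf_on_imp_continuous_on[OF A] inj] by metis
  have "\<exists>d K. 0 < d \<and> 0 \<le> K \<and>
      (\<forall>y\<in>ball x0 d. \<forall>z\<in>ball x0 d. norm (A y b - A z b) \<le> K * norm (y - z))" for b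
    using Cinf_on_locally_Lipschitz[OF U(1) A U(2), of b] by metis
  then obtain dA KA where dA: "\<And>b. 0 < dA b" "\<And>b. 0 \<le> KA b"
    "\<And>b y z. y \<in> ball x0 (dA b) \<Longrightarrow> z \<in> ball x0 (dA b) \<Longrightarrow> norm (A y b - A z b) \<le> KA b * norm (y - z)"
    by metis
  obtain dR KR where dR: "0 < dR" "0 \<le> KR" "\<And>y z. y \<in> ball (t0, x0) dR \<Longrightarrow> z \<in> ball (t0, x0) dR \<Longrightarrow>
      norm (R y - R z) \<le> KR * norm (y - z)"
    using Cinf_on_locally_Lipschitz[OF Q(1) R Q(2)] by metis
  define dm where "dm = Min (dA ` Basis)"
  have dm: "0 < dm" "\<And>b. b \<in> Basis \<Longrightarrow> dm \<le> dA b" using dA(1) by (auto simp: dm_def)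
  define e where "e = min d (min dm (dR / 2))"
  have e: "0 < e" "e \<le> d" "e \<le> dm" "2 * e \<le> dR" using c dm dR by (auto simp: e_def)
  define C where "C = (norm (R (t0, x0)) + KR * dR) / c"
  define KS where "KS = (\<Sum>b\<in>Basis. KA b)"
  define K where "K = (KR + KS * C) / c"
  have KS: "0 \<le> KS" using dA(2) by (simp add: KS_def sum_nonneg)
  have C: "0 \<le> C" using c dR by (simp add: C_def)
  show ?thesis
  proof (rule that[OF e(1), of K])
    show "0 \<le> K" using c dR KS C by (simp add: K_def)
    fix t w w' u u'
    assume t: "\<bar>t - t0\<bar> < e" and w: "w \<in> ball x0 e" "w' \<in> ball x0 e"
      and eq: "A w u = R (t, w)" "A w' u' = R (t, w')"
    have wd: "w \<in> ball x0 d" "w' \<in> ball x0 d" using w e(2) by auto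
    then have wU: "w \<in> U" "w' \<in> U" using c(3) by auto
    have inR: "(t, y) \<in> ball (t0, x0) dR" if "y \<in> ball x0 e" for y
    proof -
      have "dist (t0, x0) (t, y) \<le> dist t0 t + dist x0 y"
        unfolding dist_Pair_Pair by (rule sqrt_sum_squares_le_sum) auto
      also have "\<dots> < dR" using t that e(4) by (simp add: dist_real_def abs_minus_commute)
      finally show ?thesis by simp
    qed
    have u': "norm u' \<le> C"
    proof -
      have "norm (R (t, w') - R (t0, x0)) \<le> KR * norm ((t, w') - (t0, x0))"
        using dR(3)[OF inR[OF w(2)], of "(t0, x0)"] dR(1) by simp
      also have "\<dots> \<le> KR * dR"
        using inR[OF w(2)] dR(2) by (intro mult_left_mono) (metis dist_commute dist_norm mem_ball less_imp_le)+
      finally have "norm (R (t, w')) \<le> norm (R (t0, x0)) + KR * dR"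
        using norm_triangle_sub[of "R (t, w')" "R (t0, x0)"] by linarith
      then show ?thesis using c(4)[OF wd(2), of u'] c(1) eq(2) by (simp add: C_def field_simps)
    qed
    have "norm (A w u' - A w' u') \<le> KS * norm (w - w') * norm u'"
    proof -
      have "linear (\<lambda>u. A w u - A w' u)" using lin wU by (intro linear_compose_sub) auto
      then have "A w u' - A w' u' = (\<Sum>b\<in>Basis. (u' \<bullet> b) *\<^sub>R (A w b - A w' b))"
        using linear_basis_expansion by metis
      then have "norm (A w u' - A w' u') \<le> (\<Sum>b\<in>Basis. norm ((u' \<bullet> b) *\<^sub>R (A w b - A w' b)))"
        by (simp only: norm_sum)
      also have "\<dots> \<le> (\<Sum>b\<in>Basis. norm u' * (KA b * norm (w - w')))"
        unfolding norm_scaleR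
      proof (intro sum_mono mult_mono)
        fix b :: 'e assume b: "b \<in> Basis"
        have "w \<in> ball x0 (dA b)" "w' \<in> ball x0 (dA b)" using w e(3) dm(2)[OF b] by auto
        then show "norm (A w b - A w' b) \<le> KA b * norm (w - w')" by (rule dA(3))
        show "\<bar>u' \<bullet> b\<bar> \<le> norm u'" using b by (rule Basis_le_norm)
      qed auto
      also have "\<dots> = KS * norm (w - w') * norm u'"
        by (simp add: KS_def sum_distrib_left sum_distrib_right mult_ac)
      finally show ?thesis .
    qed
    also have "\<dots> \<le> KS * norm (w - w') * C"
      using u' KS by (intro mult_left_mono) auto
    finally have 1: "norm (A w u' - A w' u') \<le> KS * norm (w - w') * C" .
    have 2: "norm (R (t, w) - R (t, w')) \<le> KR * norm (w - w')"
      using dR(3)[OF inR[OF w(1)] inR[OF w(2)]] by (simp add: norm_Pair)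
    have "A w (u - u') = (R (t, w) - R (t, w')) - (A w u' - A w' u')"
      using lin[OF wU(1)] eq by (simp add: linear_diff)
    then have "norm (A w (u - u')) \<le> norm (R (t, w) - R (t, w')) + norm (A w u' - A w' u')"
      by (metis norm_triangle_ineq4)
    with 1 2 c(4)[OF wd(1), of "u - u'"] have "c * norm (u - u') \<le> (KR + KS * C) * norm (w - w')"
      by (simp add: algebra_simps)
    then show "norm (u - u') \<le> K * norm (w - w')" using c(1) by (simp add: K_def field_simps)
  qed
qed

text \<open>On an interval of length at most \<open>1 / (2 K)\<close> around a common value, the mean value inequality bounds the
  maximal distance of the two curves by half of itself.\<close>

lemma short_time_uniqueness:
  fixes a b :: "real \<Rightarrow> 'e::euclidean_space"
  assumes d: "\<And>t. t \<in> {l..r} \<Longrightarrow> (a has_vector_derivative a' t) (at t within {l..r})"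
      "\<And>t. t \<in> {l..r} \<Longrightarrow> (b has_vector_derivative b' t) (at t within {l..r})"
    and K: "\<And>t. t \<in> {l..r} \<Longrightarrow> norm (a' t - b' t) \<le> K * norm (a t - b t)" "0 \<le> K" "K * (r - l) \<le> 1 / 2"
    and t0: "t0 \<in> {l..r}" "a t0 = b t0" and t: "t \<in> {l..r}"
  shows "a t = b t"
proof -
  define f where "f t = a t - b t" for t
  have f: "(f has_vector_derivative a' t - b' t) (at t within {l..r})" if "t \<in> {l..r}" for t
    unfolding f_def by (intro has_vector_derivative_diff d that)
  have "continuous_on {l..r} f"
    using f has_vector_derivative_continuous continuous_on_eq_continuous_within by blast
  then have "continuous_on {l..r} (\<lambda>t. norm (f t))" by (rule continuous_on_norm)
  then obtain s where s: "s \<in> {l..r}" "\<And>t. t \<in> {l..r} \<Longrightarrow> norm (f t) \<le> norm (f s)"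
    using continuous_attains_sup[of "{l..r}" "\<lambda>t. norm (f t)"] t by auto
  have "norm (f s - f t0) \<le> (K * norm (f s)) * norm (s - t0)"
  proof (rule differentiable_bound[of "{l..r}" f "\<lambda>t h. h *\<^sub>R (a' t - b' t)"])
    show "(f has_derivative (\<lambda>h. h *\<^sub>R (a' t - b' t))) (at t within {l..r})" if "t \<in> {l..r}" for t
      using f[OF that] by (simp add: has_vector_derivative_def)
    show "onorm (\<lambda>h. h *\<^sub>R (a' t - b' t)) \<le> K * norm (f s)" if t: "t \<in> {l..r}" for t
    proof (rule onorm_le)
      have "norm (a' t - b' t) \<le> K * norm (f s)"
        using K(1)[OF t] mult_left_mono[OF s(2)[OF t] K(2)] by (simp add: f_def)
      then show "norm (h *\<^sub>R (a' t - b' t)) \<le> K * norm (f s) * norm h" for h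
        by (simp add: mult.commute mult_left_mono)
    qed
  qed (use s t0 in auto)
  also have "\<dots> \<le> (K * norm (f s)) * (r - l)"
    using s(1) t0(1) K(2) by (intro mult_left_mono) auto
  also have "\<dots> = (K * (r - l)) * norm (f s)" by simp
  also have "\<dots> \<le> 1 / 2 * norm (f s)" by (rule mult_right_mono[OF K(3)]) simp
  finally have "norm (f s) = 0" using t0(2) by (simp add: f_def)
  then show ?thesis using s(2)[OF t] by (simp add: f_def)
qed

context
  fixes M :: "('a, 'e::euclidean_space, 'x) symplectic_scheme"
  assumes M: "symplectic_manifold M"
begin

text \<open>Near \<open>(t0, q)\<close>, Hamilton's equation reads \<open>A w \<xi> = R (t, w)\<close> with \<open>A\<close> the Gram map of the
  local form and \<open>R\<close> the gradient of the Hamiltonian.\<close>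

lemma ham_velocity_Lipschitz:
  assumes h: "smooth_hamiltonian M \<delta> h" and q: "q \<in> points M" and t0: "t0 \<in> {0..\<delta>}"
  obtains e K where "0 < e" "0 \<le> K"
    "\<And>t w w' u u'. t \<in> {0..\<delta>} \<Longrightarrow> \<bar>t - t0\<bar> < e \<Longrightarrow>
       w \<in> ball (coord M q q) e \<inter> crange M q \<Longrightarrow> w' \<in> ball (coord M q q) e \<inter> crange M q \<Longrightarrow>
       u \<in> model M \<Longrightarrow> u' \<in> model M \<Longrightarrow>
       (\<And>v. v \<in> model M \<Longrightarrow> local_form M q w u v = sderiv (model M) (\<lambda>y. h t (cinv M q y)) w v) \<Longrightarrow>
       (\<And>v. v \<in> model M \<Longrightarrow> local_form M q w' u' v = sderiv (model M) (\<lambda>y. h t (cinv M q y)) w' v) \<Longrightarrow>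
       norm (u - u') \<le> K * norm (w - w')"
proof -
  let ?V = "model M" and ?\<pi> = "proj (model M)"
  note S = symplectic_smooth[OF M]
  note V = manifold_model[OF S]
  define x0 where "x0 = coord M q q"
  have x0: "x0 \<in> crange M q" using manifold_centre[OF S q] by (simp add: x0_def)
  have oc: "openin (top_of_set ?V) (crange M q)" by (rule chart_range_open[OF manifold_chart[OF S q]])
  have pi: "?\<pi> w = w" if "w \<in> crange M q" for w using proj_id[OF V crange_model[OF S q that]] .
  define U where "U = ?\<pi> -` crange M q"
  have U: "open U" "x0 \<in> U" using open_proj_vimage[OF V oc] x0 pi[OF x0] by (auto simp: U_def)
  define A where "A w = gram ?V (local_form M q (?\<pi> w))" for w
  have bil: "bilinear_form_on ?V (local_form M q (?\<pi> w))" if "w \<in> U" for w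
    using local_form_bilinear(1)[OF M q] that by (simp add: U_def)
  have linA: "linear (A w)" if "w \<in> U" for w unfolding A_def by (rule gram_linear[OF V bil[OF that]])
  have injA: "inj (A x0)" unfolding A_def
    using gram_inj[OF V bil[OF U(2)]] local_form_bilinear(3)[OF M q x0] pi[OF x0] by simp
  have cA: "Cinf_on U (\<lambda>w. A w u)" for u
    unfolding A_def gram_def U_def
    by (intro Cinf_on_sum Cinf_on_scaleR Cinf_on_add Cinf_on_const
        smooth_on_imp_Cinf_on_proj[OF V oc local_form_smooth[OF M q proj_in[OF V] proj_in[OF V]]])
  have sm: "smooth_on ({0..\<delta>} \<times> crange M q) (\<lambda>(t, x). h t (cinv M q x))"
    using h q by (simp add: smooth_hamiltonian_def)
  have in0: "(t0, x0) \<in> {0..\<delta>} \<times> crange M q" using t0 x0 by simp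
  obtain Q g where Q: "open Q" "(t0, x0) \<in> Q" "Cinf_on Q g"
    and g: "\<And>z. z \<in> Q \<Longrightarrow> z \<in> {0..\<delta>} \<times> crange M q \<Longrightarrow> g z = (\<lambda>(t, x). h t (cinv M q x)) z"
    by (rule smooth_onE[OF sm in0]) blast
  define R where "R z = (\<Sum>b\<in>Basis. frechet_derivative g (at z) (0, ?\<pi> b) *\<^sub>R b)" for z
  have cR: "Cinf_on Q R" unfolding R_def
    by (intro Cinf_on_sum Cinf_on_scaleR Cinf_on_const Cinf_on_derivative[OF Q(1,3)])
  have grad: "sderiv ?V (\<lambda>y. h t (cinv M q y)) w v = frechet_derivative g (at (t, w)) (0, v)"
    if t: "t \<in> {0..\<delta>}" and w: "w \<in> crange M q" "(t, w) \<in> Q" and v: "v \<in> ?V" for t w v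
    by (rule sderiv_slice[OF V oc smooth_hamiltonian_slice[OF M h t q] w(1) v Q(1) w(2) Q(3)])
      (use g t in auto)
  obtain e1 where e1: "0 < e1" "ball (t0, x0) e1 \<subseteq> Q" using Q open_contains_ball by blast
  obtain e2 K where eK: "0 < e2" "0 \<le> K"
    "\<And>t w w' u u'. \<bar>t - t0\<bar> < e2 \<Longrightarrow> w \<in> ball x0 e2 \<Longrightarrow> w' \<in> ball x0 e2 \<Longrightarrow>
       A w u = R (t, w) \<Longrightarrow> A w' u' = R (t, w') \<Longrightarrow> norm (u - u') \<le> K * norm (w - w')"
    using implicit_velocity_Lipschitz[OF U linA injA cA Q(1,2) cR] by metis
  define e where "e = min (e1 / 2) e2"
  have e: "0 < e" "2 * e \<le> e1" "e \<le> e2" using e1 eK by (auto simp: e_def)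
  have sys: "A w u = R (t, w)"
    if t: "t \<in> {0..\<delta>}" "\<bar>t - t0\<bar> < e" and w: "w \<in> ball x0 e \<inter> crange M q" and u: "u \<in> ?V"
      and eq: "\<And>v. v \<in> ?V \<Longrightarrow> local_form M q w u v = sderiv ?V (\<lambda>y. h t (cinv M q y)) w v" for t w u
  proof (rule euclidean_eqI)
    fix b :: 'e assume b: "b \<in> Basis"
    have wc: "w \<in> crange M q" using w by blast
    then have wU: "w \<in> U" using pi[of w] by (simp add: U_def)
    have "dist (t0, x0) (t, w) \<le> dist t0 t + dist x0 w"
      unfolding dist_Pair_Pair by (rule sqrt_sum_squares_le_sum) auto
    also have "\<dots> < e1" using t w e(2) by (simp add: dist_real_def abs_minus_commute)
    finally have wO: "(t, w) \<in> Q" using e1(2) by auto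
    have "A w u \<bullet> b = local_form M q w u (?\<pi> b)"
      unfolding A_def using gram_inner[OF V bil[OF wU], of u b] pi[OF wc] proj_id[OF V u] by simp
    also have "\<dots> = frechet_derivative g (at (t, w)) (0, ?\<pi> b)"
      using eq[OF proj_in[OF V]] grad[OF t(1) wc wO proj_in[OF V]] by simp
    also have "\<dots> = R (t, w) \<bullet> b"
      using b by (simp add: R_def inner_sum_left inner_Basis if_distrib cong: if_cong)
    finally show "A w u \<bullet> b = R (t, w) \<bullet> b" .
  qed
  show ?thesis
  proof (rule that[OF e(1) eK(2)])
    fix t w w' u u'
    assume "t \<in> {0..\<delta>}" "\<bar>t - t0\<bar> < e" "w \<in> ball (coord M q q) e \<inter> crange M q"
      "w' \<in> ball (coord M q q) e \<inter> crange M q" "u \<in> ?V" "u' \<in> ?V"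
      "\<And>v. v \<in> ?V \<Longrightarrow> local_form M q w u v = sderiv ?V (\<lambda>y. h t (cinv M q y)) w v"
      "\<And>v. v \<in> ?V \<Longrightarrow> local_form M q w' u' v = sderiv ?V (\<lambda>y. h t (cinv M q y)) w' v"
    then show "norm (u - u') \<le> K * norm (w - w')"
      using sys e(3) by (intro eK(3)[of t]) (auto simp: x0_def)
  qed
qed

lemma ham_trajectory_unique_near:
  assumes h: "smooth_hamiltonian M \<delta> h" and x: "ham_trajectory M \<delta> h x" and y: "ham_trajectory M \<delta> h y"
    and t0: "t0 \<in> {0..\<delta>}" "x t0 = y t0"
  obtains e where "0 < e" "\<And>t. t \<in> {0..\<delta>} \<Longrightarrow> \<bar>t - t0\<bar> < e \<Longrightarrow> x t = y t"
proof -
  note S = symplectic_smooth[OF M]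
  define q where "q = x t0"
  have cont: "continuous_map (top_of_set {0..\<delta>}) (mtop M) x" "continuous_map (top_of_set {0..\<delta>}) (mtop M) y"
    using x y by (auto simp: ham_trajectory_def)
  have q: "q \<in> points M" using cont(1) t0(1) by (auto simp: q_def continuous_map_def Pi_iff)
  obtain e K where e: "0 < e" "0 \<le> K"
    and Lip: "\<And>t w w' u u'. t \<in> {0..\<delta>} \<Longrightarrow> \<bar>t - t0\<bar> < e \<Longrightarrow>
       w \<in> ball (coord M q q) e \<inter> crange M q \<Longrightarrow> w' \<in> ball (coord M q q) e \<inter> crange M q \<Longrightarrow>
       u \<in> model M \<Longrightarrow> u' \<in> model M \<Longrightarrow>
       (\<And>v. v \<in> model M \<Longrightarrow> local_form M q w u v = sderiv (model M) (\<lambda>y. h t (cinv M q y)) w v) \<Longrightarrow>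
       (\<And>v. v \<in> model M \<Longrightarrow> local_form M q w' u' v = sderiv (model M) (\<lambda>y. h t (cinv M q y)) w' v) \<Longrightarrow>
       norm (u - u') \<le> K * norm (w - w')"
    using ham_velocity_Lipschitz[OF h q t0(1)] by metis
  define B where "B = {z \<in> cdom M q. coord M q z \<in> ball (coord M q q) e \<inter> model M}"
  have oB: "openin (mtop M) B" unfolding B_def
    by (rule chart_preimage_open[OF manifold_chart[OF S q]]) (metis Int_commute open_ball openin_open_Int)
  have qB: "q \<in> B"
    using manifold_centre[OF S q] coord_model[OF S q manifold_centre[OF S q]] e(1) by (simp add: B_def)
  have nearB: "\<exists>d>0. \<forall>t\<in>{0..\<delta>}. \<bar>t - t0\<bar> < d \<longrightarrow> z t \<in> B"
    if z: "continuous_map (top_of_set {0..\<delta>}) (mtop M) z" "z t0 = q" for z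
  proof -
    have "openin (top_of_set {0..\<delta>}) {t \<in> {0..\<delta>}. z t \<in> B}"
      using openin_continuous_map_preimage[OF z(1) oB] by simp
    then obtain d where "d > 0" "ball t0 d \<inter> {0..\<delta>} \<subseteq> {t \<in> {0..\<delta>}. z t \<in> B}"
      using t0(1) z(2) qB unfolding openin_contains_ball by blast
    then show ?thesis by (intro exI[of _ d]) (auto simp: dist_real_def abs_minus_commute subset_iff)
  qed
  obtain d1 where d1: "0 < d1" "\<And>t. t \<in> {0..\<delta>} \<Longrightarrow> \<bar>t - t0\<bar> < d1 \<Longrightarrow> x t \<in> B"
    using nearB[OF cont(1)] q_def by blast
  obtain d2 where d2: "0 < d2" "\<And>t. t \<in> {0..\<delta>} \<Longrightarrow> \<bar>t - t0\<bar> < d2 \<Longrightarrow> y t \<in> B"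
    using nearB[OF cont(2)] t0(2) q_def by auto
  define d where "d = min (min (d1 / 2) (d2 / 2)) (min (e / 2) (1 / (4 * (K + 1))))"
  have d: "0 < d" "d < d1" "d < d2" "d < e" "d \<le> 1 / (4 * (K + 1))"
    using d1 d2 e by (auto simp: d_def min_def)
  define l r where "l = max 0 (t0 - d)" and "r = min \<delta> (t0 + d)"
  have I: "t \<in> {0..\<delta>}" "\<bar>t - t0\<bar> < d1" "\<bar>t - t0\<bar> < d2" "\<bar>t - t0\<bar> < e" if "t \<in> {l..r}" for t
    using that d by (auto simp: l_def r_def)
  have inB: "x t \<in> B" "y t \<in> B" if "t \<in> {l..r}" for t using I[OF that] d1 d2 by auto
  have sub: "{l..r} \<subseteq> {0..\<delta>}" using I by blast
  have "\<exists>\<xi>. \<xi> \<in> model M \<and> ((\<lambda>s. coord M q (z s)) has_vector_derivative \<xi>) (at t within {l..r}) \<and>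
      (\<forall>v\<in>model M. local_form M q (coord M q (z t)) \<xi> v = sderiv (model M) (\<lambda>y. h t (cinv M q y)) (coord M q (z t)) v)"
    if z: "ham_trajectory M \<delta> h z" and t: "t \<in> {l..r}" "z t \<in> B" for z t
  proof -
    have "z t \<in> cdom M q" using t by (simp add: B_def)
    from ham_trajectory_in_chart[OF M h z I(1)[OF t(1)] q this]
    show ?thesis using has_vector_derivative_within_subset[OF _ sub] by metis
  qed
  note ex = this
  obtain a' where a': "\<And>t. t \<in> {l..r} \<Longrightarrow> a' t \<in> model M \<and> ((\<lambda>s. coord M q (x s)) has_vector_derivative a' t) (at t within {l..r}) \<and>
      (\<forall>v\<in>model M. local_form M q (coord M q (x t)) (a' t) v = sderiv (model M) (\<lambda>y. h t (cinv M q y)) (coord M q (x t)) v)"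
    using ex[OF x _ inB(1)] by metis
  obtain b' where b': "\<And>t. t \<in> {l..r} \<Longrightarrow> b' t \<in> model M \<and> ((\<lambda>s. coord M q (y s)) has_vector_derivative b' t) (at t within {l..r}) \<and>
      (\<forall>v\<in>model M. local_form M q (coord M q (y t)) (b' t) v = sderiv (model M) (\<lambda>y. h t (cinv M q y)) (coord M q (y t)) v)"
    using ex[OF y _ inB(2)] by metis
  have Klr: "K * (r - l) \<le> 1 / 2"
  proof -
    have "K * (r - l) \<le> K * (2 * d)" using e(2) by (intro mult_left_mono) (auto simp: l_def r_def)
    also have "\<dots> \<le> (K + 1) * (2 * (1 / (4 * (K + 1))))" using d e(2) by (intro mult_mono) auto
    also have "\<dots> = 1 / 2" using e(2) by simp
    finally show ?thesis .
  qed
  have eq: "coord M q (x t) = coord M q (y t)" if t: "t \<in> {l..r}" for t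
  proof (rule short_time_uniqueness[where a = "\<lambda>t. coord M q (x t)" and b = "\<lambda>t. coord M q (y t)", OF _ _ _ e(2) Klr _ _ t])
    show "t0 \<in> {l..r}" using t0(1) d(1) by (auto simp: l_def r_def)
    show "coord M q (x t0) = coord M q (y t0)" by (simp add: t0(2))
    fix s assume s: "s \<in> {l..r}"
    show "((\<lambda>t. coord M q (x t)) has_vector_derivative a' s) (at s within {l..r})"
      "((\<lambda>t. coord M q (y t)) has_vector_derivative b' s) (at s within {l..r})"
      using a'[OF s] b'[OF s] by auto
    show "norm (a' s - b' s) \<le> K * norm (coord M q (x s) - coord M q (y s))"
      using a'[OF s] b'[OF s] inB[OF s] by (intro Lip[OF I(1)[OF s] I(4)[OF s]]) (auto simp: B_def)
  qed
  show ?thesis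
  proof (rule that[OF d(1)])
    fix t assume "t \<in> {0..\<delta>}" "\<bar>t - t0\<bar> < d"
    then have t: "t \<in> {l..r}" by (auto simp: l_def r_def)
    then have "x t \<in> cdom M q" "y t \<in> cdom M q" using inB by (auto simp: B_def)
    then show "x t = y t" using eq[OF t] chart_inj[OF manifold_chart[OF S q]] by (auto dest: inj_onD)
  qed
qed

text \<open>The times at which two trajectories agree form a closed set, since the manifold is Hausdorff, and an
  open one, by local uniqueness.  Agreement at any time suffices: at time \<open>0\<close> this identifies
  trajectories with flow lines, at time \<open>\<delta>\<close> it shows that the flow is injective.\<close>

theorem ham_trajectory_unique:
  assumes h: "smooth_hamiltonian M \<delta> h" and x: "ham_trajectory M \<delta> h x" and y: "ham_trajectory M \<delta> h y"
    and s: "s \<in> {0..\<delta>}" "x s = y s" and t: "t \<in> {0..\<delta>}"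
  shows "x t = y t"
proof -
  define T where "T = {t \<in> {0..\<delta>}. x t = y t}"
  have cont: "continuous_map (top_of_set {0..\<delta>}) (mtop M) x" "continuous_map (top_of_set {0..\<delta>}) (mtop M) y"
    using x y by (auto simp: ham_trajectory_def)
  have "Hausdorff_space (mtop M)" using symplectic_smooth[OF M] by (simp add: smooth_manifold_def)
  then have cl: "closedin (top_of_set {0..\<delta>}) T"
    using closedin_continuous_maps_eq[OF _ cont] by (simp add: T_def)
  have op: "openin (top_of_set {0..\<delta>}) T"
    unfolding openin_contains_ball
  proof (intro conjI ballI)
    show "T \<subseteq> {0..\<delta>}" by (auto simp: T_def)
    fix t0 assume "t0 \<in> T"
    then obtain e where "0 < e" "\<And>t. t \<in> {0..\<delta>} \<Longrightarrow> \<bar>t - t0\<bar> < e \<Longrightarrow> x t = y t"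
      using ham_trajectory_unique_near[OF h x y] by (auto simp: T_def)
    then show "\<exists>e>0. ball t0 e \<inter> {0..\<delta>} \<subseteq> T"
      by (intro exI[of _ e]) (auto simp: T_def dist_real_def abs_minus_commute)
  qed
  have "openin (top_of_set {0..\<delta>}) T \<and> closedin (top_of_set {0..\<delta>}) T \<longrightarrow> T = {} \<or> T = {0..\<delta>}"
    using connected_Icc[of 0 \<delta>] unfolding connected_clopen by (rule spec)
  from mp[OF this conjI[OF op cl]] have "T = {} \<or> T = {0..\<delta>}" .
  moreover have "s \<in> T" using s by (simp add: T_def)
  ultimately have "t \<in> T" using t by blast
  then show ?thesis by (simp add: T_def)
qed

end

section \<open>Pulling back closed forms\<close>

abbreviation fderiv :: "('e::euclidean_space \<Rightarrow> 'f::real_normed_vector) \<Rightarrow> 'e \<Rightarrow> 'e \<Rightarrow> 'f" where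
  "fderiv f x \<equiv> frechet_derivative f (at x)"

lemma fderiv_linear_apply:
  fixes s :: "'e::euclidean_space \<Rightarrow> 'f::euclidean_space" and A :: "'e \<Rightarrow> 'f \<Rightarrow> 'g::real_normed_vector"
  assumes W: "open W" "w0 \<in> W" and lin: "\<And>w. w \<in> W \<Longrightarrow> linear (A w)"
    and A: "\<And>v. Cinf_on W (\<lambda>w. A w v)" and s: "Cinf_on W s"
  shows "fderiv (\<lambda>w. A w (s w)) w0 a = fderiv (\<lambda>w. A w (s w0)) w0 a + A w0 (fderiv s w0 a)"
proof -
  note ds = Cinf_on_has_derivative[OF s W(2)]
  note dA = Cinf_on_has_derivative[OF A W(2)]
  have 1: "((\<lambda>w. A w (s w)) has_derivative
      (\<lambda>a. \<Sum>b\<in>Basis. (s w0 \<bullet> b) *\<^sub>R fderiv (\<lambda>w. A w b) w0 a + (fderiv s w0 a \<bullet> b) *\<^sub>R A w0 b)) (at w0)"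
  proof (rule has_derivative_transform_within_open[OF _ W])
    show "((\<lambda>w. \<Sum>b\<in>Basis. (s w \<bullet> b) *\<^sub>R A w b) has_derivative
        (\<lambda>a. \<Sum>b\<in>Basis. (s w0 \<bullet> b) *\<^sub>R fderiv (\<lambda>w. A w b) w0 a + (fderiv s w0 a \<bullet> b) *\<^sub>R A w0 b)) (at w0)"
      by (intro has_derivative_sum has_derivative_scaleR has_derivative_inner_left ds dA)
  qed (rule linear_basis_expansion[OF lin])
  have 2: "((\<lambda>w. A w (s w0)) has_derivative
      (\<lambda>a. \<Sum>b\<in>Basis. (s w0 \<bullet> b) *\<^sub>R fderiv (\<lambda>w. A w b) w0 a)) (at w0)"
  proof (rule has_derivative_transform_within_open[OF _ W])
    show "((\<lambda>w. \<Sum>b\<in>Basis. (s w0 \<bullet> b) *\<^sub>R A w b) has_derivative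
        (\<lambda>a. \<Sum>b\<in>Basis. (s w0 \<bullet> b) *\<^sub>R fderiv (\<lambda>w. A w b) w0 a)) (at w0)"
      by (intro has_derivative_sum has_derivative_scaleR_right dA)
  qed (rule linear_basis_expansion[OF lin])
  show ?thesis
    unfolding frechet_derivative_at[OF 1, symmetric] frechet_derivative_at[OF 2, symmetric]
    using linear_basis_expansion[OF lin[OF W(2)], of "fderiv s w0 a"] by (simp add: sum.distrib)
qed

lemma fderiv_inner_left:
  assumes "Cinf_on U f" "x \<in> U"
  shows "fderiv (\<lambda>x. f x \<bullet> i) x a = fderiv f x a \<bullet> i"
  using frechet_derivative_at[OF has_derivative_inner_left[OF Cinf_on_has_derivative[OF assms], of i]] by metis

lemma symmetric_second_derivative_vector:
  fixes f :: "'e::euclidean_space \<Rightarrow> 'f::euclidean_space"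
  assumes U: "open U" "Cinf_on U f" and x: "x \<in> U"
  shows "fderiv (\<lambda>y. fderiv f y u) x v = fderiv (\<lambda>y. fderiv f y v) x u"
proof (rule euclidean_eqI)
  fix i :: 'f
  have fi: "Cinf_on U (\<lambda>x. f x \<bullet> i)" by (rule Cinf_on_bounded_linear_compose[OF bounded_linear_inner_left U(2)])
  have "fderiv (\<lambda>y. fderiv f y u) x v \<bullet> i = fderiv (\<lambda>y. fderiv (\<lambda>x. f x \<bullet> i) y u) x v" for u v
  proof -
    have "((\<lambda>y. fderiv f y u \<bullet> i) has_derivative (\<lambda>v. fderiv (\<lambda>y. fderiv f y u) x v \<bullet> i)) (at x)"
      by (intro has_derivative_inner_left Cinf_on_has_derivative[OF Cinf_on_derivative[OF U] x])
    then have "((\<lambda>y. fderiv (\<lambda>x. f x \<bullet> i) y u) has_derivative (\<lambda>v. fderiv (\<lambda>y. fderiv f y u) x v \<bullet> i)) (at x)"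
      by (rule has_derivative_transform_within_open[OF _ U(1) x]) (simp add: fderiv_inner_left[OF U(2)])
    from frechet_derivative_at[OF this] show ?thesis by metis
  qed
  then show "fderiv (\<lambda>y. fderiv f y u) x v \<bullet> i = fderiv (\<lambda>y. fderiv f y v) x u \<bullet> i"
    using symmetric_second_derivative[OF U(1) fi x] by metis
qed

context
  fixes U :: "'e::euclidean_space set" and B :: "'e \<Rightarrow> 'e \<Rightarrow> 'e \<Rightarrow> real"
    and W :: "'w::euclidean_space set" and G :: "'w \<Rightarrow> 'e"
  assumes U: "open U" and W: "open W"
    and lin: "\<And>y p. y \<in> U \<Longrightarrow> linear (B y p)" "\<And>y q. y \<in> U \<Longrightarrow> linear (\<lambda>p. B y p q)"
    and smooth: "\<And>p q. Cinf_on U (\<lambda>y. B y p q)"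
    and G: "Cinf_on W G" "\<And>w. w \<in> W \<Longrightarrow> G w \<in> U"
begin

lemma
  assumes P: "Cinf_on W P" and Q: "Cinf_on W Q"
  shows Cinf_on_form_apply: "Cinf_on W (\<lambda>w. B (G w) (P w) (Q w))"
    and fderiv_form_apply: "w0 \<in> W \<Longrightarrow> fderiv (\<lambda>w. B (G w) (P w) (Q w)) w0 a =
      fderiv (\<lambda>y. B y (P w0) (Q w0)) (G w0) (fderiv G w0 a) +
      B (G w0) (fderiv P w0 a) (Q w0) + B (G w0) (P w0) (fderiv Q w0 a)"
proof -
  have BG: "Cinf_on W (\<lambda>w. B (G w) p q)" for p q
    by (rule Cinf_on_compose[OF G(1) smooth _ W]) (use G(2) in blast)
  have BGQ: "Cinf_on W (\<lambda>w. B (G w) p (Q w))" for p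
    by (rule Cinf_on_linear_apply[OF W lin(1)[OF G(2)] BG Q])
  show "Cinf_on W (\<lambda>w. B (G w) (P w) (Q w))"
    by (rule Cinf_on_linear_apply[where A = "\<lambda>w p. B (G w) p (Q w)", OF W lin(2)[OF G(2)] BGQ P])
  assume w0: "w0 \<in> W"
  have "fderiv (\<lambda>w. B (G w) (P w) (Q w)) w0 a =
      fderiv (\<lambda>w. B (G w) (P w0) (Q w)) w0 a + B (G w0) (fderiv P w0 a) (Q w0)"
    by (rule fderiv_linear_apply[where A = "\<lambda>w p. B (G w) p (Q w)", OF W w0 lin(2)[OF G(2)] BGQ P])
  also have "fderiv (\<lambda>w. B (G w) (P w0) (Q w)) w0 a =
      fderiv (\<lambda>w. B (G w) (P w0) (Q w0)) w0 a + B (G w0) (P w0) (fderiv Q w0 a)"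
    by (rule fderiv_linear_apply[OF W w0 lin(1)[OF G(2)] BG Q])
  also have "fderiv (\<lambda>w. B (G w) (P w0) (Q w0)) w0 a = fderiv (\<lambda>y. B y (P w0) (Q w0)) (G w0) (fderiv G w0 a)"
    using frechet_derivative_at[OF has_derivative_compose[where f = G and g = "\<lambda>y. B y (P w0) (Q w0)",
        OF Cinf_on_has_derivative[OF G(1) w0] Cinf_on_has_derivative[OF smooth G(2)[OF w0]]]]
    by metis
  finally show "fderiv (\<lambda>w. B (G w) (P w) (Q w)) w0 a =
      fderiv (\<lambda>y. B y (P w0) (Q w0)) (G w0) (fderiv G w0 a) +
      B (G w0) (fderiv P w0 a) (Q w0) + B (G w0) (P w0) (fderiv Q w0 a)" by simp
qed

text \<open>In the cyclic sum, the derivatives of \<open>B\<close> cancel by closedness, and the second derivatives of \<open>G\<close>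
  cancel in pairs, because they are symmetric and \<open>B\<close> is antisymmetric.\<close>

lemma pullback_closed:
  assumes anti: "\<And>y p q. y \<in> U \<Longrightarrow> B y q p = - B y p q" and w0: "w0 \<in> W"
    and closed: "fderiv (\<lambda>y. B y (fderiv G w0 b) (fderiv G w0 c)) (G w0) (fderiv G w0 a) +
      fderiv (\<lambda>y. B y (fderiv G w0 c) (fderiv G w0 a)) (G w0) (fderiv G w0 b) +
      fderiv (\<lambda>y. B y (fderiv G w0 a) (fderiv G w0 b)) (G w0) (fderiv G w0 c) = 0"
  shows "fderiv (\<lambda>w. B (G w) (fderiv G w b) (fderiv G w c)) w0 a +
    fderiv (\<lambda>w. B (G w) (fderiv G w c) (fderiv G w a)) w0 b +
    fderiv (\<lambda>w. B (G w) (fderiv G w a) (fderiv G w b)) w0 c = 0"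
proof -
  note d = fderiv_form_apply[OF Cinf_on_derivative[OF W G(1)] Cinf_on_derivative[OF W G(1)] w0]
  note sym = symmetric_second_derivative_vector[OF W G(1) w0]
  note an = anti[OF G(2)[OF w0]]
  show ?thesis unfolding d
    using closed an[of "fderiv (\<lambda>y. fderiv G y b) w0 a" "fderiv G w0 c"]
      an[of "fderiv (\<lambda>y. fderiv G y c) w0 a" "fderiv G w0 b"]
      an[of "fderiv (\<lambda>y. fderiv G y c) w0 b" "fderiv G w0 a"] sym[of a b] sym[of a c] sym[of b c]
    by simp
qed

end

lemma fderiv_eq_along_subspace:
  assumes V: "subspace V" "openin (top_of_set V) S" and x: "x \<in> S" and a: "a \<in> V"
    and f: "f differentiable (at x)" and g: "g differentiable (at x)" and eq: "\<And>y. y \<in> S \<Longrightarrow> f y = g y"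
  shows "fderiv f x a = fderiv g x a"
proof -
  have f': "(f has_derivative fderiv f x) (at x within S)" and g': "(g has_derivative fderiv g x) (at x within S)"
    using f g by (auto simp: frechet_derivative_works intro: has_derivative_at_withinI)
  have "(g has_derivative fderiv f x) (at x within S)"
    by (rule has_derivative_transform[OF x _ f']) (simp add: eq)
  from within_derivative_unique[OF V x this g' a] show ?thesis .
qed

section \<open>Hamiltonian flows preserve the symplectic form\<close>

lemma dmap_in_chart:
  assumes M: "smooth_manifold M" and N: "smooth_manifold N"
    and f: "smooth_map_on M N W f" and p: "p \<in> W" and q: "q \<in> points N" "f p \<in> cdom N q"
  shows "dmap M N f p u = tchange N q (f p) (f p) (sderiv (model M) (\<lambda>y. coord N q (f (cinv M p y))) (coord M p p) u)"
    and "sderiv (model M) (\<lambda>y. coord N q (f (cinv M p y))) (coord M p p) u \<in> model N"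
proof -
  note V = manifold_model[OF M]
  have pp: "p \<in> points M" and fp: "f p \<in> points N"
    using smooth_map_on_subset[OF f] p smooth_map_on_points[OF f p] by auto
  have pc: "p \<in> cdom M p" "f p \<in> cdom N (f p)" by (rule manifold_centre[OF M pp], rule manifold_centre[OF N fp])
  define D where "D = {x \<in> W \<inter> cdom M p. f x \<in> cdom N (f p)} \<inter> {x \<in> W \<inter> cdom M p. f x \<in> cdom N q}"
  have oD: "openin (top_of_set (model M)) (coord M p ` D)"
    unfolding D_def using smooth_map_on_coordinate_domain(1)[OF M N f pp]  fp q
    by (intro coord_image_open[OF M pp] openin_Int) auto
  have x: "coord M p p \<in> coord M p ` D" using p pc q by (auto simp: D_def)
  have sm: "smooth_on (coord M p ` {x \<in> W \<inter> cdom M p. f x \<in> cdom N r}) (\<lambda>y. coord N r (f (cinv M p y)))"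
    if "r \<in> points N" for r using f pp that unfolding smooth_map_on_def by blast
  have s1: "smooth_on (coord M p ` D) (\<lambda>y. coord N q (f (cinv M p y)))"
    by (rule smooth_on_subset[OF sm[OF q(1)]]) (auto simp: D_def)
  have s2: "smooth_on (coord M p ` D) (\<lambda>y. coord N (f p) (f (cinv M p y)))"
    by (rule smooth_on_subset[OF sm[OF fp]]) (auto simp: D_def)
  have sub: "coord N q (f (cinv M p y)) \<in> coord N q ` (cdom N q \<inter> cdom N (f p))" if "y \<in> coord M p ` D" for y
    using that cinv_coord[OF M pp] by (auto simp: D_def)
  have "sderiv (model M) (\<lambda>y. coord N (f p) (f (cinv M p y))) (coord M p p) =
      sderiv (model M) (\<lambda>y. coord N (f p) (cinv N q (coord N q (f (cinv M p y))))) (coord M p p)"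
    by (rule sderiv_cong[OF V oD s2 x]) (use cinv_coord[OF M pp] cinv_coord[OF N q(1)] in \<open>auto simp: D_def\<close>)
  then show "dmap M N f p u = tchange N q (f p) (f p) (sderiv (model M) (\<lambda>y. coord N q (f (cinv M p y))) (coord M p p) u)"
    unfolding dmap_def tchange_def
    using sderiv_compose[OF V oD s1 x manifold_model[OF N] overlap_open[OF N q(1) fp] manifold_transition[OF N q(1) fp] sub, of u]
      cinv_coord[OF M pp pc(1)] by simp
  show "sderiv (model M) (\<lambda>y. coord N q (f (cinv M p y))) (coord M p p) u \<in> model N"
    by (rule sderiv_in_subspace[OF V oD s1 x manifold_model[OF N]])
      (use cinv_coord[OF M pp] coord_model[OF N q(1)] in \<open>auto simp: D_def\<close>)
qed


context
  fixes M :: "('a, 'e::euclidean_space, 'x) symplectic_scheme" and \<delta> :: real and h :: "real \<Rightarrow> 'a \<Rightarrow> real"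
    and \<Phi> :: "real \<Rightarrow> 'a \<Rightarrow> 'a"
  assumes M: "symplectic_manifold M" and h: "smooth_hamiltonian M \<delta> h" and \<Phi>: "is_ham_flow M \<delta> h \<Phi>"
begin

lemma flow_trajectory: "p \<in> points M \<Longrightarrow> ham_trajectory M \<delta> h (\<lambda>t. \<Phi> t p)"
  and flow_0: "p \<in> points M \<Longrightarrow> \<Phi> 0 p = p"
  and flow_continuous: "continuous_map (prod_topology (top_of_set {0..\<delta>}) (mtop M)) (mtop M) (\<lambda>(t, p). \<Phi> t p)"
  and flow_smooth: "p \<in> points M \<Longrightarrow> q \<in> points M \<Longrightarrow>
    smooth_on {(t, x). t \<in> {0..\<delta>} \<and> x \<in> crange M p \<and> \<Phi> t (cinv M p x) \<in> cdom M q}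
      (\<lambda>(t, x). coord M q (\<Phi> t (cinv M p x)))"
  using \<Phi> by (auto simp: is_ham_flow_def)

lemma flow_smooth_map:
  assumes t: "t \<in> {0..\<delta>}"
  shows "smooth_map_on M M (points M) (\<Phi> t)"
  unfolding smooth_map_on_def
proof (intro conjI ballI)
  note S = symplectic_smooth[OF M]
  have "continuous_map (mtop M) (prod_topology (top_of_set {0..\<delta>}) (mtop M)) (\<lambda>p. (t, p))"
    using t by (intro continuous_map_pairedI) auto
  from continuous_map_compose[OF this flow_continuous]
  show "continuous_map (subtopology (mtop M) (points M)) (mtop M) (\<Phi> t)" by (simp add: o_def)
  fix p q assume p: "p \<in> points M" and q: "q \<in> points M"
  let ?S = "coord M p ` {x \<in> points M \<inter> cdom M p. \<Phi> t x \<in> cdom M q}"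
  have "smooth_on ?S (\<lambda>x. (\<lambda>(t, x). coord M q (\<Phi> t (cinv M p x))) (t, x))"
    by (rule smooth_on_compose[OF smooth_on_Pair[OF smooth_on_const smooth_on_id] flow_smooth[OF p q]])
      (use t cinv_coord[OF S p] in auto)
  then show "smooth_on ?S (\<lambda>y. coord M q (\<Phi> t (cinv M p y)))" by simp
qed simp

end

text \<open>The flow is symplectic once this is known to be constant in \<open>t\<close>.\<close>

definition transported_form ::
    "('a, 'e::euclidean_space, 'x) symplectic_scheme \<Rightarrow> (real \<Rightarrow> 'a \<Rightarrow> 'a) \<Rightarrow> 'a \<Rightarrow> 'e \<Rightarrow> 'e \<Rightarrow> real \<Rightarrow> real" where
  "transported_form M \<Phi> p u v t = form M (\<Phi> t p) (dmap M M (\<Phi> t) p u) (dmap M M (\<Phi> t) p v)"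

text \<open>The local form, extended to an open set of the ambient space of the model and to all vectors there,
  as the calculus of bilinear expressions above requires.\<close>

definition ambient_form ::
    "('a, 'e::euclidean_space, 'x) symplectic_scheme \<Rightarrow> 'a \<Rightarrow> 'e \<Rightarrow> 'e \<Rightarrow> 'e \<Rightarrow> real" where
  "ambient_form M q y a b =
     local_form M q (proj (model M) y) (proj (model M) a) (proj (model M) b)"

lemma ambient_form:
  fixes M :: "('a, 'e::euclidean_space, 'x) symplectic_scheme"
  assumes M: "symplectic_manifold M" and q: "q \<in> points M"
  defines "U \<equiv> proj (model M) -` crange M q"
  shows ambient_open: "open U"
    and ambient_linear: "y \<in> U \<Longrightarrow> linear (ambient_form M q y a)" "y \<in> U \<Longrightarrow> linear (\<lambda>a. ambient_form M q y a b)"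
    and ambient_smooth: "Cinf_on U (\<lambda>y. ambient_form M q y a b)"
    and ambient_antisym: "y \<in> U \<Longrightarrow> ambient_form M q y b a = - ambient_form M q y a b"
    and crange_ambient: "crange M q \<subseteq> U"
    and ambient_eq: "y \<in> crange M q \<Longrightarrow> u \<in> model M \<Longrightarrow> v \<in> model M \<Longrightarrow>
      ambient_form M q y u v = local_form M q y u v"
    and ambient_closed: "y \<in> crange M q \<Longrightarrow> u \<in> model M \<Longrightarrow> v \<in> model M \<Longrightarrow> w \<in> model M \<Longrightarrow>
      fderiv (\<lambda>y. ambient_form M q y v w) y u + fderiv (\<lambda>y. ambient_form M q y w u) y v +
      fderiv (\<lambda>y. ambient_form M q y u v) y w = 0"
proof -
  note S = symplectic_smooth[OF M]
  note V = manifold_model[OF S]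
  have oc: "openin (top_of_set (model M)) (crange M q)" by (rule chart_range_open[OF manifold_chart[OF S q]])
  show "open U" unfolding U_def by (rule open_proj_vimage[OF V oc])
  show "y \<in> U \<Longrightarrow> linear (ambient_form M q y a)" "y \<in> U \<Longrightarrow> linear (\<lambda>a. ambient_form M q y a b)"
    unfolding ambient_form_def U_def
    using bilinear_form_on_proj[OF V local_form_bilinear(1)[OF M q]] by auto
  show "Cinf_on U (\<lambda>y. ambient_form M q y a b)"
    unfolding ambient_form_def U_def
    by (rule smooth_on_imp_Cinf_on_proj[OF V oc local_form_smooth[OF M q proj_in[OF V] proj_in[OF V]]])
  show "y \<in> U \<Longrightarrow> ambient_form M q y b a = - ambient_form M q y a b"
    unfolding ambient_form_def U_def
    by (rule local_form_bilinear(2)[OF M q _ proj_in[OF V] proj_in[OF V]]) simp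
  show "crange M q \<subseteq> U" using proj_id[OF V crange_model[OF S q]] by (auto simp: U_def)
  show "ambient_form M q y u v = local_form M q y u v"
    if "y \<in> crange M q" "u \<in> model M" "v \<in> model M"
    unfolding ambient_form_def using that proj_id[OF V] crange_model[OF S q] by simp
  have "fderiv (\<lambda>y. ambient_form M q y b c) y a = sderiv (model M) (\<lambda>y. local_form M q y b c) y a"
    if "b \<in> model M" "c \<in> model M" for a b c y
    unfolding ambient_form_def sderiv_def using proj_id[OF V] that by simp
  then show "fderiv (\<lambda>y. ambient_form M q y v w) y u + fderiv (\<lambda>y. ambient_form M q y w u) y v +
      fderiv (\<lambda>y. ambient_form M q y u v) y w = 0"
    if "y \<in> crange M q" "u \<in> model M" "v \<in> model M" "w \<in> model M"
    using local_form_closed[OF M q that] that by simp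
qed

context
  fixes M :: "('a, 'e::euclidean_space, 'x) symplectic_scheme" and \<delta> :: real and h :: "real \<Rightarrow> 'a \<Rightarrow> real"
    and \<Phi> :: "real \<Rightarrow> 'a \<Rightarrow> 'a"
  assumes M: "symplectic_manifold M" and h: "smooth_hamiltonian M \<delta> h" and \<Phi>: "is_ham_flow M \<delta> h \<Phi>"
begin

lemma flow_slice_smooth:
  assumes t: "t \<in> {0..\<delta>}" and p: "p \<in> points M" and q: "q \<in> points M"
  defines "R \<equiv> coord M p ` {x \<in> points M \<inter> cdom M p. \<Phi> t x \<in> cdom M q}"
  shows "openin (top_of_set (model M)) R" "smooth_on R (\<lambda>y. coord M q (\<Phi> t (cinv M p y)))"
    "y \<in> R \<longleftrightarrow> y \<in> crange M p \<and> \<Phi> t (cinv M p y) \<in> cdom M q"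
proof -
  note S = symplectic_smooth[OF M]
  note f = flow_smooth_map[OF M h \<Phi> t]
  show "openin (top_of_set (model M)) R" unfolding R_def
    by (rule smooth_map_on_coordinate_domain(2)[OF S S f p q])
  show "smooth_on R (\<lambda>y. coord M q (\<Phi> t (cinv M p y)))"
    using f p q unfolding smooth_map_on_def R_def by blast
  show "y \<in> R \<longleftrightarrow> y \<in> crange M p \<and> \<Phi> t (cinv M p y) \<in> cdom M q"
    unfolding R_def using cinv_coord[OF S p] cdom_points[OF S p] by auto
qed

lemma transported_form_in_chart:
  assumes t: "t \<in> {0..\<delta>}" and p: "p \<in> points M" and q: "q \<in> points M" "\<Phi> t p \<in> cdom M q"
    and Q: "open Q" "(t, coord M p p) \<in> Q" "Cinf_on Q g"
    and eq: "\<And>y. y \<in> crange M p \<Longrightarrow> \<Phi> t (cinv M p y) \<in> cdom M q \<Longrightarrow> (t, y) \<in> Q \<Longrightarrow>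
      g (t, y) = coord M q (\<Phi> t (cinv M p y))"
    and uv: "u \<in> model M" "v \<in> model M"
  shows "transported_form M \<Phi> p u v t =
    ambient_form M q (g (t, coord M p p)) (fderiv g (t, coord M p p) (0, u)) (fderiv g (t, coord M p p) (0, v))"
proof -
  note S = symplectic_smooth[OF M]
  note V = manifold_model[OF S]
  note f = flow_smooth_map[OF M h \<Phi> t]
  define x0 where "x0 = coord M p p"
  let ?s = "sderiv (model M) (\<lambda>y. coord M q (\<Phi> t (cinv M p y))) x0"
  have pc: "p \<in> cdom M p" by (rule manifold_centre[OF S p])
  have x0: "x0 \<in> crange M p" "cinv M p x0 = p" using pc cinv_coord[OF S p pc] by (auto simp: x0_def)
  note sl = flow_slice_smooth[OF t p q(1)]
  have s: "?s w = fderiv g (t, x0) (0, w)" if "w \<in> model M" for w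
    by (rule sderiv_slice[OF V sl(1,2) _ that Q(1) Q(2)[folded x0_def] Q(3)])
      (use sl(3) x0 q(2) eq in auto)
  have sV: "?s w \<in> model M" for w
    using dmap_in_chart(2)[OF S S f p q, of w] by (simp add: x0_def)
  have "transported_form M \<Phi> p u v t =
      form M (\<Phi> t p) (tchange M q (\<Phi> t p) (\<Phi> t p) (?s u)) (tchange M q (\<Phi> t p) (\<Phi> t p) (?s v))"
    unfolding transported_form_def dmap_in_chart(1)[OF S S f p q] x0_def ..
  also have "\<dots> = local_form M q (coord M q (\<Phi> t p)) (?s u) (?s v)"
    by (rule local_form_at[OF M q sV sV, symmetric])
  also have "\<dots> = ambient_form M q (coord M q (\<Phi> t p)) (?s u) (?s v)"
    by (rule ambient_eq[OF M q(1) imageI[OF q(2)] sV sV, symmetric])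
  also have "coord M q (\<Phi> t p) = g (t, x0)"
    using eq[OF x0(1)] x0(2) q(2) Q(2) by (simp add: x0_def)
  finally show ?thesis unfolding s[OF uv(1)] s[OF uv(2)] unfolding x0_def .
qed

text \<open>At the ends of the time interval the flow has only one-sided derivatives in time; constancy will follow from a
  vanishing derivative in the interior together with continuity on the closed interval.  Continuity
  comes from a smooth extension of the flow beyond the interval.\<close>

lemma transported_form_continuous:
  assumes p: "p \<in> points M" and uv: "u \<in> model M" "v \<in> model M"
  shows "continuous_on {0..\<delta>} (transported_form M \<Phi> p u v)"
proof (subst continuous_on_eq_continuous_within, rule ballI)
  fix t0 assume t0: "t0 \<in> {0..\<delta>}"
  note S = symplectic_smooth[OF M]
  note V = manifold_model[OF S]
  define q where "q = \<Phi> t0 p"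
  have q: "q \<in> points M" unfolding q_def by (rule smooth_map_on_points[OF flow_smooth_map[OF M h \<Phi> t0] p])
  define x0 where "x0 = coord M p p"
  have pc: "p \<in> cdom M p" by (rule manifold_centre[OF S p])
  have x0: "x0 \<in> crange M p" "cinv M p x0 = p" using pc cinv_coord[OF S p pc] by (auto simp: x0_def)
  have in0: "(t0, x0) \<in> {(t, x). t \<in> {0..\<delta>} \<and> x \<in> crange M p \<and> \<Phi> t (cinv M p x) \<in> cdom M q}"
    using t0 x0 manifold_centre[OF S q] by (simp add: q_def)
  obtain Q g where Q: "open Q" "(t0, x0) \<in> Q" "Cinf_on Q g"
    and g: "\<And>z. z \<in> Q \<Longrightarrow> z \<in> {(t, x). t \<in> {0..\<delta>} \<and> x \<in> crange M p \<and> \<Phi> t (cinv M p x) \<in> cdom M q} \<Longrightarrow>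
      g z = (\<lambda>(t, x). coord M q (\<Phi> t (cinv M p x))) z"
    by (rule smooth_onE[OF flow_smooth[OF M h \<Phi> p q] in0]) blast
  let ?U = "proj (model M) -` crange M q"
  define Q' where "Q' = Q \<inter> g -` ?U"
  have oQ': "open Q'" unfolding Q'_def
    by (rule continuous_open_preimage[OF Cinf_on_imp_continuous_on[OF Q(3)] Q(1) ambient_open[OF M q]])
  have "g (t0, x0) \<in> crange M q" using g[OF Q(2) in0] x0 manifold_centre[OF S q] by (simp add: q_def)
  then have in0': "(t0, x0) \<in> Q'" using Q(2) crange_ambient[OF M q] by (auto simp: Q'_def)
  have gQ': "Cinf_on Q' g" by (rule Cinf_on_subset[OF Q(3)]) (simp add: Q'_def)
  define \<beta> where "\<beta> z = ambient_form M q (g z) (fderiv g z (0, u)) (fderiv g z (0, v))" for z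
  have gU: "g z \<in> ?U" if "z \<in> Q'" for z using that by (simp add: Q'_def)
  have "Cinf_on Q' \<beta>" unfolding \<beta>_def
    by (rule Cinf_on_form_apply[where U = ?U, OF ambient_open[OF M q] oQ' ambient_linear[OF M q] ambient_smooth[OF M q] gQ'
        gU Cinf_on_derivative[OF oQ' gQ'] Cinf_on_derivative[OF oQ' gQ']])
  then have "continuous_on Q' \<beta>" by (rule Cinf_on_imp_continuous_on)
  then have "isCont \<beta> (t0, x0)" using oQ' in0' continuous_on_eq_continuous_at by blast
  moreover have "continuous (at t0 within {0..\<delta>}) (\<lambda>t. (t, x0))" by (intro continuous_intros)
  ultimately have c: "continuous (at t0 within {0..\<delta>}) (\<lambda>t. \<beta> (t, x0))"
    using continuous_within_compose3[of "\<lambda>t. (t, x0)" t0 \<beta> "{0..\<delta>}"] by simp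
  have "continuous_map (top_of_set {0..\<delta>}) (mtop M) (\<lambda>t. \<Phi> t p)"
    using flow_trajectory[OF M h \<Phi> p] by (simp add: ham_trajectory_def)
  then have "openin (top_of_set {0..\<delta>}) {t \<in> {0..\<delta>}. \<Phi> t p \<in> cdom M q}"
    using openin_continuous_map_preimage[OF _ chart_open[OF manifold_chart[OF S q]]] by fastforce
  then obtain T where T: "open T" "{t \<in> {0..\<delta>}. \<Phi> t p \<in> cdom M q} = {0..\<delta>} \<inter> T"
    using openin_open by blast
  have oT': "open ((\<lambda>t. (t, x0)) -` Q')" using oQ' by (intro open_vimage continuous_intros)
  have eq: "transported_form M \<Phi> p u v t = \<beta> (t, x0)"
    if "t \<in> {0..\<delta>}" "t \<in> T \<inter> (\<lambda>t. (t, x0)) -` Q'" for t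
    unfolding \<beta>_def x0_def
  proof (rule transported_form_in_chart[OF that(1) p q _ oQ' _ gQ' _ uv])
    show "\<Phi> t p \<in> cdom M q" using that T(2) by blast
    show "(t, coord M p p) \<in> Q'" using that(2) by (simp add: x0_def)
    fix y assume "y \<in> crange M p" "\<Phi> t (cinv M p y) \<in> cdom M q" "(t, y) \<in> Q'"
    then show "g (t, y) = coord M q (\<Phi> t (cinv M p y))" using g[of "(t, y)"] that(1) by (simp add: Q'_def)
  qed
  have t0T: "t0 \<in> T \<inter> (\<lambda>t. (t, x0)) -` Q'" using T(2) t0 in0 in0' x0 by auto
  have "\<forall>\<^sub>F t in at t0 within {0..\<delta>}. \<beta> (t, x0) = transported_form M \<Phi> p u v t"
    using eq t0T T(1) oT' by (auto simp: eventually_at_topological intro!: exI[of _ "T \<inter> (\<lambda>t. (t, x0)) -` Q'"])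
  then show "continuous (at t0 within {0..\<delta>}) (transported_form M \<Phi> p u v)"
    using c eq[OF t0 t0T] unfolding continuous_within by (simp add: tendsto_cong)
qed

text \<open>On space-time the flow pulls the form back to a closed form \<open>\<beta>\<close> with
  \<open>\<beta>(\<partial>\<^sub>t, v) = d(h \<circ> \<Phi>) v\<close>.  Closedness, applied to \<open>\<partial>\<^sub>t\<close> and two space directions, expresses the time
  derivative of \<open>\<beta>(u, v)\<close> as a difference of two mixed second derivatives of \<open>h \<circ> \<Phi>\<close>.\<close>

lemma transported_form_derivative:
  assumes p: "p \<in> points M" and uv: "u \<in> model M" "v \<in> model M" and t0: "0 < t0" "t0 < \<delta>"
  shows "DERIV (transported_form M \<Phi> p u v) t0 :> 0"
proof -
  note S = symplectic_smooth[OF M]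
  note V = manifold_model[OF S]
  have t0': "t0 \<in> {0..\<delta>}" using t0 by simp
  define q where "q = \<Phi> t0 p"
  have q: "q \<in> points M" unfolding q_def by (rule smooth_map_on_points[OF flow_smooth_map[OF M h \<Phi> t0'] p])
  define x0 where "x0 = coord M p p"
  have pc: "p \<in> cdom M p" by (rule manifold_centre[OF S p])
  have x0: "x0 \<in> crange M p" "cinv M p x0 = p" "x0 \<in> model M"
    using pc cinv_coord[OF S p pc] coord_model[OF S p pc] by (auto simp: x0_def)
  define W where "W = (UNIV :: real set) \<times> model M"
  have W: "subspace W" unfolding W_def by (intro subspace_Times V) simp
  define F where "F z = coord M q (\<Phi> (fst z) (cinv M p (snd z)))" for z
  define S0 where "S0 = {(t, x). t \<in> {0<..<\<delta>} \<and> x \<in> crange M p \<and> \<Phi> t (cinv M p x) \<in> cdom M q}"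
  have oS0: "openin (top_of_set W) S0"
  proof -
    have "continuous_map (prod_topology (top_of_set {0..\<delta>}) (top_of_set (crange M p)))
        (prod_topology (top_of_set {0..\<delta>}) (mtop M)) (\<lambda>(t, x). (t, cinv M p x))"
      using cinv_continuous[OF S p] by (simp only: continuous_map_prod_top) (simp add: continuous_map_id[unfolded id_def])
    from continuous_map_compose[OF this flow_continuous[OF M h \<Phi>]]
    have "continuous_map (top_of_set ({0..\<delta>} \<times> crange M p)) (mtop M) (\<lambda>z. \<Phi> (fst z) (cinv M p (snd z)))"
      by (simp add: o_def split_beta)
    from openin_continuous_map_preimage[OF this chart_open[OF manifold_chart[OF S q]]]
    have "openin (top_of_set ({0..\<delta>} \<times> crange M p)) {z \<in> {0..\<delta>} \<times> crange M p. \<Phi> (fst z) (cinv M p (snd z)) \<in> cdom M q}"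
      by simp
    then obtain T where T: "open T"
      "{z \<in> {0..\<delta>} \<times> crange M p. \<Phi> (fst z) (cinv M p (snd z)) \<in> cdom M q} = ({0..\<delta>} \<times> crange M p) \<inter> T"
      using openin_open by blast
    obtain T' where T': "open T'" "crange M p = model M \<inter> T'"
      using chart_range_open[OF manifold_chart[OF S p]] openin_open by blast
    have T3: "\<Phi> (fst z) (cinv M p (snd z)) \<in> cdom M q \<longleftrightarrow> z \<in> T" if "z \<in> {0..\<delta>} \<times> crange M p" for z
      using that eqset_imp_iff[OF T(2), of z] by simp
    have cr: "x \<in> crange M p \<longleftrightarrow> x \<in> model M \<and> x \<in> T'" for x
      using eqset_imp_iff[OF T'(2), of x] by simp
    have "z \<in> S0 \<longleftrightarrow> z \<in> W \<inter> (({0<..<\<delta>} \<times> T') \<inter> T)" for z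
    proof -
      obtain t x where z: "z = (t, x)" by (cases z)
      show ?thesis
        using T3[of z] cr[of x] unfolding z S0_def W_def by (simp del: image_iff) (metis less_imp_le)
    qed
    then have "S0 = W \<inter> (({0<..<\<delta>} \<times> T') \<inter> T)" by blast
    then show ?thesis
      using T(1) T'(1) by (auto simp: openin_open intro!: exI[of _ "({0<..<\<delta>} \<times> T') \<inter> T"] open_Times)
  qed
  have S0W: "z \<in> W" if "z \<in> S0" for z using openin_imp_subset[OF oS0] that by blast
  have sF: "smooth_on S0 F"
    by (rule smooth_on_cong[OF smooth_on_subset[OF flow_smooth[OF M h \<Phi> p q]]]) (auto simp: S0_def F_def)
  have FV: "F z \<in> crange M q" "F z \<in> model M" if "z \<in> S0" for z
    using that coord_model[OF S q] by (auto simp: F_def S0_def)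
  define Q where "Q = proj W -` S0"
  have oQ: "open Q" unfolding Q_def by (rule open_proj_vimage[OF W oS0])
  have S0Q: "z \<in> Q" "proj W z = z" if "z \<in> S0" for z
    using proj_id[OF W S0W[OF that]] that by (auto simp: Q_def)
  define G where "G z = F (proj W z)" for z
  have cG: "Cinf_on Q G" unfolding G_def Q_def by (rule smooth_on_imp_Cinf_on_proj[OF W oS0 sF])
  have GF: "G z = F z" if "z \<in> S0" for z using S0Q[OF that] by (simp add: G_def)
  let ?U = "proj (model M) -` crange M q"
  have GU: "G z \<in> ?U" if "z \<in> Q" for z
  proof -
    have "proj W z \<in> S0" using that by (simp add: Q_def)
    then show ?thesis unfolding G_def by (rule subsetD[OF crange_ambient[OF M q] FV(1)])
  qed
  have dGV: "fderiv G z a \<in> model M" if "z \<in> S0" for z a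
    using sderiv_in_subspace[OF W oS0 sF that V FV(2), of a] by (simp add: sderiv_def G_def[abs_def])
  define K where "K z = h (fst (proj W z)) (cinv M q (F (proj W z)))" for z
  have "smooth_on ({0..\<delta>} \<times> crange M q) (\<lambda>(t, x). h t (cinv M q x))"
    using h q by (simp add: smooth_hamiltonian_def)
  then have "smooth_on S0 (\<lambda>z. (\<lambda>(t, x). h t (cinv M q x)) (fst z, F z))"
    by (rule smooth_on_compose[OF smooth_on_Pair[OF smooth_on_bounded_linear[OF bounded_linear_fst] sF]])
      (use FV in \<open>auto simp: S0_def\<close>)
  then have "smooth_on S0 (\<lambda>z. h (fst z) (cinv M q (F z)))" by simp
  then have cK: "Cinf_on Q K" unfolding K_def Q_def by (rule smooth_on_imp_Cinf_on_proj[OF W oS0])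
  define e :: "real \<times> 'e" where "e = (1, 0)"
  note amb = ambient_open[OF M q] oQ ambient_linear[OF M q] ambient_smooth[OF M q] cG GU
  \<comment> \<open>Hamilton's equation, \<open>\<beta>(\<partial>\<^sub>t, w) = d(h \<circ> \<Phi>) w\<close>.  It holds at the points of \<open>S0\<close> only, where \<open>G\<close> is the
    coordinate expression of the flow.\<close>
  have ham: "ambient_form M q (G z) (fderiv G z e) (fderiv G z (0, w)) = fderiv K z (0, w)"
    if z: "z \<in> S0" and w: "w \<in> model M" for z w
  proof -
    obtain t x where tx: "z = (t, x)" by (cases z)
    have t: "0 < t" "t < \<delta>" and x: "x \<in> crange M p" "\<Phi> t (cinv M p x) \<in> cdom M q"
      using z by (auto simp: tx S0_def)
    have t': "t \<in> {0..\<delta>}" using t by simp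
    have xp: "cinv M p x \<in> points M" using cinv_in[OF S x(1)] cdom_points[OF S p] by blast
    obtain \<xi> where \<xi>: "\<xi> \<in> model M"
      "((\<lambda>s. coord M q (\<Phi> s (cinv M p x))) has_vector_derivative \<xi>) (at t within {0..\<delta>})"
      "\<And>v. v \<in> model M \<Longrightarrow> local_form M q (coord M q (\<Phi> t (cinv M p x))) \<xi> v =
        sderiv (model M) (\<lambda>y. h t (cinv M q y)) (coord M q (\<Phi> t (cinv M p x))) v"
      using ham_trajectory_in_chart[OF M h flow_trajectory[OF M h \<Phi> xp] t' q x(2)] by metis
    have \<xi>e: "\<xi> = fderiv G z e"
    proof -
      have "((\<lambda>s. (s, x)) has_derivative (\<lambda>s. (s, 0))) (at t)" by (auto intro!: derivative_eq_intros)
      then have 1: "((\<lambda>s. G (s, x)) has_derivative (\<lambda>s. fderiv G (t, x) (s, 0))) (at t)"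
        by (rule has_derivative_compose[where f = "\<lambda>s. (s, x)" and g = G, OF _
            Cinf_on_has_derivative[OF cG S0Q(1)[OF z[unfolded tx]]]])
      have "fderiv G (t, x) (s, 0) = s *\<^sub>R fderiv G z e" for s
        using linear_scale[OF has_derivative_linear[OF Cinf_on_has_derivative[OF cG S0Q(1)[OF z]]], of s e]
        by (simp add: tx e_def)
      then have 2: "((\<lambda>s. G (s, x)) has_vector_derivative fderiv G z e) (at t)"
        using 1 by (simp add: has_vector_derivative_def)
      have "open ((\<lambda>s. (s, x)) -` Q)" using oQ by (intro open_vimage continuous_intros)
      then have op: "open ((\<lambda>s. (s, x)) -` Q \<inter> {0<..<\<delta>})" by (intro open_Int) auto
      have inQ: "(s, x) \<in> S0" if "s \<in> (\<lambda>s. (s, x)) -` Q \<inter> {0<..<\<delta>}" for s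
      proof -
        have "(s, x) \<in> W" using crange_model[OF S p x(1)] by (simp add: W_def)
        then show ?thesis using that proj_id[OF W, of "(s, x)"] by (simp add: Q_def)
      qed
      have 3: "((\<lambda>s. coord M q (\<Phi> s (cinv M p x))) has_vector_derivative fderiv G z e) (at t)"
        by (rule has_vector_derivative_transform_within_open[OF 2 op])
          (use S0Q(1)[OF z] t in \<open>simp add: tx\<close>, use GF[OF inQ] in \<open>simp add: F_def\<close>)
      have "at t within {0..\<delta>} = at t" using t by (rule at_within_Icc_at)
      then have "((\<lambda>s. coord M q (\<Phi> s (cinv M p x))) has_vector_derivative \<xi>) (at t)" using \<xi>(2) by simp
      then show ?thesis by (rule vector_derivative_unique_at[OF _ 3])
    qed
    define R where "R = coord M p ` {x \<in> points M \<inter> cdom M p. \<Phi> t x \<in> cdom M q}"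
    have R: "openin (top_of_set (model M)) R" "smooth_on R (\<lambda>y. coord M q (\<Phi> t (cinv M p y)))"
      "\<And>y. y \<in> R \<longleftrightarrow> y \<in> crange M p \<and> \<Phi> t (cinv M p y) \<in> cdom M q"
      unfolding R_def by (rule flow_slice_smooth[OF t' p q])+
    have xR: "x \<in> R" using x R(3) by simp
    have tyS: "(t, y) \<in> S0" if "y \<in> R" for y using that t R(3) by (simp add: S0_def)
    have sG: "sderiv (model M) (\<lambda>y. coord M q (\<Phi> t (cinv M p y))) x w = fderiv G z (0, w)"
      unfolding tx by (rule sderiv_slice[OF V R(1,2) xR w oQ S0Q(1)[OF z[unfolded tx]] cG])
        (use GF[OF tyS] in \<open>simp add: F_def\<close>)
    have hs: "smooth_on (crange M q) (\<lambda>y. h t (cinv M q y))" by (rule smooth_hamiltonian_slice[OF M h t' q])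
    have RF: "coord M q (\<Phi> t (cinv M p y)) \<in> crange M q" if "y \<in> R" for y using that R(3) by blast
    have "sderiv (model M) (\<lambda>y. h t (cinv M q (coord M q (\<Phi> t (cinv M p y))))) x w =
        sderiv (model M) (\<lambda>y. h t (cinv M q y)) (coord M q (\<Phi> t (cinv M p x)))
          (sderiv (model M) (\<lambda>y. coord M q (\<Phi> t (cinv M p y))) x w)"
      by (rule sderiv_compose[OF V R(1,2) xR V chart_range_open[OF manifold_chart[OF S q]] hs RF])
    also have "sderiv (model M) (\<lambda>y. h t (cinv M q (coord M q (\<Phi> t (cinv M p y))))) x w = fderiv K z (0, w)"
      unfolding tx by (rule sderiv_slice[OF V R(1) smooth_on_compose[OF R(2) hs RF] xR w oQ S0Q(1)[OF z[unfolded tx]] cK])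
        (use S0Q(2)[OF tyS] in \<open>simp_all add: K_def F_def\<close>)
    finally have "fderiv K z (0, w) = local_form M q (coord M q (\<Phi> t (cinv M p x))) \<xi> (fderiv G z (0, w))"
      unfolding sG using \<xi>(3)[OF dGV[OF z]] by simp
    then show ?thesis
      unfolding \<xi>e using ambient_eq[OF M q FV(1)[OF z] dGV[OF z] dGV[OF z]] GF[OF z] by (simp add: F_def tx)
  qed
  define z0 where "z0 = (t0, x0)"
  have z0: "z0 \<in> S0" using t0 x0 manifold_centre[OF S q] by (auto simp: z0_def S0_def q_def)
  note z0Q = S0Q(1)[OF z0]
  have uvW: "(0, u) \<in> W" "(0, v) \<in> W" using uv by (auto simp: W_def)
  note cd = Cinf_on_derivative[OF oQ cG]
  note diffB = differentiableI[OF Cinf_on_has_derivative[OF Cinf_on_form_apply[OF amb cd cd] z0Q]]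
  note diffK = differentiableI[OF Cinf_on_has_derivative[OF Cinf_on_derivative[OF oQ cK] z0Q]]
  \<comment> \<open>Derivatives in directions of \<open>W\<close> depend only on the values on \<open>S0\<close>.\<close>
  have 1: "fderiv (\<lambda>w. ambient_form M q (G w) (fderiv G w e) (fderiv G w (0, u))) z0 (0, v) =
      fderiv (\<lambda>w. fderiv K w (0, u)) z0 (0, v)"
    by (rule fderiv_eq_along_subspace[OF W oS0 z0 uvW(2) diffB diffK ham[OF _ uv(1)]])
  have am: "ambient_form M q (G y) (fderiv G y (0, v)) (fderiv G y e) = - fderiv K y (0, v)" if "y \<in> S0" for y
    using ham[OF that uv(2)]
      ambient_antisym[OF M q GU[OF S0Q(1)[OF that]], where b = "fderiv G y (0, v)" and a = "fderiv G y e"]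
    by simp
  have "fderiv (\<lambda>w. ambient_form M q (G w) (fderiv G w (0, v)) (fderiv G w e)) z0 (0, u) =
      fderiv (\<lambda>w. - fderiv K w (0, v)) z0 (0, u)"
    by (rule fderiv_eq_along_subspace[OF W oS0 z0 uvW(1) diffB differentiable_minus[OF diffK] am])
  also have "\<dots> = - fderiv (\<lambda>w. fderiv K w (0, v)) z0 (0, u)"
    using frechet_derivative_at[OF has_derivative_minus[OF Cinf_on_has_derivative[OF Cinf_on_derivative[OF oQ cK] z0Q]]]
    by metis
  finally have 2: "fderiv (\<lambda>w. ambient_form M q (G w) (fderiv G w (0, v)) (fderiv G w e)) z0 (0, u) =
      - fderiv (\<lambda>w. fderiv K w (0, v)) z0 (0, u)" .
  have 3: "fderiv (\<lambda>w. fderiv K w (0, u)) z0 (0, v) = fderiv (\<lambda>w. fderiv K w (0, v)) z0 (0, u)"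
    by (rule symmetric_second_derivative[OF oQ cK z0Q])
  have Gz0: "G z0 \<in> crange M q" using GF[OF z0] FV(1)[OF z0] by simp
  have "fderiv (\<lambda>w. ambient_form M q (G w) (fderiv G w (0, u)) (fderiv G w (0, v))) z0 e +
    fderiv (\<lambda>w. ambient_form M q (G w) (fderiv G w (0, v)) (fderiv G w e)) z0 (0, u) +
    fderiv (\<lambda>w. ambient_form M q (G w) (fderiv G w e) (fderiv G w (0, u))) z0 (0, v) = 0"
    by (rule pullback_closed[OF amb ambient_antisym[OF M q] z0Q ambient_closed[OF M q Gz0 dGV[OF z0] dGV[OF z0] dGV[OF z0]]])
  then have der0: "fderiv (\<lambda>w. ambient_form M q (G w) (fderiv G w (0, u)) (fderiv G w (0, v))) z0 e = 0"
    unfolding 1 2 3 by simp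
  define \<beta> where "\<beta> w = ambient_form M q (G w) (fderiv G w (0, u)) (fderiv G w (0, v))" for w
  have d\<beta>: "(\<beta> has_derivative fderiv \<beta> z0) (at (t0, x0))"
    unfolding \<beta>_def using Cinf_on_has_derivative[OF Cinf_on_form_apply[OF amb cd cd] z0Q] by (simp add: z0_def)
  have "((\<lambda>s. (s, x0)) has_derivative (\<lambda>s. (s, 0))) (at t0)" by (auto intro!: derivative_eq_intros)
  then have "((\<lambda>s. \<beta> (s, x0)) has_derivative (\<lambda>s. fderiv \<beta> z0 (s, 0))) (at t0)"
    by (rule has_derivative_compose[where f = "\<lambda>s. (s, x0)" and g = \<beta>, OF _ d\<beta>])
  moreover have "fderiv \<beta> z0 (s, 0) = 0" for s
    using linear_scale[OF has_derivative_linear[OF d\<beta>], of s e] der0 by (simp add: \<beta>_def[abs_def] e_def)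
  ultimately have d: "((\<lambda>s. \<beta> (s, x0)) has_derivative (\<lambda>s. 0)) (at t0)" by simp
  have "open ((\<lambda>s. (s, x0)) -` Q)" using oQ by (intro open_vimage continuous_intros)
  then have op: "open ((\<lambda>s. (s, x0)) -` Q \<inter> {0<..<\<delta>})" by (intro open_Int) auto
  have "(transported_form M \<Phi> p u v has_derivative (\<lambda>s. 0)) (at t0)"
  proof (rule has_derivative_transform_within_open[OF d op])
    show "t0 \<in> (\<lambda>s. (s, x0)) -` Q \<inter> {0<..<\<delta>}" using z0Q t0 by (simp add: z0_def)
    fix s assume s: "s \<in> (\<lambda>s. (s, x0)) -` Q \<inter> {0<..<\<delta>}"
    have "(s, x0) \<in> W" using x0 by (simp add: W_def)
    then have sS: "(s, x0) \<in> S0" using s proj_id[OF W, of "(s, x0)"] by (simp add: Q_def)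
    show "\<beta> (s, x0) = transported_form M \<Phi> p u v s"
      unfolding \<beta>_def x0_def
    proof (rule transported_form_in_chart[OF _ p q _ oQ _ cG _ uv, symmetric])
      show "s \<in> {0..\<delta>}" "\<Phi> s p \<in> cdom M q" "(s, coord M p p) \<in> Q"
        using s sS x0(2) by (auto simp: S0_def x0_def)
      fix y assume y: "y \<in> crange M p" "\<Phi> s (cinv M p y) \<in> cdom M q"
      then have "(s, y) \<in> S0" using s by (simp add: S0_def)
      then show "G (s, y) = coord M q (\<Phi> s (cinv M p y))" using GF by (simp add: F_def)
    qed
  qed
  then show ?thesis by (simp only: has_field_derivative_def lambda_zero)
qed

theorem flow_symplectic:
  assumes \<delta>: "0 < \<delta>" and p: "p \<in> points M" and uv: "u \<in> model M" "v \<in> model M"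
  shows "form M (\<Phi> \<delta> p) (dmap M M (\<Phi> \<delta>) p u) (dmap M M (\<Phi> \<delta>) p v) = form M p u v"
proof -
  note S = symplectic_smooth[OF M]
  have "transported_form M \<Phi> p u v \<delta> = transported_form M \<Phi> p u v 0"
    by (rule DERIV_isconst_end[OF \<delta> transported_form_continuous[OF p uv] transported_form_derivative[OF p uv]])
  moreover have "dmap M M (\<Phi> 0) p w = w" if w: "w \<in> model M" for w
  proof -
    obtain c where c: "curve_at M p c w" "\<And>t. c t \<in> points M" using curve_through[OF S p w] by metis
    have "smooth_map_on M M (points M) (\<Phi> 0)" by (rule flow_smooth_map[OF M h \<Phi>]) (use \<delta> in simp)
    from smooth_map_on_curve[OF S S this p c(1)]
    have "curve_at M p c (dmap M M (\<Phi> 0) p w)" using flow_0[OF M h \<Phi>] c(2) p by simp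
    then show ?thesis by (rule curve_at_unique[OF _ c(1)])
  qed
  ultimately show ?thesis using uv flow_0[OF M h \<Phi> p] by (simp add: transported_form_def)
qed

text \<open>The derivatives of a symplectic map are injective, since the form is nondegenerate, and the map itself
  is injective by uniqueness of trajectories.  It need not be onto: backward trajectories may leave
  the manifold before time \<open>\<delta>\<close> has passed.\<close>

theorem flow_open_embedding:
  assumes \<delta>: "0 < \<delta>"
  shows "open_embedding M M (\<Phi> \<delta>)"
proof (rule open_embedding_if_injective_immersion)
  note S = symplectic_smooth[OF M]
  have \<delta>': "\<delta> \<in> {0..\<delta>}" "0 \<in> {0..\<delta>}" using \<delta> by auto
  show "smooth_manifold M" by (rule S)
  show f: "smooth_map_on M M (points M) (\<Phi> \<delta>)" by (rule flow_smooth_map[OF M h \<Phi> \<delta>'(1)])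
  show "inj_on (\<Phi> \<delta>) (points M)"
  proof (rule inj_onI)
    fix p q assume pq: "p \<in> points M" "q \<in> points M" "\<Phi> \<delta> p = \<Phi> \<delta> q"
    have "\<Phi> 0 p = \<Phi> 0 q"
      by (rule ham_trajectory_unique[OF M h flow_trajectory[OF M h \<Phi> pq(1)] flow_trajectory[OF M h \<Phi> pq(2)] \<delta>'(1) pq(3) \<delta>'(2)])
    then show "p = q" using flow_0[OF M h \<Phi>] pq by simp
  qed
  fix p u assume p: "p \<in> points M" and u: "u \<in> model M" and 0: "dmap M M (\<Phi> \<delta>) p u = 0"
  have fp: "\<Phi> \<delta> p \<in> points M" by (rule smooth_map_on_points[OF f p])
  have "form M p u v = 0" if v: "v \<in> model M" for v
  proof -
    let ?v = "dmap M M (\<Phi> \<delta>) p v"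
    have "?v \<in> model M" by (rule dmap_in_model[OF S S f p v])
    from bilinear_form_onD(1)[OF form_bilinear[OF M fp] this this this, of 0 0]
    have "form M (\<Phi> \<delta> p) 0 ?v = 0" by simp
    then show ?thesis using flow_symplectic[OF \<delta> p u v] 0 by simp
  qed
  then show "u = 0" by (rule form_nondeg[OF M p u])
qed

end

section \<open>Perturbed Lagrangian correspondences\<close>

lemma dmap_eqI:
  assumes M: "smooth_manifold M" and N: "smooth_manifold N" and f: "smooth_map_on M N W f" and p: "p \<in> W"
    and c: "curve_at M p c v" and d: "curve_at N (f p) (\<lambda>t. f (c t)) w"
  shows "dmap M N f p v = w"
  by (rule curve_at_unique[OF smooth_map_on_curve[OF M N f p c] d])

lemma dmap_id:
  assumes M: "smooth_manifold M" and p: "p \<in> points M" and v: "v \<in> model M"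
  shows "dmap M M id p v = v"
proof -
  obtain c where c: "curve_at M p c v" using curve_through[OF M p v] by metis
  show ?thesis
    by (rule dmap_eqI[OF M M open_embedding_smooth[OF M M open_embedding_id[OF M]] p c]) (simp add: c)
qed

lemma dmap_map_prod:
  assumes M: "smooth_manifold M" "smooth_manifold M'" and N: "smooth_manifold N" "smooth_manifold N'"
    and f: "smooth_map_on M N (points M) f" and g: "smooth_map_on M' N' (points M') g"
    and p: "p \<in> points M" "q \<in> points M'" and uv: "u \<in> model M" "v \<in> model M'"
  shows "dmap (mprod M M') (mprod N N') (map_prod f g) (p, q) (u, v) = (dmap M N f p u, dmap M' N' g q v)"
proof -
  obtain c where c: "curve_at M p c u" using curve_through[OF M(1) p(1) uv(1)] by metis
  obtain d where d: "curve_at M' q d v" using curve_through[OF M(2) p(2) uv(2)] by metis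
  show ?thesis
  proof (rule dmap_eqI[OF smooth_manifold_mprod[OF M] smooth_manifold_mprod[OF N] smooth_map_on_map_prod[OF M N f g]])
    show "(p, q) \<in> points M \<times> points M'" using p by simp
    show "curve_at (mprod M M') (p, q) (\<lambda>t. (c t, d t)) (u, v)" using c d by (simp add: curve_at_mprod_iff)
    show "curve_at (mprod N N') (map_prod f g (p, q)) (\<lambda>t. map_prod f g (c t, d t)) (dmap M N f p u, dmap M' N' g q v)"
      using smooth_map_on_curve[OF M(1) N(1) f p(1) c] smooth_map_on_curve[OF M(2) N(2) g p(2) d]
      by (simp add: curve_at_mprod_iff)
  qed
qed

text \<open>Tangent spaces are carried over by the derivative \<open>(u, v) \<mapsto> (u, df v)\<close>, which is injective, hence keeps
  the dimension, and preserves the form of \<open>M\<^sup>- \<times> N\<close>, hence isotropy.\<close>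

lemma lagrangian_image:
  assumes M: "symplectic_manifold M" and N: "symplectic_manifold N" and f: "open_embedding N N f"
    and symp: "\<And>q u v. q \<in> points N \<Longrightarrow> u \<in> model N \<Longrightarrow> v \<in> model N \<Longrightarrow>
      form N (f q) (dmap N N f q u) (dmap N N f q v) = form N q u v"
    and L: "lagrangian (twisted_prod M N) L"
  shows "lagrangian (twisted_prod M N) (map_prod id f ` L)"
proof -
  note S = symplectic_smooth[OF M] symplectic_smooth[OF N]
  let ?P = "mprod M N" and ?F = "map_prod id f"
  note P = smooth_manifold_mprod[OF S]
  have F: "open_embedding ?P ?P ?F" by (rule open_embedding_map_prod[OF S S open_embedding_id[OF S(1)] f])
  have emb: "embedded_submanifold ?P L" using L by (simp add: lagrangian_def twisted_prod_as_manifold)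
  have Lp: "L \<subseteq> points ?P" using emb by (simp add: embedded_submanifold_def)
  show ?thesis
    unfolding lagrangian_def twisted_prod_as_manifold
  proof (intro conjI ballI)
    show "embedded_submanifold ?P (?F ` L)" by (rule embedded_submanifold_image[OF P P F refl emb])
    fix z assume "z \<in> ?F ` L"
    then obtain p q where pq: "(p, q) \<in> L" "z = ?F (p, q)" by auto
    then have pqp: "(p, q) \<in> points ?P" using Lp by blast
    then have pp: "p \<in> points M" "q \<in> points N" by auto
    note ts = tangent_space_image[OF P P F Lp pqp]
    have d: "2 * dim (tangent_space ?P L (p, q)) = dim (model (twisted_prod M N))"
      using L pq(1) by (simp only: lagrangian_def twisted_prod_as_manifold)
    then show "2 * dim (tangent_space ?P (?F ` L) z) = dim (model (twisted_prod M N))"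
      unfolding pq(2) dim_tangent_space_image[OF P P F Lp pqp] .
    fix a b assume "a \<in> tangent_space ?P (?F ` L) z" "b \<in> tangent_space ?P (?F ` L) z"
    then obtain u v where uv: "u \<in> tangent_space ?P L (p, q)" "v \<in> tangent_space ?P L (p, q)"
      "a = dmap ?P ?P ?F (p, q) u" "b = dmap ?P ?P ?F (p, q) v" unfolding pq(2) ts by blast
    obtain u1 u2 where u: "u = (u1, u2)" by (cases u)
    obtain v1 v2 where v: "v = (v1, v2)" by (cases v)
    have m: "u1 \<in> model M" "u2 \<in> model N" "v1 \<in> model M" "v2 \<in> model N"
      using uv(1,2) tangent_space_model[OF P P F pqp, of L] by (auto simp: u v)
    have fs: "smooth_map_on M M (points M) id" "smooth_map_on N N (points N) f"
      using open_embedding_id[OF S(1)] f by (auto simp: open_embedding_def)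
    note dF = dmap_map_prod[OF S S fs pp]
    have "form (twisted_prod M N) (p, q) u v = 0"
      using L pq(1) uv(1,2) by (simp only: lagrangian_def twisted_prod_as_manifold)
    then show "form (twisted_prod M N) z a b = 0"
      unfolding pq(2) uv(3,4) u v dF[OF m(1,2)] dF[OF m(3,4)] dmap_id[OF S(1) pp(1) m(1)] dmap_id[OF S(1) pp(1) m(3)]
      using symp[OF pp(2) m(2,4)] by simp
  qed
qed

lemma map_prod_continuous:
  assumes "continuous_map (mtop N) (mtop N) f"
  shows "continuous_map (mtop (twisted_prod M N)) (mtop (twisted_prod M N)) (map_prod id f)"
  using assms by (simp add: map_prod_def continuous_map_prod_top)


section \<open>Trajectories and their endpoints\<close>

lemma cyclic_mod:
  assumes "cyclic r f"
  shows "f (i mod Suc r) = f i"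
proof -
  have "f (k + n * Suc r) = f k" for k n
  proof (induction n)
    case (Suc n)
    have "f (k + Suc n * Suc r) = f (k + n * Suc r + Suc r)" by (simp add: algebra_simps)
    then show ?case using assms Suc unfolding cyclic_def by metis
  qed simp
  from this[of "i mod Suc r" "i div Suc r"] show ?thesis by (simp only: mod_div_mult_eq)
qed

lemma incoming_mod:
  assumes "0 < i"
  shows "incoming r y (i mod Suc r) = snd (y ((i - 1) mod Suc r))"
proof -
  have "(if i mod Suc r = 0 then r else i mod Suc r - 1) = (i - 1) mod Suc r"
    using assms by (cases i) (auto simp: mod_Suc)
  then show ?thesis by (simp add: incoming_def)
qed

lemma incoming_succ: "j \<le> r \<Longrightarrow> incoming r y (Suc j mod Suc r) = snd (y j)"
  using incoming_mod[of "Suc j" r y] by simp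

lemma ham_trajectory_cong:
  assumes x: "ham_trajectory M \<delta> h x" and eq: "\<And>t. t \<in> {0..\<delta>} \<Longrightarrow> x t = y t"
  shows "ham_trajectory M \<delta> h y"
  unfolding ham_trajectory_def
proof (intro conjI ballI)
  show "continuous_map (top_of_set {0..\<delta>}) (mtop M) y"
    by (rule continuous_map_eq[of _ _ x]) (use x eq in \<open>auto simp: ham_trajectory_def\<close>)
  fix t assume t: "t \<in> {0..\<delta>}"
  then have "((coord M (x t) \<circ> x) has_vector_derivative ham_vector_field M (h t) (x t)) (at t within {0..\<delta>})"
    using x by (simp add: ham_trajectory_def)
  then show "((coord M (y t) \<circ> y) has_vector_derivative ham_vector_field M (h t) (y t)) (at t within {0..\<delta>})"
    unfolding eq[OF t] by (rule has_vector_derivative_transform[OF t, rotated]) (simp add: eq)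
qed

text \<open>A trajectory \<open>x j\<close> is determined by its starting point, which is the point \<open>incoming r y j\<close> of the
  tuple \<open>y\<close> of endpoints.  Conversely, flowing these points recovers the trajectories.\<close>

lemma endpoints_bij:
  assumes M: "\<And>j. symplectic_manifold (M j)" and cyc: "cyclic r M"
    and h: "\<And>j. smooth_hamiltonian (M j) (\<delta> j) (H j)" and \<Phi>: "\<And>j. is_ham_flow (M j) (\<delta> j) (H j) (\<Phi> j)"
    and \<delta>: "\<And>j. 0 < \<delta> j" and L: "\<And>j. L j \<subseteq> points (M j) \<times> points (M (Suc j))"
  shows "bij_betw (endpoints r \<delta>) (gen_intersection r M \<delta> L H)
    ((\<Pi>\<^sub>E j\<in>{..r}. L j) \<inter> cyclic_graphs r M (\<lambda>j. \<Phi> j (\<delta> j)))"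
    (is "bij_betw ?e ?G ?C")
proof -
  note flow = flow_trajectory[OF M h \<Phi>] flow_0[OF M h \<Phi>]
  define g where "g y = (\<lambda>j\<in>{..r}. \<lambda>t\<in>{0..\<delta> j}. \<Phi> j t (incoming r y j))" for y
  have \<delta>': "\<delta> j \<in> {0..\<delta> j}" "0 \<in> {0..\<delta> j}" for j using \<delta>[of j] by auto
  have inc_e: "incoming r (?e x) i = x i 0" if "i \<le> r" for x i
    using that by (auto simp: incoming_def endpoints_def)
  have traj: "x j t = \<Phi> j t (x j 0)" if x: "x \<in> ?G" and j: "j \<le> r" and t: "t \<in> {0..\<delta> j}" for x j t
  proof -
    have xj: "ham_trajectory (M j) (\<delta> j) (H j) (x j)" using x j by (simp add: gen_intersection_def)
    have p: "x j 0 \<in> points (M j)"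
      using xj \<delta>'(2)[of j] by (auto simp: ham_trajectory_def continuous_map_def Pi_iff)
    show ?thesis
      by (rule ham_trajectory_unique[OF M h xj flow(1)[OF p] \<delta>'(2) _ t]) (simp add: flow(2)[OF p])
  qed
  have inc_p: "incoming r y j \<in> points (M j)" if y: "y \<in> ?C" and j: "j \<le> r" for y j
  proof (cases "j = 0")
    case True
    have "y r \<in> L r" using y by auto
    then have "snd (y r) \<in> points (M (Suc r))" using L[of r] by (auto simp: mem_Times_iff)
    then show ?thesis using True cyc[unfolded cyclic_def, rule_format, of 0] by (simp add: incoming_def)
  next
    case False
    have "y (j - 1) \<in> L (j - 1)" using y j by auto
    then have "snd (y (j - 1)) \<in> points (M (Suc (j - 1)))" using L[of "j - 1"] by (auto simp: mem_Times_iff)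
    then show ?thesis using False by (simp add: incoming_def)
  qed
  show ?thesis
  proof (rule bij_betw_byWitness[where f' = g])
    show "\<forall>x\<in>?G. g (?e x) = x"
    proof
      fix x assume x: "x \<in> ?G"
      have "g (?e x) j = x j" for j
      proof (cases "j \<le> r")
        case True
        have ext: "x j \<in> extensional {0..\<delta> j}" using x True by (auto simp: gen_intersection_def)
        show ?thesis
        proof
          fix t show "g (?e x) j t = x j t"
            using traj[OF x True, of t] inc_e[OF True] True ext by (auto simp: g_def extensional_def)
        qed
      next
        case False
        have "x j = undefined" using x False unfolding gen_intersection_def by (auto dest: PiE_arb)
        then show ?thesis using False by (simp add: g_def)
      qed
      then show "g (?e x) = x" by blast
    qed
    have eg: "?e (g y) j = y j" if y: "y \<in> ?C" and j: "j \<le> r" for y j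
    proof -
      have s: "Suc j mod Suc r \<le> r" using mod_less_divisor[of "Suc r" "Suc j"] by linarith
      have "\<Phi> j (\<delta> j) (incoming r y j) = fst (y j)" using y j by (simp add: cyclic_graphs_def)
      moreover have "\<Phi> (Suc j mod Suc r) 0 (incoming r y (Suc j mod Suc r)) = snd (y j)"
        using flow(2)[OF inc_p[OF y s]] incoming_succ[OF j] by simp
      ultimately show ?thesis using j s \<delta>' by (simp add: endpoints_def g_def prod_eq_iff)
    qed
    show "\<forall>y\<in>?C. ?e (g y) = y"
    proof
      fix y assume y: "y \<in> ?C"
      have "?e (g y) j = y j" for j
      proof (cases "j \<le> r")
        case True then show ?thesis by (rule eg[OF y])
      next
        case False
        then have "y j = undefined" using y by (auto dest: PiE_arb)
        then show ?thesis using False by (simp add: endpoints_def)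
      qed
      then show "?e (g y) = y" by blast
    qed
    show "?e ` ?G \<subseteq> ?C"
    proof (rule image_subsetI)
      fix x assume x: "x \<in> ?G"
      have eL: "?e x \<in> (\<Pi>\<^sub>E j\<in>{..r}. L j)" using x by (auto simp: gen_intersection_def endpoints_def)
      then have "?e x \<in> (\<Pi>\<^sub>E j\<in>{..r}. points (M j) \<times> points (M (Suc j)))"
        using PiE_mono[of "{..r}" L "\<lambda>j. points (M j) \<times> points (M (Suc j))"] L by blast
      moreover have "\<Phi> i (\<delta> i) (incoming r (?e x) i) = fst (?e x i)" if "i \<le> r" for i
        using traj[OF x that \<delta>'(1)] inc_e[OF that] that by (simp add: endpoints_def)
      ultimately show "?e x \<in> ?C" using eL by (simp add: cyclic_graphs_def)
    qed
    show "g ` ?C \<subseteq> ?G"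
    proof (rule image_subsetI)
      fix y assume y: "y \<in> ?C"
      have "ham_trajectory (M j) (\<delta> j) (H j) (g y j)" if j: "j \<le> r" for j
        by (rule ham_trajectory_cong[OF flow(1)[OF inc_p[OF y j]]]) (use j in \<open>simp add: g_def\<close>)
      moreover have "(g y j (\<delta> j), g y (Suc j mod Suc r) 0) \<in> L j" if j: "j \<le> r" for j
      proof -
        have "(g y j (\<delta> j), g y (Suc j mod Suc r) 0) = y j" using eg[OF y j] j by (simp add: endpoints_def)
        then show ?thesis using y j by (metis IntD1 PiE_mem atMost_iff)
      qed
      moreover have "g y \<in> (\<Pi>\<^sub>E j\<in>{..r}. extensional {0..\<delta> j})" by (simp add: g_def)
      ultimately show "g y \<in> ?G" by (simp add: gen_intersection_def)
    qed
  qed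
qed

text \<open>The trajectories of the zero Hamiltonian are constant: its flow is the identity, and uniqueness of
  trajectories applies.\<close>

lemma zero_hamiltonian:
  assumes M: "symplectic_manifold M"
  shows "smooth_hamiltonian M \<delta> (\<lambda>_ _. 0)" and "is_ham_flow M \<delta> (\<lambda>_ _. 0) (\<lambda>_ p. p)"
proof -
  note S = symplectic_smooth[OF M]
  show "smooth_hamiltonian M \<delta> (\<lambda>_ _. 0)"
    unfolding smooth_hamiltonian_def by (auto intro!: smooth_on_cong[OF smooth_on_const[of _ 0]])
  have X0: "ham_vector_field M (\<lambda>_. 0) p = 0" if p: "p \<in> points M" for p
  proof -
    note X = ham_vector_field[OF M p smooth_on_const[of _ 0]]
    have "sderiv (model M) (\<lambda>x. 0 :: real) (coord M p p) v = 0" for v by (simp add: sderiv_def)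
    then show ?thesis using X(2) by (intro form_nondeg[OF M p X(1)]) simp
  qed
  show "is_ham_flow M \<delta> (\<lambda>_ _. 0) (\<lambda>_ p. p)"
    unfolding is_ham_flow_def
  proof (intro conjI ballI)
    fix p assume p: "p \<in> points M"
    show "ham_trajectory M \<delta> (\<lambda>_ _. 0) (\<lambda>_. p)"
      using X0[OF p] p by (simp add: ham_trajectory_def o_def)
    fix q assume q: "q \<in> points M"
    have "smooth_on {(t :: real, x). t \<in> {0..\<delta>} \<and> x \<in> crange M p \<and> cinv M p x \<in> cdom M q} (\<lambda>z. coord M q (cinv M p (snd z)))"
      by (rule smooth_on_compose[OF smooth_on_bounded_linear[OF bounded_linear_snd] manifold_transition[OF S p q]])
        (auto simp: cinv_coord[OF S p])
    then show "smooth_on {(t, x). t \<in> {0..\<delta>} \<and> x \<in> crange M p \<and> cinv M p x \<in> cdom M q} (\<lambda>(t, x). coord M q (cinv M p x))"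
      by (rule smooth_on_cong) auto
  qed (auto simp: continuous_map_snd[unfolded snd_def])
qed


section \<open>The perturbation as a bijection\<close>

lemma bij_betw_restrict_pred:
  assumes "bij_betw f A B" "\<And>a. a \<in> A \<Longrightarrow> P a \<longleftrightarrow> Q (f a)"
  shows "bij_betw f {a \<in> A. P a} {b \<in> B. Q b}"
  using assms unfolding bij_betw_def by (auto simp: inj_on_def)

lemma bij_betw_PiE:
  assumes "\<And>x. x \<in> A \<Longrightarrow> bij_betw (f x) (B x) (C x)"
  shows "bij_betw (\<lambda>z. \<lambda>x\<in>A. f x (z x)) (\<Pi>\<^sub>E x\<in>A. B x) (\<Pi>\<^sub>E x\<in>A. C x)"
proof (rule bij_betw_byWitness[where f' = "\<lambda>z. \<lambda>x\<in>A. inv_into (B x) (f x) (z x)"])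
  have b: "inj_on (f x) (B x)" "f x ` B x = C x" if "x \<in> A" for x
    using assms[OF that] by (auto simp: bij_betw_def)
  show "\<forall>z\<in>\<Pi>\<^sub>E x\<in>A. B x. (\<lambda>x\<in>A. inv_into (B x) (f x) ((\<lambda>x\<in>A. f x (z x)) x)) = z"
    using b(1) by (auto simp: fun_eq_iff inv_into_f_f PiE_mem dest: PiE_arb)
  show "\<forall>z\<in>\<Pi>\<^sub>E x\<in>A. C x. (\<lambda>x\<in>A. f x ((\<lambda>x\<in>A. inv_into (B x) (f x) (z x)) x)) = z"
    using b(2) by (auto simp: fun_eq_iff f_inv_into_f PiE_mem dest: PiE_arb)
  show "(\<lambda>z. \<lambda>x\<in>A. f x (z x)) ` (\<Pi>\<^sub>E x\<in>A. B x) \<subseteq> (\<Pi>\<^sub>E x\<in>A. C x)"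
    using b(2) by (fastforce dest: PiE_mem)
  show "(\<lambda>z. \<lambda>x\<in>A. inv_into (B x) (f x) (z x)) ` (\<Pi>\<^sub>E x\<in>A. C x) \<subseteq> (\<Pi>\<^sub>E x\<in>A. B x)"
    using b(2) by (auto intro!: inv_into_into simp: PiE_mem)
qed

text \<open>The perturbation applies \<open>\<phi>\<close> exactly to the incoming points.  It thus turns the equations
  \<open>\<phi>\<^sub>i(m\<^sub>i) = m'\<^sub>i\<close> into \<open>m\<^sub>i = m'\<^sub>i\<close>.\<close>

lemma incoming_perturb_map:
  assumes "cyclic r \<phi>" "i \<le> r"
  shows "incoming r (perturb_map \<phi> {..r} y) i = \<phi> i (incoming r y i)"
proof -
  have "\<phi> (Suc r) = \<phi> 0" using assms(1)[unfolded cyclic_def, rule_format, of 0] by simp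
  then show ?thesis using assms(2) by (auto simp: incoming_def perturb_map_def)
qed

context
  fixes M :: "nat \<Rightarrow> ('a, 'e::euclidean_space) symplectic" and L :: "nat \<Rightarrow> ('a \<times> 'a) set" and \<phi> :: "nat \<Rightarrow> 'a \<Rightarrow> 'a"
  assumes L: "\<And>j. L j \<subseteq> points (M j) \<times> points (M (Suc j))"
    and \<phi>: "\<And>j. inj_on (\<phi> j) (points (M j))" "\<And>j p. p \<in> points (M j) \<Longrightarrow> \<phi> j p \<in> points (M j)"
begin

lemma perturbed_points: "perturbed \<phi> L j \<subseteq> points (M j) \<times> points (M (Suc j))"
  using L[of j] \<phi>(2) by (auto simp: perturbed_def)

lemma perturb_map_bij: "bij_betw (perturb_map \<phi> K) (\<Pi>\<^sub>E i\<in>K. L i) (\<Pi>\<^sub>E i\<in>K. perturbed \<phi> L i)"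
proof -
  have "bij_betw (map_prod id (\<phi> (Suc i))) (L i) (perturbed \<phi> L i)" for i
  proof -
    have "inj_on (map_prod id (\<phi> (Suc i))) (L i)"
    proof (rule inj_onI)
      fix x y assume xy: "x \<in> L i" "y \<in> L i" "map_prod id (\<phi> (Suc i)) x = map_prod id (\<phi> (Suc i)) y"
      then have "snd x \<in> points (M (Suc i))" "snd y \<in> points (M (Suc i))" using L[of i] by auto
      then show "x = y" using xy(3) \<phi>(1)[of "Suc i"] by (auto simp: prod_eq_iff dest: inj_onD)
    qed
    then show ?thesis by (simp add: perturbed_def bij_betw_def)
  qed
  then have "bij_betw (\<lambda>z. \<lambda>i\<in>K. map_prod id (\<phi> (Suc i)) (z i)) (\<Pi>\<^sub>E i\<in>K. L i) (\<Pi>\<^sub>E i\<in>K. perturbed \<phi> L i)"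
    by (rule bij_betw_PiE)
  then show ?thesis by (simp add: perturb_map_def[abs_def])
qed

lemma PiE_points:
  "(\<Pi>\<^sub>E i\<in>K. L i) \<subseteq> (\<Pi>\<^sub>E i\<in>K. points (M i) \<times> points (M (Suc i)))"
  "(\<Pi>\<^sub>E i\<in>K. perturbed \<phi> L i) \<subseteq> (\<Pi>\<^sub>E i\<in>K. points (M i) \<times> points (M (Suc i)))"
  using L perturbed_points by (auto intro!: PiE_mono)

lemma perturb_map_cyclic_bij:
  assumes "cyclic r \<phi>"
  shows "bij_betw (perturb_map \<phi> {..r}) ((\<Pi>\<^sub>E j\<in>{..r}. L j) \<inter> cyclic_graphs r M \<phi>)
    ((\<Pi>\<^sub>E j\<in>{..r}. perturbed \<phi> L j) \<inter> cyclic_graphs r M (\<lambda>_ p. p))"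
proof -
  have 1: "(\<Pi>\<^sub>E j\<in>{..r}. L j) \<inter> cyclic_graphs r M \<phi> =
      {y \<in> (\<Pi>\<^sub>E j\<in>{..r}. L j). \<forall>i\<le>r. \<phi> i (incoming r y i) = fst (y i)}"
    using PiE_points(1)[of "{..r}"] unfolding cyclic_graphs_def by blast
  have 2: "(\<Pi>\<^sub>E j\<in>{..r}. perturbed \<phi> L j) \<inter> cyclic_graphs r M (\<lambda>_ p. p) =
      {y \<in> (\<Pi>\<^sub>E j\<in>{..r}. perturbed \<phi> L j). \<forall>i\<le>r. incoming r y i = fst (y i)}"
    using PiE_points(2)[of "{..r}"] unfolding cyclic_graphs_def by blast
  show ?thesis unfolding 1 2
    by (rule bij_betw_restrict_pred[OF perturb_map_bij])
      (simp add: incoming_perturb_map[OF assms], simp add: perturb_map_def)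
qed

lemma perturb_map_fiber_product_bij:
  "bij_betw (perturb_map \<phi> {j..<j'}) (fiber_product M L \<phi> j j') (fiber_product M (perturbed \<phi> L) (\<lambda>_ p. p) j j')"
proof -
  have 1: "fiber_product M L \<phi> j j' =
      {z \<in> (\<Pi>\<^sub>E i\<in>{j..<j'}. L i). \<forall>i. j < i \<and> i < j' \<longrightarrow> \<phi> i (snd (z (i - 1))) = fst (z i)}"
    using PiE_points(1)[of "{j..<j'}"] unfolding fiber_product_def segment_graphs_def by blast
  have 2: "fiber_product M (perturbed \<phi> L) (\<lambda>_ p. p) j j' =
      {z \<in> (\<Pi>\<^sub>E i\<in>{j..<j'}. perturbed \<phi> L i). \<forall>i. j < i \<and> i < j' \<longrightarrow> snd (z (i - 1)) = fst (z i)}"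
    using PiE_points(2)[of "{j..<j'}"] unfolding fiber_product_def segment_graphs_def by blast
  have "(\<phi> i (snd (z (i - 1))) = fst (z i)) =
      (snd (perturb_map \<phi> {j..<j'} z (i - 1)) = fst (perturb_map \<phi> {j..<j'} z i))" if "j < i" "i < j'" for z i
  proof -
    have "i - 1 \<in> {j..<j'}" "Suc (i - 1) = i" using that by auto
    then show ?thesis using that by (simp add: perturb_map_def)
  qed
  then show ?thesis unfolding 1 2
    by (intro bij_betw_restrict_pred[OF perturb_map_bij]) auto
qed

lemma perturb_map_partial_fiber_product_bij:
  "bij_betw (\<lambda>z. \<lambda>(j, j')\<in>consecutive r I. perturb_map \<phi> {j..<j'} (z (j, j')))
     (partial_fiber_product r M L \<phi> I) (partial_fiber_product r M (perturbed \<phi> L) (\<lambda>_ p. p) I)"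
proof -
  have "bij_betw (\<lambda>z. \<lambda>x\<in>consecutive r I. (case x of (j, j') \<Rightarrow> perturb_map \<phi> {j..<j'}) (z x))
     (\<Pi>\<^sub>E x\<in>consecutive r I. case x of (j, j') \<Rightarrow> fiber_product M L \<phi> j j')
     (\<Pi>\<^sub>E x\<in>consecutive r I. case x of (j, j') \<Rightarrow> fiber_product M (perturbed \<phi> L) (\<lambda>_ p. p) j j')"
    by (rule bij_betw_PiE) (auto simp: perturb_map_fiber_product_bij)
  moreover have "(\<lambda>x\<in>consecutive r I. (case x of (j, j') \<Rightarrow> perturb_map \<phi> {j..<j'}) (z x)) =
      (\<lambda>(j, j')\<in>consecutive r I. perturb_map \<phi> {j..<j'} (z (j, j')))" for z
    by (rule restrict_ext) auto
  ultimately show ?thesis unfolding partial_fiber_product_def by simp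
qed

end

section \<open>Transversality of the perturbed correspondences\<close>

lemma curve_at_mprod:
  "curve_at (mprod M N) y c v \<longleftrightarrow>
    curve_at M (fst y) (\<lambda>t. fst (c t)) (fst v) \<and> curve_at N (snd y) (\<lambda>t. snd (c t)) (snd v)"
  using curve_at_mprod_iff[of M N "fst y" "snd y" c "fst v" "snd v"] by simp

lemma curve_at_corr_space:
  "curve_at (corr_space M i) y c v \<longleftrightarrow>
    curve_at (M i) (fst y) (\<lambda>t. fst (c t)) (fst v) \<and> curve_at (M (Suc i)) (snd y) (\<lambda>t. snd (c t)) (snd v)"
  by (simp add: corr_space_def twisted_prod_as_manifold curve_at_mprod)

lemma model_corr_space [simp]: "model (corr_space M i) = model (M i) \<times> model (M (Suc i))"
  by (simp add: corr_space_def)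

lemma cyclic_corr_space: "cyclic r M \<Longrightarrow> cyclic r (corr_space M)"
  unfolding cyclic_def corr_space_def by (metis add_Suc)

text \<open>The map defining the equations for \<open>L'\<close>, composed with the perturbation, is the map for \<open>L\<close>.  A curve in
  \<open>L\<close> and its image in \<open>L'\<close> therefore give the same velocity, and the same decompositions of vectors
  work on both sides.\<close>

lemma perturbed_transversal_equations:
  fixes M :: "nat \<Rightarrow> ('a, 'e::euclidean_space) symplectic"
  assumes M: "\<And>j. smooth_manifold (M j)" and cyc: "cyclic r \<phi>"
    and L: "\<And>j. L j \<subseteq> points (M j) \<times> points (M (Suc j))"
    and \<phi>: "\<And>j. inj_on (\<phi> j) (points (M j))" "\<And>j. smooth_map_on (M j) (M j) (points (M j)) (\<phi> j)"
    and te: "transversal_equations r M L \<phi> I" and I: "I \<subseteq> {..r}"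
  shows "transversal_equations r M (perturbed \<phi> L) (\<lambda>_ p. p) I"
  unfolding transversal_equations_def transverse_map_def
proof (intro ballI impI)
  let ?P = "perturb_map \<phi> {..r}"
  let ?F = "\<lambda>y. \<lambda>i\<in>I. (\<phi> i (incoming r y i), fst (y i))"
  let ?F' = "\<lambda>y. \<lambda>i\<in>I. (incoming r y i, fst (y i))"
  let ?Z = "\<Pi>\<^sub>E i\<in>I. {(q, q) | q. q \<in> points (M i)}"
  have FP: "?F' (?P y) = ?F y" for y
    using I incoming_perturb_map[OF cyc] by (auto simp: restrict_def fun_eq_iff perturb_map_def)
  have P: "?P ` (\<Pi>\<^sub>E j\<in>{..r}. L j) = (\<Pi>\<^sub>E j\<in>{..r}. perturbed \<phi> L j)"
    using perturb_map_bij[where M = M and L = L and \<phi> = \<phi> and K = "{..r}",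
        OF L \<phi>(1) smooth_map_on_points[OF \<phi>(2)]]
    by (simp add: bij_betw_def)
  fix y' a assume y'L: "y' \<in> (\<Pi>\<^sub>E j\<in>{..r}. perturbed \<phi> L j)" and y'Z: "?F' y' \<in> ?Z"
    and a: "a \<in> (\<Pi> i\<in>I. model (mprod (M i) (M i)))"
  have "y' \<in> ?P ` (\<Pi>\<^sub>E j\<in>{..r}. L j)" unfolding P by (rule y'L)
  then obtain y where y: "y' = ?P y" "y \<in> (\<Pi>\<^sub>E j\<in>{..r}. L j)" by (rule imageE)
  note y = y(2,1)
  have "?F y \<in> ?Z" using y'Z unfolding y(2) FP .
  then obtain u w where u: "u \<in> differential_image {..r} (corr_space M) (\<Pi>\<^sub>E j\<in>{..r}. L j) I (\<lambda>i. mprod (M i) (M i)) ?F y"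
    and w: "w \<in> family_tangent I (\<lambda>i. mprod (M i) (M i)) ?Z (?F y)" "\<forall>i\<in>I. a i = u i + w i"
    using te y(1) a unfolding transversal_equations_def transverse_map_def by blast
  obtain c v where c: "family_curve {..r} (corr_space M) (\<Pi>\<^sub>E j\<in>{..r}. L j) y c v"
    "\<forall>i\<in>I. curve_at (mprod (M i) (M i)) (?F y i) (\<lambda>t. ?F (c t) i) (u i)"
    using u unfolding differential_image_def by blast
  define v' where "v' j = (fst (v j), dmap (M (Suc j)) (M (Suc j)) (\<phi> (Suc j)) (snd (y j)) (snd (v j)))" for j
  have "curve_at (corr_space M j) (y' j) (\<lambda>t. ?P (c t) j) (v' j)" if j: "j \<in> {..r}" for j
  proof -
    have cj: "curve_at (M j) (fst (y j)) (\<lambda>t. fst (c t j)) (fst (v j))"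
      "curve_at (M (Suc j)) (snd (y j)) (\<lambda>t. snd (c t j)) (snd (v j))"
      using c(1) j by (auto simp: family_curve_def curve_at_corr_space)
    have "snd (y j) \<in> points (M (Suc j))" using L[of j] PiE_mem[OF y(1) j] by auto
    from smooth_map_on_curve[OF M M \<phi>(2) this cj(2)] cj(1) j show ?thesis
      by (simp add: curve_at_corr_space v'_def y(2) perturb_map_def)
  qed
  moreover have "\<exists>e>0. \<forall>t\<in>{-e<..<e}. ?P (c t) \<in> (\<Pi>\<^sub>E j\<in>{..r}. perturbed \<phi> L j)"
    using c(1) P unfolding family_curve_def by (metis imageI)
  ultimately have "family_curve {..r} (corr_space M) (\<Pi>\<^sub>E j\<in>{..r}. perturbed \<phi> L j) y' (\<lambda>t. ?P (c t)) v'"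
    unfolding family_curve_def by blast
  moreover have "\<forall>i\<in>I. curve_at (mprod (M i) (M i)) (?F' y' i) (\<lambda>t. ?F' (?P (c t)) i) (u i)"
    using c(2) unfolding FP y(2) .
  ultimately have "u \<in> differential_image {..r} (corr_space M) (\<Pi>\<^sub>E j\<in>{..r}. perturbed \<phi> L j) I
      (\<lambda>i. mprod (M i) (M i)) ?F' y'"
    unfolding differential_image_def by blast
  with w show "\<exists>u\<in>differential_image {..r} (corr_space M) (\<Pi>\<^sub>E j\<in>{..r}. perturbed \<phi> L j) I
      (\<lambda>i. mprod (M i) (M i)) ?F' y'. \<exists>w\<in>family_tangent I (\<lambda>i. mprod (M i) (M i)) ?Z (?F' y').
      \<forall>i\<in>I. a i = u i + w i"
    unfolding y(2) FP by blast
qed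

lemma mod_Suc_cancel:
  assumes "Suc a mod Suc r = Suc b mod Suc r"
  shows "a mod Suc r = b mod Suc r"
  using assms by (auto simp: mod_Suc split: if_splits)

text \<open>The equations with index in \<open>I\<close> couple the outgoing point at position \<open>pre k\<close> to the first point at
  position \<open>pos k\<close>.  Given \<open>a\<close>, transversality of the equations yields a vector tangent to the product of all \<open>L j\<close>
  that has the components of \<open>a\<close> in the coupled positions up to a vector tangent to the diagonals.  Restricted
  to \<open>K\<close>, it differs from \<open>a\<close> by a vector whose coupled components move along the diagonals and whose
  other components are free, that is, by a vector tangent to the second set.  A point over \<open>K\<close> is extended
  to all positions by arbitrary points of the sets \<open>L j\<close>, which is where nonemptiness enters.\<close>

lemma transversal_equations_imp_transverse_intersection:
  fixes M :: "nat \<Rightarrow> ('a, 'e::euclidean_space) symplectic" and I K :: "nat set"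
  assumes M: "\<And>j. smooth_manifold (M j)" and cyc: "cyclic r M" "cyclic r L"
    and L: "\<And>j. L j \<subseteq> points (M j) \<times> points (M (Suc j))" "\<And>j. L j \<noteq> {}"
    and te: "transversal_equations r M L (\<lambda>_ p. p) I"
    and inj: "inj_on (\<lambda>i. i mod Suc r) K"
    and pos: "\<And>k. k \<in> I \<Longrightarrow> pos k \<in> K" "\<And>k. k \<in> I \<Longrightarrow> pos k mod Suc r = k"
    and pre: "\<And>k. k \<in> I \<Longrightarrow> pre k \<in> K" "\<And>k. k \<in> I \<Longrightarrow> Suc (pre k) mod Suc r = k"
  shows "transverse_intersection K (corr_space M) (\<Pi>\<^sub>E i\<in>K. L i)
    {z \<in> (\<Pi>\<^sub>E i\<in>K. points (M i) \<times> points (M (Suc i))). \<forall>k\<in>I. snd (z (pre k)) = fst (z (pos k))}"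
    (is "transverse_intersection K _ ?A ?B")
  unfolding transverse_intersection_def
proof (intro ballI)
  let ?N = "\<lambda>i. mprod (M i) (M i)"
  let ?F = "\<lambda>y. \<lambda>i\<in>I. (incoming r y i, fst (y i))"
  let ?Z = "\<Pi>\<^sub>E i\<in>I. {(q, q) | q. q \<in> points (M i)}"
  define m where "m i = i mod Suc r" for i
  have mr: "m i \<le> r" for i using mod_less_divisor[of "Suc r" i] unfolding m_def by linarith
  have injm: "inj_on m K" using inj by (simp add: m_def[abs_def])
  have Mm: "M (m i) = M i" "corr_space M (m i) = corr_space M i" "L (m i) = L i" for i
    unfolding m_def using cyclic_mod cyc cyclic_corr_space by metis+
  have Mpos: "M (pos k) = M k" "M (Suc (pre k)) = M k" if "k \<in> I" for k
    using pos(2)[OF that] pre(2)[OF that] Mm(1)[unfolded m_def] by metis+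
  fix y a assume y: "y \<in> ?A \<inter> ?B" and a: "a \<in> (\<Pi> k\<in>K. model (corr_space M k))"
  define Y where "Y = (\<lambda>k\<in>{..r}. if k \<in> m ` K then y (inv_into K m k) else (SOME l. l \<in> L k))"
  have Ym: "Y (m i) = y i" if "i \<in> K" for i
    using that injm mr by (simp add: Y_def)
  have YL: "Y \<in> (\<Pi>\<^sub>E j\<in>{..r}. L j)"
  proof (rule PiE_I)
    fix k assume k: "k \<in> {..r}"
    show "Y k \<in> L k"
    proof (cases "k \<in> m ` K")
      case True
      then obtain i where i: "i \<in> K" "k = m i" by blast
      then have "y i \<in> L i" using y by auto
      then show ?thesis using i Ym Mm(3) by simp
    next
      case False
      then show ?thesis using k some_in_eq[of "L k"] L(2)[of k] by (simp add: Y_def)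
    qed
  qed (simp add: Y_def)
  have inc: "incoming r z k = snd (z (m (pre k)))" if "k \<in> I" for z :: "nat \<Rightarrow> 'a \<times> 'a" and k
    using incoming_mod[of "Suc (pre k)" r z] pre(2)[OF that] by (simp add: m_def)
  have kpos: "m (pos k) = k" if "k \<in> I" for k using pos(2)[OF that] by (simp add: m_def)
  have FY: "?F Y k = (snd (y (pre k)), fst (y (pos k)))" if k: "k \<in> I" for k
    using inc[OF k, of Y] Ym[OF pre(1)[OF k]] Ym[OF pos(1)[OF k]] kpos[OF k] k by simp
  have FZ: "?F Y \<in> ?Z"
  proof (rule PiE_I)
    fix k assume k: "k \<in> I"
    have "fst (y (pos k)) \<in> points (M k)"
      using y pos(1)[OF k] Mpos(1)[OF k] by (auto simp: PiE_iff mem_Times_iff)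
    moreover have "snd (y (pre k)) = fst (y (pos k))" using y k by blast
    ultimately show "?F Y k \<in> {(q, q) | q. q \<in> points (M k)}" unfolding FY[OF k] by auto
  qed simp
  define b where "b k = (snd (a (pre k)), fst (a (pos k)))" for k
  have "b \<in> (\<Pi> i\<in>I. model (?N i))"
  proof (rule Pi_I)
    fix k assume k: "k \<in> I"
    have "a (pre k) \<in> model (corr_space M (pre k))" "a (pos k) \<in> model (corr_space M (pos k))"
      using a pre(1)[OF k] pos(1)[OF k] by auto
    then show "b k \<in> model (?N k)" using Mpos[OF k] by (auto simp: b_def)
  qed
  then obtain u w where u: "u \<in> differential_image {..r} (corr_space M) (\<Pi>\<^sub>E j\<in>{..r}. L j) I ?N ?F Y"
    and w: "w \<in> family_tangent I ?N ?Z (?F Y)" "\<forall>i\<in>I. b i = u i + w i"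
    using te YL FZ unfolding transversal_equations_def transverse_map_def by blast
  obtain c v where c: "family_curve {..r} (corr_space M) (\<Pi>\<^sub>E j\<in>{..r}. L j) Y c v"
    "\<And>i. i \<in> I \<Longrightarrow> curve_at (?N i) (?F Y i) (\<lambda>t. ?F (c t) i) (u i)"
    using u unfolding differential_image_def by blast
  define vs where "vs i = v (m i)" for i
  define cs where "cs t = (\<lambda>i\<in>K. c t (m i))" for t
  have cc: "curve_at (corr_space M i) (y i) (\<lambda>t. c t (m i)) (vs i)" if "i \<in> K" for i
    using c(1) mr[of i] Ym[OF that] Mm(2)[of i] unfolding family_curve_def vs_def by (metis atMost_iff)
  have "\<exists>e>0. \<forall>t\<in>{-e<..<e}. cs t \<in> ?A"
  proof -
    obtain e where e: "0 < e" "\<And>t. t \<in> {-e<..<e} \<Longrightarrow> c t \<in> (\<Pi>\<^sub>E j\<in>{..r}. L j)"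
      using c(1) unfolding family_curve_def by blast
    have "cs t \<in> ?A" if t: "t \<in> {-e<..<e}" for t
    proof (rule PiE_I)
      fix i assume i: "i \<in> K"
      have "c t (m i) \<in> L (m i)" using e(2)[OF t] mr[of i] by auto
      then show "cs t i \<in> L i" using i Mm(3) by (simp add: cs_def)
    qed (simp add: cs_def)
    then show ?thesis using e(1) by blast
  qed
  then have vsA: "vs \<in> family_tangent K (corr_space M) ?A y"
    unfolding family_tangent_def family_curve_def using cc by (auto simp: cs_def intro!: exI[of _ cs])
  have uk: "u k = (snd (vs (pre k)), fst (vs (pos k)))" if k: "k \<in> I" for k
  proof -
    have 1: "curve_at (M k) (snd (y (pre k))) (\<lambda>t. snd (c t (m (pre k)))) (fst (u k))"
      "curve_at (M k) (fst (y (pos k))) (\<lambda>t. fst (c t (m (pos k)))) (snd (u k))"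
      using c(2)[OF k] k unfolding FY[OF k] by (auto simp: curve_at_mprod inc[OF k] kpos[OF k])
    have 2: "curve_at (M k) (snd (y (pre k))) (\<lambda>t. snd (c t (m (pre k)))) (snd (vs (pre k)))"
      "curve_at (M k) (fst (y (pos k))) (\<lambda>t. fst (c t (m (pos k)))) (fst (vs (pos k)))"
      using cc[OF pre(1)[OF k]] cc[OF pos(1)[OF k]] Mpos[OF k] by (auto simp: curve_at_corr_space)
    show ?thesis using curve_at_unique[OF 1(1) 2(1)] curve_at_unique[OF 1(2) 2(2)] by (simp add: prod_eq_iff)
  qed
  define w' where "w' i = a i - vs i" for i
  obtain d where d: "family_curve I ?N ?Z (?F Y) d w" using w(1) unfolding family_tangent_def by blast
  have w'm: "fst (w' i) \<in> model (M i)" "snd (w' i) \<in> model (M (Suc i))"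
    and yp: "fst (y i) \<in> points (M i)" "snd (y i) \<in> points (M (Suc i))" if i: "i \<in> K" for i
  proof -
    show yp: "fst (y i) \<in> points (M i)" "snd (y i) \<in> points (M (Suc i))"
      using y i by (auto simp: PiE_iff mem_Times_iff)
    have "fst (vs i) \<in> model (M i)" "snd (vs i) \<in> model (M (Suc i))"
      using cc[OF i] curve_velocity_in_model[OF M yp(1)] curve_velocity_in_model[OF M yp(2)]
      by (auto simp: curve_at_corr_space)
    moreover have "fst (a i) \<in> model (M i)" "snd (a i) \<in> model (M (Suc i))" using a i by (auto dest!: Pi_mem)
    ultimately show "fst (w' i) \<in> model (M i)" "snd (w' i) \<in> model (M (Suc i))"
      using manifold_model[OF M] by (auto simp: w'_def subspace_diff)
  qed
  have "\<exists>e. curve_at (M i) (fst (y i)) e (fst (w' i)) \<and> (\<forall>t. e t \<in> points (M i))" if "i \<in> K" for i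
    using curve_through[OF M yp(1)[OF that] w'm(1)[OF that]] by metis
  then obtain e1 where e1: "\<And>i. i \<in> K \<Longrightarrow> curve_at (M i) (fst (y i)) (e1 i) (fst (w' i))"
    "\<And>i t. i \<in> K \<Longrightarrow> e1 i t \<in> points (M i)" by metis
  have "\<exists>e. curve_at (M (Suc i)) (snd (y i)) e (snd (w' i)) \<and> (\<forall>t. e t \<in> points (M (Suc i)))" if "i \<in> K" for i
    using curve_through[OF M yp(2)[OF that] w'm(2)[OF that]] by metis
  then obtain e2 where e2: "\<And>i. i \<in> K \<Longrightarrow> curve_at (M (Suc i)) (snd (y i)) (e2 i) (snd (w' i))"
    "\<And>i t. i \<in> K \<Longrightarrow> e2 i t \<in> points (M (Suc i))" by metis
  \<comment> \<open>The endpoints that occur in an equation move along the diagonal, in exchanged order; the others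
    are free.\<close>
  define e where "e t = (\<lambda>i\<in>K. (if m i \<in> I then snd (d t (m i)) else e1 i t,
      if m (Suc i) \<in> I then fst (d t (m (Suc i))) else e2 i t))" for t
  have posi: "pos (m i) = i" if "i \<in> K" "m i \<in> I" for i
    using inj_onD[OF injm kpos[OF that(2)] pos(1)[OF that(2)] that(1)] .
  have prei: "pre (m (Suc i)) = i" if "i \<in> K" "m (Suc i) \<in> I" for i
  proof (rule inj_onD[OF injm _ pre(1)[OF that(2)] that(1)])
    show "m (pre (m (Suc i))) = m i"
      unfolding m_def by (rule mod_Suc_cancel) (use pre(2)[OF that(2)] in \<open>simp add: m_def\<close>)
  qed
  have dk: "curve_at (M k) (snd (y (pre k))) (\<lambda>t. fst (d t k)) (snd (w' (pre k)))"
    "curve_at (M k) (fst (y (pos k))) (\<lambda>t. snd (d t k)) (fst (w' (pos k)))" if k: "k \<in> I" for k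
  proof -
    have "w k = b k - u k" using w(2) k by simp
    then have "w k = (snd (w' (pre k)), fst (w' (pos k)))" by (simp add: b_def uk[OF k] w'_def)
    moreover have "curve_at (?N k) (?F Y k) (\<lambda>t. d t k) (w k)" using d k by (simp add: family_curve_def)
    ultimately show "curve_at (M k) (snd (y (pre k))) (\<lambda>t. fst (d t k)) (snd (w' (pre k)))"
      "curve_at (M k) (fst (y (pos k))) (\<lambda>t. snd (d t k)) (fst (w' (pos k)))"
      unfolding FY[OF k] by (auto simp: curve_at_mprod)
  qed
  have ec: "curve_at (corr_space M i) (y i) (\<lambda>t. e t i) (w' i)" if i: "i \<in> K" for i
    unfolding curve_at_corr_space
  proof
    show "curve_at (M i) (fst (y i)) (\<lambda>t. fst (e t i)) (fst (w' i))"
      using i e1(1)[OF i] dk(2)[of "m i"] posi[OF i] Mm(1)[of i] by (cases "m i \<in> I") (auto simp: e_def)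
    show "curve_at (M (Suc i)) (snd (y i)) (\<lambda>t. snd (e t i)) (snd (w' i))"
      using i e2(1)[OF i] dk(1)[of "m (Suc i)"] prei[OF i] Mm(1)[of "Suc i"]
      by (cases "m (Suc i) \<in> I") (auto simp: e_def)
  qed
  obtain \<epsilon> where \<epsilon>: "0 < \<epsilon>" "\<And>t. t \<in> {-\<epsilon><..<\<epsilon>} \<Longrightarrow> d t \<in> ?Z" using d unfolding family_curve_def by blast
  have eB: "e t \<in> ?B" if t: "t \<in> {-\<epsilon><..<\<epsilon>}" for t
  proof -
    have dd: "fst (d t k) = snd (d t k)" "snd (d t k) \<in> points (M k)" if "k \<in> I" for k
      using PiE_mem[OF \<epsilon>(2)[OF t] that] by auto
    have "e t \<in> (\<Pi>\<^sub>E i\<in>K. points (M i) \<times> points (M (Suc i)))"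
    proof (rule PiE_I)
      fix i assume i: "i \<in> K"
      show "e t i \<in> points (M i) \<times> points (M (Suc i))"
        using i e1(2)[OF i] e2(2)[OF i] dd[of "m i"] dd[of "m (Suc i)"] Mm(1)[of i] Mm(1)[of "Suc i"]
        by (auto simp: e_def)
    qed (simp add: e_def)
    moreover have "snd (e t (pre k)) = fst (e t (pos k))" if k: "k \<in> I" for k
      using pos[OF k] pre[OF k] dd(1)[OF k] k by (simp add: e_def m_def)
    ultimately show ?thesis by blast
  qed
  have "w' \<in> family_tangent K (corr_space M) ?B y"
    unfolding family_tangent_def family_curve_def using ec eB \<epsilon>(1) by blast
  moreover have "\<forall>i\<in>K. a i = vs i + w' i" by (simp add: w'_def)
  ultimately show "\<exists>v\<in>family_tangent K (corr_space M) ?A y. \<exists>w\<in>family_tangent K (corr_space M) ?B y.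
      \<forall>k\<in>K. a k = v k + w k" using vsA by blast
qed

lemma transverse_cyclic_intersection:
  fixes M :: "nat \<Rightarrow> ('a, 'e::euclidean_space) symplectic"
  assumes M: "\<And>j. smooth_manifold (M j)" and cyc: "cyclic r M" "cyclic r L"
    and L: "\<And>j. L j \<subseteq> points (M j) \<times> points (M (Suc j))" "\<And>j. L j \<noteq> {}"
    and te: "transversal_equations r M L (\<lambda>_ p. p) {..r}"
  shows "transverse_intersection {..r} (corr_space M) (\<Pi>\<^sub>E j\<in>{..r}. L j) (cyclic_graphs r M (\<lambda>_ p. p))"
proof -
  have "transverse_intersection {..r} (corr_space M) (\<Pi>\<^sub>E i\<in>{..r}. L i)
    {z \<in> (\<Pi>\<^sub>E i\<in>{..r}. points (M i) \<times> points (M (Suc i))).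
      \<forall>k\<in>{..r}. snd (z (if k = 0 then r else k - 1)) = fst (z (id k))}"
    by (rule transversal_equations_imp_transverse_intersection[OF M cyc L te]) (auto simp: inj_on_def)
  then show ?thesis by (simp add: cyclic_graphs_def incoming_def Ball_def)
qed

text \<open>A segment is at most one turn around the cycle, so its positions have distinct residues.\<close>

lemma inj_on_mod_segment:
  assumes "j' \<le> j + Suc r"
  shows "inj_on (\<lambda>i. i mod Suc r) {j..<j'}"
proof -
  have *: "i = i'" if ii: "i \<in> {j..<j'}" "i' \<in> {j..<j'}" "i mod Suc r = i' mod Suc r" "i \<le> i'" for i i'
  proof -
    have "Suc r dvd i' - i" using ii by (metis mod_eq_dvd_iff_nat)
    moreover have "i' - i < Suc r" using ii assms by auto
    ultimately show ?thesis using ii(4) nat_dvd_not_less[of "i' - i" "Suc r"] by linarith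
  qed
  show ?thesis
    by (rule inj_onI) (metis * nle_le)
qed

lemma transverse_segment_intersection:
  fixes M :: "nat \<Rightarrow> ('a, 'e::euclidean_space) symplectic"
  assumes M: "\<And>j. smooth_manifold (M j)" and cyc: "cyclic r M" "cyclic r L"
    and L: "\<And>j. L j \<subseteq> points (M j) \<times> points (M (Suc j))" "\<And>j. L j \<noteq> {}"
    and te: "transversal_equations r M L (\<lambda>_ p. p) ((\<lambda>i. i mod Suc r) ` {j<..<j'})"
    and j': "j' \<le> j + Suc r"
  shows "transverse_intersection {j..<j'} (corr_space M) (\<Pi>\<^sub>E i\<in>{j..<j'}. L i) (segment_graphs M (\<lambda>_ p. p) j j')"
proof -
  let ?m = "\<lambda>i. i mod Suc r"
  note inj = inj_on_mod_segment[OF j']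
  define pos where "pos = inv_into {j..<j'} ?m"
  have pos: "pos (?m i) = i" if "i \<in> {j<..<j'}" for i
    unfolding pos_def by (rule inv_into_f_f[OF inj]) (use that in auto)
  have "transverse_intersection {j..<j'} (corr_space M) (\<Pi>\<^sub>E i\<in>{j..<j'}. L i)
    {z \<in> (\<Pi>\<^sub>E i\<in>{j..<j'}. points (M i) \<times> points (M (Suc i))).
      \<forall>k\<in>?m ` {j<..<j'}. snd (z (pos k - 1)) = fst (z (pos k))}"
  proof (rule transversal_equations_imp_transverse_intersection[OF M cyc L te inj])
    fix k assume "k \<in> ?m ` {j<..<j'}"
    then obtain i where i: "i \<in> {j<..<j'}" "k = ?m i" by blast
    show "pos k \<in> {j..<j'}" "pos k mod Suc r = k" "pos k - 1 \<in> {j..<j'}" "Suc (pos k - 1) mod Suc r = k"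
      unfolding i(2) pos[OF i(1)] using i(1) by auto
  qed
  moreover have "{z \<in> (\<Pi>\<^sub>E i\<in>{j..<j'}. points (M i) \<times> points (M (Suc i))).
      \<forall>k\<in>?m ` {j<..<j'}. snd (z (pos k - 1)) = fst (z (pos k))} = segment_graphs M (\<lambda>_ p. p) j j'"
    unfolding segment_graphs_def using pos by auto
  ultimately show ?thesis by simp
qed


section \<open>Projection to the geometric composition\<close>

text \<open>Both velocities are those of the same curve, read in the same chart.\<close>

lemma segment_velocities_match:
  assumes A: "A \<subseteq> segment_graphs M (\<lambda>_ p. p) j j'" and y: "y \<in> A"
    and v: "v \<in> family_tangent {j..<j'} (corr_space M) A y" and i: "j < i" "i < j'"
  shows "snd (v (i - 1)) = fst (v i)"
proof -
  obtain c where c: "family_curve {j..<j'} (corr_space M) A y c v" using v unfolding family_tangent_def by blast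
  obtain e where e: "0 < e" "\<And>t. t \<in> {-e<..<e} \<Longrightarrow> c t \<in> A" using c unfolding family_curve_def by blast
  have eq: "snd (z (i - 1)) = fst (z i)" if "z \<in> A" for z
    using A that i by (auto simp: segment_graphs_def)
  have ii: "i - 1 \<in> {j..<j'}" "i \<in> {j..<j'}" "Suc (i - 1) = i" using i by auto
  have cv: "curve_at (corr_space M k) (y k) (\<lambda>t. c t k) (v k)" if "k \<in> {j..<j'}" for k
    using c that by (simp add: family_curve_def)
  have 1: "curve_at (M i) (fst (y i)) (\<lambda>t. snd (c t (i - 1))) (snd (v (i - 1)))"
    using cv[OF ii(1)] eq[OF y] ii(3) by (simp add: curve_at_corr_space)
  have "curve_at (M i) (fst (y i)) (\<lambda>t. fst (c t i)) (snd (v (i - 1)))"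
    by (rule curve_at_cong[OF 1 e(1)]) (use eq e(2) in blast)
  moreover have "curve_at (M i) (fst (y i)) (\<lambda>t. fst (c t i)) (fst (v i))"
    using cv[OF ii(2)] by (simp add: curve_at_corr_space)
  ultimately show ?thesis by (rule curve_at_unique)
qed

text \<open>Suppose \<open>v\<close> and \<open>w\<close> are tangent to the fiber product and have the same projection.  By
  transversality every vector is \<open>v' + w'\<close> with \<open>v'\<close> tangent to the Lagrangians and \<open>w'\<close> tangent to the
  diagonals.  The total form vanishes on \<open>(v - w, v')\<close> because the Lagrangians are isotropic, and on
  \<open>(v - w, w')\<close> because the contributions of adjacent factors cancel and those at the two ends vanish.
  Nondegeneracy gives \<open>v = w\<close>.\<close>

lemma fiber_product_projection_immersion:
  fixes M :: "nat \<Rightarrow> ('a, 'e::euclidean_space) symplectic"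
  assumes M: "\<And>j. symplectic_manifold (M j)" and lag: "\<And>j. lagrangian (corr_space M j) (L j)" and jj': "j < j'"
    and L: "\<And>j. L j \<subseteq> points (M j) \<times> points (M (Suc j))"
    and trans: "transverse_intersection {j..<j'} (corr_space M) (\<Pi>\<^sub>E i\<in>{j..<j'}. L i) (segment_graphs M (\<lambda>_ p. p) j j')"
  shows "immersion_on {j..<j'} (corr_space M) (fiber_product M L (\<lambda>_ p. p) j j')
    (mprod (M j) (M j')) (\<lambda>z. (fst (z j), snd (z (j' - 1))))"
  unfolding immersion_on_def
proof (intro conjI ballI)
  let ?K = "{j..<j'}" and ?A = "fiber_product M L (\<lambda>_ p. p) j j'" and ?B = "segment_graphs M (\<lambda>_ p. p) j j'"
  note S = symplectic_smooth[OF M]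
  have ends: "j \<in> ?K" "j' - 1 \<in> ?K" "Suc (j' - 1) = j'" using jj' by auto
  have AB: "?A \<subseteq> ?B" and AL: "?A \<subseteq> (\<Pi>\<^sub>E i\<in>?K. L i)" by (auto simp: fiber_product_def)
  have pts: "fst (y i) \<in> points (M i)" "snd (y i) \<in> points (M (Suc i))" if "y \<in> ?A" "i \<in> ?K" for y i
    using AL that L[of i] by (auto simp: PiE_iff mem_Times_iff dest!: subsetD)
  show "(\<lambda>z. (fst (z j), snd (z (j' - 1)))) ` ?A \<subseteq> points (mprod (M j) (M j'))"
    using pts[OF _ ends(1)] pts[OF _ ends(2)] ends(3) by auto
  fix y assume y: "y \<in> ?A"
  define D where "D v = (fst (v j), snd (v (j' - 1)))" for v :: "nat \<Rightarrow> 'e \<times> 'e"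
  have curves: "curve_at (mprod (M j) (M j')) (fst (y j), snd (y (j' - 1))) (\<lambda>t. (fst (c t j), snd (c t (j' - 1)))) (D v)"
    if "family_curve ?K (corr_space M) ?A y c v" for c v
  proof -
    have "curve_at (corr_space M i) (y i) (\<lambda>t. c t i) (v i)" if "i \<in> ?K" for i
      using \<open>family_curve ?K (corr_space M) ?A y c v\<close> that by (simp add: family_curve_def)
    from this[OF ends(1)] this[OF ends(2)] show ?thesis
      unfolding curve_at_corr_space curve_at_mprod D_def ends(3) by simp
  qed
  have "v k = w k" if v: "v \<in> family_tangent ?K (corr_space M) ?A y"
    and w: "w \<in> family_tangent ?K (corr_space M) ?A y" and Dvw: "D v = D w" and k: "k \<in> ?K" for v w k
  proof -
    define d where "d i = v i - w i" for i
    have vm: "v i \<in> tangent_space (corr_space M i) (L i) (y i)" if "v \<in> family_tangent ?K (corr_space M) (\<Pi>\<^sub>E i\<in>?K. L i) y" "i \<in> ?K" for v i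
    proof -
      obtain c e where c: "family_curve ?K (corr_space M) (\<Pi>\<^sub>E i\<in>?K. L i) y c v"
        and e: "0 < e" "\<And>t. t \<in> {-e<..<e} \<Longrightarrow> c t \<in> (\<Pi>\<^sub>E i\<in>?K. L i)"
        using \<open>v \<in> family_tangent ?K (corr_space M) (\<Pi>\<^sub>E i\<in>?K. L i) y\<close>
        unfolding family_tangent_def family_curve_def by blast
      have "curve_at (corr_space M i) (y i) (\<lambda>t. c t i) (v i)"
        using c \<open>i \<in> ?K\<close> by (simp add: family_curve_def)
      moreover have "c t i \<in> L i" if "t \<in> {-e<..<e}" for t using PiE_mem[OF e(2)[OF that] \<open>i \<in> ?K\<close>] .
      ultimately show ?thesis
        using e(1) unfolding tangent_space_def by (intro CollectI exI[of _ "\<lambda>t. c t i"] conjI) auto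
    qed
    have sub: "family_tangent ?K (corr_space M) ?A y \<subseteq> family_tangent ?K (corr_space M) (\<Pi>\<^sub>E i\<in>?K. L i) y"
      unfolding family_tangent_def family_curve_def using AL by blast
    have model_of: "x i \<in> model (corr_space M i)" if "i \<in> ?K" "curve_at (corr_space M i) (y i) c (x i)"
      for x :: "nat \<Rightarrow> 'e \<times> 'e" and i c
      using that curve_velocity_in_model[OF S pts(1)[OF y that(1)]] curve_velocity_in_model[OF S pts(2)[OF y that(1)]]
      by (auto simp: curve_at_corr_space mem_Times_iff)
    have tm: "x i \<in> model (corr_space M i)" if "x \<in> family_tangent ?K (corr_space M) X y" "i \<in> ?K" for x X i
      using that model_of unfolding family_tangent_def family_curve_def by blast
    define \<omega> where "\<omega> i a b = - form (M i) (fst (y i)) (fst a) (fst b) + form (M (Suc i)) (snd (y i)) (snd a) (snd b)"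
      for i and a b :: "'e \<times> 'e"
    have \<omega>form: "form (corr_space M i) (y i) a b = \<omega> i a b" for i a b
      by (cases "y i"; cases a; cases b) (simp add: corr_space_def \<omega>_def)
    have bil: "bilinear_form_on (model (corr_space M i)) (\<omega> i)" if i: "i \<in> ?K" for i
      unfolding bilinear_form_on_def
      using bilinear_form_onD[OF form_bilinear[OF M pts(1)[OF y i]]]
        bilinear_form_onD[OF form_bilinear[OF M pts(2)[OF y i]]]
      by (auto simp: \<omega>_def algebra_simps)
    have dm: "d i \<in> model (corr_space M i)" if "i \<in> ?K" for i
      using tm[OF v that] tm[OF w that] manifold_model[OF S] by (auto simp: d_def mem_Times_iff subspace_diff)
    have sum0: "(\<Sum>i\<in>?K. \<omega> i (d i) (b i)) = 0" if b: "b \<in> (\<Pi> i\<in>?K. model (corr_space M i))" for b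
    proof -
      obtain v' w' where v': "v' \<in> family_tangent ?K (corr_space M) (\<Pi>\<^sub>E i\<in>?K. L i) y"
        and w': "w' \<in> family_tangent ?K (corr_space M) ?B y" and b': "\<And>i. i \<in> ?K \<Longrightarrow> b i = v' i + w' i"
        using trans y b unfolding transverse_intersection_def fiber_product_def by blast
      have iso: "\<omega> i (d i) (v' i) = 0" if i: "i \<in> ?K" for i
      proof -
        have yL: "y i \<in> L i" by (rule PiE_mem[OF subsetD[OF AL y] i])
        have "\<omega> i (v i) (v' i) = 0" "\<omega> i (w i) (v' i) = 0"
          using lag[of i, unfolded lagrangian_def] yL vm[OF _ i] v w v' sub unfolding \<omega>form[symmetric] by blast+
        moreover have "d i = 1 *\<^sub>R v i + (-1) *\<^sub>R w i" by (simp add: d_def)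
        ultimately show ?thesis
          using bilinear_form_onD(1)[OF bil[OF i] tm[OF v' i] tm[OF v i] tm[OF w i], of 1 "-1"] by simp
      qed
      define g where "g i = (if i < j' then form (M i) (fst (y i)) (fst (d i)) (fst (w' i)) else 0)" for i
      have zero: "form (M i) p 0 x = 0" if "p \<in> points (M i)" "x \<in> model (M i)" for i p x
        using bilinear_form_onD(1)[OF form_bilinear[OF M that(1)] that(2) that(2) that(2), of 0 0] by simp
      have dends: "fst (d j) = 0" "snd (d (j' - 1)) = 0" using Dvw by (auto simp: D_def d_def)
      have telescope: "\<omega> i (d i) (w' i) = g (Suc i) - g i" if i: "i \<in> ?K" for i
      proof -
        have w'i: "snd (w' i) \<in> model (M (Suc i))" using tm[OF w' i] by (simp add: mem_Times_iff)
        have "form (M (Suc i)) (snd (y i)) (snd (d i)) (snd (w' i)) = g (Suc i)"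
        proof (cases "Suc i < j'")
          case True
          have ji: "j < Suc i" using i by simp
          have "snd (y i) = fst (y (Suc i))" using AB y ji True by (force simp: segment_graphs_def)
          moreover have "snd (d i) = fst (d (Suc i))"
            using segment_velocities_match[OF AB y v ji True] segment_velocities_match[OF AB y w ji True]
            by (simp add: d_def)
          moreover have "snd (w' i) = fst (w' (Suc i))"
            using segment_velocities_match[OF order_refl _ w' ji True] AB y by auto
          ultimately show ?thesis using True by (simp add: g_def)
        next
          case False
          then have "i = j' - 1" using i by auto
          then have "snd (d i) = 0" using dends by simp
          then show ?thesis using False zero[OF pts(2)[OF y i] w'i] by (simp add: g_def)
        qed
        then show ?thesis using i by (simp add: \<omega>_def g_def)
      qed
      have "(\<Sum>i\<in>?K. \<omega> i (d i) (b i)) = (\<Sum>i\<in>?K. g (Suc i) - g i)"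
      proof (rule sum.cong[OF refl])
        fix i assume i: "i \<in> ?K"
        have "\<omega> i (d i) (v' i + w' i) = \<omega> i (d i) (v' i) + \<omega> i (d i) (w' i)"
          using bilinear_form_onD(2)[OF bil[OF i] dm[OF i] tm[OF v' i] tm[OF w' i], of 1 1] by simp
        then show "\<omega> i (d i) (b i) = g (Suc i) - g i" using b'[OF i] iso[OF i] telescope[OF i] by simp
      qed
      also have "\<dots> = g j' - g j" using jj' by (intro sum_Suc_diff') simp
      also have "g j = 0"
      proof -
        have "fst (w' j) \<in> model (M j)" using tm[OF w' ends(1)] by (simp add: mem_Times_iff)
        then show ?thesis using zero[OF pts(1)[OF y ends(1)]] by (simp add: g_def dends)
      qed
      finally show ?thesis by (simp add: g_def)
    qed
    have \<omega>k: "\<omega> k (d k) x = 0" if x: "x \<in> model (corr_space M k)" for x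
    proof -
      define b where "b i = (if i = k then x else 0)" for i
      have "0 \<in> model (corr_space M i)" for i using manifold_model[OF S] by (simp add: subspace_0 zero_prod_def)
      then have "b \<in> (\<Pi> i\<in>?K. model (corr_space M i))" using x by (auto simp: b_def)
      from sum0[OF this] have "0 = (\<Sum>i\<in>?K. \<omega> i (d i) (b i))" by simp
      also have "\<dots> = (\<Sum>i\<in>?K. if i = k then \<omega> k (d k) x else 0)"
      proof (rule sum.cong[OF refl])
        fix i assume i: "i \<in> ?K"
        have "\<omega> i (d i) 0 = 0" using bilinear_form_onD(2)[OF bil[OF i] dm[OF i] dm[OF i] dm[OF i], of 0 0] by simp
        then show "\<omega> i (d i) (b i) = (if i = k then \<omega> k (d k) x else 0)" by (simp add: b_def)
      qed
      also have "\<dots> = \<omega> k (d k) x" using k by simp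
      finally show ?thesis by simp
    qed
    have dk: "fst (d k) \<in> model (M k)" "snd (d k) \<in> model (M (Suc k))" using dm[OF k] by (auto simp: mem_Times_iff)
    have z: "0 \<in> model (M i)" for i using manifold_model[OF S] by (rule subspace_0)
    have f0: "form (M i) p a 0 = 0" if "p \<in> points (M i)" "a \<in> model (M i)" for i p a
      using bilinear_form_onD(2)[OF form_bilinear[OF M that(1)] that(2) z z, of 0 0] by simp
    have "fst (d k) = 0"
      by (rule form_nondeg[OF M pts(1)[OF y k] dk(1)])
        (use \<omega>k z f0[OF pts(2)[OF y k] dk(2)] in \<open>force simp: \<omega>_def\<close>)
    moreover have "snd (d k) = 0"
      by (rule form_nondeg[OF M pts(2)[OF y k] dk(2)])
        (use \<omega>k z f0[OF pts(1)[OF y k] dk(1)] in \<open>force simp: \<omega>_def\<close>)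
    ultimately show "v k = w k" by (simp add: d_def prod_eq_iff)
  qed
  with curves show "\<exists>D. (\<forall>c v. family_curve ?K (corr_space M) ?A y c v \<longrightarrow>
        curve_at (mprod (M j) (M j')) (fst (y j), snd (y (j' - 1))) (\<lambda>t. (fst (c t j), snd (c t (j' - 1)))) (D v)) \<and>
      (\<forall>v\<in>family_tangent ?K (corr_space M) ?A y. \<forall>w\<in>family_tangent ?K (corr_space M) ?A y.
        D v = D w \<longrightarrow> (\<forall>k\<in>?K. v k = w k))"
    by (intro exI[of _ D]) blast
qed

lemma fiber_product_projection_image:
  assumes L: "\<And>j. L j \<subseteq> points (M j) \<times> points (M (Suc j))" and jj': "j < j'"
  shows "(\<lambda>z. (fst (z j), snd (z (j' - 1)))) ` fiber_product M L (\<lambda>_ p. p) j j' = geometric_composition M L j j'"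
proof (intro equalityI subsetI)
  fix x assume "x \<in> (\<lambda>z. (fst (z j), snd (z (j' - 1)))) ` fiber_product M L (\<lambda>_ p. p) j j'"
  then obtain z where z: "z \<in> fiber_product M L (\<lambda>_ p. p) j j'" and x: "x = (fst (z j), snd (z (j' - 1)))" by blast
  have zL: "z i \<in> L i" if "i \<in> {j..<j'}" for i using z that by (auto simp: fiber_product_def)
  have zp: "fst (z i) \<in> points (M i)" "snd (z i) \<in> points (M (Suc i))" if "i \<in> {j..<j'}" for i
    using zL[OF that] L[of i] by auto
  have match: "snd (z (i - 1)) = fst (z i)" if "j < i" "i < j'" for i
    using z that by (auto simp: fiber_product_def segment_graphs_def)
  define q where "q i = (if i < j' then fst (z i) else snd (z (j' - 1)))" for i
  have q: "(q i, q (Suc i)) = z i" if i: "i \<in> {j..<j'}" for i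
  proof (cases "Suc i < j'")
    case True
    then show ?thesis using i match[of "Suc i"] by (simp add: q_def prod_eq_iff)
  next
    case False
    then have "i = j' - 1" using i by auto
    then show ?thesis using i False by (simp add: q_def prod_eq_iff)
  qed
  have "q i \<in> points (M i)" if "i \<in> {j..j'}" for i
  proof (cases "i < j'")
    case True then show ?thesis using that zp(1)[of i] by (simp add: q_def)
  next
    case False
    then have "i = j'" using that by simp
    then show ?thesis using zp(2)[of "j' - 1"] jj' by (simp add: q_def)
  qed
  moreover have "(q i, q (Suc i)) \<in> L i" if "i \<in> {j..<j'}" for i using zL[OF that] q[OF that] by simp
  moreover have "x = (q j, q j')" using x jj' by (simp add: q_def)
  ultimately show "x \<in> geometric_composition M L j j'" unfolding geometric_composition_def by blast
next
  fix x assume "x \<in> geometric_composition M L j j'"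
  then obtain q where q: "\<And>i. i \<in> {j..j'} \<Longrightarrow> q i \<in> points (M i)" "\<And>i. i \<in> {j..<j'} \<Longrightarrow> (q i, q (Suc i)) \<in> L i"
    and x: "x = (q j, q j')" unfolding geometric_composition_def by blast
  define z where "z = (\<lambda>i\<in>{j..<j'}. (q i, q (Suc i)))"
  have "z \<in> fiber_product M L (\<lambda>_ p. p) j j'"
    using q by (auto simp: fiber_product_def segment_graphs_def z_def)
  moreover have "x = (fst (z j), snd (z (j' - 1)))" using x jj' by (auto simp: z_def)
  ultimately show "x \<in> (\<lambda>z. (fst (z j), snd (z (j' - 1)))) ` fiber_product M L (\<lambda>_ p. p) j j'" by blast
qed

section \<open>Consecutive pairs\<close>

text \<open>The segment containing the residue \<open>k\<close> is found from the position \<open>K = k + r + 1\<close>, by going back to the last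
  position outside \<open>I\<close> and forward to the next one, and then shifting by a multiple of \<open>r + 1\<close>.\<close>

lemma consecutive_exists:
  assumes I: "I \<subset> {..r}" and k: "k \<le> r"
  obtains j j' i where "(j, j') \<in> consecutive r I" "i \<in> {j..<j'}" "i mod Suc r = k"
proof -
  obtain k0 where k0: "k0 \<le> r" "k0 \<notin> I" using I by auto
  define K where "K = k + Suc r"
  define A where "A = {m. m \<le> K \<and> m mod Suc r \<notin> I}"
  have k0A: "k0 \<in> A" using k0 by (simp add: A_def K_def)
  have finA: "finite A" unfolding A_def by auto
  define m where "m = Max A"
  have mA: "m \<in> A" unfolding m_def using Max_in[OF finA] k0A by blast
  have m: "m \<le> K" "m mod Suc r \<notin> I" using mA by (auto simp: A_def)
  have mmax: "i mod Suc r \<in> I" if "m < i" "i \<le> K" for i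
    using Max_ge[OF finA, of i] that unfolding A_def m_def by fastforce
  \<comment> \<open>Among the \<open>r + 1\<close> numbers up to \<open>K\<close> every residue occurs.\<close>
  have Km: "K < m + Suc r"
  proof (rule ccontr)
    assume "\<not> K < m + Suc r"
    then have "(m + Suc r) mod Suc r \<in> I" by (intro mmax) auto
    then show False using m(2) unfolding mod_add_self2 by blast
  qed
  define P where "P i \<longleftrightarrow> K < i \<and> i mod Suc r \<notin> I" for i
  have "(m + Suc r) mod Suc r \<notin> I" using m(2) unfolding mod_add_self2 .
  with Km have P: "P (m + Suc r)" unfolding P_def by (rule conjI)
  define m' where "m' = (LEAST i. P i)"
  have m': "K < m'" "m' mod Suc r \<notin> I" using LeastI[of P, OF P] by (auto simp: m'_def P_def)
  have m'le: "m' \<le> m + Suc r" unfolding m'_def by (rule Least_le[of P, OF P])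
  have m'min: "i mod Suc r \<in> I" if "K < i" "i < m'" for i
    using not_less_Least[of i P] that by (auto simp: m'_def P_def)
  define c where "c = m div Suc r * Suc r"
  have cm: "c \<le> m" unfolding c_def by (rule div_times_less_eq_dividend)
  have shift: "(i - c) mod Suc r = i mod Suc r" if "c \<le> i" for i
  proof -
    have "((i - c) + m div Suc r * Suc r) mod Suc r = (i - c) mod Suc r" by (rule mod_mult_self1)
    then show ?thesis using that unfolding c_def by simp
  qed
  have mc: "m - c = m mod Suc r" unfolding c_def by (rule minus_div_mult_eq_mod)
  have "(m - c, m' - c) \<in> consecutive r I"
    unfolding consecutive_def
  proof (clarsimp, intro conjI allI impI)
    show "m - c \<le> r" using mod_less_divisor[of "Suc r" m] unfolding mc by linarith
    show "m - c \<notin> I" using m(2) by (simp add: mc)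
    show "m - c < m' - c" using m(1) m'(1) cm by linarith
    show "m' - c \<le> Suc (m - c + r)" using m'le cm by linarith
    show "(m' - c) mod Suc r \<notin> I" using shift[of m'] m' m(1) cm by simp
    fix i assume "m - c < i \<and> i < m' - c"
    then have i: "m < i + c" "i + c < m'" using cm by auto
    have "(i + c) mod Suc r \<in> I" using mmax[of "i + c"] m'min[of "i + c"] i by (cases "i + c \<le> K") auto
    then show "i mod Suc r \<in> I" using shift[of "i + c"] by simp
  qed
  moreover have "K - c \<in> {m - c..<m' - c}" using m(1) m'(1) cm by auto
  moreover have "(K - c) mod Suc r = k"
  proof -
    have "(K - c) mod Suc r = K mod Suc r" by (rule shift) (use m(1) cm in linarith)
    also have "\<dots> = k mod Suc r" unfolding K_def by (rule mod_add_self2)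
    finally show ?thesis using k by simp
  qed
  ultimately show ?thesis by (rule that)
qed

lemma mod_add_cancel:
  "(a + s) mod Suc r = (b + s) mod Suc r \<Longrightarrow> a mod Suc r = b mod Suc r"
  by (induction s) (auto dest: mod_Suc_cancel)

lemma consecutive_unique:
  assumes 1: "(j1, k1) \<in> consecutive r I" "i1 \<in> {j1..<k1}" and 2: "(j2, k2) \<in> consecutive r I" "i2 \<in> {j2..<k2}"
    and eq: "i1 mod Suc r = i2 mod Suc r"
  shows "(j1, k1) = (j2, k2) \<and> i1 = i2"
proof -
  have c: "j \<le> r" "j \<notin> I" "j < j'" "j' \<le> j + Suc r" "j' mod Suc r \<notin> I" "\<And>i. j < i \<Longrightarrow> i < j' \<Longrightarrow> i mod Suc r \<in> I"
    if "(j, j') \<in> consecutive r I" for j j'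
    using that by (auto simp: consecutive_def)
  \<comment> \<open>Walking back by the same number of steps from both positions, the shorter walk ends at the start of
    its segment, which is outside \<open>I\<close>; so it also ends at the start of the other segment.\<close>
  have dist: "i2 - j2 \<le> i1 - j1"
    if 1: "(j1, k1) \<in> consecutive r I" "i1 \<in> {j1..<k1}" and 2: "(j2, k2) \<in> consecutive r I" "i2 \<in> {j2..<k2}"
      and eq: "i1 mod Suc r = i2 mod Suc r" for j1 k1 j2 k2 i1 i2
  proof (rule ccontr)
    assume less: "\<not> i2 - j2 \<le> i1 - j1"
    define s where "s = i1 - j1"
    have s: "i1 = j1 + s" "s \<le> i2" using 1 less by (auto simp: s_def)
    have "(i2 - s) mod Suc r = j1 mod Suc r"
    proof -
      have "(i2 - s + s) mod Suc r = (j1 + s) mod Suc r" using eq s by simp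
      then show ?thesis by (rule mod_add_cancel)
    qed
    also have "\<dots> = j1" using c(1)[OF 1(1)] by simp
    finally have "(i2 - s) mod Suc r \<notin> I" using c(2)[OF 1(1)] by simp
    moreover have "j2 < i2 - s" "i2 - s < k2" using less 2 by (auto simp: s_def)
    ultimately show False using c(6)[OF 2(1)] by blast
  qed
  have s: "i1 - j1 = i2 - j2" using dist[OF 1 2 eq] dist[OF 2 1 eq[symmetric]] by simp
  have "j1 mod Suc r = j2 mod Suc r"
  proof -
    have "j1 + (i1 - j1) = i1" "j2 + (i1 - j1) = i2" using s 1(2) 2(2) by auto
    then have "(j1 + (i1 - j1)) mod Suc r = (j2 + (i1 - j1)) mod Suc r" using eq by (simp only:)
    then show ?thesis by (rule mod_add_cancel)
  qed
  then have j: "j1 = j2" using c(1)[OF 1(1)] c(1)[OF 2(1)] by simp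
  have "k1 = k2"
  proof (rule ccontr)
    assume "k1 \<noteq> k2"
    then consider "k1 < k2" | "k2 < k1" by linarith
    then show False
    proof cases
      case 1
      have "j2 < k1" using c(3)[OF \<open>(j1, k1) \<in> consecutive r I\<close>] j by simp
      then show False using c(6)[OF \<open>(j2, k2) \<in> consecutive r I\<close> _ 1] c(5)[OF \<open>(j1, k1) \<in> consecutive r I\<close>] by blast
    next
      case 2
      have "j1 < k2" using c(3)[OF \<open>(j2, k2) \<in> consecutive r I\<close>] j by simp
      then show False using c(6)[OF \<open>(j1, k1) \<in> consecutive r I\<close> _ 2] c(5)[OF \<open>(j2, k2) \<in> consecutive r I\<close>] by blast
    qed
  qed
  then show ?thesis using j s 1 2 by auto
qed

text \<open>The consecutive segments partition the index set, so regrouping loses nothing, and an equation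
  with index in \<open>I\<close> involves two adjacent positions of one segment.\<close>

lemma regroup_bij:
  assumes cyc: "cyclic r L" and I: "I \<subset> {..r}"
    and L: "\<And>j. L j \<subseteq> points (M j) \<times> points (M (Suc j))"
  shows "bij_betw (regroup r I) (solution_set r L (\<lambda>_ p. p) I) (partial_fiber_product r M L (\<lambda>_ p. p) I)"
proof -
  let ?S = "solution_set r L (\<lambda>_ p. p) I" and ?F = "partial_fiber_product r M L (\<lambda>_ p. p) I"
  have Lm: "L (i mod Suc r) = L i" for i by (rule cyclic_mod[OF cyc])
  have mr: "i mod Suc r \<le> r" for i using mod_less_divisor[of "Suc r" i] by linarith
  have "\<exists>s i. s \<in> consecutive r I \<and> i \<in> {fst s..<snd s} \<and> i mod Suc r = k" if "k \<le> r" for k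
    using consecutive_exists[OF I that] by (metis fst_conv snd_conv)
  then obtain s ix where s: "\<And>k. k \<le> r \<Longrightarrow> s k \<in> consecutive r I" "\<And>k. k \<le> r \<Longrightarrow> ix k \<in> {fst (s k)..<snd (s k)}"
    "\<And>k. k \<le> r \<Longrightarrow> ix k mod Suc r = k" by metis
  have uniq: "s (i mod Suc r) = (j, j')" "ix (i mod Suc r) = i" if "(j, j') \<in> consecutive r I" "i \<in> {j..<j'}" for i j j'
    using consecutive_unique[of "fst (s (i mod Suc r))" "snd (s (i mod Suc r))" r I "ix (i mod Suc r)" j j' i]
      s[OF mr[of i]] that by auto
  have fp: "fiber_product M L (\<lambda>_ p. p) j j' =
      {z \<in> (\<Pi>\<^sub>E i\<in>{j..<j'}. L i). \<forall>i. j < i \<and> i < j' \<longrightarrow> snd (z (i - 1)) = fst (z i)}" for j j'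
  proof -
    have "(\<Pi>\<^sub>E i\<in>{j..<j'}. L i) \<subseteq> (\<Pi>\<^sub>E i\<in>{j..<j'}. points (M i) \<times> points (M (Suc i)))"
      using L by (intro PiE_mono)
    then show ?thesis unfolding fiber_product_def segment_graphs_def by blast
  qed
  have zfp: "z (j, j') \<in> fiber_product M L (\<lambda>_ p. p) j j'" if "z \<in> ?F" "(j, j') \<in> consecutive r I" for z j j'
    using PiE_mem[OF that(1)[unfolded partial_fiber_product_def] that(2)] by simp
  define g where "g z = (\<lambda>k\<in>{..r}. z (s k) (ix k))" for z :: "nat \<times> nat \<Rightarrow> nat \<Rightarrow> 'a \<times> 'a"
  have gz: "g z (i mod Suc r) = z (j, j') i" if "(j, j') \<in> consecutive r I" "i \<in> {j..<j'}" for z i j j'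
    using uniq[OF that] mr by (simp add: g_def)
  have rg: "regroup r I y (j, j') i = y (i mod Suc r)" if "(j, j') \<in> consecutive r I" "i \<in> {j..<j'}" for y :: "nat \<Rightarrow> 'a \<times> 'a" and i j j'
    using that by (simp add: regroup_def)
  show ?thesis
  proof (rule bij_betw_byWitness[where f' = g])
    show "\<forall>y\<in>?S. g (regroup r I y) = y"
    proof
      fix y assume y: "y \<in> ?S"
      show "g (regroup r I y) = y"
      proof
        fix k show "g (regroup r I y) k = y k"
        proof (cases "k \<le> r")
          case True
          have "(fst (s k), snd (s k)) \<in> consecutive r I" using s(1)[OF True] by simp
          from rg[OF this s(2)[OF True], of y] show ?thesis using True s(3)[OF True] by (simp add: g_def)
        next
          case False
          then have "y k = undefined" using y by (auto simp: solution_set_def dest: PiE_arb)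
          then show ?thesis using False by (simp add: g_def)
        qed
      qed
    qed
    show "\<forall>z\<in>?F. regroup r I (g z) = z"
    proof
      fix z assume z: "z \<in> ?F"
      show "regroup r I (g z) = z"
      proof
        fix x :: "nat \<times> nat" obtain j j' where x: "x = (j, j')" by (cases x)
        show "regroup r I (g z) x = z x"
        proof (cases "(j, j') \<in> consecutive r I")
          case True
          have ext: "z (j, j') \<in> extensional {j..<j'}" using zfp[OF z True] by (auto simp: fiber_product_def PiE_def)
          show ?thesis
          proof
            fix i show "regroup r I (g z) x i = z x i"
              using rg[OF True] gz[OF True] ext True by (cases "i \<in> {j..<j'}") (auto simp: x regroup_def extensional_def)
          qed
        next
          case False
          then have "z x = undefined"
            using PiE_arb[OF z[unfolded partial_fiber_product_def]] by (simp add: x)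
          then show ?thesis using False by (simp add: x regroup_def)
        qed
      qed
    qed
    show "regroup r I ` ?S \<subseteq> ?F"
    proof (rule image_subsetI)
      fix y assume y: "y \<in> ?S"
      have yL: "y k \<in> L k" if "k \<le> r" for k using y that by (auto simp: solution_set_def)
      have yI: "incoming r y k = fst (y k)" if "k \<in> I" for k using y that by (simp add: solution_set_def)
      show "regroup r I y \<in> ?F"
        unfolding partial_fiber_product_def
      proof (rule PiE_I)
        fix x assume x: "x \<in> consecutive r I"
        obtain j j' where jj: "x = (j, j')" by (cases x)
        have c: "(j, j') \<in> consecutive r I" using x jj by simp
        have "regroup r I y (j, j') \<in> (\<Pi>\<^sub>E i\<in>{j..<j'}. L i)"
          using c yL[OF mr] Lm by (auto simp: regroup_def)
        moreover have "snd (regroup r I y (j, j') (i - 1)) = fst (regroup r I y (j, j') i)" if i: "j < i" "i < j'" for i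
        proof -
          have "i mod Suc r \<in> I" using c i by (auto simp: consecutive_def)
          then have "incoming r y (i mod Suc r) = fst (y (i mod Suc r))" by (rule yI)
          then have "snd (y ((i - 1) mod Suc r)) = fst (y (i mod Suc r))" using incoming_mod[of i r y] i by simp
          moreover have "i - 1 \<in> {j..<j'}" "i \<in> {j..<j'}" using i by auto
          ultimately show ?thesis using rg[OF c, of "i - 1" y] rg[OF c, of i y] by simp
        qed
        ultimately show "regroup r I y x \<in> (case x of (j, j') \<Rightarrow> fiber_product M L (\<lambda>_ p. p) j j')"
          by (simp add: jj fp)
      qed (auto simp: regroup_def)
    qed
    show "g ` ?F \<subseteq> ?S"
    proof (rule image_subsetI)
      fix z assume z: "z \<in> ?F"
      have zk: "z (s k) (ix k) \<in> L k" if k: "k \<le> r" for k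
      proof -
        have "z (s k) \<in> fiber_product M L (\<lambda>_ p. p) (fst (s k)) (snd (s k))"
          using zfp[OF z, of "fst (s k)" "snd (s k)"] s(1)[OF k] by simp
        then have "z (s k) (ix k) \<in> L (ix k)" using s(2)[OF k] by (auto simp: fp)
        then show ?thesis using Lm[of "ix k"] s(3)[OF k] by simp
      qed
      have "incoming r (g z) k = fst (g z k)" if k: "k \<in> I" for k
      proof -
        have kr: "k \<le> r" using k I by auto
        obtain j j' where sk: "s k = (j, j')" by (cases "s k")
        define i where "i = ix k"
        have c: "(j, j') \<in> consecutive r I" "i \<in> {j..<j'}" "i mod Suc r = k"
          using s[OF kr] sk by (auto simp: i_def)
        have "i \<noteq> j"
        proof
          assume "i = j"
          then have "k = j" using c by (auto simp: consecutive_def)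
          then show False using c(1) k by (auto simp: consecutive_def)
        qed
        then have i: "j < i" "i < j'" "i - 1 \<in> {j..<j'}" using c(2) by auto
        have "snd (z (j, j') (i - 1)) = fst (z (j, j') i)" using zfp[OF z c(1)] i by (simp add: fp)
        moreover have "incoming r (g z) k = snd (g z ((i - 1) mod Suc r))" using incoming_mod[of i r "g z"] i c(3) by simp
        ultimately show ?thesis using gz[OF c(1) i(3), of z] gz[OF c(1,2), of z] c(3) by simp
      qed
      then show "g z \<in> ?S" using zk by (auto simp: solution_set_def g_def)
    qed
  qed
qed


section \<open>Perturbation by Hamiltonian diffeomorphisms\<close>

theorem corollary2p4:
  fixes r :: nat
    and M :: "nat \<Rightarrow> ('a, 'e::euclidean_space) symplectic"
    and L L' :: "nat \<Rightarrow> ('a \<times> 'a) set"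
    and \<delta> :: "nat \<Rightarrow> real"
    and H :: "nat \<Rightarrow> real \<Rightarrow> 'a \<Rightarrow> real"
    and \<phi> :: "nat \<Rightarrow> 'a \<Rightarrow> 'a"
  assumes L: "cyclic_lagrangian_correspondence r M L"
    and widths: "cyclic r \<delta>" "\<And>j. 0 < \<delta> j"
    and H: "H \<in> Ham_star r M \<delta> L"
    and phi: "\<phi> = ham_diffeos M \<delta> H"
    and L': "L' = perturbed \<phi> L"
  shows
    "cyclic_lagrangian_correspondence r M L' \<and>
     \<comment> \<open>(a)\<close>
     transverse_intersection {..r} (corr_space M)
       (\<Pi>\<^sub>E j\<in>{..r}. L' j) (cyclic_graphs r M (\<lambda>_ p. p)) \<and>
     bij_betw (endpoints r \<delta>) (gen_intersection r M \<delta> L' (\<lambda>_ _ _. 0))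
       ((\<Pi>\<^sub>E j\<in>{..r}. L' j) \<inter> cyclic_graphs r M (\<lambda>_ p. p)) \<and>
     bij_betw (endpoints r \<delta>) (gen_intersection r M \<delta> L H)
       ((\<Pi>\<^sub>E j\<in>{..r}. L j) \<inter> cyclic_graphs r M \<phi>) \<and>
     bij_betw (perturb_map \<phi> {..r})
       ((\<Pi>\<^sub>E j\<in>{..r}. L j) \<inter> cyclic_graphs r M \<phi>)
       ((\<Pi>\<^sub>E j\<in>{..r}. L' j) \<inter> cyclic_graphs r M (\<lambda>_ p. p)) \<and>
     (\<forall>I. I \<subset> {..r} \<longrightarrow>
       \<comment> \<open>(b)\<close>
       transversal_equations r M L' (\<lambda>_ p. p) I \<and>
       bij_betw (regroup r I) (solution_set r L' (\<lambda>_ p. p) I)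
         (partial_fiber_product r M L' (\<lambda>_ p. p) I) \<and>
       bij_betw
         (\<lambda>z. \<lambda>(j, j')\<in>consecutive r I. perturb_map \<phi> {j..<j'} (z (j, j')))
         (partial_fiber_product r M L \<phi> I) (partial_fiber_product r M L' (\<lambda>_ p. p) I) \<and>
       (\<forall>(j, j')\<in>consecutive r I.
         transverse_intersection {j..<j'} (corr_space M)
           (\<Pi>\<^sub>E i\<in>{j..<j'}. L' i) (segment_graphs M (\<lambda>_ p. p) j j') \<and>
         fiber_product M L' (\<lambda>_ p. p) j j' =
           perturb_map \<phi> {j..<j'} ` fiber_product M L \<phi> j j' \<and>
         \<comment> \<open>(c)\<close>
         immersion_on {j..<j'} (corr_space M) (fiber_product M L' (\<lambda>_ p. p) j j')
           (mprod (M j) (M j')) (\<lambda>z. (fst (z j), snd (z (j' - 1)))) \<and>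
         (\<lambda>z. (fst (z j), snd (z (j' - 1)))) ` fiber_product M L' (\<lambda>_ p. p) j j' =
           geometric_composition M L' j j'))"
proof -
  have cycM: "cyclic r M" and cycL: "cyclic r L" and symp: "\<And>j. symplectic_manifold (M j)"
    and lag: "\<And>j. lagrangian (corr_space M j) (L j)" and comp: "\<And>j. compactin (mtop (corr_space M j)) (L j)"
    and ne: "\<And>j. L j \<noteq> {}"
    using L by (auto simp: cyclic_lagrangian_correspondence_def)
  have cycH: "cyclic r H" and h: "\<And>j. smooth_hamiltonian (M j) (\<delta> j) (H j)"
    and flow_ex: "\<And>j. \<exists>\<Phi>. is_ham_flow (M j) (\<delta> j) (H j) \<Phi>"
    and te: "\<And>I. I \<subseteq> {..r} \<Longrightarrow> transversal_equations r M L \<phi> I"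
    using H by (auto simp: Ham_star_def phi)
  note sm = symplectic_smooth[OF symp]
  define \<Phi> where "\<Phi> j = (SOME \<Phi>. is_ham_flow (M j) (\<delta> j) (H j) \<Phi>)" for j
  have flow: "is_ham_flow (M j) (\<delta> j) (H j) (\<Phi> j)" for j unfolding \<Phi>_def using flow_ex by (rule someI_ex)
  have \<phi>\<Phi>: "\<phi> = (\<lambda>j. \<Phi> j (\<delta> j))" by (simp add: phi ham_diffeos_def ham_diffeo_def \<Phi>_def fun_eq_iff)
  have cyc\<phi>: "cyclic r \<phi>"
    using cycM[unfolded cyclic_def, rule_format] cycH[unfolded cyclic_def, rule_format]
      widths(1)[unfolded cyclic_def, rule_format]
    unfolding phi cyclic_def ham_diffeos_def by (intro allI ext) (simp only:)
  have emb: "open_embedding (M j) (M j) (\<phi> j)" for j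
    unfolding \<phi>\<Phi> by (rule flow_open_embedding[OF symp h flow widths(2)])
  have inj: "inj_on (\<phi> j) (points (M j))" and smooth: "smooth_map_on (M j) (M j) (points (M j)) (\<phi> j)" for j
    using emb[of j] by (auto simp: open_embedding_def)
  note pts = smooth_map_on_points[OF smooth]
  have Lp: "L j \<subseteq> points (M j) \<times> points (M (Suc j))" for j
    using lag[of j] by (simp add: lagrangian_def embedded_submanifold_def corr_space_def)
  have L'p: "L' j \<subseteq> points (M j) \<times> points (M (Suc j))" for j
    unfolding L' by (rule perturbed_points[where M = M and L = L and \<phi> = \<phi>, OF Lp inj pts])
  have lag': "lagrangian (corr_space M j) (L' j)" for j
    unfolding corr_space_def L' perturbed_def
    by (rule lagrangian_image[OF symp symp emb _ lag[unfolded corr_space_def]])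
      (simp add: \<phi>\<Phi> flow_symplectic[OF symp h flow widths(2)])
  have cycL': "cyclic r L'"
    using cycL cyc\<phi> unfolding L' cyclic_def perturbed_def by (metis add_Suc)
  have comp': "compactin (mtop (corr_space M j)) (L' j)" for j
  proof -
    have "continuous_map (mtop (M (Suc j))) (mtop (M (Suc j))) (\<phi> (Suc j))"
      using smooth[of "Suc j"] by (simp add: smooth_map_on_def)
    from image_compactin[OF comp[of j, unfolded corr_space_def] map_prod_continuous[OF this]]
    show ?thesis by (simp add: L' perturbed_def corr_space_def)
  qed
  have ne': "L' j \<noteq> {}" for j using ne by (simp add: L' perturbed_def)
  have te': "transversal_equations r M L' (\<lambda>_ p. p) I" if "I \<subseteq> {..r}" for I
    unfolding L' by (rule perturbed_transversal_equations[OF sm cyc\<phi> Lp inj smooth te[OF that] that])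
  have zero: "smooth_hamiltonian (M j) (\<delta> j) (\<lambda>_ _. 0)" "is_ham_flow (M j) (\<delta> j) (\<lambda>_ _. 0) (\<lambda>_ p. p)" for j
    by (rule zero_hamiltonian[OF symp])+
  have segment: "transverse_intersection {j..<j'} (corr_space M) (\<Pi>\<^sub>E i\<in>{j..<j'}. L' i)
      (segment_graphs M (\<lambda>_ p. p) j j')" if "(j, j') \<in> consecutive r I" for j j' I
  proof (rule transverse_segment_intersection[OF sm cycM cycL' L'p ne' te'])
    show "(\<lambda>i. i mod Suc r) ` {j<..<j'} \<subseteq> {..r}" by (auto simp: less_Suc_eq_le[symmetric])
    show "j' \<le> j + Suc r" using that by (simp add: consecutive_def)
  qed
  show ?thesis
  proof (intro conjI allI impI ballI)
    show "cyclic_lagrangian_correspondence r M L'"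
      unfolding cyclic_lagrangian_correspondence_def using cycM cycL' symp lag' comp' ne' by blast
    show "transverse_intersection {..r} (corr_space M) (\<Pi>\<^sub>E j\<in>{..r}. L' j) (cyclic_graphs r M (\<lambda>_ p. p))"
      by (rule transverse_cyclic_intersection[OF sm cycM cycL' L'p ne' te'[OF order_refl]])
    show "bij_betw (endpoints r \<delta>) (gen_intersection r M \<delta> L' (\<lambda>_ _ _. 0))
       ((\<Pi>\<^sub>E j\<in>{..r}. L' j) \<inter> cyclic_graphs r M (\<lambda>_ p. p))"
      by (rule endpoints_bij[where \<Phi> = "\<lambda>_ _ p. p", OF symp cycM zero widths(2) L'p])
    show "bij_betw (endpoints r \<delta>) (gen_intersection r M \<delta> L H) ((\<Pi>\<^sub>E j\<in>{..r}. L j) \<inter> cyclic_graphs r M \<phi>)"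
      unfolding \<phi>\<Phi> by (rule endpoints_bij[OF symp cycM h flow widths(2) Lp])
    show "bij_betw (perturb_map \<phi> {..r}) ((\<Pi>\<^sub>E j\<in>{..r}. L j) \<inter> cyclic_graphs r M \<phi>)
       ((\<Pi>\<^sub>E j\<in>{..r}. L' j) \<inter> cyclic_graphs r M (\<lambda>_ p. p))"
      unfolding L' by (rule perturb_map_cyclic_bij[where M = M and L = L and \<phi> = \<phi>, OF Lp inj pts cyc\<phi>])
    fix I assume I: "I \<subset> {..r}"
    show "transversal_equations r M L' (\<lambda>_ p. p) I" using te' I by blast
    show "bij_betw (regroup r I) (solution_set r L' (\<lambda>_ p. p) I) (partial_fiber_product r M L' (\<lambda>_ p. p) I)"
      by (rule regroup_bij[OF cycL' I L'p])
    show "bij_betw (\<lambda>z. \<lambda>(j, j')\<in>consecutive r I. perturb_map \<phi> {j..<j'} (z (j, j')))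
         (partial_fiber_product r M L \<phi> I) (partial_fiber_product r M L' (\<lambda>_ p. p) I)"
      unfolding L' by (rule perturb_map_partial_fiber_product_bij[where M = M and L = L and \<phi> = \<phi>, OF Lp inj pts])
    fix x assume x: "x \<in> consecutive r I"
    obtain j j' where jj: "x = (j, j')" by (cases x)
    have c: "(j, j') \<in> consecutive r I" using x jj by simp
    have jj': "j < j'" using c by (simp add: consecutive_def)
    have "fiber_product M L' (\<lambda>_ p. p) j j' = perturb_map \<phi> {j..<j'} ` fiber_product M L \<phi> j j'"
      using perturb_map_fiber_product_bij[where M = M and L = L and \<phi> = \<phi> and j = j and j' = j', OF Lp inj pts]
      by (simp add: L' bij_betw_def)
    with segment[OF c] fiber_product_projection_immersion[OF symp lag' jj' L'p segment[OF c]]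
      fiber_product_projection_image[where M = M and L = L', OF L'p jj']
    show "case x of (j, j') \<Rightarrow>
         transverse_intersection {j..<j'} (corr_space M)
           (\<Pi>\<^sub>E i\<in>{j..<j'}. L' i) (segment_graphs M (\<lambda>_ p. p) j j') \<and>
         fiber_product M L' (\<lambda>_ p. p) j j' =
           perturb_map \<phi> {j..<j'} ` fiber_product M L \<phi> j j' \<and>
         immersion_on {j..<j'} (corr_space M) (fiber_product M L' (\<lambda>_ p. p) j j')
           (mprod (M j) (M j')) (\<lambda>z. (fst (z j), snd (z (j' - 1)))) \<and>
         (\<lambda>z. (fst (z j), snd (z (j' - 1)))) ` fiber_product M L' (\<lambda>_ p. p) j j' =
           geometric_composition M L' j j'"
      unfolding jj by simp
  qed
qed

end
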